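(* Let $\Omega\subset\mathbb{R}^n$ be a bounded domain with $C^{1,\varepsilon}$ boundary, let $1<p<\infty$ and $m>0$. If $p>n$, then $$\lambda(m,\Omega)=\inf_{\sigma\in\Sigma_m(\partial\Omega)}\ell_1(\sigma,\Omega)>0.$$ Moreover, if $p>n$ and $n>1$, then $\lambda(m,\Omega)$ is not achieved, i.e. there is no $\sigma\in\Sigma_m(\partial\Omega)$ with $\ell_1(\sigma,\Omega)=\lambda(m,\Omega)$.
   Context: $\mathcal H^{n-1}$ is the $(n-1)$-dimensional Hausdorff measure. For $\sigma\in L^1(\partial\Omega)$, $\sigma\ge0$, and $u\in W^{1,p}(\Omega)$, $u\ne0$, set $$\mathcal Q[\sigma,u]=\frac{\int_\Omega|\nabla u|^p\,dx+\int_{\partial\Omega}\sigma|u|^p\,d\mathcal H^{n-1}}{\int_\Omega|u|^p\,dx}$$ if the right-hand side is finite and $\mathcal Q[\sigma,u]=+\infty$ otherwise ($u$ on $\partial\Omega$ being understood as the trace), and $$\ell_1(\sigma,\Omega)=\inf_{u\in W^{1,p}(\Omega),\,u\neq0}\mathcal Q[\sigma,u].$$ For $m>0$, $$\Sigma_m(\partial\Omega)=\Big\{\sigma\in L^1(\partial\Omega):\ \sigma\ge0,\ \int_{\partial\Omega}\sigma\,d\mathcal H^{n-1}=m\Big\}.$$ *)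

theory Defs
  imports "HOL-Analysis.Analysis"
begin

section \<open>Hausdorff measure\<close>

text \<open>
  Normalised so that in dimension \<open>k\<close> it agrees with \<open>k\<close>-dimensional Lebesgue measure.
  For \<open>k = 0\<close> every nonempty set has weight 1 (\<open>0 ^ 0 = 1\<close>), i.e. we get counting measure.
  Boundedness of the covering sets is required explicitly because \<^const>\<open>diameter\<close> is
  meaningless on unbounded sets.
\<close>

definition hausdorff_weight :: "nat \<Rightarrow> 'a::metric_space set \<Rightarrow> ennreal" where
  "hausdorff_weight k U =
     (if U = {} then 0 else ennreal (unit_ball_vol (real k) * (diameter U / 2) ^ k))"

definition hausdorff_content :: "nat \<Rightarrow> real \<Rightarrow> 'a::metric_space set \<Rightarrow> ennreal" where
  "hausdorff_content k \<delta> E =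
     (INF U\<in>{U :: nat \<Rightarrow> 'a set. E \<subseteq> (\<Union>i. U i) \<and> (\<forall>i. bounded (U i) \<and> diameter (U i) \<le> \<delta>)}.
        \<Sum>i. hausdorff_weight k (U i))"

definition hausdorff_outer :: "nat \<Rightarrow> 'a::metric_space set \<Rightarrow> ennreal" where
  "hausdorff_outer k E = (SUP \<delta>\<in>{0<..}. hausdorff_content k \<delta> E)"

text \<open>
  \<^const>\<open>hausdorff_outer\<close> is a metric outer measure, hence countably additive on the Borel sets
  (Caratheodory), so the fallback value of \<^const>\<open>measure_of\<close> does not occur.
\<close>

definition hausdorff_measure :: "nat \<Rightarrow> 'a::metric_space measure" where
  "hausdorff_measure k = measure_of UNIV (sets borel) (hausdorff_outer k)"

definition boundary_measure :: "'a::euclidean_space set \<Rightarrow> 'a measure" where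
  "boundary_measure \<Omega> = restrict_space (hausdorff_measure (DIM('a) - 1)) (frontier \<Omega>)"

section \<open>Domains with Hoelder-differentiable boundary\<close>

definition C1_holder :: "real \<Rightarrow> ('a::euclidean_space \<Rightarrow> real) \<Rightarrow> bool" where
  "C1_holder \<epsilon> \<gamma> \<longleftrightarrow>
     (\<exists>D C. (\<forall>x. (\<gamma> has_derivative (\<lambda>h. D x \<bullet> h)) (at x)) \<and>
            (\<forall>x y. norm (D x - D y) \<le> C * norm (x - y) powr \<epsilon>))"

text \<open>
  Near each boundary point, \<open>\<Omega>\<close> is the part lying above the graph of \<open>\<gamma>\<close> in the unit direction
  \<open>e\<close>. Only the values of \<open>\<gamma>\<close> on the hyperplane orthogonal to \<open>e\<close> matter; that \<open>\<gamma>\<close> is defined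
  on the whole space is no restriction (compose with the orthogonal projection, cut off, and
  shrink the ball). In dimension 1 the hyperplane is \<open>{0}\<close>.
\<close>

definition C1_holder_boundary :: "real \<Rightarrow> 'a::euclidean_space set \<Rightarrow> bool" where
  "C1_holder_boundary \<epsilon> \<Omega> \<longleftrightarrow>
     (\<forall>z\<in>frontier \<Omega>. \<exists>r>0. \<exists>e \<gamma>. norm e = 1 \<and> C1_holder \<epsilon> \<gamma> \<and>
        \<Omega> \<inter> ball z r = {x \<in> ball z r. \<gamma> (x - (x \<bullet> e) *\<^sub>R e) < x \<bullet> e})"

section \<open>Smooth functions and weak gradients\<close>

fun Ck :: "nat \<Rightarrow> ('a::euclidean_space \<Rightarrow> real) \<Rightarrow> bool" where
  "Ck 0 f = continuous_on UNIV f"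
| "Ck (Suc k) f = (f differentiable_on UNIV \<and>
     (\<forall>i\<in>Basis. Ck k (\<lambda>x. frechet_derivative f (at x) i)))"

definition smooth :: "('a::euclidean_space \<Rightarrow> real) \<Rightarrow> bool" where
  "smooth f \<longleftrightarrow> (\<forall>k. Ck k f)"

definition test_function :: "'a::euclidean_space set \<Rightarrow> ('a \<Rightarrow> real) \<Rightarrow> bool" where
  "test_function \<Omega> \<phi> \<longleftrightarrow> smooth \<phi> \<and> (\<exists>K\<subseteq>\<Omega>. compact K \<and> (\<forall>x. x \<notin> K \<longrightarrow> \<phi> x = 0))"

definition locally_integrable_on ::
    "('a::euclidean_space \<Rightarrow> 'b::euclidean_space) \<Rightarrow> 'a set \<Rightarrow> bool" where
  "locally_integrable_on f \<Omega> \<longleftrightarrow> (\<forall>K\<subseteq>\<Omega>. compact K \<longrightarrow> f absolutely_integrable_on K)"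

definition has_weak_gradient ::
    "'a::euclidean_space set \<Rightarrow> ('a \<Rightarrow> real) \<Rightarrow> ('a \<Rightarrow> 'a) \<Rightarrow> bool" where
  "has_weak_gradient \<Omega> u g \<longleftrightarrow>
     locally_integrable_on u \<Omega> \<and> locally_integrable_on g \<Omega> \<and>
     (\<forall>\<phi>. test_function \<Omega> \<phi> \<longrightarrow> (\<forall>i\<in>Basis.
        (LINT x:\<Omega>|lebesgue. u x * frechet_derivative \<phi> (at x) i) =
        - (LINT x:\<Omega>|lebesgue. (g x \<bullet> i) * \<phi> x)))"

text \<open>Weak gradients and (below) traces are unique only almost everywhere; we fix a representative.\<close>

definition weak_grad :: "'a::euclidean_space set \<Rightarrow> ('a \<Rightarrow> real) \<Rightarrow> 'a \<Rightarrow> 'a" where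
  "weak_grad \<Omega> u = (SOME g. has_weak_gradient \<Omega> u g)"

section \<open>Lebesgue and Sobolev spaces, traces\<close>

definition p_integral :: "'a measure \<Rightarrow> real \<Rightarrow> ('a \<Rightarrow> 'b::euclidean_space) \<Rightarrow> ennreal" where
  "p_integral M p f = (\<integral>\<^sup>+ x. ennreal (norm (f x) powr p) \<partial>M)"

definition Lp :: "'a measure \<Rightarrow> real \<Rightarrow> ('a \<Rightarrow> 'b::euclidean_space) set" where
  "Lp M p = {f \<in> borel_measurable M. p_integral M p f < \<infinity>}"

definition W1p :: "real \<Rightarrow> 'a::euclidean_space set \<Rightarrow> ('a \<Rightarrow> real) set" where
  "W1p p \<Omega> = {u \<in> Lp (lebesgue_on \<Omega>) p.
      \<exists>g. has_weak_gradient \<Omega> u g \<and> g \<in> Lp (lebesgue_on \<Omega>) p}"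

text \<open>The \<open>p\<close>-th power of the usual norm of \<open>W\<^sup>1\<^sup>,\<^sup>p(\<Omega>)\<close>.\<close>

definition W1p_norm_powr :: "real \<Rightarrow> 'a::euclidean_space set \<Rightarrow> ('a \<Rightarrow> real) \<Rightarrow> ennreal" where
  "W1p_norm_powr p \<Omega> u =
     p_integral (lebesgue_on \<Omega>) p u + p_integral (lebesgue_on \<Omega>) p (weak_grad \<Omega> u)"

text \<open>
  The trace operator is the continuous extension to \<open>W\<^sup>1\<^sup>,\<^sup>p(\<Omega>)\<close> of the restriction map
  \<open>\<phi> \<mapsto> \<phi>|\<^sub>\<partial>\<^sub>\<Omega>\<close>, defined on functions that are smooth up to the boundary.
\<close>

definition is_trace ::
    "real \<Rightarrow> 'a::euclidean_space set \<Rightarrow> ('a \<Rightarrow> real) \<Rightarrow> ('a \<Rightarrow> real) \<Rightarrow> bool" where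
  "is_trace p \<Omega> u g \<longleftrightarrow> g \<in> Lp (boundary_measure \<Omega>) p \<and>
     (\<exists>\<phi> :: nat \<Rightarrow> 'a \<Rightarrow> real. (\<forall>k. smooth (\<phi> k)) \<and>
        (\<lambda>k. W1p_norm_powr p \<Omega> (\<lambda>x. \<phi> k x - u x)) \<longlonglongrightarrow> 0 \<and>
        (\<lambda>k. p_integral (boundary_measure \<Omega>) p (\<lambda>x. \<phi> k x - g x)) \<longlonglongrightarrow> 0)"

definition bdry_trace :: "real \<Rightarrow> 'a::euclidean_space set \<Rightarrow> ('a \<Rightarrow> real) \<Rightarrow> 'a \<Rightarrow> real" where
  "bdry_trace p \<Omega> u = (SOME g. is_trace p \<Omega> u g)"

section \<open>The Robin eigenvalue and its infimum over boundary weights\<close>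

text \<open>
  In \<^typ>\<open>ennreal\<close> the quotient is \<open>\<infinity>\<close> exactly when the boundary integral diverges, since for
  \<open>0 \<noteq> u \<in> W\<^sup>1\<^sup>,\<^sup>p(\<Omega>)\<close> the two integrals over \<open>\<Omega>\<close> are finite and the denominator is positive.
\<close>

definition robin_quotient ::
    "real \<Rightarrow> 'a::euclidean_space set \<Rightarrow> ('a \<Rightarrow> real) \<Rightarrow> ('a \<Rightarrow> real) \<Rightarrow> ennreal" where
  "robin_quotient p \<Omega> \<sigma> u =
     ((\<integral>\<^sup>+ x. ennreal (norm (weak_grad \<Omega> u x) powr p) \<partial>lebesgue_on \<Omega>) +
      (\<integral>\<^sup>+ x. ennreal (\<sigma> x * \<bar>bdry_trace p \<Omega> u x\<bar> powr p) \<partial>boundary_measure \<Omega>)) /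
     (\<integral>\<^sup>+ x. ennreal (\<bar>u x\<bar> powr p) \<partial>lebesgue_on \<Omega>)"

definition ell1 :: "real \<Rightarrow> 'a::euclidean_space set \<Rightarrow> ('a \<Rightarrow> real) \<Rightarrow> ennreal" where
  "ell1 p \<Omega> \<sigma> =
     (INF u\<in>{u \<in> W1p p \<Omega>. \<not> (AE x in lebesgue_on \<Omega>. u x = 0)}. robin_quotient p \<Omega> \<sigma> u)"

definition Sigma_m :: "real \<Rightarrow> 'a::euclidean_space set \<Rightarrow> ('a \<Rightarrow> real) set" where
  "Sigma_m m \<Omega> = {\<sigma>. integrable (boundary_measure \<Omega>) \<sigma> \<and>
     (AE x in boundary_measure \<Omega>. 0 \<le> \<sigma> x) \<and> (LINT x|boundary_measure \<Omega>. \<sigma> x) = m}"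

definition lambda_inf :: "real \<Rightarrow> real \<Rightarrow> 'a::euclidean_space set \<Rightarrow> ennreal" where
  "lambda_inf p m \<Omega> = (INF \<sigma>\<in>Sigma_m m \<Omega>. ell1 p \<Omega> \<sigma>)"

end

theory Submission
  imports Defs "HOL-Complex_Analysis.Great_Picard"
begin

text \<open>
  For \<open>p > n\<close> the average of a function over a small cone with vertex \<open>x\<close> and height \<open>s\<close> differs from its
  value at \<open>x\<close> by at most \<open>C s\<^bsup>1-n/p\<^esup>\<close> times the \<open>L\<^sup>p\<close> norm of its gradient, and the average is Lipschitz in \<open>x\<close>.
  So smooth functions bounded in \<open>W\<^sup>1\<^sup>,\<^sup>p(\<Omega>)\<close> are equicontinuous up to the boundary, traces are the boundary values
  of uniform limits, and by density it suffices to test the Robin quotient with smooth functions.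
  Of the boundary regularity only a uniform interior cone condition is used.

  If the infimum \<open>\<lambda>\<close> were \<open>0\<close>, smooth functions \<open>\<phi>\<^sub>k\<close> with \<open>\<integral>|\<phi>\<^sub>k|\<^sup>p = 1\<close>, with energy tending to \<open>0\<close> and with
  \<open>min |\<phi>\<^sub>k|\<close> over the boundary tending to \<open>0\<close> would converge uniformly to a constant, which is \<open>0\<close>; a contradiction.

  Let \<open>\<sigma>\<close> attain \<open>\<lambda>\<close> and let \<open>\<phi>\<^sub>k\<close> be a minimising sequence for \<open>\<sigma>\<close> with uniform limit \<open>U\<close> (no minimiser is needed).
  Weights concentrating at a point \<open>x\<close> of the support of \<open>\<sigma>\<close> give
  \<open>\<lambda> \<integral>|\<phi>|\<^sup>p \<le> \<integral>|\<nabla>\<phi>|\<^sup>p + m |\<phi>(x)|\<^sup>p\<close> for all smooth \<open>\<phi>\<close>; comparison with \<open>\<sigma>\<close> itself forces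
  \<open>m |U(x)|\<^sup>p = \<integral>\<sigma>|U|\<^sup>p\<close> for \<open>\<sigma>\<close>-almost every \<open>x\<close>. Points are null sets for \<open>n > 1\<close>, so this happens at two
  different points. Perturbing \<open>\<phi>\<^sub>k\<close> up to first order at these points shows that \<open>U\<close> vanishes there, and then
  adding small constants contradicts \<open>p > 2\<close>.
\<close>


section \<open>Smooth functions\<close>

text \<open>The minimising sequence is only known to converge uniformly, and no gradient of its
  limit \<open>U\<close> is constructed. Every inequality is therefore proved for the smooth
  \<open>\<phi>\<^sub>k\<close> and then passed to the limit, where the energies enter through the
  number \<open>l - bdry_energy \<sigma> U\<close>. An Euler-Lagrange equation is thus out of reach.
  Its place is taken by perturbations with both signs, \<open>\<phi>\<^sub>k + \<psi>\<close> and
  \<open>\<phi>\<^sub>k - \<psi>\<close>: in the sums of masses and energies the first-order terms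
  cancel, and the second differences of p-th powers have elementary bounds for p > 2. A second
  obstacle is that \<open>weak_grad\<close> and \<open>bdry_trace\<close> are choices.
  Almost-everywhere uniqueness of weak gradients, and both existence and uniqueness of traces, must
  be established before a Robin quotient can be evaluated. Kernels supported inside an interior cone
  serve twice: mollifying with them never looks outside \<Omega>, which gives density of smooth
  functions up to the boundary, and the same averages carry the Morrey estimate at boundary
  points.\<close>

abbreviation pderiv_at :: "('a::euclidean_space \<Rightarrow> real) \<Rightarrow> 'a \<Rightarrow> 'a \<Rightarrow> real" where
  "pderiv_at f i x \<equiv> frechet_derivative f (at x) i"

text \<open>The successor clause of \<open>Ck\<close> speaks of \<open>frechet_derivative\<close>, a
  choice operator; uniqueness of derivatives allows any explicit derivative \<open>F\<close> in its
  place.\<close>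

lemma CkI:
  assumes "\<And>x. (f has_derivative F x) (at x)" and "\<And>i. i \<in> Basis \<Longrightarrow> Ck k (\<lambda>x. F x i)"
  shows "Ck (Suc k) f"
proof -
  have "frechet_derivative f (at x) = F x" for x
    using frechet_derivative_at[OF assms(1)] by metis
  then show ?thesis
    using assms by (auto simp: differentiable_on_def differentiable_def)
qed

lemma CkD_deriv:
  assumes "Ck (Suc k) f"
  shows "(f has_derivative frechet_derivative f (at x)) (at x)"
  using assms by (auto simp: differentiable_on_def frechet_derivative_works)

lemma Ck_SucD: "Ck (Suc k) f \<Longrightarrow> Ck k f"
proof (induction k arbitrary: f)
  case 0
  then show ?case by (simp add: differentiable_imp_continuous_on)
next
  case (Suc k)
  have "f differentiable_on UNIV" and "\<forall>i\<in>Basis. Ck (Suc k) (pderiv_at f i)"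
    using Suc.prems by auto
  then show ?case
    using Suc.IH by simp
qed

lemma Ck_const: "Ck k (\<lambda>x. c)"
proof (induction k arbitrary: c)
  case (Suc k)
  show ?case by (rule CkI[where F = "\<lambda>_ _. 0"]) (use Suc in auto)
qed simp

lemma Ck_inner: "Ck k (\<lambda>x. x \<bullet> a)"
proof (cases k)
  case (Suc l)
  show ?thesis unfolding Suc
    by (rule CkI[where F = "\<lambda>_ h. h \<bullet> a"]) (auto intro!: derivative_eq_intros Ck_const)
qed (auto intro!: continuous_intros)

lemma Ck_add: "Ck k f \<Longrightarrow> Ck k g \<Longrightarrow> Ck k (\<lambda>x. f x + g x)"
proof (induction k arbitrary: f g)
  case (Suc k)
  show ?case
    by (rule CkI[where F = "\<lambda>x h. frechet_derivative f (at x) h + frechet_derivative g (at x) h"])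
      (use Suc in \<open>auto intro!: has_derivative_add CkD_deriv\<close>)
qed (auto intro!: continuous_intros)

lemma Ck_mult: "Ck k f \<Longrightarrow> Ck k g \<Longrightarrow> Ck k (\<lambda>x. f x * g x)"
proof (induction k arbitrary: f g)
  case (Suc k)
  have fg: "Ck k f" "Ck k g" using Suc.prems Ck_SucD by blast+
  show ?case
  proof (rule CkI[where F = "\<lambda>x h. f x * frechet_derivative g (at x) h + frechet_derivative f (at x) h * g x"])
    show "((\<lambda>x. f x * g x) has_derivative
        (\<lambda>h. f x * frechet_derivative g (at x) h + frechet_derivative f (at x) h * g x)) (at x)" for x
      by (intro has_derivative_mult CkD_deriv) (use Suc.prems in auto)
    fix i :: 'a assume "i \<in> Basis"
    then show "Ck k (\<lambda>x. f x * pderiv_at g i x + pderiv_at f i x * g x)"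
      using Suc fg by (intro Ck_add Suc.IH) auto
  qed
qed (auto intro!: continuous_intros)

lemma Ck_affine: "Ck k f \<Longrightarrow> Ck k (\<lambda>x. f (c *\<^sub>R x + a))"
proof (induction k arbitrary: f)
  case 0
  then show ?case by (auto intro!: continuous_intros continuous_on_compose2[of UNIV f])
next
  case (Suc k)
  show ?case
  proof (rule CkI[where F = "\<lambda>x h. frechet_derivative f (at (c *\<^sub>R x + a)) (c *\<^sub>R h)"])
    show "((\<lambda>x. f (c *\<^sub>R x + a)) has_derivative
        (\<lambda>h. frechet_derivative f (at (c *\<^sub>R x + a)) (c *\<^sub>R h))) (at x)" for x
      by (rule has_derivative_compose[OF _ CkD_deriv[OF Suc.prems], of "\<lambda>x. c *\<^sub>R x + a"])
        (auto intro!: derivative_eq_intros)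
    fix i :: 'a assume i: "i \<in> Basis"
    have lin: "linear (frechet_derivative f (at x))" for x
      using CkD_deriv[OF Suc.prems] has_derivative_linear by blast
    have "Ck k (\<lambda>x. c * pderiv_at f i (c *\<^sub>R x + a))"
      using Suc i by (intro Ck_mult Ck_const Suc.IH) auto
    then show "Ck k (\<lambda>x. frechet_derivative f (at (c *\<^sub>R x + a)) (c *\<^sub>R i))"
      by (simp add: linear_cmul[OF lin])
  qed
qed

lemma smooth_const: "smooth (\<lambda>x. c)"
  by (simp add: smooth_def Ck_const)

lemma smooth_inner: "smooth (\<lambda>x. x \<bullet> a)"
  by (simp add: smooth_def Ck_inner)

lemma smooth_add: "smooth f \<Longrightarrow> smooth g \<Longrightarrow> smooth (\<lambda>x. f x + g x)"
  by (simp add: smooth_def Ck_add)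

lemma smooth_mult: "smooth f \<Longrightarrow> smooth g \<Longrightarrow> smooth (\<lambda>x. f x * g x)"
  by (simp add: smooth_def Ck_mult)

lemma smooth_cmult: "smooth f \<Longrightarrow> smooth (\<lambda>x. c * f x)"
  by (intro smooth_mult smooth_const)

lemma smooth_diff: "smooth f \<Longrightarrow> smooth g \<Longrightarrow> smooth (\<lambda>x. f x - g x)"
  using smooth_add[OF _ smooth_cmult, of f g "-1"] by simp

lemma smooth_affine: "smooth f \<Longrightarrow> smooth (\<lambda>x. f (c *\<^sub>R x + a))"
  unfolding smooth_def using Ck_affine by blast

lemma smooth_continuous: "smooth f \<Longrightarrow> continuous_on S f"
  using continuous_on_subset[of UNIV f S] by (metis Ck.simps(1) smooth_def subset_UNIV)

lemma smooth_measurable [measurable (raw)]: "smooth f \<Longrightarrow> f \<in> borel_measurable borel"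
  using smooth_continuous borel_measurable_continuous_onI by blast

lemma smooth_has_derivative:
  "smooth f \<Longrightarrow> (f has_derivative frechet_derivative f (at x)) (at x)"
  by (meson CkD_deriv smooth_def)

lemma smooth_frechet_linear: "smooth f \<Longrightarrow> linear (frechet_derivative f (at x))"
  using smooth_has_derivative has_derivative_linear by blast

lemma smooth_pderiv: "smooth f \<Longrightarrow> i \<in> Basis \<Longrightarrow> smooth (pderiv_at f i)"
  unfolding smooth_def by (metis Ck.simps(2))

lemma frechet_derivative_eqI:
  "(f has_derivative F) (at x) \<Longrightarrow> frechet_derivative f (at x) h = F h"
  by (metis frechet_derivative_at)

lemma pderiv_mult:
  assumes "smooth f" "smooth g"
  shows "pderiv_at (\<lambda>x. f x * g x) i x = f x * pderiv_at g i x + pderiv_at f i x * g x"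
  by (intro frechet_derivative_eqI has_derivative_mult smooth_has_derivative assms)

lemma pderiv_add:
  assumes "smooth f" "smooth g"
  shows "pderiv_at (\<lambda>x. f x + g x) i x = pderiv_at f i x + pderiv_at g i x"
  by (intro frechet_derivative_eqI has_derivative_add smooth_has_derivative assms)

lemma pderiv_cmult:
  assumes "smooth f" shows "pderiv_at (\<lambda>x. c * f x) i x = c * pderiv_at f i x"
  by (intro frechet_derivative_eqI has_derivative_mult_right smooth_has_derivative assms)

lemma pderiv_zero_outside:
  assumes "smooth f" "open U" "x \<in> U" "\<And>y. y \<in> U \<Longrightarrow> f y = c"
  shows "frechet_derivative f (at x) i = 0"
proof -
  have "(f has_derivative (\<lambda>_. 0)) (at x)"
    using has_derivative_transform_within_open[OF has_derivative_const assms(2,3), of c f UNIV] assms(4)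
    by auto
  then show ?thesis by (rule frechet_derivative_eqI)
qed

section \<open>Gradients of smooth functions\<close>

definition grad :: "('a::euclidean_space \<Rightarrow> real) \<Rightarrow> 'a \<Rightarrow> 'a" where
  "grad f x = (\<Sum>i\<in>Basis. pderiv_at f i x *\<^sub>R i)"

lemma grad_inner_Basis: "i \<in> Basis \<Longrightarrow> grad f x \<bullet> i = pderiv_at f i x"
  by (simp add: grad_def inner_sum_left inner_Basis if_distrib cong: if_cong)

lemma frechet_eq_grad_inner:
  assumes "smooth f" shows "frechet_derivative f (at x) h = grad f x \<bullet> h"
proof -
  have "frechet_derivative f (at x) h = frechet_derivative f (at x) (\<Sum>i\<in>Basis. (h \<bullet> i) *\<^sub>R i)"
    by (simp add: euclidean_representation)
  also have "\<dots> = (\<Sum>i\<in>Basis. (h \<bullet> i) * pderiv_at f i x)"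
    unfolding linear_sum[OF smooth_frechet_linear[OF assms]]
    by (simp add: linear_cmul[OF smooth_frechet_linear[OF assms]])
  also have "\<dots> = grad f x \<bullet> h"
    by (simp add: grad_def inner_sum_left mult.commute inner_commute[of h])
  finally show ?thesis .
qed

lemma smooth_grad_continuous: "smooth f \<Longrightarrow> continuous_on S (grad f)"
  unfolding grad_def by (intro continuous_intros smooth_continuous smooth_pderiv)

lemma smooth_grad_measurable: "smooth f \<Longrightarrow> grad f \<in> borel_measurable borel"
  using smooth_grad_continuous borel_measurable_continuous_onI by blast

lemma grad_add: "smooth f \<Longrightarrow> smooth g \<Longrightarrow> grad (\<lambda>x. f x + g x) x = grad f x + grad g x"
  by (simp add: grad_def pderiv_add sum.distrib scaleR_add_left)

lemma grad_cmult: "smooth f \<Longrightarrow> grad (\<lambda>x. c * f x) x = c *\<^sub>R grad f x"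
  by (simp add: grad_def pderiv_cmult scaleR_sum_right)

lemma grad_diff: "smooth f \<Longrightarrow> smooth g \<Longrightarrow> grad (\<lambda>x. f x - g x) x = grad f x - grad g x"
  using grad_add[OF _ smooth_cmult, of f g "-1" x] grad_cmult[of g "-1" x] by simp

lemma grad_const: "grad (\<lambda>x. c) x = 0"
  by (simp add: grad_def)

lemma grad_inner: "grad (\<lambda>x. x \<bullet> a) x = a"
proof -
  have "((\<lambda>x. x \<bullet> a) has_derivative (\<lambda>h. h \<bullet> a)) (at x)" for x
    by (auto intro!: derivative_eq_intros)
  then have "frechet_derivative (\<lambda>x. x \<bullet> a) (at x) = (\<lambda>h. h \<bullet> a)"
    using frechet_derivative_at by metis
  then show ?thesis
    using euclidean_representation[of a] by (simp add: grad_def inner_commute)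
qed

text \<open>The family \<open>t\<^sup>-\<^sup>m exp (-1/t)\<close> is closed under differentiation, which gives smoothness at \<open>0\<close> for all its members at once.\<close>

definition flat :: "nat \<Rightarrow> real \<Rightarrow> real" where
  "flat m t = (if t > 0 then exp (- 1 / t) / t ^ m else 0)"

lemma flat_deriv: "(flat m has_real_derivative flat (m + 2) t - real m * flat (m + 1) t) (at t)"
proof (cases "t = 0")
  case True
  have "((\<lambda>y. flat m y / y) \<longlongrightarrow> 0) (at 0)"
  proof (rule filterlim_split_at)
    have "((\<lambda>y::real. exp (- 1 / y) / y ^ m / y) \<longlongrightarrow> 0) (at_right 0)"
    proof -
      \<comment> \<open>With x = 1/y the difference quotient at 0 from the right becomes a power of
        x divided by exp x.\<close>
      have "((\<lambda>x::real. x ^ Suc m / exp x) \<longlongrightarrow> 0) at_top"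
        by (rule tendsto_power_div_exp_0)
      then have "((\<lambda>y::real. (inverse y) ^ Suc m / exp (inverse y)) \<longlongrightarrow> 0) (at_right 0)"
        using filterlim_compose filterlim_inverse_at_top_right by blast
      then show ?thesis
        by (simp add: exp_minus field_simps)
    qed
    then show "((\<lambda>y. flat m y / y) \<longlongrightarrow> 0) (at_right 0)"
      by (rule Lim_transform_eventually) (auto simp: flat_def eventually_at_filter)
    show "((\<lambda>y. flat m y / y) \<longlongrightarrow> 0) (at_left 0)"
      by (rule Lim_transform_eventually[OF tendsto_const]) (auto simp: flat_def eventually_at_filter)
  qed
  then have "(flat m has_real_derivative 0) (at 0)"
    by (simp add: has_field_derivative_iff flat_def)
  then show ?thesis using True by (simp add: flat_def)
next
  case False
  then consider "t > 0" | "t < 0" by linarith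
  then show ?thesis
  proof cases
    case 1
    have "((\<lambda>t. exp (- 1 / t) / t ^ m) has_real_derivative flat (m + 2) t - real m * flat (m + 1) t) (at t)"
      using 1 by (cases m)
        (auto intro!: derivative_eq_intros simp: flat_def divide_simps power2_eq_square,
          simp_all add: algebra_simps power2_eq_square power_eq_if)
    then show ?thesis
      by (rule DERIV_cong_ev[THEN iffD1, rotated -1])
        (auto simp: flat_def eventually_nhds intro!: exI[of _ "{0<..}"] 1)
  next
    case 2
    have "((\<lambda>t. 0) has_real_derivative flat (m + 2) t - real m * flat (m + 1) t) (at t)"
      using 2 by (auto simp: flat_def)
    then show ?thesis
      by (rule DERIV_cong_ev[THEN iffD1, rotated -1])
        (auto simp: flat_def eventually_nhds intro!: exI[of _ "{..<0}"] 2)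
  qed
qed

text \<open>The induction generalises over \<open>m\<close>, because by \<open>flat_deriv\<close>
  one derivative of \<open>flat m\<close> brings in \<open>flat (m + 1)\<close> and
  \<open>flat (m + 2)\<close>.\<close>

lemma Ck_flat:
  fixes g :: "'a::euclidean_space \<Rightarrow> real"
  assumes "smooth g" shows "Ck k (\<lambda>x. flat m (g x))"
proof (induction k arbitrary: m)
  case 0
  have "continuous_on UNIV (flat m)"
    using flat_deriv DERIV_isCont continuous_at_imp_continuous_on by blast
  then show ?case
    using smooth_continuous[OF assms] continuous_on_compose2[of UNIV "flat m" UNIV g] by auto
next
  case (Suc k)
  show ?case
  proof (rule CkI)
    show "((\<lambda>x. flat m (g x)) has_derivative
      (\<lambda>h. (flat (m + 2) (g x) + (- real m) * flat (m + 1) (g x)) * frechet_derivative g (at x) h)) (at x)" for x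
      using has_derivative_compose[OF smooth_has_derivative[OF assms], where g = "flat m"]
        flat_deriv[of m "g x"] by (simp add: has_field_derivative_def)
    fix i :: 'a assume "i \<in> Basis"
    then have "Ck k (pderiv_at g i)" using assms smooth_pderiv smooth_def by blast
    then show "Ck k (\<lambda>x. (flat (m + 2) (g x) + - real m * flat (m + 1) (g x)) * frechet_derivative g (at x) i)"
      by (intro Ck_mult Ck_add Ck_const Suc.IH)
  qed
qed

section \<open>Test functions and bump functions\<close>

lemma test_functionD:
  assumes "test_function \<Omega> \<phi>"
  shows "smooth \<phi>" "\<exists>K\<subseteq>\<Omega>. compact K \<and> (\<forall>x. x \<notin> K \<longrightarrow> \<phi> x = 0)"
  using assms by (auto simp: test_function_def)

lemma test_function_mono: "test_function A \<phi> \<Longrightarrow> A \<subseteq> B \<Longrightarrow> test_function B \<phi>"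
  unfolding test_function_def by (meson order.trans)

lemma test_function_outside:
  assumes "test_function \<Omega> \<phi>" "x \<notin> \<Omega>" shows "\<phi> x = 0"
  using assms unfolding test_function_def by blast

lemma test_function_pderiv:
  assumes "test_function \<Omega> \<phi>" "i \<in> Basis"
  shows "test_function \<Omega> (pderiv_at \<phi> i)"
proof -
  obtain K where K: "K \<subseteq> \<Omega>" "compact K" "\<forall>x. x \<notin> K \<longrightarrow> \<phi> x = 0"
    using assms(1) test_functionD by meson
  have "pderiv_at \<phi> i x = 0" if "x \<notin> K" for x
    using pderiv_zero_outside[of \<phi> "- K" x 0 i] K that test_functionD[OF assms(1)]
    by (auto simp: compact_imp_closed open_Compl)
  then show ?thesis
    using K assms smooth_pderiv test_functionD(1) unfolding test_function_def by blast
qed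

lemma test_function_mult:
  "smooth f \<Longrightarrow> test_function \<Omega> \<phi> \<Longrightarrow> test_function \<Omega> (\<lambda>x. f x * \<phi> x)"
  unfolding test_function_def using smooth_mult by (metis mult_zero_right)

lemma test_function_bounded:
  assumes "test_function \<Omega> \<phi>" obtains B where "\<And>x. \<bar>\<phi> x\<bar> \<le> B" "B \<ge> 0"
proof -
  obtain K where K: "K \<subseteq> \<Omega>" "compact K" "\<forall>x. x \<notin> K \<longrightarrow> \<phi> x = 0"
    using assms(1) test_functionD by meson
  have "bounded (\<phi> ` K)"
    using K assms by (intro compact_imp_bounded compact_continuous_image smooth_continuous test_functionD)
  then obtain B where "\<forall>x\<in>K. \<bar>\<phi> x\<bar> \<le> B" "B > 0"
    by (auto simp: bounded_pos)
  then show thesis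
    using K that[of B] by (metis abs_zero less_eq_real_def)
qed

text \<open>The profile exp (-1/t) is applied to (r/2)^2 - |x - c|^2; radius r/2 makes the support a
  compact subset of the open ball. The centre is arbitrary because later kernels sit in a ball
  inside a cone, away from the origin.\<close>

lemma bump_exists:
  fixes c :: "'a::euclidean_space"
  assumes "0 < r"
  obtains k :: "'a \<Rightarrow> real" where "test_function (ball c r) k" "\<And>x. 0 \<le> k x"
    "integrable lborel k" "(\<integral>x. k x \<partial>lborel) = 1"
proof -
  define f where "f x = flat 0 ((r/2)\<^sup>2 - (x - c) \<bullet> (x - c))" for x :: 'a
  have "smooth (\<lambda>x::'a. x \<bullet> x)"
  proof -
    have "Ck k (\<lambda>x::'a. \<Sum>i\<in>B. (x \<bullet> i) * (x \<bullet> i))" if "finite B" for k B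
      using that by (induction B) (auto intro!: Ck_const Ck_add Ck_mult Ck_inner)
    then show ?thesis
      unfolding smooth_def by (subst euclidean_inner) simp
  qed
  then have "smooth (\<lambda>x::'a. (x - c) \<bullet> (x - c))"
    using smooth_affine[of "\<lambda>x. x \<bullet> x" 1 "- c"] by simp
  then have "smooth (\<lambda>x::'a. (r/2)\<^sup>2 - (x - c) \<bullet> (x - c))"
    by (intro smooth_diff smooth_const)
  then have sf: "smooth f"
    using Ck_flat unfolding smooth_def f_def by blast
  have pos: "f x > 0" if "x \<in> ball c (r/2)" for x
  proof -
    have "norm (x - c) ^ 2 < (r/2) ^ 2"
      using that by (intro power_strict_mono) (auto simp: dist_norm norm_minus_commute)
    then show ?thesis by (simp add: f_def flat_def power2_norm_eq_inner)
  qed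
  have zero: "f x = 0" if "x \<notin> cball c (r/2)" for x
  proof -
    have "norm (x - c) ^ 2 \<ge> (r/2) ^ 2"
      using that \<open>0 < r\<close> by (intro power_mono) (auto simp: dist_norm norm_minus_commute)
    then show ?thesis by (simp add: f_def flat_def power2_norm_eq_inner)
  qed
  have nn: "f x \<ge> 0" for x by (simp add: f_def flat_def)
  have "set_integrable lborel (cball c (r/2)) f"
    unfolding set_integrable_def
    by (rule borel_integrable_compact) (auto intro: smooth_continuous sf)
  moreover have "indicator (cball c (r/2)) x *\<^sub>R f x = f x" for x
    using zero by (cases "x \<in> cball c (r/2)") auto
  ultimately have int: "integrable lborel f"
    unfolding set_integrable_def by (simp only:)
  define I where "I = (\<integral>x. f x \<partial>lborel)"
  have "I > 0"
  proof -
    have "I \<noteq> 0"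
    proof
      assume "I = 0"
      then have "AE x in lborel. f x = 0"
        using integral_nonneg_eq_0_iff_AE[OF int] nn by (auto simp: I_def)
      then have "AE x in lborel. x \<notin> ball c (r/2)"
        using pos by (auto elim!: eventually_mono) (metis less_irrefl mem_ball)
      then have "emeasure lborel (ball c (r/2)) = 0"
        using AE_iff_null_sets[of "ball c (r/2)" lborel] by auto
      then show False
        using \<open>0 < r\<close> unit_ball_vol_pos[OF of_nat_0_le_iff, of "DIM('a)"] zero_less_power[of "r/2" "DIM('a)"]
        by (simp add: emeasure_ball ennreal_eq_0_iff mult_le_0_iff del: zero_less_power)
    qed
    moreover have "I \<ge> 0" unfolding I_def using nn by (rule Bochner_Integration.integral_nonneg)
    ultimately show ?thesis by simp
  qed
  define k where "k x = (1/I) * f x" for x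
  show thesis
  proof
    have "smooth k" unfolding k_def by (intro smooth_cmult sf)
    moreover have "cball c (r/2) \<subseteq> ball c r" using \<open>0 < r\<close> by auto
    ultimately show "test_function (ball c r) k"
      unfolding test_function_def k_def using zero by auto
    show "integrable lborel k" unfolding k_def using int by auto
    show "0 \<le> k x" for x using nn \<open>I > 0\<close> by (simp add: k_def)
    show "(\<integral>x. k x \<partial>lborel) = 1" using \<open>I > 0\<close> by (simp add: k_def I_def)
  qed
qed

section \<open>Convolution with test functions\<close>

lemma compact_support_uniformly_continuous:
  fixes f :: "'a::euclidean_space \<Rightarrow> 'b::real_normed_vector"
  assumes "continuous_on UNIV f" "compact K" "\<And>x. x \<notin> K \<Longrightarrow> f x = 0"
    and "e > 0"
  obtains d where "d > 0" "\<And>x y. dist x y < d \<Longrightarrow> norm (f x - f y) < e"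
proof -
  obtain R where R: "\<And>x. x \<in> K \<Longrightarrow> norm x \<le> R"
    using assms(2) compact_imp_bounded bounded_iff by metis
  have "uniformly_continuous_on (cball 0 (R + 1)) f"
    by (intro compact_uniformly_continuous continuous_on_subset[OF assms(1)]) auto
  then obtain d where d: "d > 0" "\<And>x y. x \<in> cball 0 (R + 1) \<Longrightarrow> y \<in> cball 0 (R + 1) \<Longrightarrow> dist x y < d \<Longrightarrow> dist (f x) (f y) < e"
    unfolding uniformly_continuous_on_def using \<open>e > 0\<close> by metis
  show thesis
  proof
    \<comment> \<open>The bound 1 forces both points into the ball of radius \<open>R + 1\<close> as
      soon as one of them is in the ball of radius \<open>R\<close>.\<close>
    show "min d 1 > 0" using d by simp
    fix x y :: 'a assume xy: "dist x y < min d 1"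
    show "norm (f x - f y) < e"
    proof (cases "norm x \<le> R \<or> norm y \<le> R")
      case True
      then have "x \<in> cball 0 (R + 1)" "y \<in> cball 0 (R + 1)"
        using xy norm_triangle_ineq2[of x y] norm_triangle_ineq2[of y x]
        by (auto simp: dist_norm norm_minus_commute)
      then show ?thesis using d xy by (auto simp: dist_norm)
    next
      case False
      then have "x \<notin> K" "y \<notin> K" using R by auto
      then show ?thesis using assms by simp
    qed
  qed
qed

lemma test_function_grad_support:
  assumes "test_function \<Omega> k"
  obtains K where "compact K" "K \<subseteq> \<Omega>" "\<And>x. x \<notin> K \<Longrightarrow> k x = 0" "\<And>x. x \<notin> K \<Longrightarrow> grad k x = 0"
proof -
  obtain K where K: "K \<subseteq> \<Omega>" "compact K" "\<forall>x. x \<notin> K \<longrightarrow> k x = 0"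
    using assms(1) test_functionD by meson
  have "pderiv_at k i x = 0" if "x \<notin> K" for x i
    using pderiv_zero_outside[of k "- K" x 0 i] K that test_functionD[OF assms(1)]
    by (auto simp: compact_imp_closed open_Compl)
  then have "grad k x = 0" if "x \<notin> K" for x
    using that by (simp add: grad_def)
  then show thesis using K that by blast
qed

lemma smooth_has_derivative_grad:
  assumes "smooth f" shows "(f has_derivative (\<bullet>) (grad f x)) (at x within S)"
proof -
  have "frechet_derivative f (at x) = (\<bullet>) (grad f x)"
    using frechet_eq_grad_inner[OF assms] by (rule ext)
  then show ?thesis
    using smooth_has_derivative[OF assms, of x] by (metis has_derivative_at_withinI)
qed

text \<open>Uniform continuity of the compactly supported gradient makes the Taylor remainder small
  uniformly in the base point. This uniformity is what allows a convolution to be differentiated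
  against a merely integrable function.\<close>

lemma test_function_first_order:
  fixes k :: "'a::euclidean_space \<Rightarrow> real"
  assumes k: "test_function UNIV k" and "e > 0"
  obtains d where "d > 0" "\<And>x h. norm h < d \<Longrightarrow> \<bar>k (x + h) - k x - grad k x \<bullet> h\<bar> \<le> e * norm h"
proof -
  note sk = test_functionD(1)[OF k]
  obtain K where K: "compact K" "\<And>x. x \<notin> K \<Longrightarrow> grad k x = 0"
    using test_function_grad_support[OF k] by metis
  obtain d where d: "d > 0" "\<And>x y. dist x y < d \<Longrightarrow> norm (grad k x - grad k y) < e"
    using compact_support_uniformly_continuous[OF smooth_grad_continuous[OF sk] K \<open>e > 0\<close>] by metis
  show thesis
  proof
    fix x h :: 'a assume h: "norm h < d"
    have "norm (k (x + h) - k x - grad k x \<bullet> (x + h - x)) \<le> norm (x + h - x) * e"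
    proof (rule differentiable_bound_linearization[where S = "ball x d" and f' = "\<lambda>y h. grad k y \<bullet> h"])
      show "x + t *\<^sub>R (x + h - x) \<in> ball x d" if "t \<in> {0..1}" for t
      proof -
        have "norm (t *\<^sub>R h) \<le> norm h" using that mult_right_mono[of t 1 "norm h"] by auto
        then show ?thesis using h by (auto simp: dist_norm)
      qed
      show "(k has_derivative (\<bullet>) (grad k y)) (at y within ball x d)" for y
        by (rule smooth_has_derivative_grad[OF sk])
      show "onorm ((\<bullet>) (grad k y) - (\<bullet>) (grad k x)) \<le> e" if "y \<in> ball x d" for y
      proof (rule onorm_le)
        fix h
        have "norm (grad k y \<bullet> h - grad k x \<bullet> h) \<le> norm (grad k y - grad k x) * norm h"
          by (metis inner_diff_left real_norm_def Cauchy_Schwarz_ineq2)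
        also have "\<dots> \<le> e * norm h"
          using d(2)[of y x] that by (intro mult_right_mono) (auto simp: dist_commute)
        finally show "norm (((\<bullet>) (grad k y) - (\<bullet>) (grad k x)) h) \<le> e * norm h" by simp
      qed
    qed (use d in auto)
    then show "\<bar>k (x + h) - k x - grad k x \<bullet> h\<bar> \<le> e * norm h"
      by (simp add: mult.commute)
  qed (use d in auto)
qed

text \<open>A correlation: the kernel is evaluated at y - x, so the value at x depends on
  \<open>w\<close> over x + supp k. A kernel supported in a cone of directions then looks from x
  into that cone; the price is a minus sign in each derivative.\<close>

definition conv :: "('a::euclidean_space \<Rightarrow> real) \<Rightarrow> ('a \<Rightarrow> real) \<Rightarrow> 'a \<Rightarrow> real" where
  "conv k w x = (\<integral>y. k (y - x) * w y \<partial>lborel)"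

lemma test_function_measurable: "test_function \<Omega> k \<Longrightarrow> k \<in> borel_measurable borel"
  using test_functionD(1) smooth_measurable by blast

lemma integrable_mult_bounded:
  fixes f w :: "'a \<Rightarrow> real"
  assumes "integrable M w" "f \<in> borel_measurable M" "\<And>x. \<bar>f x\<bar> \<le> B"
  shows "integrable M (\<lambda>x. f x * w x)"
proof (rule Bochner_Integration.integrable_bound)
  show "integrable M (\<lambda>x. B * w x)" using assms by auto
  have "B \<ge> 0" using assms(3)[of undefined] by linarith
  then show "AE x in M. norm (f x * w x) \<le> norm (B * w x)"
    using assms(3) by (auto simp: abs_mult intro!: AE_I2 mult_right_mono)
qed (use assms in measurable)

lemma conv_integrable:
  assumes k: "test_function UNIV k" and w: "integrable lborel w"
  shows "integrable lborel (\<lambda>y. k (y - x) * w y)"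
proof -
  obtain B where B: "\<And>x. \<bar>k x\<bar> \<le> B" using test_function_bounded[OF k] by blast
  have "(\<lambda>y. k (y - x)) \<in> borel_measurable borel"
    using test_function_measurable[OF k] by measurable
  then show ?thesis using B w by (intro integrable_mult_bounded[of _ _ _ B]) auto
qed

lemma test_function_neg_pderiv:
  "test_function \<Omega> k \<Longrightarrow> i \<in> Basis \<Longrightarrow> test_function \<Omega> (\<lambda>z. - pderiv_at k i z)"
  using test_function_mult[OF smooth_const[of "-1"] test_function_pderiv] by auto

text \<open>The remainder of the kernel is uniformly small compared with \<open>norm h\<close>, so
  the remainder of the convolution is controlled by the L1 norm of \<open>w\<close>. The minus signs
  come from x entering the kernel as y - x.\<close>

lemma conv_has_derivative:
  fixes k :: "'a::euclidean_space \<Rightarrow> real"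
  assumes k: "test_function UNIV k" and w: "integrable lborel w"
  shows "(conv k w has_derivative (\<lambda>h. \<Sum>i\<in>Basis. (h \<bullet> i) * conv (\<lambda>z. - pderiv_at k i z) w x)) (at x)"
    (is "(_ has_derivative ?D) _")
  unfolding has_derivative_at_alt
proof (intro conjI allI impI)
  show "bounded_linear ?D"
    by (intro bounded_linear_sum bounded_linear_mult_const bounded_linear_inner_left)
  fix e :: real assume "e > 0"
  define I where "I = (\<integral>y. \<bar>w y\<bar> \<partial>lborel)"
  have I: "I \<ge> 0" unfolding I_def by (rule Bochner_Integration.integral_nonneg) simp
  \<comment> \<open>\<open>I + 1\<close> keeps the quotient meaningful when \<open>w\<close>
    vanishes almost everywhere; at the end I / (I + 1) is at most 1.\<close>
  obtain d where d: "d > 0" "\<And>x h. norm h < d \<Longrightarrow> \<bar>k (x + h) - k x - grad k x \<bullet> h\<bar> \<le> e / (I + 1) * norm h"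
    using test_function_first_order[OF k, of "e / (I + 1)"] \<open>e > 0\<close> I by auto
  note neg = conv_integrable[OF test_function_neg_pderiv[OF k] w]
  have "norm (conv k w z - conv k w x - ?D (z - x)) \<le> e * norm (z - x)" if z: "norm (z - x) < d" for z
  proof -
    define h where "h = z - x"
    have eq: "grad k (y - x) \<bullet> h * w y = - (\<Sum>i\<in>Basis. (h \<bullet> i) * (- pderiv_at k i (y - x) * w y))" for y
      by (simp add: grad_def inner_sum_left sum_distrib_left sum_distrib_right sum_negf inner_commute[of h] mult_ac
        flip: sum_negf)
    have Dh: "?D h = - (\<integral>y. grad k (y - x) \<bullet> h * w y \<partial>lborel)"
      unfolding eq conv_def by (subst Bochner_Integration.integral_minus, subst Bochner_Integration.integral_sum)
        (use neg in auto)
    have intg: "integrable lborel (\<lambda>y. grad k (y - x) \<bullet> h * w y)"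
      unfolding eq using neg by (intro Bochner_Integration.integrable_minus Bochner_Integration.integrable_sum integrable_mult_right) auto
    have "conv k w z - conv k w x - ?D h =
        (\<integral>y. k (y - z) * w y - k (y - x) * w y + grad k (y - x) \<bullet> h * w y \<partial>lborel)"
      unfolding Dh unfolding conv_def using conv_integrable[OF k w] intg by simp
    also have "\<dots> = (\<integral>y. (k (y - x + (-h)) - k (y - x) - grad k (y - x) \<bullet> (-h)) * w y \<partial>lborel)"
      by (simp add: h_def algebra_simps)
    finally have "norm (conv k w z - conv k w x - ?D h) \<le>
       (\<integral>y. norm ((k (y - x + (-h)) - k (y - x) - grad k (y - x) \<bullet> (-h)) * w y) \<partial>lborel)"
      by (simp only: integral_norm_bound)
    also have "\<dots> \<le> (\<integral>y. e / (I + 1) * norm h * \<bar>w y\<bar> \<partial>lborel)"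
    proof (rule integral_mono')
      show "integrable lborel (\<lambda>y. e / (I + 1) * norm h * \<bar>w y\<bar>)" using w by auto
      fix y
      have "\<bar>k (y - x + (-h)) - k (y - x) - grad k (y - x) \<bullet> (-h)\<bar> \<le> e / (I + 1) * norm (-h)"
        by (rule d(2)) (use z h_def in \<open>auto simp: norm_minus_commute\<close>)
      then have "\<bar>k (y - x + (-h)) - k (y - x) - grad k (y - x) \<bullet> (-h)\<bar> * \<bar>w y\<bar> \<le> e / (I + 1) * norm h * \<bar>w y\<bar>"
        by (intro mult_right_mono) auto
      then show "norm ((k (y - x + - h) - k (y - x) - grad k (y - x) \<bullet> - h) * w y) \<le> e / (I + 1) * norm h * \<bar>w y\<bar>"
        by (simp only: real_norm_def abs_mult)
    qed (use I \<open>e > 0\<close> in auto)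
    also have "\<dots> = e / (I + 1) * norm h * I" by (simp add: I_def)
    also have "\<dots> = e * norm h * (I / (I + 1))" by simp
    also have "\<dots> \<le> e * norm h * 1"
      by (intro mult_left_mono) (use I \<open>e > 0\<close> in auto)
    finally show ?thesis by (simp add: h_def)
  qed
  then show "\<exists>d>0. \<forall>z. norm (z - x) < d \<longrightarrow> norm (conv k w z - conv k w x - ?D (z - x)) \<le> e * norm (z - x)"
    using d by blast
qed

lemma pderiv_conv:
  assumes "test_function UNIV k" "integrable lborel w" "i \<in> Basis"
  shows "pderiv_at (conv k w) i x = conv (\<lambda>z. - pderiv_at k i z) w x"
proof -
  have "pderiv_at (conv k w) i x = (\<Sum>j\<in>Basis. (i \<bullet> j) * conv (\<lambda>z. - pderiv_at k j z) w x)"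
    by (rule frechet_derivative_eqI[OF conv_has_derivative[OF assms(1,2)]])
  also have "\<dots> = (\<Sum>j\<in>Basis. if j = i then conv (\<lambda>z. - pderiv_at k i z) w x else 0)"
    using assms by (intro sum.cong) (auto simp: inner_Basis)
  finally show ?thesis using assms by simp
qed

text \<open>A partial derivative of a convolution is the convolution with
  \<open>- pderiv_at k i\<close>, again a test function, so the induction generalises over the
  kernel while \<open>w\<close> stays fixed.\<close>

lemma smooth_conv:
  fixes k :: "'a::euclidean_space \<Rightarrow> real"
  assumes k: "test_function UNIV k" and w: "integrable lborel w"
  shows "smooth (conv k w)"
proof -
  have "Ck n (conv k w)" if "test_function UNIV k" for n k
    using that
  proof (induction n arbitrary: k)
    case 0
    have "isCont (conv k w) x" for x
      by (rule has_derivative_continuous[OF conv_has_derivative[OF 0 w]])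
    then show ?case
      by (simp add: continuous_at_imp_continuous_on)
  next
    case (Suc n)
    have "conv k w differentiable_on UNIV"
      using conv_has_derivative[OF Suc.prems w] by (auto simp: differentiable_on_def differentiable_def)
    moreover have "Ck n (pderiv_at (conv k w) i)" if "i \<in> Basis" for i
      using Suc.IH[OF test_function_neg_pderiv[OF Suc.prems that]] pderiv_conv[OF Suc.prems w that]
      by presburger
    ultimately show ?case by simp
  qed
  then show ?thesis using k smooth_def by blast
qed

section \<open>Affine substitution and integration by parts\<close>

lemma lborel_affine_nn_integral:
  fixes t :: "'a::euclidean_space"
  assumes [measurable]: "f \<in> borel_measurable borel" and "c \<noteq> 0"
  shows "(\<integral>\<^sup>+x. f x \<partial>lborel) = ennreal (\<bar>c\<bar> ^ DIM('a)) * (\<integral>\<^sup>+x. f (t + c *\<^sub>R x) \<partial>lborel)"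
  by (subst lborel_affine[OF \<open>c \<noteq> 0\<close>, of t])
    (simp add: nn_integral_density nn_integral_distr nn_integral_cmult)

lemma lborel_affine_integral:
  fixes t :: "'a::euclidean_space" and f :: "'a \<Rightarrow> real"
  assumes [measurable]: "f \<in> borel_measurable borel" and "c \<noteq> 0"
  shows "(\<integral>x. f x \<partial>lborel) = \<bar>c\<bar> ^ DIM('a) * (\<integral>x. f (t + c *\<^sub>R x) \<partial>lborel)"
  by (subst lborel_affine[OF \<open>c \<noteq> 0\<close>, of t])
    (simp add: integral_density integral_distr)

lemma lborel_affine_integrable:
  fixes t :: "'a::euclidean_space" and f :: "'a \<Rightarrow> real"
  assumes [measurable]: "f \<in> borel_measurable borel" and "c \<noteq> 0"
  shows "integrable lborel (\<lambda>x. f (t + c *\<^sub>R x)) \<longleftrightarrow> integrable lborel f"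
  by (subst (2) lborel_affine[OF \<open>c \<noteq> 0\<close>, of t], subst integrable_density)
    (use \<open>c \<noteq> 0\<close> in \<open>auto simp: integrable_distr_eq\<close>)

lemma test_function_integrable:
  fixes k :: "'a::euclidean_space \<Rightarrow> real"
  assumes "test_function \<Omega> k" shows "integrable lborel k"
proof -
  obtain K where K: "K \<subseteq> \<Omega>" "compact K" "\<forall>x. x \<notin> K \<longrightarrow> k x = 0"
    using assms(1) test_functionD by meson
  have "set_integrable lborel K k"
    unfolding set_integrable_def
    by (rule borel_integrable_compact) (use K smooth_continuous test_functionD[OF assms(1)] in auto)
  moreover have "indicator K x *\<^sub>R k x = k x" for x
    using K by (cases "x \<in> K") auto
  ultimately show ?thesis
    unfolding set_integrable_def by (simp only:)
qed

text \<open>Convolve \<open>f\<close> with the indicator of a large ball. Near 0 the result is the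
  constant \<open>\<integral>f\<close> by translation invariance, so its derivative at 0 vanishes;
  that derivative is also minus the integral of the partial derivative of \<open>f\<close>.\<close>

lemma integral_pderiv_zero:
  fixes f :: "'a::euclidean_space \<Rightarrow> real"
  assumes f: "test_function UNIV f" and i: "i \<in> Basis"
  shows "(\<integral>x. pderiv_at f i x \<partial>lborel) = 0"
proof -
  obtain K where K: "compact K" "\<And>x. x \<notin> K \<Longrightarrow> f x = 0" "\<And>x. x \<notin> K \<Longrightarrow> grad f x = 0"
    using test_function_grad_support[OF f] by metis
  obtain R where R: "\<And>x. x \<in> K \<Longrightarrow> norm x \<le> R"
    using K(1) compact_imp_bounded bounded_iff by metis
  \<comment> \<open>The extra 1 in the radius is room for translations: for |x| < 1 the support of
    f(y - x) still lies where \<open>w\<close> is 1.\<close>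
  define w :: "'a \<Rightarrow> real" where "w = indicator (ball 0 (R + 1))"
  have w: "integrable lborel w"
    unfolding w_def by (rule integrable_real_indicator) (use emeasure_lborel_ball_finite in \<open>auto simp: less_top\<close>)
  have "conv f w x = (\<integral>x. f x \<partial>lborel)" if "x \<in> ball 0 1" for x
  proof -
    have "f (y - x) * w y = f (- x + 1 *\<^sub>R y)" for y
    proof (cases "y - x \<in> K")
      case True
      then have "norm y < R + 1"
        using R[OF True] that norm_triangle_ineq2[of y x] by simp
      then show ?thesis by (simp add: w_def)
    next
      case False
      then show ?thesis using K by simp
    qed
    then have "conv f w x = (\<integral>y. f (- x + 1 *\<^sub>R y) \<partial>lborel)"
      unfolding conv_def by (simp only:)
    also have "\<dots> = (\<integral>x. f x \<partial>lborel)"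
      using lborel_affine_integral[OF test_function_measurable[OF f], of 1 "- x"] by simp
    finally show ?thesis .
  qed
  then have "pderiv_at (conv f w) i 0 = 0"
    using pderiv_zero_outside[OF smooth_conv[OF f w], of "ball 0 1"] by auto
  then have "(\<integral>y. - pderiv_at f i y * w y \<partial>lborel) = 0"
    by (simp add: pderiv_conv[OF f w i] conv_def)
  moreover have "- pderiv_at f i y * w y = - pderiv_at f i y" for y
  proof (cases "y \<in> K")
    case True
    then show ?thesis using R[OF True] by (simp add: w_def)
  next
    case False
    then show ?thesis using K(3) grad_inner_Basis[OF i, of f y] by simp
  qed
  ultimately have "(\<integral>y. - pderiv_at f i y \<partial>lborel) = 0"
    by (simp only:)
  then show ?thesis by simp
qed

lemma integral_by_parts_smooth:
  fixes f :: "'a::euclidean_space \<Rightarrow> real"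
  assumes f: "smooth f" and g: "test_function UNIV g" and i: "i \<in> Basis"
  shows "(\<integral>x. f x * pderiv_at g i x \<partial>lborel) = - (\<integral>x. pderiv_at f i x * g x \<partial>lborel)"
proof -
  have "(\<integral>x. f x * pderiv_at g i x + pderiv_at f i x * g x \<partial>lborel) = 0"
    using integral_pderiv_zero[OF test_function_mult[OF f g] i]
    by (simp add: pderiv_mult[OF f test_functionD(1)[OF g]])
  moreover have "integrable lborel (\<lambda>x. f x * pderiv_at g i x)" "integrable lborel (\<lambda>x. pderiv_at f i x * g x)"
    using test_function_integrable test_function_mult test_function_pderiv f g i smooth_pderiv by blast+
  ultimately show ?thesis by simp
qed

section \<open>Rescaled kernels\<close>

definition rescale :: "real \<Rightarrow> ('a::euclidean_space \<Rightarrow> real) \<Rightarrow> 'a \<Rightarrow> real" where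
  "rescale s k y = k (y /\<^sub>R s) / s ^ DIM('a)"

lemma test_function_rescale:
  fixes k :: "'a::euclidean_space \<Rightarrow> real"
  assumes k: "test_function U k" and "s > 0"
  shows "test_function ((*\<^sub>R) s ` U) (rescale s k)"
proof -
  obtain K where K: "K \<subseteq> U" "compact K" "\<forall>x. x \<notin> K \<longrightarrow> k x = 0"
    using k test_functionD by meson
  have eq: "rescale s k = (\<lambda>y. (1 / s ^ DIM('a)) * k ((inverse s) *\<^sub>R y + 0))"
    by (auto simp: rescale_def)
  have "smooth (rescale s k)"
    unfolding eq by (intro smooth_cmult smooth_affine test_functionD[OF k])
  moreover have "rescale s k y = 0" if "y \<notin> (*\<^sub>R) s ` K" for y
  proof -
    have "y /\<^sub>R s \<notin> K" using that \<open>s > 0\<close> by (auto simp: image_iff dest!: bspec[where x = "y /\<^sub>R s"])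
    then show ?thesis using K by (simp add: rescale_def)
  qed
  moreover have "compact ((*\<^sub>R) s ` K)" using K compact_scaling by blast
  ultimately show ?thesis
    unfolding test_function_def by (intro conjI exI[of _ "(*\<^sub>R) s ` K"] allI impI image_mono K(1))
qed

lemma rescale_integral:
  fixes k :: "'a::euclidean_space \<Rightarrow> real"
  assumes "k \<in> borel_measurable borel" and "s > 0"
  shows "(\<integral>x. rescale s k x \<partial>lborel) = (\<integral>x. k x \<partial>lborel)"
  using lborel_affine_integral[OF assms(1), of "inverse s" 0] \<open>s > 0\<close>
  by (simp add: rescale_def power_inverse field_simps)

text \<open>In this form mollification at scale s is the average of \<open>w\<close> over x + s supp
  k, which is the quantity estimated in the Morrey argument.\<close>

lemma conv_rescale:
  fixes k :: "'a::euclidean_space \<Rightarrow> real"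
  assumes [measurable]: "k \<in> borel_measurable borel" "w \<in> borel_measurable borel" and "s > 0"
  shows "conv (rescale s k) w x = (\<integral>y. k y * w (x + s *\<^sub>R y) \<partial>lborel)"
proof -
  have "conv (rescale s k) w x = \<bar>s\<bar> ^ DIM('a) * (\<integral>y. rescale s k (x + s *\<^sub>R y - x) * w (x + s *\<^sub>R y) \<partial>lborel)"
    unfolding conv_def
    by (rule lborel_affine_integral) (use \<open>s > 0\<close> in \<open>auto simp: rescale_def\<close>)
  then show ?thesis using \<open>s > 0\<close> by (simp add: rescale_def)
qed

section \<open>Mollification in \<open>L\<^sup>p\<close>\<close>

text \<open>Convexity of the p-th power in tangent form. Jensen's inequality, the weighted triangle
  inequality and both second-difference estimates are read off from it by a suitable choice of the
  point of tangency.\<close>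

lemma powr_tangent:
  fixes a t p :: real
  assumes p: "1 \<le> p" and "0 \<le> a" "0 \<le> t"
  shows "a powr p + p * a powr (p - 1) * (t - a) \<le> t powr p"
proof (cases "a = 0 \<or> t = 0")
  case False
  then have pos: "a > 0" "t > 0" using assms by auto
  have "t powr p - a powr p \<ge> (p * a powr (p - 1)) * (t - a)"
  proof (rule convex_on_imp_above_tangent[where A = "{0<..}"])
    show "((\<lambda>x. x powr p) has_real_derivative p * a powr (p - 1)) (at a within {0<..})"
      using pos by (auto intro!: derivative_eq_intros)
  qed (use pos powr_convex[OF p] in \<open>auto simp: interior_open\<close>)
  then show ?thesis by simp
next
  case True
  \<comment> \<open>For a = 0 the left side is 0, as \<open>0 powr\<close> any exponent is 0; for t
    = 0 the claim is a^p \<le> p a^p.\<close>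
  show ?thesis
  proof (cases "a = 0")
    case False
    then have t: "t = 0" "a > 0" using True assms by auto
    have "a powr (p - 1) * a = a powr p"
      using powr_add[of a "p - 1" 1] t by simp
    then have e: "p * a powr (p - 1) * (t - a) = - (p * a powr p)" unfolding t by (simp add: mult.assoc)
    moreover have "a powr p \<le> p * a powr p"
      using p by (simp add: mult_le_cancel_right1)
    ultimately show ?thesis unfolding e using p t by simp
  qed simp
qed

text \<open>Convexity at a + b = (1 - \<theta>) (a / (1 - \<theta>)) + \<theta> (b / \<theta>),
  proved by adding two tangent inequalities at a + b. For small \<theta> the weight on a^p is close
  to 1, so a small \<open>b\<close> changes the p-th power only a little.\<close>

lemma powr_add_le:
  fixes a b p \<theta> :: real
  assumes p: "1 \<le> p" and "0 \<le> a" "0 \<le> b" "0 < \<theta>" "\<theta> < 1"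
  shows "(a + b) powr p \<le> (1 - \<theta>) powr (1 - p) * a powr p + \<theta> powr (1 - p) * b powr p"
proof -
  define c where "c = a + b"
  have x: "s * (y / s) powr p = s powr (1 - p) * y powr p" if "s > 0" "y \<ge> 0" for s y
    using that by (simp add: powr_divide powr_diff)
  have "(1 - \<theta>) * (c powr p + p * c powr (p - 1) * (a / (1 - \<theta>) - c)) +
     \<theta> * (c powr p + p * c powr (p - 1) * (b / \<theta> - c)) \<le>
     (1 - \<theta>) * (a / (1 - \<theta>)) powr p + \<theta> * (b / \<theta>) powr p"
    using assms by (intro add_mono mult_left_mono powr_tangent) (auto simp: c_def)
  also have "(1 - \<theta>) * (c powr p + p * c powr (p - 1) * (a / (1 - \<theta>) - c)) +
     \<theta> * (c powr p + p * c powr (p - 1) * (b / \<theta> - c)) =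
     c powr p + p * c powr (p - 1) * ((1 - \<theta>) * (a / (1 - \<theta>)) + \<theta> * (b / \<theta>) - c)"
    by (simp add: algebra_simps)
  also have "(1 - \<theta>) * (a / (1 - \<theta>)) + \<theta> * (b / \<theta>) - c = 0"
    using assms by (simp add: c_def)
  finally show ?thesis
    using assms x[of "1 - \<theta>" a] x[of \<theta> b] by (simp add: c_def)
qed

lemma norm_add_powr_le:
  fixes a b :: "'a::real_normed_vector"
  assumes "0 \<le> p"
  shows "norm (a + b) powr p \<le> 2 powr p * (norm a powr p + norm b powr p)"
proof -
  have "norm (a + b) powr p \<le> (2 * max (norm a) (norm b)) powr p"
    using norm_triangle_ineq[of a b] assms by (intro powr_mono2) auto
  also have "\<dots> = 2 powr p * max (norm a) (norm b) powr p"
    by (simp add: powr_mult)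
  also have "\<dots> \<le> 2 powr p * (norm a powr p + norm b powr p)"
    by (intro mult_left_mono) (auto simp: max_def)
  finally show ?thesis .
qed

lemma p_integral_add_le:
  fixes f g :: "'a \<Rightarrow> 'b::euclidean_space"
  assumes "0 \<le> p" and [measurable]: "f \<in> borel_measurable M" "g \<in> borel_measurable M"
  shows "p_integral M p (\<lambda>x. f x + g x) \<le> ennreal (2 powr p) * (p_integral M p f + p_integral M p g)"
proof -
  have "p_integral M p (\<lambda>x. f x + g x) \<le> (\<integral>\<^sup>+x. ennreal (2 powr p) * (ennreal (norm (f x) powr p) + ennreal (norm (g x) powr p)) \<partial>M)"
    unfolding p_integral_def
    by (intro nn_integral_mono) (use norm_add_powr_le[OF \<open>0 \<le> p\<close>] in \<open>simp flip: ennreal_plus ennreal_mult\<close>)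
  also have "\<dots> = ennreal (2 powr p) * (p_integral M p f + p_integral M p g)"
    unfolding p_integral_def by (simp add: nn_integral_cmult nn_integral_add)
  finally show ?thesis .
qed

text \<open>Integrate the tangent inequality at the mean of |f| against the probability density
  \<open>k\<close>. If the right side is infinite there is nothing to show, which is why it is
  stated in \<open>ennreal\<close>.\<close>

lemma jensen_powr:
  fixes k f :: "'a \<Rightarrow> real"
  assumes p: "1 \<le> p" and k: "integrable M k" "\<And>x. 0 \<le> k x" "(\<integral>x. k x \<partial>M) = 1"
    and f [measurable]: "f \<in> borel_measurable M" and kf: "integrable M (\<lambda>x. k x * f x)"
  shows "ennreal (\<bar>\<integral>x. k x * f x \<partial>M\<bar> powr p) \<le> (\<integral>\<^sup>+x. ennreal (k x * \<bar>f x\<bar> powr p) \<partial>M)"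
proof (cases "(\<integral>\<^sup>+x. ennreal (k x * \<bar>f x\<bar> powr p) \<partial>M) = \<infinity>")
  case False
  have [measurable]: "k \<in> borel_measurable M" using k by auto
  have fin: "integrable M (\<lambda>x. k x * \<bar>f x\<bar> powr p)"
    by (rule integrableI_nonneg) (use k False in \<open>auto simp: less_top\<close>)
  have kaf: "integrable M (\<lambda>x. k x * \<bar>f x\<bar>)"
    using integrable_abs[OF kf] k by (simp add: abs_mult)
  define a where "a = (\<integral>x. k x * \<bar>f x\<bar> \<partial>M)"
  have a: "0 \<le> a" unfolding a_def using k by (intro Bochner_Integration.integral_nonneg) auto
  have "\<bar>\<integral>x. k x * f x \<partial>M\<bar> \<le> a"
    using integral_abs_bound[of M "\<lambda>x. k x * f x"] k by (simp add: a_def abs_mult)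
  then have "\<bar>\<integral>x. k x * f x \<partial>M\<bar> powr p \<le> a powr p"
    using p by (intro powr_mono2) auto
  also have "a powr p = (\<integral>x. (a powr p - p * a powr (p - 1) * a) * k x + p * a powr (p - 1) * (k x * \<bar>f x\<bar>) \<partial>M)"
    using k kaf by (simp add: a_def)
  also have "\<dots> \<le> (\<integral>x. k x * \<bar>f x\<bar> powr p \<partial>M)"
  proof (rule integral_mono)
    fix x
    have "k x * (a powr p + p * a powr (p - 1) * (\<bar>f x\<bar> - a)) \<le> k x * \<bar>f x\<bar> powr p"
      using p a k(2) by (intro mult_left_mono powr_tangent) auto
    then show "(a powr p - p * a powr (p - 1) * a) * k x + p * a powr (p - 1) * (k x * \<bar>f x\<bar>) \<le> k x * \<bar>f x\<bar> powr p"
      by (simp add: algebra_simps)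
  qed (use k kaf fin in auto)
  finally show ?thesis
    using nn_integral_eq_integral[OF fin] k by (simp add: ennreal_leI)
qed simp

lemma conv_alt:
  fixes k w :: "'a::euclidean_space \<Rightarrow> real"
  assumes [measurable]: "k \<in> borel_measurable borel" "w \<in> borel_measurable borel"
  shows "conv k w x = (\<integral>y. k y * w (x + y) \<partial>lborel)"
  unfolding conv_def
  using lborel_affine_integral[of "\<lambda>y. k (y - x) * w y" 1 x] by simp

text \<open>Young's inequality for a probability kernel: Jensen at each point, then exchange of the
  two integrals and translation invariance.\<close>

lemma conv_p_integral_le:
  fixes k w :: "'a::euclidean_space \<Rightarrow> real"
  assumes p: "1 \<le> p" and k: "test_function UNIV k" "\<And>x. 0 \<le> k x" "(\<integral>x. k x \<partial>lborel) = 1"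
    and w: "integrable lborel w"
  shows "p_integral lborel p (conv k w) \<le> p_integral lborel p w"
proof -
  have [measurable]: "k \<in> borel_measurable borel" "w \<in> borel_measurable borel"
    using test_function_measurable[OF k(1)] w by auto
  have int: "integrable lborel (\<lambda>y. k y * w (x + y))" for x
    using conv_integrable[OF k(1) w, of x]
      lborel_affine_integrable[of "\<lambda>y. k (y - x) * w y" 1 x] by simp
  have "p_integral lborel p (conv k w) \<le> (\<integral>\<^sup>+x. \<integral>\<^sup>+y. ennreal (k y * \<bar>w (x + y)\<bar> powr p) \<partial>lborel \<partial>lborel)"
    unfolding p_integral_def real_norm_def
  proof (rule nn_integral_mono)
    fix x
    show "ennreal (\<bar>conv k w x\<bar> powr p) \<le> (\<integral>\<^sup>+y. ennreal (k y * \<bar>w (x + y)\<bar> powr p) \<partial>lborel)"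
      unfolding conv_alt[OF \<open>k \<in> _\<close> \<open>w \<in> _\<close>]
      by (rule jensen_powr) (use p k int test_function_integrable in auto)
  qed
  also have "\<dots> = (\<integral>\<^sup>+y. \<integral>\<^sup>+x. ennreal (k y * \<bar>w (x + y)\<bar> powr p) \<partial>lborel \<partial>lborel)"
    by (rule lborel_pair.Fubini'[symmetric]) measurable
  also have "\<dots> = (\<integral>\<^sup>+y. ennreal (k y) * p_integral lborel p w \<partial>lborel)"
  proof (rule nn_integral_cong)
    fix y
    have "(\<integral>\<^sup>+x. ennreal (k y * \<bar>w (x + y)\<bar> powr p) \<partial>lborel) = ennreal (k y) * (\<integral>\<^sup>+x. ennreal (\<bar>w (y + 1 *\<^sub>R x)\<bar> powr p) \<partial>lborel)"
      using k(2) by (simp add: ennreal_mult nn_integral_cmult add.commute)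
    also have "\<dots> = ennreal (k y) * p_integral lborel p w"
      unfolding p_integral_def
      using lborel_affine_nn_integral[of "\<lambda>x. ennreal (\<bar>w x\<bar> powr p)" 1 y] by simp
    finally show "(\<integral>\<^sup>+x. ennreal (k y * \<bar>w (x + y)\<bar> powr p) \<partial>lborel) = ennreal (k y) * p_integral lborel p w" .
  qed
  also have "\<dots> = p_integral lborel p w"
    using nn_integral_eq_integral[OF test_function_integrable[OF k(1)]] k
    by (simp add: nn_integral_multc)
  finally show ?thesis .
qed

section \<open>Approximation in p-th mean\<close>

definition clamp_real :: "real \<Rightarrow> real \<Rightarrow> real" where
  "clamp_real M x = max (- M) (min M x)"

lemma clamp_real_measurable [measurable]: "clamp_real M \<in> borel_measurable borel"
  unfolding clamp_real_def by measurable

lemma p_integral_tendsto_0: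
  fixes f :: "nat \<Rightarrow> 'a \<Rightarrow> 'b::euclidean_space" and h :: "'a \<Rightarrow> real"
  assumes "1 \<le> p" and [measurable]: "\<And>n. f n \<in> borel_measurable M" "h \<in> borel_measurable M"
    and "\<And>n. AE x in M. norm (f n x) powr p \<le> h x" "(\<integral>\<^sup>+x. ennreal (h x) \<partial>M) < \<infinity>"
    and "AE x in M. (\<lambda>n. f n x) \<longlonglongrightarrow> 0"
  shows "(\<lambda>n. p_integral M p (f n)) \<longlonglongrightarrow> 0"
proof -
  have "(\<lambda>n. \<integral>\<^sup>+x. ennreal (norm (f n x) powr p) \<partial>M) \<longlonglongrightarrow> (\<integral>\<^sup>+x. 0 \<partial>M)"
  proof (rule nn_integral_dominated_convergence[where w = "\<lambda>x. ennreal (h x)"])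
    show "AE x in M. ennreal (norm (f j x) powr p) \<le> ennreal (h x)" for j
      using assms(4)[of j] by eventually_elim (simp add: ennreal_leI)
    show "AE x in M. (\<lambda>i. ennreal (norm (f i x) powr p)) \<longlonglongrightarrow> 0"
      using assms(6)
    proof eventually_elim
      case (elim x)
      have "(\<lambda>i. norm (f i x) powr p) \<longlonglongrightarrow> 0 powr p"
        using \<open>1 \<le> p\<close> by (intro tendsto_powr' tendsto_norm_zero elim) auto
      then show ?case using tendsto_ennrealI by fastforce
    qed
  qed (use assms in auto)
  then show ?thesis by (simp add: p_integral_def)
qed

text \<open>Truncate \<open>f\<close> at a height M, then approximate the truncation almost
  everywhere by continuous functions clamped to the same height and cut off near the support. Both
  limits are dominated, the second by the constant (2M)^p on a ball.\<close>

lemma p_integral_approx_continuous: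
  fixes f :: "'a::euclidean_space \<Rightarrow> real"
  assumes p: "1 \<le> p" and [measurable]: "f \<in> borel_measurable borel"
    and fin: "p_integral lborel p f < \<infinity>" and supp: "\<And>x. R \<le> norm x \<Longrightarrow> f x = 0" and "e > 0"
  obtains g where "continuous_on UNIV g" "\<And>x. R + 1 \<le> norm x \<Longrightarrow> g x = 0"
    "p_integral lborel p (\<lambda>x. f x - g x) < ennreal e"
proof -
  \<comment> \<open>Two errors below e', amplified by the factor \<open>2 powr p\<close> of the
    quasi-triangle inequality, add up to at most e/2.\<close>
  define e' where "e' = e / (4 * 2 powr p)"
  have e': "e' > 0" using \<open>e > 0\<close> by (simp add: e'_def)
  have "(\<lambda>n. p_integral lborel p (\<lambda>x. f x - clamp_real (real n) (f x))) \<longlonglongrightarrow> 0"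
  proof (rule p_integral_tendsto_0[OF p, where h = "\<lambda>x. \<bar>f x\<bar> powr p"])
    show "AE x in lborel. norm (f x - clamp_real (real n) (f x)) powr p \<le> \<bar>f x\<bar> powr p" for n
      using p by (intro AE_I2 powr_mono2) (auto simp: clamp_real_def)
    show "(\<integral>\<^sup>+ x. ennreal (\<bar>f x\<bar> powr p) \<partial>lborel) < \<infinity>"
      using fin by (simp add: p_integral_def)
    have "(\<lambda>n. f x - clamp_real (real n) (f x)) \<longlonglongrightarrow> 0" for x
    proof (rule tendsto_eventually, rule eventually_sequentiallyI)
      fix n assume "n \<ge> nat \<lceil>\<bar>f x\<bar>\<rceil>"
      then have "\<bar>f x\<bar> \<le> real n" by linarith
      then show "f x - clamp_real (real n) (f x) = 0" by (auto simp: clamp_real_def)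
    qed
    then show "AE x in lborel. (\<lambda>n. f x - clamp_real (real n) (f x)) \<longlonglongrightarrow> 0" by simp
  qed measurable
  then have "\<forall>\<^sub>F n in sequentially. p_integral lborel p (\<lambda>x. f x - clamp_real (real n) (f x)) < ennreal e'"
    using e' by (intro order_tendstoD(2)[of _ 0]) auto
  then obtain M :: nat where M: "p_integral lborel p (\<lambda>x. f x - clamp_real (real M) (f x)) < ennreal e'"
    using eventually_happens'[OF sequentially_bot] by auto
  define fM where "fM x = clamp_real (real M) (f x)" for x
  have [measurable]: "fM \<in> borel_measurable borel" unfolding fM_def by measurable
  \<comment> \<open>\<open>measurable_on\<close> supplies the continuous approximants: it means
    being a limit of continuous functions off a negligible set.\<close>
  have "f \<in> borel_measurable lebesgue"
    by (simp add: measurable_completion)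
  then have "f measurable_on UNIV"
    by (rule lebesgue_measurable_imp_measurable_on) auto
  then obtain N g where N: "negligible N" and g: "\<And>n. continuous_on UNIV (g n)"
    and lim: "\<And>x. x \<notin> N \<Longrightarrow> (\<lambda>n::nat. g n x) \<longlonglongrightarrow> f x"
    unfolding measurable_on_def by auto
  define cut where "cut x = max 0 (min 1 (R + 1 - norm x))" for x :: 'a
  define h where "h n x = clamp_real (real M) (g n x) * cut x" for n x
  have cut0: "cut x = 0" if "R + 1 \<le> norm x" for x using that by (auto simp: cut_def)
  have cut1: "cut x = 1" if "norm x \<le> R" for x using that by (auto simp: cut_def)
  have cutb: "0 \<le> cut x" "cut x \<le> 1" for x by (auto simp: cut_def)
  have h_cont: "continuous_on UNIV (h n)" for n
    unfolding h_def clamp_real_def cut_def by (intro continuous_intros g)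
  then have [measurable]: "h n \<in> borel_measurable borel" for n
    by (rule borel_measurable_continuous_onI)
  have "(\<lambda>n. p_integral lborel p (\<lambda>x. fM x - h n x)) \<longlonglongrightarrow> 0"
  proof (rule p_integral_tendsto_0[OF p, where h = "\<lambda>x. (2 * real M) powr p * indicator (cball 0 (R + 1)) x"])
    have "norm (fM x - h n x) powr p \<le> (2 * real M) powr p * indicator (cball 0 (R + 1)) x" for n x
    proof (cases "norm x \<le> R + 1")
      case True
      have "\<bar>h n x\<bar> \<le> real M * 1"
        unfolding h_def abs_mult by (intro mult_mono) (use cutb[of x] in \<open>auto simp: clamp_real_def\<close>)
      moreover have "\<bar>fM x\<bar> \<le> real M" by (auto simp: fM_def clamp_real_def)
      ultimately have "norm (fM x - h n x) powr p \<le> (2 * real M) powr p"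
        using p by (intro powr_mono2) auto
      then show ?thesis using True by simp
    next
      case False
      then show ?thesis using supp[of x] cut0[of x] by (simp add: fM_def h_def clamp_real_def)
    qed
    then show "AE x in lborel. norm (fM x - h n x) powr p \<le> (2 * real M) powr p * indicator (cball 0 (R + 1)) x" for n
      by simp
    have "(\<integral>\<^sup>+ x. ennreal ((2 * real M) powr p * indicator (cball 0 (R + 1)) x) \<partial>(lborel :: 'a measure))
      = ennreal ((2 * real M) powr p) * emeasure lborel (cball (0::'a) (R + 1))"
      by (simp add: ennreal_mult nn_integral_cmult_indicator ennreal_indicator borel_closed)
    also have "\<dots> < \<infinity>"
      using emeasure_lborel_cball_finite[of "0::'a" "R + 1"] by (simp add: ennreal_mult_less_top)
    finally show "(\<integral>\<^sup>+ x. ennreal ((2 * real M) powr p * indicator (cball 0 (R + 1)) x) \<partial>(lborel :: 'a measure)) < \<infinity>" .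
    have "(\<lambda>n. fM x - h n x) \<longlonglongrightarrow> 0" if "x \<notin> N" for x
    proof -
      have "(\<lambda>n. fM x - h n x) \<longlonglongrightarrow> fM x - fM x * cut x"
        unfolding h_def fM_def clamp_real_def by (intro tendsto_intros lim that)
      moreover have "fM x = fM x * cut x"
        using cut1[of x] supp[of x] by (cases "norm x \<le> R") (auto simp: fM_def clamp_real_def)
      ultimately show ?thesis by simp
    qed
    moreover have "AE x in lborel. x \<notin> N"
      using N AE_not_in[of N lebesgue] by (simp add: negligible_iff_null_sets AE_completion_iff)
    ultimately show "AE x in lborel. (\<lambda>n. fM x - h n x) \<longlonglongrightarrow> 0"
      by (auto elim: eventually_mono)
    show "(\<lambda>x. (2 * real M) powr p * indicator (cball 0 (R + 1)) x) \<in> borel_measurable (lborel :: 'a measure)"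
      by (intro borel_measurable_times borel_measurable_const borel_measurable_indicator) (simp add: borel_closed)
  qed simp
  then have "\<forall>\<^sub>F n in sequentially. p_integral lborel p (\<lambda>x. fM x - h n x) < ennreal e'"
    using e' by (intro order_tendstoD(2)[of _ 0]) auto
  then obtain n where n: "p_integral lborel p (\<lambda>x. fM x - h n x) < ennreal e'"
    using eventually_happens'[OF sequentially_bot] by auto
  have "p_integral lborel p (\<lambda>x. f x - h n x) = p_integral lborel p (\<lambda>x. (f x - fM x) + (fM x - h n x))"
    by simp
  also have "\<dots> \<le> ennreal (2 powr p) * (p_integral lborel p (\<lambda>x. f x - fM x) + p_integral lborel p (\<lambda>x. fM x - h n x))"
    by (rule p_integral_add_le) (use p in auto)
  also have "\<dots> \<le> ennreal (2 powr p) * (ennreal e' + ennreal e')"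
    using M n by (intro mult_left_mono add_mono) (auto simp: fM_def)
  also have "\<dots> = ennreal (e / 2)"
    using e' by (simp add: e'_def flip: ennreal_plus ennreal_mult)
  also have "\<dots> < ennreal e" using \<open>e > 0\<close> by (simp add: ennreal_less_iff)
  finally have "p_integral lborel p (\<lambda>x. f x - h n x) < ennreal e" .
  moreover have "h n x = 0" if "R + 1 \<le> norm x" for x
    using cut0[OF that] by (simp add: h_def)
  ultimately show thesis using that h_cont by blast
qed

lemma integrable_of_p_integral:
  fixes f :: "'a::euclidean_space \<Rightarrow> real"
  assumes p: "1 \<le> p" and [measurable]: "f \<in> borel_measurable borel"
    and fin: "p_integral lborel p f < \<infinity>" and supp: "\<And>x. R \<le> norm x \<Longrightarrow> f x = 0"
  shows "integrable lborel f"
proof (rule integrableI_bounded)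
  have "(\<integral>\<^sup>+x. ennreal (norm (f x)) \<partial>lborel) \<le> (\<integral>\<^sup>+x. ennreal (norm (f x) powr p) + indicator (cball 0 R) x \<partial>lborel)"
  proof (rule nn_integral_mono)
    fix x
    show "ennreal (norm (f x)) \<le> ennreal (norm (f x) powr p) + indicator (cball 0 R) x"
    proof (cases "norm x \<le> R")
      case True
      have "\<bar>f x\<bar> \<le> \<bar>f x\<bar> powr p + 1"
        using p powr_mono[of 1 p "\<bar>f x\<bar>"] by (cases "\<bar>f x\<bar> \<ge> 1") (auto intro: add_increasing)
      then show ?thesis using True
        by (simp flip: ennreal_plus ennreal_1)
    next
      case False
      then show ?thesis using supp[of x] by simp
    qed
  qed
  also have "\<dots> = p_integral lborel p f + emeasure lborel (cball (0::'a) R)"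
    unfolding p_integral_def by (subst nn_integral_add) (auto intro!: borel_measurable_indicator)
  also have "\<dots> < \<infinity>"
    using fin emeasure_lborel_cball_finite[of "0::'a" R] by simp
  finally show "(\<integral>\<^sup>+x. ennreal (norm (f x)) \<partial>lborel) < \<infinity>" .
qed simp

lemma conv_rescale_uniform:
  fixes k g :: "'a::euclidean_space \<Rightarrow> real"
  assumes k: "test_function (ball c r) k" "\<And>x. 0 \<le> k x" "(\<integral>x. k x \<partial>lborel) = 1"
    and g: "continuous_on UNIV g" "\<And>x. R \<le> norm x \<Longrightarrow> g x = 0" and "e > 0"
  obtains s0 where "s0 > 0" "\<And>s x. 0 < s \<Longrightarrow> s < s0 \<Longrightarrow> \<bar>conv (rescale s k) g x - g x\<bar> \<le> e"
    "\<And>s x. 0 < s \<Longrightarrow> s < s0 \<Longrightarrow> R + 1 \<le> norm x \<Longrightarrow> conv (rescale s k) g x = 0"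
proof -
  \<comment> \<open>\<rho> bounds |y| on the support of the kernel, whose ball need not contain the
    origin; mollifying at scale s displaces arguments by less than s \<rho>.\<close>
  define \<rho> where "\<rho> = norm c + \<bar>r\<bar> + 1"
  have \<rho>: "norm y < \<rho>" if "y \<in> ball c r" for y
    using that norm_triangle_ineq2[of y c] by (auto simp: \<rho>_def dist_norm norm_minus_commute)
  have \<rho>0: "\<rho> > 0" by (simp add: \<rho>_def add_nonneg_pos)
  have supp: "norm x \<le> R" if "g x \<noteq> 0" for x using g(2)[of x] that by force
  obtain d where d: "d > 0" "\<And>x y. dist x y < d \<Longrightarrow> norm (g x - g y) < e"
    using compact_support_uniformly_continuous[OF g(1) compact_cball, of 0 R] g(2) \<open>e > 0\<close>
    by (metis linorder_not_le mem_cball_0 nle_le)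
  have [measurable]: "k \<in> borel_measurable borel" "g \<in> borel_measurable borel"
    using test_function_measurable[OF k(1)] borel_measurable_continuous_onI[OF g(1)] by auto
  have kint: "integrable lborel k" using test_function_integrable[OF k(1)] .
  have "set_integrable lborel (cball 0 R) g"
    unfolding set_integrable_def by (rule borel_integrable_compact) (auto intro: continuous_on_subset[OF g(1)])
  moreover have "indicator (cball 0 R) x *\<^sub>R g x = g x" for x
    using supp[of x] by (auto simp: indicator_def)
  ultimately have gint: "integrable lborel g"
    unfolding set_integrable_def by (simp only:)
  show thesis
  proof
    show "min (d / \<rho>) (1 / \<rho>) > 0" using d \<rho>0 by simp
    fix s x assume s: "0 < s" "s < min (d / \<rho>) (1 / \<rho>)"
    have ss: "s * \<rho> < d" "s * \<rho> < 1" using s \<rho>0 by (auto simp: pos_less_divide_eq)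
    have sy: "norm (s *\<^sub>R y) < s * \<rho>" if "k y \<noteq> 0" for y
      using test_function_outside[OF k(1), of y] \<rho>[of y] that s by auto
    have int: "integrable lborel (\<lambda>y. k y * g (x + s *\<^sub>R y))"
    proof -
      have "integrable lborel (\<lambda>y. g (x + s *\<^sub>R y))"
        using lborel_affine_integrable[of g s x] gint s by simp
      moreover obtain B where "\<And>x. \<bar>k x\<bar> \<le> B" using test_function_bounded[OF k(1)] by blast
      ultimately show ?thesis by (intro integrable_mult_bounded[where B = B]) auto
    qed
    have cr: "conv (rescale s k) g x = (\<integral>y. k y * g (x + s *\<^sub>R y) \<partial>lborel)"
      by (rule conv_rescale) (use s in auto)
    have "conv (rescale s k) g x - g x = (\<integral>y. k y * g (x + s *\<^sub>R y) - k y * g x \<partial>lborel)"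
      using cr int kint k by simp
    also have "\<bar>\<dots>\<bar> \<le> (\<integral>y. \<bar>k y * g (x + s *\<^sub>R y) - k y * g x\<bar> \<partial>lborel)"
      by (rule integral_abs_bound)
    also have "\<dots> \<le> (\<integral>y. k y * e \<partial>lborel)"
    proof (rule integral_mono')
      fix y
      show "\<bar>k y * g (x + s *\<^sub>R y) - k y * g x\<bar> \<le> k y * e"
      proof (cases "k y = 0")
        case False
        have "\<bar>g (x + s *\<^sub>R y) - g x\<bar> < e"
          using d(2)[of "x + s *\<^sub>R y" x] sy[OF False] ss by (simp add: dist_norm)
        then have "k y * \<bar>g (x + s *\<^sub>R y) - g x\<bar> \<le> k y * e"
          using k(2) by (intro mult_left_mono) auto
        then show ?thesis using k(2)[of y] by (simp add: abs_mult flip: right_diff_distrib)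
      qed simp
    qed (use kint k \<open>e > 0\<close> in auto)
    also have "\<dots> = e" using k by simp
    finally show "\<bar>conv (rescale s k) g x - g x\<bar> \<le> e" .
    assume x: "R + 1 \<le> norm x"
    have "k y * g (x + s *\<^sub>R y) = 0" for y
    proof (cases "k y = 0")
      case False
      have "norm (x + s *\<^sub>R y) \<ge> norm x - norm (s *\<^sub>R y)" by (rule norm_diff_ineq)
      then have "norm (x + s *\<^sub>R y) \<ge> R" using x sy[OF False] ss by linarith
      then show ?thesis using g by simp
    qed simp
    then show "conv (rescale s k) g x = 0" unfolding cr by (simp only: Bochner_Integration.integral_zero)
  qed
qed

lemma conv_diff:
  assumes "test_function UNIV k" "integrable lborel v" "integrable lborel w"
  shows "conv k (\<lambda>x. v x - w x) x = conv k v x - conv k w x"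
  unfolding conv_def right_diff_distrib
  by (rule Bochner_Integration.integral_diff) (intro conv_integrable assms)+

lemma conv_measurable:
  assumes "test_function UNIV k" "integrable lborel w"
  shows "conv k w \<in> borel_measurable borel"
  using smooth_conv[OF assms] by (rule smooth_measurable)

lemma test_function_rescale_UNIV:
  "test_function U k \<Longrightarrow> s > 0 \<Longrightarrow> test_function UNIV (rescale s k)"
  using test_function_rescale test_function_mono by blast

lemma rescale_nonneg: "(\<And>x. 0 \<le> k x) \<Longrightarrow> s > 0 \<Longrightarrow> 0 \<le> rescale s k x"
  by (simp add: rescale_def)

text \<open>With \<open>g\<close> continuous and close to \<open>w\<close>, split the error into
  conv (w - g), conv g - g and g - w. The first is no larger than w - g by
  \<open>conv_p_integral_le\<close>, the second is uniformly small with bounded support.\<close>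

lemma conv_rescale_Lp:
  fixes k w :: "'a::euclidean_space \<Rightarrow> real"
  assumes p: "1 \<le> p"
    and k: "test_function (ball c r) k" "\<And>x. 0 \<le> k x" "(\<integral>x. k x \<partial>lborel) = 1"
    and w [measurable]: "w \<in> borel_measurable borel" and fin: "p_integral lborel p w < \<infinity>"
    and supp: "\<And>x. R \<le> norm x \<Longrightarrow> w x = 0" and "e > 0"
  obtains s0 where "s0 > 0"
    "\<And>s. 0 < s \<Longrightarrow> s < s0 \<Longrightarrow> p_integral lborel p (\<lambda>x. conv (rescale s k) w x - w x) < ennreal e"
proof -
  define A where "A = (2::real) powr p"
  have A: "A \<ge> 1" using p by (simp add: A_def ge_one_powr_ge_zero)
  \<comment> \<open>Two nested quasi-triangle inequalities give A (e1 + A (e1 + e1)) \<le> 3 A^2 e1,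
    which is 3e/8.\<close>
  define e1 where "e1 = e / (8 * A * A)"
  have e1: "e1 > 0" using \<open>e > 0\<close> A by (simp add: e1_def)
  obtain g where g: "continuous_on UNIV g" "\<And>x. R + 1 \<le> norm x \<Longrightarrow> g x = 0"
    and wg: "p_integral lborel p (\<lambda>x. w x - g x) < ennreal e1"
    using p_integral_approx_continuous[OF p w fin supp e1] by blast
  define V where "V = measure lborel (cball (0::'a) (R + 1 + 1))"
  \<comment> \<open>A uniform error e2 on a ball of volume V has p-integral at most e2^p V \<le> e1;
    V + 1 avoids division by 0.\<close>
  define e2 where "e2 = (e1 / (V + 1)) powr (1 / p)"
  have V: "V \<ge> 0" by (simp add: V_def)
  have e2: "e2 > 0" using e1 V by (simp add: e2_def)
  obtain s0 where s0: "s0 > 0" "\<And>s x. 0 < s \<Longrightarrow> s < s0 \<Longrightarrow> \<bar>conv (rescale s k) g x - g x\<bar> \<le> e2"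
    "\<And>s x. 0 < s \<Longrightarrow> s < s0 \<Longrightarrow> R + 1 + 1 \<le> norm x \<Longrightarrow> conv (rescale s k) g x = 0"
    using conv_rescale_uniform[OF k g e2] by metis
  have [measurable]: "g \<in> borel_measurable borel"
    using borel_measurable_continuous_onI[OF g(1)] .
  have wint: "integrable lborel w"
    using integrable_of_p_integral[OF p w fin supp] .
  have wgint: "integrable lborel (\<lambda>x. w x - g x)"
    by (rule integrable_of_p_integral[OF p, where R = "R + 1"])
      (use supp g(2) wg in \<open>auto intro: order.strict_trans\<close>)
  have gint: "integrable lborel g"
    using Bochner_Integration.integrable_diff[OF wint wgint] by simp
  show thesis
  proof
    show "s0 > 0" using s0 by simp
    fix s assume s: "0 < s" "s < s0"
    let ?K = "rescale s k"
    have K: "test_function UNIV ?K" using test_function_rescale_UNIV[OF k(1) s(1)] .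
    have Kpos: "0 \<le> ?K x" for x using rescale_nonneg[OF k(2) s(1)] .
    have Kint: "(\<integral>x. ?K x \<partial>lborel) = 1"
      using rescale_integral[OF test_function_measurable[OF k(1)] s(1)] k(3) by simp
    note meas [measurable] = conv_measurable[OF K wint] conv_measurable[OF K gint] conv_measurable[OF K wgint]
    have 1: "p_integral lborel p (conv ?K (\<lambda>x. w x - g x)) \<le> ennreal e1"
      using conv_p_integral_le[OF p K Kpos Kint wgint] wg by (simp add: order.strict_implies_order)
    have 2: "p_integral lborel p (\<lambda>x. conv ?K g x - g x) \<le> ennreal e1"
    proof -
      have "p_integral lborel p (\<lambda>x. conv ?K g x - g x) \<le> (\<integral>\<^sup>+x. ennreal (e2 powr p) * indicator (cball (0::'a) (R + 1 + 1)) x \<partial>lborel)"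
        unfolding p_integral_def
      proof (rule nn_integral_mono)
        fix x :: 'a
        show "ennreal (norm (conv ?K g x - g x) powr p) \<le> ennreal (e2 powr p) * indicator (cball 0 (R + 1 + 1)) x"
        proof (cases "norm x \<le> R + 1 + 1")
          case True
          have "norm (conv ?K g x - g x) powr p \<le> e2 powr p"
            using s0(2)[OF s] p by (intro powr_mono2) auto
          then show ?thesis using True by (simp add: ennreal_leI)
        next
          case False
          then show ?thesis using s0(3)[OF s, of x] g(2)[of x] by simp
        qed
      qed
      also have "\<dots> = ennreal (e2 powr p) * emeasure lborel (cball (0::'a) (R + 1 + 1))"
        by (simp add: nn_integral_cmult_indicator borel_closed)
      also have "\<dots> = ennreal (e2 powr p) * ennreal V"
        using emeasure_lborel_cball_finite[of "0::'a" "R + 1 + 1"]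
        by (subst emeasure_eq_ennreal_measure) (auto simp: V_def)
      also have "\<dots> = ennreal (e1 / (V + 1) * V)"
        using p e1 V by (simp add: e2_def powr_powr flip: ennreal_mult)
      also have "\<dots> \<le> ennreal e1"
        using e1 V by (intro ennreal_leI) (simp add: divide_simps)
      finally show ?thesis .
    qed
    have 3: "p_integral lborel p (\<lambda>x. g x - w x) \<le> ennreal e1"
      using wg by (simp add: p_integral_def norm_minus_commute abs_minus_commute order.strict_implies_order)
    have "p_integral lborel p (\<lambda>x. conv ?K w x - w x) =
       p_integral lborel p (\<lambda>x. conv ?K (\<lambda>x. w x - g x) x + ((conv ?K g x - g x) + (g x - w x)))"
      by (simp add: conv_diff[OF K wint gint])
    also have "\<dots> \<le> ennreal A * (p_integral lborel p (conv ?K (\<lambda>x. w x - g x)) + p_integral lborel p (\<lambda>x. (conv ?K g x - g x) + (g x - w x)))"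
      unfolding A_def by (rule p_integral_add_le) (use p in auto)
    also have "\<dots> \<le> ennreal A * (p_integral lborel p (conv ?K (\<lambda>x. w x - g x)) +
       ennreal A * (p_integral lborel p (\<lambda>x. conv ?K g x - g x) + p_integral lborel p (\<lambda>x. g x - w x)))"
      unfolding A_def by (intro mult_left_mono add_mono p_integral_add_le) (use p in auto)
    also have "\<dots> \<le> ennreal A * (ennreal e1 + ennreal A * (ennreal e1 + ennreal e1))"
      by (intro mult_left_mono add_mono 1 2 3) auto
    also have "\<dots> = ennreal (A * (e1 + A * (e1 + e1)))"
      using A e1 by (simp flip: ennreal_plus ennreal_mult)
    also have "\<dots> < ennreal e"
    proof (rule ennreal_lessI)
      have "A * e1 \<le> A * A * e1" using A e1 by (simp add: mult_le_cancel_right1)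
      then have "A * (e1 + A * (e1 + e1)) \<le> 3 * (A * A * e1)" by (simp add: algebra_simps)
      also have "\<dots> < e" using A \<open>e > 0\<close> by (simp add: e1_def)
      finally show "A * (e1 + A * (e1 + e1)) < e" .
    qed (use \<open>e > 0\<close> in auto)
    finally show "p_integral lborel p (\<lambda>x. conv ?K w x - w x) < ennreal e" .
  qed
qed

section \<open>The local cone condition and the surface measure\<close>

text \<open>The cone is the union of the dilates s \<open>ball e \<kappa>\<close> for 0 < s < r,
  with one axis and one aperture for all points of \<Omega> near z. The choice e = 0 is allowed and
  describes a full ball, so interior points fit the same notion.\<close>

definition cone_at :: "'a::euclidean_space set \<Rightarrow> 'a \<Rightarrow> real \<Rightarrow> 'a \<Rightarrow> real \<Rightarrow> bool" where
  "cone_at \<Omega> z r e \<kappa> \<longleftrightarrow> 0 < r \<and> 0 < \<kappa> \<and>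
     (\<forall>x\<in>\<Omega> \<inter> ball z r. \<forall>s. 0 < s \<and> s < r \<longrightarrow> (\<forall>y\<in>ball e \<kappa>. x + s *\<^sub>R y \<in> \<Omega>))"

definition cone_domain :: "'a::euclidean_space set \<Rightarrow> bool" where
  "cone_domain \<Omega> \<longleftrightarrow> (\<forall>z\<in>closure \<Omega>. \<exists>r e \<kappa>. cone_at \<Omega> z r e \<kappa>)"

lemma cone_atD:
  assumes "cone_at \<Omega> z r e \<kappa>"
  shows "0 < r" "0 < \<kappa>"
    "\<And>x s y. x \<in> \<Omega> \<Longrightarrow> x \<in> ball z r \<Longrightarrow> 0 < s \<Longrightarrow> s < r \<Longrightarrow> y \<in> ball e \<kappa> \<Longrightarrow> x + s *\<^sub>R y \<in> \<Omega>"
  using assms unfolding cone_at_def by blast+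

lemma cone_at_interior:
  assumes "open \<Omega>" "z \<in> \<Omega>" shows "\<exists>r. cone_at \<Omega> z r 0 1"
proof -
  obtain d where d: "d > 0" "ball z d \<subseteq> \<Omega>"
    using assms openE by blast
  have "x + s *\<^sub>R y \<in> \<Omega>" if "x \<in> ball z (d/2)" "0 < s" "s < d/2" "y \<in> ball 0 1" for x s y
  proof -
    have "s * norm y \<le> s * 1" using that by (intro mult_left_mono) auto
    moreover have "dist (x + s *\<^sub>R y) x = s * norm y" using that by (simp add: dist_norm)
    moreover have "dist x z < d/2" using that by (simp add: dist_commute)
    ultimately have "dist (x + s *\<^sub>R y) z < d"
      using dist_triangle[of "x + s *\<^sub>R y" z x] that by linarith
    then show ?thesis using d by (auto simp: dist_commute)
  qed
  then show ?thesis using d unfolding cone_at_def by (intro exI[of _ "d/2"]) auto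
qed

lemma C1_holder_lipschitz:
  fixes \<gamma> :: "'a::euclidean_space \<Rightarrow> real"
  assumes "C1_holder \<epsilon> \<gamma>" "0 < \<epsilon>"
  obtains L where "L \<ge> 0" "\<And>x y. x \<in> ball 0 R \<Longrightarrow> y \<in> ball 0 R \<Longrightarrow> \<bar>\<gamma> x - \<gamma> y\<bar> \<le> L * norm (x - y)"
proof -
  obtain D C where D: "\<And>x. (\<gamma> has_derivative (\<lambda>h. D x \<bullet> h)) (at x)"
    and C: "\<And>x y. norm (D x - D y) \<le> C * norm (x - y) powr \<epsilon>"
    using assms(1) unfolding C1_holder_def by blast
  define L where "L = norm (D 0) + \<bar>C\<bar> * \<bar>R\<bar> powr \<epsilon>"
  have DL: "norm (D x) \<le> L" if "x \<in> ball 0 R" for x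
  proof -
    have "norm (D x) \<le> norm (D 0) + norm (D x - D 0)" by (rule norm_triangle_sub)
    moreover have "C * norm (x - 0) powr \<epsilon> \<le> \<bar>C\<bar> * \<bar>R\<bar> powr \<epsilon>"
      using that assms by (intro mult_mono powr_mono2) auto
    ultimately show ?thesis using C[of x 0] by (simp add: L_def)
  qed
  show thesis
  proof
    show "L \<ge> 0" by (simp add: L_def)
    fix x y :: 'a assume xy: "x \<in> ball 0 R" "y \<in> ball 0 R"
    have "norm (\<gamma> x - \<gamma> y) \<le> L * norm (x - y)"
    proof (rule differentiable_bound[where S = "ball 0 R" and f' = "\<lambda>x h. D x \<bullet> h"])
      show "onorm ((\<bullet>) (D w)) \<le> L" if "w \<in> ball 0 R" for w
        by (rule onorm_le)
          (metis DL[OF that] Cauchy_Schwarz_ineq2 mult_right_mono norm_ge_zero order.trans real_norm_def)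
      show "(\<gamma> has_derivative (\<bullet>) (D w)) (at w within ball 0 R)" for w
        by (rule has_derivative_at_withinI[OF D])
    qed (use xy in auto)
    then show "\<bar>\<gamma> x - \<gamma> y\<bar> \<le> L * norm (x - y)" by simp
  qed
qed

text \<open>The graph function is Lipschitz near the boundary point, with constant \<open>L\<close>
  say. A step s y with y close to e gains at least s (1 - \<kappa>) in height, while the graph rises
  by at most L s \<kappa>, so the step stays above the graph.\<close>

lemma cone_at_boundary:
  fixes \<Omega> :: "'a::euclidean_space set"
  assumes "C1_holder_boundary \<epsilon> \<Omega>" "0 < \<epsilon>" "z \<in> frontier \<Omega>"
  shows "\<exists>r e \<kappa>. cone_at \<Omega> z r e \<kappa>"
proof -
  obtain r e \<gamma> where r: "r > 0" "norm e = 1" "C1_holder \<epsilon> \<gamma>"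
    and \<Omega>: "\<Omega> \<inter> ball z r = {x \<in> ball z r. \<gamma> (x - (x \<bullet> e) *\<^sub>R e) < x \<bullet> e}"
    using assms unfolding C1_holder_boundary_def by meson
  define P where "P x = x - (x \<bullet> e) *\<^sub>R e" for x :: 'a
  have ee: "e \<bullet> e = 1" using r(2) by (simp add: dot_square_norm)
  have Pn: "norm (P x) \<le> norm x" for x
  proof -
    have "(norm (P x))\<^sup>2 = (norm x)\<^sup>2 - (x \<bullet> e)\<^sup>2"
      unfolding power2_norm_eq_inner P_def using ee
      by (simp add: inner_diff_left inner_diff_right inner_commute algebra_simps power2_eq_square)
    then have "(norm (P x))\<^sup>2 \<le> (norm x)\<^sup>2" by simp
    then show ?thesis by (rule power2_le_imp_le) simp
  qed
  have Padd: "P (x + y) = P x + P y" "P (x - y) = P x - P y" for x y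
    by (simp_all add: P_def inner_add_left inner_diff_left algebra_simps)
  have Pscale: "P (c *\<^sub>R x) = c *\<^sub>R P x" for c x
    by (simp add: P_def algebra_simps)
  have Pe: "P e = 0" by (simp add: P_def ee)
  obtain L where L: "L \<ge> 0" "\<And>x y. x \<in> ball 0 (norm z + r) \<Longrightarrow> y \<in> ball 0 (norm z + r) \<Longrightarrow> \<bar>\<gamma> x - \<gamma> y\<bar> \<le> L * norm (x - y)"
    using C1_holder_lipschitz[OF r(3) assms(2)] by metis
  \<comment> \<open>Chosen so that L \<kappa> < 1 - \<kappa>, i.e. the gain in height beats the
    slope.\<close>
  define \<kappa> where "\<kappa> = 1 / (2 * (L + 1))"
  have \<kappa>: "0 < \<kappa>" "\<kappa> \<le> 1" "(L + 1) * \<kappa> < 1"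
    using L by (auto simp: \<kappa>_def divide_simps)
  have inP: "P x \<in> ball 0 (norm z + r)" if "x \<in> ball z r" for x
    using Pn[of x] that norm_triangle_ineq2[of x z] by (auto simp: dist_norm norm_minus_commute)
  \<comment> \<open>The radius r/4 keeps x + s y within r/4 + r/2 of z, as |y| \<le> 2, and so
    inside the ball where \<Omega> is given by the graph.\<close>
  have "x + s *\<^sub>R y \<in> \<Omega>" if x: "x \<in> \<Omega>" "x \<in> ball z (r/4)" and s: "0 < s" "s < r/4" and y: "y \<in> ball e \<kappa>" for x s y
  proof -
    have ye: "norm (y - e) < \<kappa>" using y by (simp add: dist_norm norm_minus_commute)
    have "norm y \<le> 2" using norm_triangle_ineq2[of y e] ye \<kappa> r by simp
    then have "s * norm y \<le> s * 2" using s by (intro mult_left_mono) auto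
    moreover have "norm (x + s *\<^sub>R y - z) \<le> norm (x - z) + norm (s *\<^sub>R y)"
      using norm_triangle_ineq[of "x - z" "s *\<^sub>R y"] by (simp add: algebra_simps)
    moreover have "norm (s *\<^sub>R y) = s * norm y" "norm (x - z) < r / 4"
      using s x by (auto simp: dist_norm norm_minus_commute)
    ultimately have "norm (x + s *\<^sub>R y - z) < r" using s by linarith
    then have x': "x + s *\<^sub>R y \<in> ball z r" by (simp add: dist_norm norm_minus_commute)
    have xr: "x \<in> ball z r" using x r by auto
    have "\<gamma> (P (x + s *\<^sub>R y)) \<le> \<gamma> (P x) + L * norm (P (x + s *\<^sub>R y) - P x)"
      using L(2)[OF inP[OF x'] inP[OF xr]] by linarith
    moreover have "P (x + s *\<^sub>R y) - P x = s *\<^sub>R P (y - e)"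
      by (simp add: Padd Pscale Pe)
    moreover have "L * norm (s *\<^sub>R P (y - e)) \<le> L * (s * \<kappa>)"
    proof (rule mult_left_mono[OF _ L(1)])
      have "s * norm (P (y - e)) \<le> s * \<kappa>"
        using Pn[of "y - e"] ye s by (intro mult_left_mono) linarith+
      then show "norm (s *\<^sub>R P (y - e)) \<le> s * \<kappa>" using s by simp
    qed
    moreover have "\<gamma> (P x) < x \<bullet> e"
    proof -
      have "x \<in> \<Omega> \<inter> ball z r" using x xr by simp
      then show ?thesis unfolding \<Omega> P_def by simp
    qed
    moreover have "L * (s * \<kappa>) \<le> s * (1 - \<kappa>)"
    proof -
      have "s * ((L + 1) * \<kappa>) \<le> s * 1" using \<kappa> s by (intro mult_left_mono) auto
      then show ?thesis by (simp add: algebra_simps)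
    qed
    moreover have "s * (1 - \<kappa>) \<le> s * (y \<bullet> e)"
    proof -
      have "\<bar>(y - e) \<bullet> e\<bar> \<le> norm (y - e) * norm e" by (rule Cauchy_Schwarz_ineq2)
      then have "1 - \<kappa> \<le> y \<bullet> e" using ye r ee by (simp add: inner_diff_left)
      then show ?thesis using s by (intro mult_left_mono) auto
    qed
    moreover have "(x + s *\<^sub>R y) \<bullet> e = x \<bullet> e + s * (y \<bullet> e)"
      by (simp add: inner_add_left)
    ultimately have "\<gamma> (P (x + s *\<^sub>R y)) < (x + s *\<^sub>R y) \<bullet> e"
      by (smt (verit))
    then have "x + s *\<^sub>R y \<in> \<Omega> \<inter> ball z r" using x' unfolding \<Omega> P_def by simp
    then show ?thesis by simp
  qed
  then show ?thesis
    using r \<kappa> unfolding cone_at_def by (intro exI[of _ "r/4"] exI[of _ e] exI[of _ \<kappa>]) auto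
qed

lemma C1_holder_boundary_cone_domain:
  assumes "open \<Omega>" "C1_holder_boundary \<epsilon> \<Omega>" "0 < \<epsilon>"
  shows "cone_domain \<Omega>"
  unfolding cone_domain_def
proof
  fix z assume "z \<in> closure \<Omega>"
  then have "z \<in> \<Omega> \<or> z \<in> frontier \<Omega>" using assms by (auto simp: frontier_def interior_open)
  then show "\<exists>r e \<kappa>. cone_at \<Omega> z r e \<kappa>"
    using cone_at_interior[OF assms(1)] cone_at_boundary[OF assms(2,3)] by blast
qed

text \<open>Replace q by a nearby point x of \<Omega> and absorb the displacement (q - x) / s into
  the open aperture. Consequently no boundary point lies in the cone of another nearby one, the
  geometric fact behind the counting below.\<close>

lemma frontier_cone_free:
  fixes \<Omega> :: "'a::euclidean_space set"
  assumes c: "cone_at \<Omega> z r e \<kappa>" and "open \<Omega>"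
    and q: "q \<in> frontier \<Omega>" "q \<in> ball z r" and s: "0 < s" "s < r" and y: "y \<in> ball e \<kappa>"
  shows "q + s *\<^sub>R y \<in> \<Omega>"
proof -
  define d where "d = min (s * (\<kappa> - dist e y)) (r - dist z q)"
  have d: "d > 0" using q s y by (simp add: d_def)
  have "q \<in> closure \<Omega>" using q by (simp add: frontier_def)
  then obtain x where x: "x \<in> \<Omega>" "dist x q < d"
    using d closure_approachable by blast
  have "dist z x \<le> dist z q + dist q x" by (rule dist_triangle)
  then have "x \<in> ball z r" using x by (simp add: d_def dist_commute)
  moreover have "y + (q - x) /\<^sub>R s \<in> ball e \<kappa>"
  proof -
    have "dist e (y + (q - x) /\<^sub>R s) \<le> dist e y + dist y (y + (q - x) /\<^sub>R s)" by (rule dist_triangle)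
    also have "dist y (y + (q - x) /\<^sub>R s) = dist x q / s"
      using s by (simp add: dist_norm norm_minus_commute divide_inverse_commute)
    also have "dist x q / s < \<kappa> - dist e y"
      using x(2) s by (simp add: d_def pos_divide_less_eq mult.commute)
    finally show ?thesis by simp
  qed
  ultimately have "x + s *\<^sub>R (y + (q - x) /\<^sub>R s) \<in> \<Omega>"
    using cone_atD(3)[OF c x(1)] s by blast
  moreover have "x + s *\<^sub>R (y + (q - x) /\<^sub>R s) = q + s *\<^sub>R y"
    using s by (simp add: algebra_simps)
  ultimately show ?thesis by simp
qed

text \<open>
  A \<open>\<delta>\<close>-separated subset of the boundary has at most \<open>C / \<delta>\<^sup>n\<^sup>-\<^sup>1\<close> elements: the cone condition makes the
  translates of its points along the cone axis, at about \<open>1 / \<delta>\<close> heights, centres of disjoint balls of radius \<open>\<delta> / 2\<close>.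
\<close>

lemma separated_card_bound:
  fixes \<Omega> :: "'a::euclidean_space set"
  assumes c: "cone_at \<Omega> z r e \<kappa>" and "open \<Omega>"
  obtains C where "C > 0" "\<And>P \<delta>. finite P \<Longrightarrow> P \<subseteq> frontier \<Omega> \<inter> ball z r \<Longrightarrow> 0 < \<delta> \<Longrightarrow> \<delta> \<le> 1 \<Longrightarrow>
     pairwise (\<lambda>p q. \<delta> \<le> dist p q) P \<Longrightarrow> real (card P) * \<delta> ^ (DIM('a) - 1) \<le> C"
proof -
  note r = cone_atD(1)[OF c] and \<kappa> = cone_atD(2)[OF c]
  define n where "n = DIM('a)"
  have n: "n > 0" by (simp add: n_def)
  \<comment> \<open>Heights are spaced by L \<delta>, so two points within \<delta> of each other
    after the shift differ in direction from e by less than 1 / L = \<kappa> / 2.\<close>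
  define L where "L = 2 / \<kappa>"
  have L: "L > 0" using \<kappa> by (simp add: L_def)
  define R where "R = r + r * norm e + 1"
  have R: "R > 0" using r by (simp add: R_def add_pos_nonneg)
  define v where "v = unit_ball_vol (real n)"
  have v: "v > 0" by (simp add: v_def)
  define C where "C = (v * R ^ n) * (2 * L / r) * 2 ^ n / v"
  have "C > 0" using v R L r by (simp add: C_def)
  moreover have "real (card P) * \<delta> ^ (DIM('a) - 1) \<le> C"
    if P: "finite P" "P \<subseteq> frontier \<Omega> \<inter> ball z r" and \<delta>: "0 < \<delta>" "\<delta> \<le> 1"
      and sep: "pairwise (\<lambda>p q. \<delta> \<le> dist p q) P" for P \<delta>
  proof -
    \<comment> \<open>As many heights as fit into r/2: J L \<delta> \<le> r/2 keeps every shift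
      inside the cone, while J + 1 is still at least r / (2 L \<delta>).\<close>
    define J where "J = nat \<lfloor>r / (2 * L * \<delta>)\<rfloor>"
    have quot: "r / (2 * L * \<delta>) \<ge> 0" using r L \<delta> by simp
    have J1: "r / (2 * L * \<delta>) \<le> real (J + 1)" using quot unfolding J_def by linarith
    have J2: "real J \<le> r / (2 * L * \<delta>)" using quot unfolding J_def by linarith
    then have J3: "real J * (L * \<delta>) \<le> r / 2" using L \<delta> by (simp add: pos_le_divide_eq field_simps)
    define b where "b = (\<lambda>(q, j). ball (q + (real j * L * \<delta>) *\<^sub>R e) (\<delta> / 2))"
    have sJ: "real j * L * \<delta> \<le> r / 2" if "j \<le> J" for j
    proof -
      have "real j * (L * \<delta>) \<le> real J * (L * \<delta>)" using that L \<delta> by (intro mult_right_mono) auto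
      then show ?thesis using J3 by (simp add: mult.assoc)
    qed
    \<comment> \<open>If balls at different heights met, q' would be q + s y with y in
      \<open>ball e \<kappa>\<close>, hence a point of the open set \<Omega> and not on its
      frontier.\<close>
    have ndis: False
      if q: "q \<in> P" "q' \<in> P" and j: "j' < j" "j \<le> J"
        and x: "dist (q + (real j * L * \<delta>) *\<^sub>R e) x < \<delta> / 2" "dist (q' + (real j' * L * \<delta>) *\<^sub>R e) x < \<delta> / 2"
      for q q' j j' x
    proof -
      define s where "s = (real j - real j') * L * \<delta>"
      have s: "s > 0" using j L \<delta> by (simp add: s_def)
      have "s \<le> real j * L * \<delta>" using L \<delta> by (simp add: s_def)
      then have sr: "s < r" using sJ[OF j(2)] r by linarith
      have sd: "L * \<delta> \<le> s"
      proof -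
        have "1 * (L * \<delta>) \<le> (real j - real j') * (L * \<delta>)" using j L \<delta> by (intro mult_right_mono) auto
        then show ?thesis by (simp add: s_def mult.assoc)
      qed
      define y where "y = (q' - q) /\<^sub>R s"
      have "dist (q + (real j * L * \<delta>) *\<^sub>R e) (q' + (real j' * L * \<delta>) *\<^sub>R e) < \<delta>"
        using dist_triangle2[of "q + (real j * L * \<delta>) *\<^sub>R e" "q' + (real j' * L * \<delta>) *\<^sub>R e" x] x by linarith
      then have "norm (q + s *\<^sub>R e - q') < \<delta>"
        by (simp add: dist_norm s_def algebra_simps)
      moreover have "q + s *\<^sub>R e - q' = s *\<^sub>R (e - y)" using s by (simp add: y_def algebra_simps)
      ultimately have "s * dist e y < \<delta>" using s by (simp add: dist_norm)
      then have "L * \<delta> * dist e y < \<delta>"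
        using mult_right_mono[OF sd, of "dist e y"] by simp
      then have "dist e y < 1 / L" using \<delta> L by (simp add: pos_less_divide_eq mult.commute)
      also have "1 / L < \<kappa>" using \<kappa> by (simp add: L_def)
      finally have "y \<in> ball e \<kappa>" by simp
      moreover have "q \<in> frontier \<Omega>" "q \<in> ball z r" using q P by auto
      ultimately have "q + s *\<^sub>R y \<in> \<Omega>"
        using frontier_cone_free[OF c \<open>open \<Omega>\<close>] s sr by blast
      then have "q' \<in> \<Omega>" using s by (simp add: y_def)
      then show False using q P \<open>open \<Omega>\<close> by (auto simp: frontier_def interior_open)
    qed
    have disj: "disjoint_family_on b (P \<times> {..J})"
      unfolding disjoint_family_on_def
    proof (intro ballI impI)
      fix a a' assume a: "a \<in> P \<times> {..J}" "a' \<in> P \<times> {..J}" "a \<noteq> a'"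
      obtain q j q' j' where qj: "a = (q, j)" "a' = (q', j')" by (cases a, cases a')
      show "b a \<inter> b a' = {}"
      proof (rule ccontr)
        assume "b a \<inter> b a' \<noteq> {}"
        then obtain x where x: "dist (q + (real j * L * \<delta>) *\<^sub>R e) x < \<delta> / 2"
          "dist (q' + (real j' * L * \<delta>) *\<^sub>R e) x < \<delta> / 2"
          by (auto simp: b_def qj)
        consider "j = j'" | "j' < j" | "j < j'" by linarith
        then show False
        proof cases
          case 1
          have "dist (q + (real j * L * \<delta>) *\<^sub>R e) (q' + (real j' * L * \<delta>) *\<^sub>R e) < \<delta>"
            using dist_triangle2[of "q + (real j * L * \<delta>) *\<^sub>R e" "q' + (real j' * L * \<delta>) *\<^sub>R e" x] x by linarith
          then have "dist q q' < \<delta>" using 1 by simp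
          moreover have "q \<noteq> q'" using a qj 1 by auto
          ultimately show False using sep a qj unfolding pairwise_def by fastforce
        next
          case 2
          then show False using ndis[of q q' j' j x] x a qj by auto
        next
          case 3
          then show False using ndis[of q' q j j' x] x a qj by auto
        qed
      qed
    qed
    have sub: "(\<Union>a\<in>P \<times> {..J}. b a) \<subseteq> ball z R"
    proof
      fix x assume "x \<in> (\<Union>a\<in>P \<times> {..J}. b a)"
      then obtain q j where qj: "q \<in> P" "j \<le> J" "dist (q + (real j * L * \<delta>) *\<^sub>R e) x < \<delta> / 2"
        by (auto simp: b_def)
      have "dist z x \<le> dist z q + dist q (q + (real j * L * \<delta>) *\<^sub>R e) + dist (q + (real j * L * \<delta>) *\<^sub>R e) x"
        using dist_triangle[of z x q] dist_triangle[of q x "q + (real j * L * \<delta>) *\<^sub>R e"] by linarith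
      moreover have "dist q (q + (real j * L * \<delta>) *\<^sub>R e) \<le> r * norm e"
      proof -
        have "dist q (q + (real j * L * \<delta>) *\<^sub>R e) = (real j * L * \<delta>) * norm e"
          using L \<delta> by (simp add: dist_norm)
        also have "\<dots> \<le> r * norm e" using sJ[OF qj(2)] r by (intro mult_right_mono) auto
        finally show ?thesis .
      qed
      moreover have "dist z q < r" using qj P by auto
      ultimately show "x \<in> ball z R" using qj \<delta> by (simp add: R_def)
    qed
    have "(\<Sum>a\<in>P \<times> {..J}. measure lborel (b a)) = measure lborel (\<Union>a\<in>P \<times> {..J}. b a)"
      using emeasure_lborel_ball_finite
      by (intro measure_finite_Union[symmetric] disj) (auto simp: P(1) b_def less_top[symmetric])
    also have "\<dots> \<le> measure lborel (ball z R)"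
      by (rule measure_mono_fmeasurable[OF sub])
        (use emeasure_lborel_ball_finite[of z R] in \<open>auto simp: b_def fmeasurable_def intro!: borel_open open_UN\<close>)
    also have "\<dots> = v * R ^ n"
      using R by (simp add: content_ball v_def n_def)
    finally have "(\<Sum>a\<in>P \<times> {..J}. measure lborel (b a)) \<le> v * R ^ n" .
    moreover have "measure lborel (b a) = v * (\<delta> / 2) ^ n" for a
      using \<delta> by (cases a) (simp add: b_def content_ball v_def n_def)
    ultimately have "real (card P) * real (J + 1) * (v * (\<delta> / 2) ^ n) \<le> v * R ^ n"
      by (simp add: card_cartesian_product distrib_left)
    \<comment> \<open>Each point of P owns about 1 / \<delta> balls of volume proportional to
      \<delta>^n, and the total volume is bounded; this trades one power of \<delta> and leaves the
      exponent n - 1.\<close>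
    moreover have "real (card P) * (r / (2 * L * \<delta>)) * (v * (\<delta> / 2) ^ n) \<le> real (card P) * real (J + 1) * (v * (\<delta> / 2) ^ n)"
      using J1 v \<delta> by (intro mult_right_mono mult_left_mono) auto
    ultimately have "real (card P) * (r / (2 * L * \<delta>)) * (v * (\<delta> / 2) ^ n) \<le> v * R ^ n" by linarith
    moreover have "\<delta> ^ n = \<delta> * \<delta> ^ (n - 1)" using n by (metis power_minus_mult mult.commute)
    ultimately have "real (card P) * \<delta> ^ (n - 1) * (r * v / (2 * L * 2 ^ n)) \<le> v * R ^ n"
      using \<delta> by (simp add: power_divide field_simps)
    then have "real (card P) * \<delta> ^ (n - 1) \<le> v * R ^ n / (r * v / (2 * L * 2 ^ n))"
      using r v L by (subst pos_le_divide_eq) auto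
    also have "\<dots> = C" by (simp add: C_def)
    finally show ?thesis by (simp add: n_def)
  qed
  ultimately show thesis using that by blast
qed

text \<open>A separated set of greatest cardinality is a net, since a point it misses could be
  added. For \<delta> \<le> 0 the balls are empty and cover nothing, hence the second
  alternative.\<close>

lemma separated_net:
  fixes S :: "'a::metric_space set"
  assumes bound: "\<And>P. finite P \<Longrightarrow> P \<subseteq> S \<Longrightarrow> pairwise (\<lambda>p q. \<delta> \<le> dist p q) P \<Longrightarrow> card P \<le> N"
  obtains P where "finite P" "P \<subseteq> S" "pairwise (\<lambda>p q. \<delta> \<le> dist p q) P" "S \<subseteq> (\<Union>p\<in>P. ball p \<delta>)" | "\<delta> \<le> 0"
proof (cases "\<delta> \<le> 0")
  case False
  define Q where "Q P \<longleftrightarrow> finite P \<and> P \<subseteq> S \<and> pairwise (\<lambda>p q. \<delta> \<le> dist p q) P" for P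
  have "Q {}" by (simp add: Q_def)
  moreover have "\<forall>P. Q P \<longrightarrow> card P < Suc N" using bound by (auto simp: Q_def less_Suc_eq_le)
  ultimately obtain P where P: "Q P" "\<And>P'. Q P' \<Longrightarrow> card P' \<le> card P"
    using ex_has_greatest_nat[of Q "{}" card "Suc N"] by auto
  have "S \<subseteq> (\<Union>p\<in>P. ball p \<delta>)"
  proof (rule ccontr)
    assume "\<not> S \<subseteq> (\<Union>p\<in>P. ball p \<delta>)"
    then obtain x where x: "x \<in> S" "\<And>p. p \<in> P \<Longrightarrow> \<delta> \<le> dist p x" by force
    then have "x \<notin> P" using False by force
    moreover have "Q (insert x P)"
      using P(1) x unfolding Q_def by (auto simp: pairwise_insert dist_commute)
    ultimately show False using P(2)[of "insert x P"] P(1) by (simp add: Q_def)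
  qed
  then show thesis using that(1) P(1) by (auto simp: Q_def)
qed (use that in auto)

text \<open>A concrete certificate of finite Hausdorff outer measure: finite covers of every mesh
  with a common bound on the total weight. It passes to finite unions directly by uniting
  covers.\<close>

definition hausdorff_bounded :: "nat \<Rightarrow> 'a::metric_space set \<Rightarrow> bool" where
  "hausdorff_bounded k S \<longleftrightarrow> (\<exists>C::real. \<forall>\<delta>>0. \<exists>F. finite F \<and> S \<subseteq> \<Union>F \<and>
     (\<forall>U\<in>F. bounded U \<and> diameter U \<le> \<delta>) \<and> (\<Sum>U\<in>F. hausdorff_weight k U) \<le> ennreal C)"

lemma hausdorff_bounded_Un:
  assumes "hausdorff_bounded k S" "hausdorff_bounded k T"
  shows "hausdorff_bounded k (S \<union> T)"
proof -
  obtain C where C: "\<And>\<delta>. \<delta> > 0 \<Longrightarrow> \<exists>F. finite F \<and> S \<subseteq> \<Union>F \<and>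
     (\<forall>U\<in>F. bounded U \<and> diameter U \<le> \<delta>) \<and> (\<Sum>U\<in>F. hausdorff_weight k U) \<le> ennreal C"
    using assms(1) unfolding hausdorff_bounded_def by blast
  obtain D where D: "\<And>\<delta>. \<delta> > 0 \<Longrightarrow> \<exists>F. finite F \<and> T \<subseteq> \<Union>F \<and>
     (\<forall>U\<in>F. bounded U \<and> diameter U \<le> \<delta>) \<and> (\<Sum>U\<in>F. hausdorff_weight k U) \<le> ennreal D"
    using assms(2) unfolding hausdorff_bounded_def by blast
  have "\<exists>F. finite F \<and> S \<union> T \<subseteq> \<Union>F \<and> (\<forall>U\<in>F. bounded U \<and> diameter U \<le> \<delta>) \<and>
     (\<Sum>U\<in>F. hausdorff_weight k U) \<le> ennreal (max 0 C + max 0 D)" if \<delta>: "\<delta> > 0" for \<delta>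
  proof -
    obtain F where F: "finite F" "S \<subseteq> \<Union>F" "\<forall>U\<in>F. bounded U \<and> diameter U \<le> \<delta>" "(\<Sum>U\<in>F. hausdorff_weight k U) \<le> ennreal C"
      using C[OF \<delta>] by blast
    obtain G where G: "finite G" "T \<subseteq> \<Union>G" "\<forall>U\<in>G. bounded U \<and> diameter U \<le> \<delta>" "(\<Sum>U\<in>G. hausdorff_weight k U) \<le> ennreal D"
      using D[OF \<delta>] by blast
    have "(\<Sum>U\<in>F \<union> G. hausdorff_weight k U) \<le> (\<Sum>U\<in>F \<union> G. hausdorff_weight k U) + (\<Sum>U\<in>F \<inter> G. hausdorff_weight k U)"
      by simp
    also have "\<dots> = (\<Sum>U\<in>F. hausdorff_weight k U) + (\<Sum>U\<in>G. hausdorff_weight k U)"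
      by (rule sum.union_inter[OF F(1) G(1)])
    also have "\<dots> \<le> ennreal (max 0 C) + ennreal (max 0 D)"
      using F(4) G(4) by (intro add_mono) (auto elim!: order.trans intro: ennreal_leI)
    also have "\<dots> = ennreal (max 0 C + max 0 D)" by simp
    finally show ?thesis using F G by (intro exI[of _ "F \<union> G"]) auto
  qed
  then show ?thesis unfolding hausdorff_bounded_def by blast
qed

lemma hausdorff_bounded_empty: "hausdorff_bounded k {}"
  unfolding hausdorff_bounded_def by (intro exI[of _ 0] allI impI exI[of _ "{}"]) auto

lemma hausdorff_bounded_UN:
  "finite A \<Longrightarrow> (\<And>a. a \<in> A \<Longrightarrow> hausdorff_bounded k (S a)) \<Longrightarrow> hausdorff_bounded k (\<Union>a\<in>A. S a)"
  by (induction A rule: finite_induct) (auto intro: hausdorff_bounded_Un hausdorff_bounded_empty)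

lemma hausdorff_bounded_subset:
  "hausdorff_bounded k T \<Longrightarrow> S \<subseteq> T \<Longrightarrow> hausdorff_bounded k S"
  unfolding hausdorff_bounded_def by (meson order.trans)

lemma hausdorff_bounded_outer:
  assumes "hausdorff_bounded k S" shows "hausdorff_outer k S < \<infinity>"
proof -
  obtain C where C: "\<And>\<delta>. \<delta> > 0 \<Longrightarrow> \<exists>F. finite F \<and> S \<subseteq> \<Union>F \<and>
     (\<forall>U\<in>F. bounded U \<and> diameter U \<le> \<delta>) \<and> (\<Sum>U\<in>F. hausdorff_weight k U) \<le> ennreal C"
    using assms(1) unfolding hausdorff_bounded_def by blast
  have "hausdorff_content k \<delta> S \<le> ennreal C" if \<delta>: "\<delta> > 0" for \<delta>
  proof -
    obtain F where F: "finite F" "S \<subseteq> \<Union>F" "\<forall>U\<in>F. bounded U \<and> diameter U \<le> \<delta>" "(\<Sum>U\<in>F. hausdorff_weight k U) \<le> ennreal C"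
      using C[OF \<delta>] by blast
    obtain h where h: "bij_betw h {..<card F} F"
      using F(1) by (metis atLeast0LessThan ex_bij_betw_nat_finite)
    \<comment> \<open>\<open>hausdorff_content\<close> wants a sequence; the tail is filled with
      empty sets, whose weight is 0 in every dimension by definition.\<close>
    define U where "U i = (if i < card F then h i else {})" for i
    have "S \<subseteq> (\<Union>i. U i)"
    proof
      fix x assume "x \<in> S"
      then obtain V where V: "V \<in> F" "x \<in> V" using F(2) by blast
      then obtain i where "i < card F" "h i = V" using h unfolding bij_betw_def by (metis imageE lessThan_iff)
      then have "x \<in> U i" using V by (simp add: U_def)
      then show "x \<in> (\<Union>i. U i)" by blast
    qed
    moreover have "bounded (U i) \<and> diameter (U i) \<le> \<delta>" for i
    proof (cases "i < card F")
      case True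
      then have "h i \<in> F" using h by (auto simp: bij_betw_def)
      then show ?thesis using F(3) True by (simp add: U_def)
    qed (use \<delta> in \<open>simp add: U_def\<close>)
    ultimately have "hausdorff_content k \<delta> S \<le> (\<Sum>i. hausdorff_weight k (U i))"
      unfolding hausdorff_content_def by (intro INF_lower) auto
    also have "\<dots> = (\<Sum>i\<in>{..<card F}. hausdorff_weight k (U i))"
      by (rule suminf_finite) (auto simp: U_def hausdorff_weight_def)
    also have "\<dots> = (\<Sum>i\<in>{..<card F}. hausdorff_weight k (h i))"
      by (intro sum.cong) (auto simp: U_def)
    also have "\<dots> = (\<Sum>U\<in>F. hausdorff_weight k U)"
      by (rule sum.reindex_bij_betw[OF h])
    finally show ?thesis using F(4) by simp
  qed
  then have "hausdorff_outer k S \<le> ennreal C"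
    unfolding hausdorff_outer_def by (intro SUP_least) auto
  then show ?thesis by (simp add: le_less_trans)
qed

text \<open>Cover by balls of radius d around a d-net. Each has weight
  \<open>unit_ball_vol k * d ^ k\<close>, and \<open>separated_card_bound\<close> limits their
  number by C / d^k. The counting bound asks for d \<le> 1, the mesh for 2 d \<le> \<delta>.\<close>

lemma hausdorff_bounded_local:
  fixes \<Omega> :: "'a::euclidean_space set"
  assumes c: "cone_at \<Omega> z r e \<kappa>" and "open \<Omega>"
  shows "hausdorff_bounded (DIM('a) - 1) (frontier \<Omega> \<inter> ball z r)"
proof -
  define k where "k = DIM('a) - 1"
  obtain C where C: "C > 0" "\<And>P \<delta>. finite P \<Longrightarrow> P \<subseteq> frontier \<Omega> \<inter> ball z r \<Longrightarrow> 0 < \<delta> \<Longrightarrow> \<delta> \<le> 1 \<Longrightarrow>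
     pairwise (\<lambda>p q. \<delta> \<le> dist p q) P \<Longrightarrow> real (card P) * \<delta> ^ k \<le> C"
    using separated_card_bound[OF assms] unfolding k_def by metis
  have "\<exists>F. finite F \<and> frontier \<Omega> \<inter> ball z r \<subseteq> \<Union>F \<and> (\<forall>U\<in>F. bounded U \<and> diameter U \<le> \<delta>) \<and>
     (\<Sum>U\<in>F. hausdorff_weight k U) \<le> ennreal (unit_ball_vol (real k) * C)" if \<delta>: "\<delta> > 0" for \<delta>
  proof -
    define d where "d = min 1 (\<delta> / 2)"
    have d: "0 < d" "d \<le> 1" "2 * d \<le> \<delta>" using \<delta> by (auto simp: d_def)
    have card: "card P \<le> nat \<lceil>C / d ^ k\<rceil>" if "finite P" "P \<subseteq> frontier \<Omega> \<inter> ball z r" "pairwise (\<lambda>p q. d \<le> dist p q) P" for P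
    proof -
      have "real (card P) \<le> C / d ^ k" using C(2)[OF that(1,2) d(1,2) that(3)] d by (simp add: pos_le_divide_eq)
      then show ?thesis by linarith
    qed
    obtain P where P: "finite P" "P \<subseteq> frontier \<Omega> \<inter> ball z r" "pairwise (\<lambda>p q. d \<le> dist p q) P"
      "frontier \<Omega> \<inter> ball z r \<subseteq> (\<Union>p\<in>P. ball p d)"
      by (rule separated_net[of "frontier \<Omega> \<inter> ball z r" d, OF card]) (use d in auto)
    define F where "F = (\<lambda>p. ball p d) ` P"
    have w: "hausdorff_weight k (ball p d) = ennreal (unit_ball_vol (real k) * d ^ k)" for p :: 'a
      using d by (simp add: hausdorff_weight_def diameter_ball)
    have "(\<Sum>U\<in>F. hausdorff_weight k U) \<le> (\<Sum>p\<in>P. hausdorff_weight k (ball p d))"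
      unfolding F_def using sum_image_le[OF P(1), of "hausdorff_weight k" "\<lambda>p. ball p d"] by simp
    also have "\<dots> = ennreal (real (card P) * (unit_ball_vol (real k) * d ^ k))"
      using d by (simp add: w ennreal_mult ennreal_of_nat_eq_real_of_nat)
    also have "\<dots> \<le> ennreal (unit_ball_vol (real k) * C)"
    proof (rule ennreal_leI)
      have "unit_ball_vol (real k) * (real (card P) * d ^ k) \<le> unit_ball_vol (real k) * C"
        by (intro mult_left_mono C(2) P d) auto
      then show "real (card P) * (unit_ball_vol (real k) * d ^ k) \<le> unit_ball_vol (real k) * C" by (simp add: mult_ac)
    qed
    finally show ?thesis
      using P d by (intro exI[of _ F]) (auto simp: F_def diameter_ball)
  qed
  then show ?thesis unfolding hausdorff_bounded_def k_def by blast
qed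

text \<open>
  Only this inequality relates \<^const>\<open>boundary_measure\<close> to the outer measure; it also holds for the
  fallback value \<open>0\<close> of \<^const>\<open>measure_of\<close>, so the Caratheodory property is never needed.
\<close>

lemma boundary_emeasure_le:
  fixes \<Omega> :: "'a::euclidean_space set"
  assumes "A \<in> sets borel" "A \<subseteq> frontier \<Omega>"
  shows "emeasure (boundary_measure \<Omega>) A \<le> hausdorff_outer (DIM('a) - 1) A"
proof -
  have "frontier \<Omega> \<in> sets borel" by (simp add: borel_closed)
  then have "emeasure (boundary_measure \<Omega>) A = emeasure (hausdorff_measure (DIM('a) - 1)) A"
    unfolding boundary_measure_def
    by (intro emeasure_restrict_space) (auto simp: hausdorff_measure_def assms)
  then show ?thesis
    unfolding hausdorff_measure_def by (simp add: emeasure_measure_of_conv)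
qed

section \<open>Finiteness and null points of the boundary measure\<close>

lemma space_boundary_measure: "space (boundary_measure \<Omega>) = frontier \<Omega>"
  by (simp add: boundary_measure_def space_restrict_space hausdorff_measure_def)

lemma sets_boundary_measure: "sets (boundary_measure \<Omega>) = sets (restrict_space borel (frontier \<Omega>))"
proof -
  have "sets (hausdorff_measure k :: 'a measure) = sets borel" for k
    unfolding hausdorff_measure_def using sets.sigma_sets_eq[of "borel :: 'a measure"]
    by (simp add: sets_measure_of_conv)
  then show ?thesis unfolding boundary_measure_def by (rule sets_restrict_space_cong)
qed

lemma finite_boundary_measure:
  fixes \<Omega> :: "'a::euclidean_space set"
  assumes "open \<Omega>" "bounded \<Omega>" "cone_domain \<Omega>"
  shows "finite_measure (boundary_measure \<Omega>)"
proof
  have cpt: "compact (frontier \<Omega>)" using assms(2) by (rule compact_frontier_bounded)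
  have "\<forall>z\<in>frontier \<Omega>. \<exists>r>0. hausdorff_bounded (DIM('a) - 1) (frontier \<Omega> \<inter> ball z r)"
  proof
    fix z assume "z \<in> frontier \<Omega>"
    then obtain r e \<kappa> where c: "cone_at \<Omega> z r e \<kappa>"
      using assms(3) unfolding cone_domain_def frontier_def by blast
    show "\<exists>r>0. hausdorff_bounded (DIM('a) - 1) (frontier \<Omega> \<inter> ball z r)"
      using hausdorff_bounded_local[OF c assms(1)] cone_atD(1)[OF c] by blast
  qed
  then obtain r where r: "\<And>z. z \<in> frontier \<Omega> \<Longrightarrow> r z > 0 \<and> hausdorff_bounded (DIM('a) - 1) (frontier \<Omega> \<inter> ball z (r z))"
    by metis
  obtain Z where Z: "Z \<subseteq> frontier \<Omega>" "finite Z" "frontier \<Omega> \<subseteq> (\<Union>z\<in>Z. ball z (r z))"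
    by (rule compactE_image[OF cpt, of "frontier \<Omega>" "\<lambda>z. ball z (r z)"]) (use r in auto)
  have "hausdorff_bounded (DIM('a) - 1) (\<Union>z\<in>Z. frontier \<Omega> \<inter> ball z (r z))"
    using Z r by (intro hausdorff_bounded_UN) auto
  then have "hausdorff_bounded (DIM('a) - 1) (frontier \<Omega>)"
    by (rule hausdorff_bounded_subset) (use Z in auto)
  then have "hausdorff_outer (DIM('a) - 1) (frontier \<Omega>) < \<infinity>"
    by (rule hausdorff_bounded_outer)
  then have "emeasure (boundary_measure \<Omega>) (frontier \<Omega>) < \<infinity>"
    using boundary_emeasure_le[of "frontier \<Omega>" \<Omega>] by (simp add: borel_closed order.strict_trans1)
  then show "emeasure (boundary_measure \<Omega>) (space (boundary_measure \<Omega>)) \<noteq> \<infinity>"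
    by (simp add: space_boundary_measure)
qed

text \<open>Cover the point by itself: diameter 0 to the positive power n - 1 is 0. In dimension 1
  the same cover has weight 1.\<close>

lemma boundary_emeasure_singleton:
  fixes \<Omega> :: "'a::euclidean_space set"
  assumes "DIM('a) > 1" "x \<in> frontier \<Omega>"
  shows "emeasure (boundary_measure \<Omega>) {x} = 0"
proof -
  have "hausdorff_content (DIM('a) - 1) \<delta> {x} = 0" if "\<delta> > 0" for \<delta>
  proof -
    have "hausdorff_content (DIM('a) - 1) \<delta> {x} \<le> (\<Sum>i::nat. hausdorff_weight (DIM('a) - 1) {x})"
      unfolding hausdorff_content_def by (rule INF_lower2[of "\<lambda>_. {x}"]) (use that in auto)
    also have "hausdorff_weight (DIM('a) - 1) {x} = 0"
      using assms(1) by (simp add: hausdorff_weight_def)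
    finally show ?thesis by simp
  qed
  then have "hausdorff_outer (DIM('a) - 1) {x} = 0"
    unfolding hausdorff_outer_def by (intro antisym SUP_least) auto
  then show ?thesis using boundary_emeasure_le[of "{x}" \<Omega>] assms by simp
qed

lemma continuous_on_boundary_measurable:
  fixes g :: "'a::euclidean_space \<Rightarrow> real"
  assumes "continuous_on (frontier \<Omega>) g"
  shows "g \<in> borel_measurable (boundary_measure \<Omega>)"
  using borel_measurable_continuous_on_restrict[OF assms]
  by (simp cong: measurable_cong_sets add: measurable_cong_sets[OF sets_boundary_measure refl])

section \<open>Weak gradients\<close>

lemma open_sets_lebesgue: "open \<Omega> \<Longrightarrow> \<Omega> \<in> sets lebesgue"
  by (simp add: borel_open)

lemma AE_lebesgue_on_iff:
  fixes \<Omega> :: "'a::euclidean_space set"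
  assumes "open \<Omega>"
  shows "(AE x in lebesgue_on \<Omega>. P x) \<longleftrightarrow> (AE x in lborel. x \<in> \<Omega> \<longrightarrow> P x)"
  using open_sets_lebesgue[OF assms] by (simp add: AE_restrict_space_iff AE_completion_iff)

lemma nn_integral_lebesgue_on:
  fixes \<Omega> :: "'a::euclidean_space set"
  assumes "open \<Omega>"
  shows "(\<integral>\<^sup>+x. f x \<partial>lebesgue_on \<Omega>) = (\<integral>\<^sup>+x. f x * indicator \<Omega> x \<partial>lborel)"
  using open_sets_lebesgue[OF assms] by (simp add: nn_integral_restrict_space nn_integral_completion)

lemma borel_measurable_lebesgue_on:
  fixes f :: "'a::euclidean_space \<Rightarrow> 'b::topological_space"
  assumes "f \<in> borel_measurable borel"
  shows "f \<in> borel_measurable (lebesgue_on \<Omega>)"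
  using assms by (simp add: measurable_completion measurable_restrict_space1)

lemma p_integral_lebesgue_on_zero_outside:
  fixes f :: "'a::euclidean_space \<Rightarrow> 'b::euclidean_space"
  assumes "open \<Omega>" "\<And>x. x \<notin> \<Omega> \<Longrightarrow> f x = 0"
  shows "p_integral (lebesgue_on \<Omega>) p f = p_integral lborel p f"
  unfolding p_integral_def nn_integral_lebesgue_on[OF assms(1)]
  by (intro nn_integral_cong) (use assms(2) in \<open>auto simp: indicator_def\<close>)

lemma p_integral_lebesgue_on_le:
  fixes f :: "'a::euclidean_space \<Rightarrow> 'b::euclidean_space"
  assumes "open \<Omega>"
  shows "p_integral (lebesgue_on \<Omega>) p f \<le> p_integral lborel p f"
  unfolding p_integral_def nn_integral_lebesgue_on[OF assms(1)]
  by (intro nn_integral_mono) (auto simp: indicator_def)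

lemma p_integral_cong_AE:
  "AE x in M. f x = g x \<Longrightarrow> p_integral M p f = p_integral M p g"
  unfolding p_integral_def by (rule nn_integral_cong_AE) auto

lemma lebesgue_borel_representative_real:
  fixes f :: "'a::euclidean_space \<Rightarrow> real"
  assumes "f \<in> borel_measurable lebesgue"
  obtains f' where "f' \<in> borel_measurable borel" "AE x in lborel. f x = f' x"
  using completion_ex_borel_measurable_real[of f lborel] assms by auto

lemma lebesgue_on_borel_representative:
  fixes f :: "'a::euclidean_space \<Rightarrow> 'b::euclidean_space"
  assumes "open \<Omega>" "f \<in> borel_measurable (lebesgue_on \<Omega>)"
  obtains f' where "f' \<in> borel_measurable borel" "AE x in lborel. x \<in> \<Omega> \<longrightarrow> f x = f' x" "\<And>x. x \<notin> \<Omega> \<Longrightarrow> f' x = 0"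
proof -
  have m: "(\<lambda>x. indicator \<Omega> x *\<^sub>R f x) \<in> borel_measurable lebesgue"
    using assms open_sets_lebesgue[OF assms(1)] borel_measurable_restrict_space_iff[of \<Omega> lebesgue f] by simp
  have "\<exists>h. h \<in> borel_measurable borel \<and> (AE x in lborel. (indicator \<Omega> x *\<^sub>R f x) \<bullet> i = h x)" for i
  proof -
    have "(\<lambda>x. (indicator \<Omega> x *\<^sub>R f x) \<bullet> i) \<in> borel_measurable lebesgue"
      using m by (intro borel_measurable_inner) auto
    from lebesgue_borel_representative_real[OF this] show ?thesis by blast
  qed
  then obtain h where h: "\<And>i. h i \<in> borel_measurable borel" "\<And>i. AE x in lborel. (indicator \<Omega> x *\<^sub>R f x) \<bullet> i = h i x"
    by metis
  note [measurable] = h(1)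
  have [measurable]: "\<Omega> \<in> sets borel" using assms(1) by auto
  define f' where "f' x = indicator \<Omega> x *\<^sub>R (\<Sum>i\<in>Basis. h i x *\<^sub>R i)" for x
  have "AE x in lborel. \<forall>i\<in>Basis. (indicator \<Omega> x *\<^sub>R f x) \<bullet> i = h i x"
    using h(2) by (intro AE_finite_allI) auto
  then have "AE x in lborel. x \<in> \<Omega> \<longrightarrow> f x = f' x"
  proof eventually_elim
    case (elim x)
    show ?case
    proof
      assume "x \<in> \<Omega>"
      then have "\<forall>i\<in>Basis. f x \<bullet> i = h i x" using elim by simp
      then have "(\<Sum>i\<in>Basis. (f x \<bullet> i) *\<^sub>R i) = (\<Sum>i\<in>Basis. h i x *\<^sub>R i)" by (intro sum.cong) auto
      then show "f x = f' x" using \<open>x \<in> \<Omega>\<close> by (simp add: f'_def euclidean_representation)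
    qed
  qed
  moreover have "f' \<in> borel_measurable borel" unfolding f'_def by measurable
  moreover have "f' x = 0" if "x \<notin> \<Omega>" for x using that by (simp add: f'_def)
  ultimately show thesis using that by blast
qed

lemma bounded_Lp_integrable:
  fixes f :: "'a::euclidean_space \<Rightarrow> real"
  assumes "bounded \<Omega>" "1 \<le> p" "f \<in> borel_measurable borel" "p_integral lborel p f < \<infinity>"
    and "\<And>x. x \<notin> \<Omega> \<Longrightarrow> f x = 0"
  shows "integrable lborel f"
proof -
  obtain R where R: "\<And>x. x \<in> \<Omega> \<Longrightarrow> norm x \<le> R" using assms(1) bounded_iff by metis
  have "f x = 0" if "R + 1 \<le> norm x" for x
    using assms(5)[of x] R[of x] that by force
  then show ?thesis using integrable_of_p_integral[OF assms(2-4)] by blast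
qed

text \<open>
  Borel representatives extended by zero: Fubini on \<^const>\<open>lborel\<close> needs Borel functions,
  whereas \<^const>\<open>has_weak_gradient\<close> only provides Lebesgue measurable ones.
\<close>

definition borel_weak_grad :: "'a::euclidean_space set \<Rightarrow> ('a \<Rightarrow> real) \<Rightarrow> ('a \<Rightarrow> 'a) \<Rightarrow> bool" where
  "borel_weak_grad \<Omega> u g \<longleftrightarrow> integrable lborel u \<and> g \<in> borel_measurable borel \<and>
     (\<forall>i\<in>Basis. integrable lborel (\<lambda>x. g x \<bullet> i)) \<and> (\<forall>x. x \<notin> \<Omega> \<longrightarrow> u x = 0 \<and> g x = 0) \<and>
     (\<forall>\<phi>. test_function \<Omega> \<phi> \<longrightarrow> (\<forall>i\<in>Basis.
        (\<integral>x. u x * pderiv_at \<phi> i x \<partial>lborel) = - (\<integral>x. (g x \<bullet> i) * \<phi> x \<partial>lborel)))"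

lemma borel_weak_gradD:
  assumes "borel_weak_grad \<Omega> u g"
  shows "integrable lborel u" "u \<in> borel_measurable borel" "g \<in> borel_measurable borel"
    "\<And>i. i \<in> Basis \<Longrightarrow> integrable lborel (\<lambda>x. g x \<bullet> i)"
    "\<And>x. x \<notin> \<Omega> \<Longrightarrow> u x = 0" "\<And>x. x \<notin> \<Omega> \<Longrightarrow> g x = 0"
    "\<And>\<phi> i. test_function \<Omega> \<phi> \<Longrightarrow> i \<in> Basis \<Longrightarrow>
      (\<integral>x. u x * pderiv_at \<phi> i x \<partial>lborel) = - (\<integral>x. (g x \<bullet> i) * \<phi> x \<partial>lborel)"
  using assms unfolding borel_weak_grad_def by auto

lemma set_integral_lebesgue_lborel:
  fixes f :: "'a::euclidean_space \<Rightarrow> real"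
  assumes "open \<Omega>" "f' \<in> borel_measurable borel" "AE x in lborel. x \<in> \<Omega> \<longrightarrow> f x = f' x" "\<And>x. x \<notin> \<Omega> \<Longrightarrow> f' x = 0"
    and "(\<lambda>x. indicator \<Omega> x *\<^sub>R f x) \<in> borel_measurable lebesgue"
  shows "(LINT x:\<Omega>|lebesgue. f x) = (\<integral>x. f' x \<partial>lborel)"
proof -
  have "(LINT x:\<Omega>|lebesgue. f x) = (\<integral>x. f' x \<partial>lebesgue)"
    unfolding set_lebesgue_integral_def
  proof (rule integral_cong_AE)
    have "AE x in lborel. indicator \<Omega> x *\<^sub>R f x = f' x"
      using assms(3) by eventually_elim (use assms(4) in \<open>auto simp: indicator_def\<close>)
    then show "AE x in lebesgue. indicator \<Omega> x *\<^sub>R f x = f' x" by (simp add: AE_completion_iff)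
  qed (use assms in \<open>auto simp: measurable_completion\<close>)
  then show ?thesis using assms(2) by (simp add: integral_completion)
qed

lemma borel_weak_grad_exists:
  fixes \<Omega> :: "'a::euclidean_space set"
  assumes \<Omega>: "open \<Omega>" "bounded \<Omega>" and p: "1 \<le> p"
    and u: "u \<in> Lp (lebesgue_on \<Omega>) p" and g: "g \<in> Lp (lebesgue_on \<Omega>) p" and w: "has_weak_gradient \<Omega> u g"
  obtains u' g' where "borel_weak_grad \<Omega> u' g'" "AE x in lborel. x \<in> \<Omega> \<longrightarrow> u x = u' x" "AE x in lborel. x \<in> \<Omega> \<longrightarrow> g x = g' x"
    "p_integral lborel p u' < \<infinity>" "p_integral lborel p g' < \<infinity>"
proof -
  have um: "u \<in> borel_measurable (lebesgue_on \<Omega>)" and gm: "g \<in> borel_measurable (lebesgue_on \<Omega>)"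
    using u g by (auto simp: Lp_def)
  obtain u' where u': "u' \<in> borel_measurable borel" "AE x in lborel. x \<in> \<Omega> \<longrightarrow> u x = u' x" "\<And>x. x \<notin> \<Omega> \<Longrightarrow> u' x = 0"
    using lebesgue_on_borel_representative[OF \<Omega>(1) um] by blast
  obtain g' where g': "g' \<in> borel_measurable borel" "AE x in lborel. x \<in> \<Omega> \<longrightarrow> g x = g' x" "\<And>x. x \<notin> \<Omega> \<Longrightarrow> g' x = 0"
    using lebesgue_on_borel_representative[OF \<Omega>(1) gm] by blast
  note [measurable] = u'(1) g'(1)
  have pu: "p_integral lborel p u' < \<infinity>"
    using u p_integral_cong_AE[OF AE_lebesgue_on_iff[OF \<Omega>(1), THEN iffD2, OF u'(2)], where p = p]
      p_integral_lebesgue_on_zero_outside[where f = u' and p = p, OF \<Omega>(1) u'(3)] by (simp add: Lp_def)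
  have pg: "p_integral lborel p g' < \<infinity>"
    using g p_integral_cong_AE[OF AE_lebesgue_on_iff[OF \<Omega>(1), THEN iffD2, OF g'(2)], where p = p]
      p_integral_lebesgue_on_zero_outside[where f = g' and p = p, OF \<Omega>(1) g'(3)] by (simp add: Lp_def)
  have gi: "integrable lborel (\<lambda>x. g' x \<bullet> i)" if "i \<in> Basis" for i
  proof (rule bounded_Lp_integrable[OF \<Omega>(2) p])
    have "p_integral lborel p (\<lambda>x. g' x \<bullet> i) \<le> p_integral lborel p g'"
      unfolding p_integral_def using p Basis_le_norm[OF that]
      by (intro nn_integral_mono ennreal_leI powr_mono2) auto
    then show "p_integral lborel p (\<lambda>x. g' x \<bullet> i) < \<infinity>" using pg by (rule le_less_trans)
  qed (use g' in auto)
  have um: "(\<lambda>x. indicator \<Omega> x *\<^sub>R u x) \<in> borel_measurable lebesgue"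
    using u open_sets_lebesgue[OF \<Omega>(1)] borel_measurable_restrict_space_iff[of \<Omega> lebesgue u] by (simp add: Lp_def)
  have gm: "(\<lambda>x. indicator \<Omega> x *\<^sub>R g x) \<in> borel_measurable lebesgue"
    using g open_sets_lebesgue[OF \<Omega>(1)] borel_measurable_restrict_space_iff[of \<Omega> lebesgue g] by (simp add: Lp_def)
  have "(\<integral>x. u' x * pderiv_at \<phi> i x \<partial>lborel) = - (\<integral>x. (g' x \<bullet> i) * \<phi> x \<partial>lborel)"
    if \<phi>: "test_function \<Omega> \<phi>" and i: "i \<in> Basis" for \<phi> i
  proof -
    have [measurable]: "\<phi> \<in> borel_measurable borel" "pderiv_at \<phi> i \<in> borel_measurable borel"
      using test_function_measurable[OF \<phi>] test_function_measurable[OF test_function_pderiv[OF \<phi> i]] by auto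
    have 1: "(LINT x:\<Omega>|lebesgue. u x * pderiv_at \<phi> i x) = (\<integral>x. u' x * pderiv_at \<phi> i x \<partial>lborel)"
    proof (rule set_integral_lebesgue_lborel[OF \<Omega>(1)])
      have "(\<lambda>x. (indicator \<Omega> x *\<^sub>R u x) * pderiv_at \<phi> i x) \<in> borel_measurable lebesgue"
        by (intro borel_measurable_times um) (simp add: measurable_completion)
      then show "(\<lambda>x. indicator \<Omega> x *\<^sub>R (u x * pderiv_at \<phi> i x)) \<in> borel_measurable lebesgue"
        by (simp add: mult.assoc)
      show "AE x in lborel. x \<in> \<Omega> \<longrightarrow> u x * pderiv_at \<phi> i x = u' x * pderiv_at \<phi> i x"
        using u'(2) by eventually_elim auto
    qed (use u' in auto)
    have 2: "(LINT x:\<Omega>|lebesgue. (g x \<bullet> i) * \<phi> x) = (\<integral>x. (g' x \<bullet> i) * \<phi> x \<partial>lborel)"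
    proof (rule set_integral_lebesgue_lborel[OF \<Omega>(1)])
      have "(\<lambda>x. ((indicator \<Omega> x *\<^sub>R g x) \<bullet> i) * \<phi> x) \<in> borel_measurable lebesgue"
        by (intro borel_measurable_times borel_measurable_inner gm) (simp_all add: measurable_completion)
      then show "(\<lambda>x. indicator \<Omega> x *\<^sub>R ((g x \<bullet> i) * \<phi> x)) \<in> borel_measurable lebesgue"
        by (simp add: mult.assoc)
      show "AE x in lborel. x \<in> \<Omega> \<longrightarrow> (g x \<bullet> i) * \<phi> x = (g' x \<bullet> i) * \<phi> x"
        using g'(2) by eventually_elim auto
    qed (use g' in auto)
    show ?thesis using w \<phi> i 1 2 unfolding has_weak_gradient_def by metis
  qed
  then have "borel_weak_grad \<Omega> u' g'"
    unfolding borel_weak_grad_def using u' g' gi bounded_Lp_integrable[OF \<Omega>(2) p u'(1) pu u'(3)] by blast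
  then show thesis using that u' g' pu pg by blast
qed

lemma borel_weak_grad_diff:
  assumes "borel_weak_grad \<Omega> u g" "borel_weak_grad \<Omega> v h"
  shows "borel_weak_grad \<Omega> (\<lambda>x. u x - v x) (\<lambda>x. g x - h x)"
  unfolding borel_weak_grad_def
proof (intro conjI allI ballI impI)
  note u = borel_weak_gradD[OF assms(1)] and v = borel_weak_gradD[OF assms(2)]
  show "integrable lborel (\<lambda>x. u x - v x)" using u(1) v(1) by simp
  show "(\<lambda>x. g x - h x) \<in> borel_measurable borel" using u(3) v(3) by simp
  show "integrable lborel (\<lambda>x. (g x - h x) \<bullet> i)" if "i \<in> Basis" for i
    using u(4)[OF that] v(4)[OF that] by (simp add: inner_diff_left)
  show "u x - v x = 0" "g x - h x = 0" if "x \<notin> \<Omega>" for x using u(5,6) v(5,6) that by auto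
  fix \<phi> i assume \<phi>: "test_function \<Omega> \<phi>" and i: "i \<in> (Basis :: 'a set)"
  have I: "integrable lborel (\<lambda>x. w x * \<psi> x)" if w: "integrable lborel w" and t: "test_function \<Omega> \<psi>" for w \<psi>
  proof -
    obtain B where "\<And>x. \<bar>\<psi> x\<bar> \<le> B" using test_function_bounded[OF t] by blast
    then show ?thesis
      using integrable_mult_bounded[OF w, of \<psi> B] test_function_measurable[OF t] by (simp add: mult.commute)
  qed
  note \<phi>i = test_function_pderiv[OF \<phi> i]
  show "(\<integral>x. (u x - v x) * pderiv_at \<phi> i x \<partial>lborel) = - (\<integral>x. ((g x - h x) \<bullet> i) * \<phi> x \<partial>lborel)"
    using u(7)[OF \<phi> i] v(7)[OF \<phi> i] I[OF u(1) \<phi>i] I[OF v(1) \<phi>i] I[OF u(4)[OF i] \<phi>] I[OF v(4)[OF i] \<phi>]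
    by (simp add: left_diff_distrib inner_diff_left)
qed

text \<open>The Leibniz rule follows by inserting k \<phi>, again a test function on \<Omega>, into
  the weak identity for \<open>u\<close>.\<close>

lemma borel_weak_grad_mult:
  fixes \<Omega> :: "'a::euclidean_space set"
  assumes "borel_weak_grad \<Omega> u g" and k: "test_function UNIV k"
  shows "borel_weak_grad \<Omega> (\<lambda>x. k x * u x) (\<lambda>x. k x *\<^sub>R g x + u x *\<^sub>R grad k x)"
  unfolding borel_weak_grad_def
proof (intro conjI allI ballI impI)
  note u = borel_weak_gradD[OF assms(1)]
  note sk = test_functionD(1)[OF k]
  have I: "integrable lborel (\<lambda>x. \<psi> x * w x)" if w: "integrable lborel w" and t: "test_function UNIV \<psi>" for w \<psi>
  proof -
    obtain B where "\<And>x. \<bar>\<psi> x\<bar> \<le> B" using test_function_bounded[OF t] by blast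
    then show ?thesis
      using integrable_mult_bounded[OF w, of \<psi> B] test_function_measurable[OF t] by simp
  qed
  show "integrable lborel (\<lambda>x. k x * u x)" by (rule I[OF u(1) k])
  show "(\<lambda>x. k x *\<^sub>R g x + u x *\<^sub>R grad k x) \<in> borel_measurable borel"
    using u(2,3) smooth_grad_measurable[OF sk] test_function_measurable[OF k] by simp
  have e: "(k x *\<^sub>R g x + u x *\<^sub>R grad k x) \<bullet> i = k x * (g x \<bullet> i) + pderiv_at k i x * u x" if "i \<in> Basis" for i x
    using that by (simp add: inner_add_left grad_inner_Basis)
  show "integrable lborel (\<lambda>x. (k x *\<^sub>R g x + u x *\<^sub>R grad k x) \<bullet> i)" if "i \<in> Basis" for i
    unfolding e[OF that]
    by (intro Bochner_Integration.integrable_add I u that k test_function_pderiv)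
  show "k x * u x = 0" "k x *\<^sub>R g x + u x *\<^sub>R grad k x = 0" if "x \<notin> \<Omega>" for x using u(5,6) that by auto
  fix \<phi> i assume \<phi>: "test_function \<Omega> \<phi>" and i: "i \<in> (Basis :: 'a set)"
  have \<phi>': "test_function UNIV \<phi>" using test_function_mono[OF \<phi>] by simp
  have k\<phi>: "test_function \<Omega> (\<lambda>x. k x * \<phi> x)" by (rule test_function_mult[OF sk \<phi>])
  have "(\<integral>x. u x * pderiv_at (\<lambda>x. k x * \<phi> x) i x \<partial>lborel) =
     (\<integral>x. (pderiv_at \<phi> i x * (k x * u x)) + \<phi> x * (pderiv_at k i x * u x) \<partial>lborel)"
    unfolding pderiv_mult[OF sk test_functionD(1)[OF \<phi>]] by (simp add: algebra_simps)
  also have "\<dots> = (\<integral>x. pderiv_at \<phi> i x * (k x * u x) \<partial>lborel) + (\<integral>x. \<phi> x * (pderiv_at k i x * u x) \<partial>lborel)"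
    by (intro Bochner_Integration.integral_add I u k \<phi>' test_function_pderiv i)
  finally have A: "(\<integral>x. (k x * u x) * pderiv_at \<phi> i x \<partial>lborel) =
     - (\<integral>x. (g x \<bullet> i) * (k x * \<phi> x) \<partial>lborel) - (\<integral>x. \<phi> x * (pderiv_at k i x * u x) \<partial>lborel)"
    using u(7)[OF k\<phi> i] by (simp add: mult_ac)
  have "(\<integral>x. ((k x *\<^sub>R g x + u x *\<^sub>R grad k x) \<bullet> i) * \<phi> x \<partial>lborel) =
     (\<integral>x. \<phi> x * (k x * (g x \<bullet> i)) + \<phi> x * (pderiv_at k i x * u x) \<partial>lborel)"
    unfolding e[OF i] by (simp add: algebra_simps)
  also have "\<dots> = (\<integral>x. \<phi> x * (k x * (g x \<bullet> i)) \<partial>lborel) + (\<integral>x. \<phi> x * (pderiv_at k i x * u x) \<partial>lborel)"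
    by (intro Bochner_Integration.integral_add I u k \<phi>' test_function_pderiv i)
  finally show "(\<integral>x. (k x * u x) * pderiv_at \<phi> i x \<partial>lborel) =
     - (\<integral>x. ((k x *\<^sub>R g x + u x *\<^sub>R grad k x) \<bullet> i) * \<phi> x \<partial>lborel)"
    unfolding A by (simp add: mult_ac)
qed

text \<open>The derivative falls on the kernel y \<mapsto> k (y - x). When this is an admissible
  test function on \<Omega>, the weak identity moves it to \<open>u\<close>, and the sign of the
  weak identity cancels the one produced by y - x.\<close>

lemma borel_weak_grad_conv_pderiv:
  assumes b: "borel_weak_grad \<Omega> u g" and i: "i \<in> Basis" and k: "test_function UNIV k"
    and supp: "test_function \<Omega> (\<lambda>y. k (y - x))"
  shows "pderiv_at (conv k u) i x = conv k (\<lambda>x. g x \<bullet> i) x"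
proof -
  note u = borel_weak_gradD[OF b]
  have d: "pderiv_at (\<lambda>y. k (y - x)) i y = pderiv_at k i (y - x)" for y
    by (rule frechet_derivative_eqI, rule has_derivative_compose[of "\<lambda>y. y - x" "\<lambda>h. h" y UNIV k])
      (auto intro!: derivative_eq_intros smooth_has_derivative test_functionD(1)[OF k])
  have "pderiv_at (conv k u) i x = (\<integral>y. - (u y * pderiv_at (\<lambda>y. k (y - x)) i y) \<partial>lborel)"
    unfolding pderiv_conv[OF k u(1) i] conv_def d by (simp add: mult.commute)
  also have "\<dots> = (\<integral>y. (g y \<bullet> i) * k (y - x) \<partial>lborel)"
    using u(7)[OF supp i] by simp
  finally show ?thesis by (simp add: conv_def mult.commute)
qed

text \<open>At scales s < r/2 the mollification of \<open>h\<close> at a point of the half ball is a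
  test integral over the full ball, hence 0. Since mollifications converge in L1 (the case p = 1 of
  \<open>conv_rescale_Lp\<close>), \<open>h\<close> is 0 almost everywhere there.\<close>

lemma fundamental_lemma_local:
  fixes h :: "'a::euclidean_space \<Rightarrow> real"
  assumes "r > 0" and int: "integrable lebesgue (\<lambda>x. indicator (cball z r) x *\<^sub>R h x)"
    and test: "\<And>\<phi>. test_function (ball z r) \<phi> \<Longrightarrow> (\<integral>x. (indicator (cball z r) x *\<^sub>R h x) * \<phi> x \<partial>lebesgue) = 0"
  shows "AE x in lborel. x \<in> ball z (r / 2) \<longrightarrow> h x = 0"
proof -
  define f where "f x = indicator (cball z r) x *\<^sub>R h x" for x
  have fm: "f \<in> borel_measurable lebesgue" using int unfolding f_def by (rule borel_measurable_integrable)
  obtain f1 where f1: "f1 \<in> borel_measurable borel" "AE x in lborel. f x = f1 x"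
    using lebesgue_borel_representative_real[OF fm] by blast
  define f0 where "f0 x = indicator (cball z r) x * f1 x" for x
  have ff0: "AE x in lborel. f x = f0 x"
    using f1(2) by eventually_elim (auto simp: f0_def f_def indicator_def)
  have [measurable]: "f0 \<in> borel_measurable borel"
    unfolding f0_def using f1(1) by (intro borel_measurable_times borel_measurable_indicator) (auto simp: borel_closed)
  have "integrable lebesgue f0"
    using int ff0 fm unfolding f_def[symmetric]
    by (subst integrable_cong_AE[of _ _ f]) (auto simp: AE_completion_iff measurable_completion)
  then have f0i: "integrable lborel f0" by (simp add: integrable_completion)
  have test0: "(\<integral>x. f0 x * \<phi> x \<partial>lborel) = 0" if "test_function (ball z r) \<phi>" for \<phi>
  proof -
    have [measurable]: "\<phi> \<in> borel_measurable borel" using test_function_measurable[OF that] .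
    have "(\<integral>x. f0 x * \<phi> x \<partial>lborel) = (\<integral>x. f0 x * \<phi> x \<partial>lebesgue)"
      by (rule integral_completion[symmetric]) simp
    also have "\<dots> = (\<integral>x. f x * \<phi> x \<partial>lebesgue)"
    proof (rule integral_cong_AE)
      show "AE x in lebesgue. f0 x * \<phi> x = f x * \<phi> x"
        unfolding AE_completion_iff using ff0 by eventually_elim simp
    qed (use fm in \<open>auto simp: measurable_completion intro!: borel_measurable_times\<close>)
    finally show ?thesis using test[OF that] by (simp add: f_def)
  qed
  obtain k :: "'a \<Rightarrow> real" where k: "test_function (ball 0 1) k" "\<And>x. 0 \<le> k x" "(\<integral>x. k x \<partial>lborel) = 1"
    using bump_exists[of 1 0] by auto
  have p1: "p_integral lborel 1 f0 < \<infinity>"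
    using f0i by (simp add: p_integral_def powr_one' integrable_iff_bounded)
  have supp: "f0 x = 0" if "norm z + r + 1 \<le> norm x" for x
  proof -
    have "x \<notin> cball z r" using that norm_triangle_ineq2[of x z] by (auto simp: dist_norm norm_minus_commute)
    then show ?thesis by (simp add: f0_def)
  qed
  have conv0: "conv (rescale s k) f0 x = 0" if s: "0 < s" "s < r / 2" and x: "x \<in> ball z (r / 2)" for s x
  proof -
    have tk: "test_function ((*\<^sub>R) s ` ball 0 1) (rescale s k)" by (rule test_function_rescale[OF k(1) s(1)])
    obtain K where K: "compact K" "K \<subseteq> (*\<^sub>R) s ` ball 0 1" "\<And>y. y \<notin> K \<Longrightarrow> rescale s k y = 0"
      using tk test_functionD(2) by meson
    have "test_function (ball z r) (\<lambda>y. rescale s k (y - x))"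
      unfolding test_function_def
    proof (intro conjI exI[of _ "(\<lambda>y. y + x) ` K"])
      show "smooth (\<lambda>y. rescale s k (y - x))"
        using smooth_affine[OF test_functionD(1)[OF tk], of 1 "- x"] by simp
      show "compact ((\<lambda>y. y + x) ` K)"
        using compact_translation[OF K(1), of x] by (simp add: add.commute)
      show "(\<lambda>y. y + x) ` K \<subseteq> ball z r"
      proof
        fix v assume "v \<in> (\<lambda>y. y + x) ` K"
        then obtain y where y: "y \<in> K" "v = y + x" by blast
        obtain w where w: "y = s *\<^sub>R w" "norm w < 1" using subsetD[OF K(2) y(1)] by (metis imageE mem_ball_0)
        have "s * norm w < s * 1" using w s by (intro mult_strict_left_mono) auto
        moreover have "dist z (y + x) \<le> dist z x + dist x (y + x)" by (rule dist_triangle)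
        moreover have "dist x (y + x) = s * norm w" using s w by (simp add: dist_norm)
        ultimately have "dist z (y + x) < r" using s x unfolding mem_ball by linarith
        then show "v \<in> ball z r" using y by simp
      qed
      show "\<forall>y. y \<notin> (\<lambda>y. y + x) ` K \<longrightarrow> rescale s k (y - x) = 0"
        using K(3) by (metis diff_add_cancel image_eqI)
    qed
    from test0[OF this] show ?thesis by (simp add: conv_def mult.commute)
  qed
  have le: "(\<integral>\<^sup>+x. ennreal \<bar>f0 x\<bar> * indicator (ball z (r / 2)) x \<partial>lborel) \<le> ennreal e" if "e > 0" for e
  proof -
    obtain s0 where s0: "s0 > 0" "\<And>s. 0 < s \<Longrightarrow> s < s0 \<Longrightarrow> p_integral lborel 1 (\<lambda>x. conv (rescale s k) f0 x - f0 x) < ennreal e"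
      using conv_rescale_Lp[OF _ k _ p1 supp \<open>e > 0\<close>] by auto
    define s where "s = min (s0 / 2) (r / 4)"
    have s: "0 < s" "s < s0" "s < r / 2" using s0 \<open>r > 0\<close> by (auto simp: s_def)
    have "(\<integral>\<^sup>+x. ennreal \<bar>f0 x\<bar> * indicator (ball z (r / 2)) x \<partial>lborel) \<le> p_integral lborel 1 (\<lambda>x. conv (rescale s k) f0 x - f0 x)"
      unfolding p_integral_def
    proof (rule nn_integral_mono)
      fix x
      show "ennreal \<bar>f0 x\<bar> * indicator (ball z (r / 2)) x \<le> ennreal (norm (conv (rescale s k) f0 x - f0 x) powr 1)"
        using conv0[OF s(1,3), of x] by (cases "x \<in> ball z (r / 2)") auto
    qed
    also have "\<dots> \<le> ennreal e" using s0(2)[OF s(1,2)] by simp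
    finally show ?thesis .
  qed
  have "(\<integral>\<^sup>+x. ennreal \<bar>f0 x\<bar> * indicator (ball z (r / 2)) x \<partial>lborel) \<le> 0"
  proof (rule ennreal_le_epsilon)
    fix e :: real assume "0 < e"
    from le[OF this] show "(\<integral>\<^sup>+x. ennreal \<bar>f0 x\<bar> * indicator (ball z (r / 2)) x \<partial>lborel) \<le> 0 + ennreal e"
      by simp
  qed
  then have zero: "(\<integral>\<^sup>+x. ennreal \<bar>f0 x\<bar> * indicator (ball z (r / 2)) x \<partial>lborel) = 0"
    by simp
  have [measurable]: "ball z (r / 2) \<in> sets borel" by (simp add: borel_open)
  have "(\<lambda>x. ennreal \<bar>f0 x\<bar> * indicator (ball z (r / 2)) x) \<in> borel_measurable lborel"
    by measurable
  from nn_integral_0_iff_AE[OF this] zero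
  have "AE x in lborel. ennreal \<bar>f0 x\<bar> * indicator (ball z (r / 2)) x = 0"
    by blast
  then show ?thesis
    using ff0
  proof eventually_elim
    case (elim x)
    show ?case
    proof
      assume x: "x \<in> ball z (r / 2)"
      then have "f0 x = 0" using elim(1) by simp
      moreover have "x \<in> cball z r" using x \<open>r > 0\<close> by auto
      ultimately show "h x = 0" using elim(2) by (simp add: f_def)
    qed
  qed
qed

section \<open>Uniqueness of weak gradients\<close>

lemma locally_integrable_onD:
  fixes f :: "'a::euclidean_space \<Rightarrow> 'b::euclidean_space"
  assumes "locally_integrable_on f \<Omega>" "K \<subseteq> \<Omega>" "compact K"
  shows "integrable lebesgue (\<lambda>x. indicator K x *\<^sub>R f x)"
  using assms unfolding locally_integrable_on_def set_integrable_def by blast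

lemma locally_integrable_on_inner:
  fixes f :: "'a::euclidean_space \<Rightarrow> 'b::euclidean_space"
  assumes "locally_integrable_on f \<Omega>"
  shows "locally_integrable_on (\<lambda>x. f x \<bullet> i) \<Omega>"
  unfolding locally_integrable_on_def set_integrable_def
proof (intro allI impI)
  fix K assume "K \<subseteq> \<Omega>" "compact K"
  then have "integrable lebesgue (\<lambda>x. (indicator K x *\<^sub>R f x) \<bullet> i)"
    by (intro integrable_inner_left locally_integrable_onD[OF assms])
  then show "integrable lebesgue (\<lambda>x. indicator K x *\<^sub>R (f x \<bullet> i))" by simp
qed

lemma locally_integrable_on_diff:
  fixes f :: "'a::euclidean_space \<Rightarrow> 'b::euclidean_space"
  assumes "locally_integrable_on f \<Omega>" "locally_integrable_on g \<Omega>"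
  shows "locally_integrable_on (\<lambda>x. f x - g x) \<Omega>"
  using assms unfolding locally_integrable_on_def by auto

lemma locally_integrable_test:
  fixes f :: "'a::euclidean_space \<Rightarrow> real"
  assumes f: "locally_integrable_on f \<Omega>" and \<phi>: "test_function \<Omega> \<phi>"
  shows "integrable lebesgue (\<lambda>x. indicator \<Omega> x *\<^sub>R (f x * \<phi> x))"
proof -
  obtain K where K: "K \<subseteq> \<Omega>" "compact K" "\<forall>x. x \<notin> K \<longrightarrow> \<phi> x = 0"
    using \<phi> test_functionD by meson
  obtain B where B: "\<And>x. \<bar>\<phi> x\<bar> \<le> B" using test_function_bounded[OF \<phi>] by blast
  have "integrable lebesgue (\<lambda>x. \<phi> x * (indicator K x *\<^sub>R f x))"
    using B by (intro integrable_mult_bounded[where B = B] locally_integrable_onD[OF f K(1,2)])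
      (simp_all add: measurable_completion test_function_measurable[OF \<phi>])
  moreover have "\<phi> x * (indicator K x *\<^sub>R f x) = indicator \<Omega> x *\<^sub>R (f x * \<phi> x)" for x
    using K by (auto simp: indicator_def)
  ultimately show ?thesis by (simp only:)
qed

text \<open>This is what gives the choice \<open>weak_grad\<close> a definite value. The gradients
  are only locally integrable, so the fundamental lemma is applied on balls whose enlargements lie
  in \<Omega>; by Lindelof countably many of them suffice and the exceptional null sets can be
  united.\<close>

lemma weak_gradient_unique:
  fixes \<Omega> :: "'a::euclidean_space set"
  assumes \<Omega>: "open \<Omega>" and g: "has_weak_gradient \<Omega> u g" and h: "has_weak_gradient \<Omega> u h"
  shows "AE x in lebesgue_on \<Omega>. g x = h x"
proof -
  define d where "d i x = (g x - h x) \<bullet> i" for i x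
  have lg: "locally_integrable_on g \<Omega>" and lh: "locally_integrable_on h \<Omega>"
    using g h unfolding has_weak_gradient_def by auto
  have ld: "locally_integrable_on (d i) \<Omega>" for i
    using locally_integrable_on_inner[OF locally_integrable_on_diff[OF lg lh], of i] unfolding d_def .
  have z: "(\<integral>x. indicator \<Omega> x *\<^sub>R (d i x * \<phi> x) \<partial>lebesgue) = 0" if \<phi>: "test_function \<Omega> \<phi>" and i: "i \<in> Basis" for i \<phi>
  proof -
    have "(LINT x:\<Omega>|lebesgue. u x * pderiv_at \<phi> i x) = - (LINT x:\<Omega>|lebesgue. (g x \<bullet> i) * \<phi> x)"
      "(LINT x:\<Omega>|lebesgue. u x * pderiv_at \<phi> i x) = - (LINT x:\<Omega>|lebesgue. (h x \<bullet> i) * \<phi> x)"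
      using g h \<phi> i unfolding has_weak_gradient_def by blast+
    then have "(LINT x:\<Omega>|lebesgue. (g x \<bullet> i) * \<phi> x) = (LINT x:\<Omega>|lebesgue. (h x \<bullet> i) * \<phi> x)"
      by linarith
    moreover have "(\<integral>x. indicator \<Omega> x *\<^sub>R (d i x * \<phi> x) \<partial>lebesgue) =
       (LINT x:\<Omega>|lebesgue. (g x \<bullet> i) * \<phi> x) - (LINT x:\<Omega>|lebesgue. (h x \<bullet> i) * \<phi> x)"
      unfolding set_lebesgue_integral_def
      by (subst Bochner_Integration.integral_diff[symmetric])
        (use locally_integrable_test[OF locally_integrable_on_inner[OF lg] \<phi>, of i]
          locally_integrable_test[OF locally_integrable_on_inner[OF lh] \<phi>, of i] in
          \<open>simp_all add: d_def inner_diff_left left_diff_distrib right_diff_distrib\<close>)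
    ultimately show ?thesis by simp
  qed
  have loc: "AE x in lborel. x \<in> ball z (r / 2) \<longrightarrow> g x = h x" if r: "r > 0" "cball z r \<subseteq> \<Omega>" for z r
  proof -
    have "AE x in lborel. x \<in> ball z (r / 2) \<longrightarrow> d i x = 0" if i: "i \<in> Basis" for i
    proof (rule fundamental_lemma_local[OF r(1)])
      show "integrable lebesgue (\<lambda>x. indicator (cball z r) x *\<^sub>R d i x)"
        by (rule locally_integrable_onD[OF ld r(2)]) simp
      fix \<phi> assume \<phi>: "test_function (ball z r) \<phi>"
      have "ball z r \<subseteq> \<Omega>" using r(2) ball_subset_cball by blast
      then have "test_function \<Omega> \<phi>" using test_function_mono[OF \<phi>] by blast
      moreover have "(indicator (cball z r) x *\<^sub>R d i x) * \<phi> x = indicator \<Omega> x *\<^sub>R (d i x * \<phi> x)" for x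
      proof (cases "x \<in> ball z r")
        case True
        then have "x \<in> cball z r" "x \<in> \<Omega>" using r(2) by auto
        then show ?thesis by simp
      qed (use test_function_outside[OF \<phi>, of x] in simp)
      ultimately show "(\<integral>x. (indicator (cball z r) x *\<^sub>R d i x) * \<phi> x \<partial>lebesgue) = 0"
        using z[OF _ i] by (simp only:)
    qed
    then have "AE x in lborel. \<forall>i\<in>Basis. x \<in> ball z (r / 2) \<longrightarrow> d i x = 0"
      by (intro AE_finite_allI) auto
    then show ?thesis
    proof eventually_elim
      case (elim x)
      show ?case
      proof
        assume "x \<in> ball z (r / 2)"
        then have "\<forall>i\<in>Basis. (g x - h x) \<bullet> i = 0" using elim by (simp add: d_def)
        then show "g x = h x" by (simp add: euclidean_eq_iff[of "g x"] inner_diff_left)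
      qed
    qed
  qed
  define \<F> where "\<F> = {ball z (r / 2) |z r. r > 0 \<and> cball z r \<subseteq> \<Omega>}"
  have un: "\<Union>\<F> = \<Omega>"
  proof
    show "\<Omega> \<subseteq> \<Union>\<F>"
    proof
      fix x assume "x \<in> \<Omega>"
      then obtain r where "r > 0" "cball x r \<subseteq> \<Omega>" using \<Omega> open_contains_cball by blast
      then show "x \<in> \<Union>\<F>" unfolding \<F>_def by (intro UnionI[of "ball x (r / 2)"]) auto
    qed
    show "\<Union>\<F> \<subseteq> \<Omega>"
    proof
      fix x assume "x \<in> \<Union>\<F>"
      then obtain z r where zr: "r > 0" "cball z r \<subseteq> \<Omega>" "dist z x < r / 2" unfolding \<F>_def by auto
      then have "x \<in> cball z r" by simp
      then show "x \<in> \<Omega>" using zr by blast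
    qed
  qed
  obtain \<G> where \<G>: "\<G> \<subseteq> \<F>" "countable \<G>" "\<Union>\<G> = \<Union>\<F>"
    by (rule Lindelof[of \<F>]) (auto simp: \<F>_def)
  have "AE x in lborel. x \<in> B \<longrightarrow> g x = h x" if "B \<in> \<G>" for B
    using that \<G>(1) loc unfolding \<F>_def by blast
  then have "AE x in lborel. \<forall>B\<in>\<G>. x \<in> B \<longrightarrow> g x = h x"
    using \<G>(2) by (subst AE_ball_countable) auto
  then have "AE x in lborel. x \<in> \<Omega> \<longrightarrow> g x = h x"
    by eventually_elim (use \<G>(3) un in blast)
  then show ?thesis using AE_lebesgue_on_iff[OF \<Omega>] by blast
qed

lemma weak_grad_AE:
  fixes \<Omega> :: "'a::euclidean_space set"
  assumes "open \<Omega>" "has_weak_gradient \<Omega> u g"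
  shows "AE x in lebesgue_on \<Omega>. weak_grad \<Omega> u x = g x"
  unfolding weak_grad_def
  by (rule weak_gradient_unique[OF assms(1) someI[of "has_weak_gradient \<Omega> u", OF assms(2)] assms(2)])

lemma has_weak_gradient_diff:
  fixes \<Omega> :: "'a::euclidean_space set"
  assumes u: "has_weak_gradient \<Omega> u g" and v: "has_weak_gradient \<Omega> v h"
  shows "has_weak_gradient \<Omega> (\<lambda>x. u x - v x) (\<lambda>x. g x - h x)"
  unfolding has_weak_gradient_def
proof (intro conjI allI impI ballI)
  have l: "locally_integrable_on u \<Omega>" "locally_integrable_on v \<Omega>" "locally_integrable_on g \<Omega>" "locally_integrable_on h \<Omega>"
    using u v unfolding has_weak_gradient_def by auto
  show "locally_integrable_on (\<lambda>x. u x - v x) \<Omega>" "locally_integrable_on (\<lambda>x. g x - h x) \<Omega>"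
    using l locally_integrable_on_diff by auto
  fix \<phi> i assume \<phi>: "test_function \<Omega> \<phi>" and i: "i \<in> (Basis :: 'a set)"
  note \<phi>i = test_function_pderiv[OF \<phi> i]
  have "(LINT x:\<Omega>|lebesgue. (u x - v x) * pderiv_at \<phi> i x) =
     (LINT x:\<Omega>|lebesgue. u x * pderiv_at \<phi> i x) - (LINT x:\<Omega>|lebesgue. v x * pderiv_at \<phi> i x)"
    unfolding set_lebesgue_integral_def
    by (subst Bochner_Integration.integral_diff[symmetric])
      (use locally_integrable_test[OF l(1) \<phi>i] locally_integrable_test[OF l(2) \<phi>i] in
        \<open>simp_all add: left_diff_distrib right_diff_distrib\<close>)
  moreover have "(LINT x:\<Omega>|lebesgue. ((g x - h x) \<bullet> i) * \<phi> x) =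
     (LINT x:\<Omega>|lebesgue. (g x \<bullet> i) * \<phi> x) - (LINT x:\<Omega>|lebesgue. (h x \<bullet> i) * \<phi> x)"
    unfolding set_lebesgue_integral_def
    by (subst Bochner_Integration.integral_diff[symmetric])
      (use locally_integrable_test[OF locally_integrable_on_inner[OF l(3)] \<phi>, of i]
          locally_integrable_test[OF locally_integrable_on_inner[OF l(4)] \<phi>, of i] in
        \<open>simp_all add: inner_diff_left left_diff_distrib right_diff_distrib\<close>)
  ultimately show "(LINT x:\<Omega>|lebesgue. (u x - v x) * pderiv_at \<phi> i x) = - (LINT x:\<Omega>|lebesgue. ((g x - h x) \<bullet> i) * \<phi> x)"
    using u v \<phi> i unfolding has_weak_gradient_def by simp
qed

lemma locally_integrable_on_continuous:
  fixes f :: "'a::euclidean_space \<Rightarrow> 'b::euclidean_space"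
  assumes "continuous_on UNIV f" shows "locally_integrable_on f \<Omega>"
  unfolding locally_integrable_on_def set_integrable_def
proof (intro allI impI)
  fix K :: "'a set" assume "compact K"
  then have "integrable lborel (\<lambda>x. indicator K x *\<^sub>R f x)"
    by (intro borel_integrable_compact continuous_on_subset[OF assms]) auto
  then show "integrable lebesgue (\<lambda>x. indicator K x *\<^sub>R f x)"
    by (subst integrable_completion) (use borel_measurable_integrable in auto)
qed

lemma has_weak_gradient_smooth:
  fixes \<Omega> :: "'a::euclidean_space set"
  assumes "open \<Omega>" "smooth f"
  shows "has_weak_gradient \<Omega> f (grad f)"
  unfolding has_weak_gradient_def
proof (intro conjI allI impI ballI)
  show "locally_integrable_on f \<Omega>" "locally_integrable_on (grad f) \<Omega>"
    using smooth_continuous smooth_grad_continuous assms(2) locally_integrable_on_continuous by blast+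
  fix \<phi> i assume \<phi>: "test_function \<Omega> \<phi>" and i: "i \<in> (Basis :: 'a set)"
  have \<phi>': "test_function UNIV \<phi>" using test_function_mono[OF \<phi>] by simp
  have [measurable]: "\<phi> \<in> borel_measurable borel" "pderiv_at \<phi> i \<in> borel_measurable borel"
    "f \<in> borel_measurable borel" "grad f \<in> borel_measurable borel" "\<Omega> \<in> sets borel"
    using test_function_measurable[OF \<phi>] test_function_measurable[OF test_function_pderiv[OF \<phi> i]]
      smooth_measurable[OF assms(2)] smooth_grad_measurable[OF assms(2)] borel_open[OF assms(1)] by auto
  have "(LINT x:\<Omega>|lebesgue. f x * pderiv_at \<phi> i x) = (\<integral>x. f x * pderiv_at \<phi> i x \<partial>lborel)"
    by (rule set_integral_lebesgue_lborel[OF assms(1)])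
      (use test_function_outside[OF test_function_pderiv[OF \<phi> i]] in \<open>auto intro!: measurable_completion\<close>)
  also have "\<dots> = - (\<integral>x. (grad f x \<bullet> i) * \<phi> x \<partial>lborel)"
    using integral_by_parts_smooth[OF assms(2) \<phi>' i] by (simp add: grad_inner_Basis[OF i])
  also have "(\<integral>x. (grad f x \<bullet> i) * \<phi> x \<partial>lborel) = (LINT x:\<Omega>|lebesgue. (grad f x \<bullet> i) * \<phi> x)"
    by (rule set_integral_lebesgue_lborel[OF assms(1), symmetric])
      (use test_function_outside[OF \<phi>] in \<open>auto intro!: measurable_completion\<close>)
  finally show "(LINT x:\<Omega>|lebesgue. f x * pderiv_at \<phi> i x) = - (LINT x:\<Omega>|lebesgue. (grad f x \<bullet> i) * \<phi> x)" .
qed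

section \<open>Density of smooth functions\<close>

lemma test_function_translate:
  assumes k: "test_function U k" and sub: "\<And>y. y \<in> U \<Longrightarrow> x + y \<in> V"
  shows "test_function V (\<lambda>y. k (y - x))"
proof -
  obtain K where K: "K \<subseteq> U" "compact K" "\<forall>y. y \<notin> K \<longrightarrow> k y = 0"
    using k test_functionD by meson
  show ?thesis
    unfolding test_function_def
  proof (intro conjI exI[of _ "(+) x ` K"])
    show "smooth (\<lambda>y. k (y - x))"
      using smooth_affine[OF test_functionD(1)[OF k], of 1 "- x"] by simp
    show "compact ((+) x ` K)" using compact_translation[OF K(2), of x] .
    show "(+) x ` K \<subseteq> V" using K(1) sub by blast
    show "\<forall>y. y \<notin> (+) x ` K \<longrightarrow> k (y - x) = 0"
      using K(3) by (metis add.commute diff_add_cancel image_eqI)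
  qed
qed

text \<open>Mollify the indicator of the intermediate ball of radius a + d with a kernel of radius
  d: the result is 1 on \<open>ball z a\<close> and 0 beyond radius a + 2 d, which lies halfway
  between a and b.\<close>

lemma cutoff_exists:
  fixes z :: "'a::euclidean_space"
  assumes "0 < a" "a < b"
  obtains c where "test_function (ball z b) c" "\<And>x. x \<in> ball z a \<Longrightarrow> c x = 1"
proof -
  define d where "d = (b - a) / 4"
  have d: "d > 0" "a + 2 * d < b" "a + 3 * d < b" using assms by (auto simp: d_def field_simps)
  obtain k :: "'a \<Rightarrow> real" where k: "test_function (ball 0 d) k" "\<And>x. 0 \<le> k x" "(\<integral>x. k x \<partial>lborel) = 1"
    using bump_exists[of d 0] d by auto
  define w :: "'a \<Rightarrow> real" where "w = indicator (cball z (a + d))"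
  have w: "integrable lborel w"
    unfolding w_def by (rule integrable_real_indicator)
      (use emeasure_lborel_cball_finite[of z "a + d"] in \<open>auto simp: borel_closed\<close>)
  have kU: "test_function UNIV k" using test_function_mono[OF k(1)] by simp
  have kz: "norm (y - x) < d" if "k (y - x) \<noteq> 0" for x y
    using test_function_outside[OF k(1), of "y - x"] that by force
  have one: "conv k w x = 1" if x: "x \<in> ball z a" for x
  proof -
    have "k (y - x) * w y = k (y - x)" for y
    proof (cases "k (y - x) = 0")
      case False
      have "dist z y \<le> dist z x + dist x y" by (rule dist_triangle)
      then have "y \<in> cball z (a + d)" using kz[OF False] x by (simp add: dist_norm norm_minus_commute)
      then show ?thesis by (simp add: w_def)
    qed simp
    then have "conv k w x = (\<integral>y. k (y - x) \<partial>lborel)" unfolding conv_def by (simp only:)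
    also have "\<dots> = (\<integral>y. k y \<partial>lborel)"
      using lborel_affine_integral[of "\<lambda>y. k (y - x)" 1 x] test_function_measurable[OF k(1)] by simp
    finally show ?thesis using k(3) by simp
  qed
  have zero: "conv k w x = 0" if x: "x \<notin> cball z (a + 2 * d)" for x
  proof -
    have "k (y - x) * w y = 0" for y
    proof (cases "k (y - x) = 0")
      case False
      have "dist z x \<le> dist z y + dist y x" by (rule dist_triangle)
      then have "y \<notin> cball z (a + d)" using kz[OF False] x by (simp add: dist_norm)
      then show ?thesis by (simp add: w_def)
    qed simp
    then show ?thesis unfolding conv_def by (simp only: Bochner_Integration.integral_zero)
  qed
  have "test_function (ball z b) (conv k w)"
    unfolding test_function_def
  proof (intro conjI exI[of _ "cball z (a + 2 * d)"])
    show "cball z (a + 2 * d) \<subseteq> ball z b" using d by auto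
  qed (use smooth_conv[OF kU w] zero in auto)
  then show thesis using that one by blast
qed

lemma norm_powr_le_sum_Basis:
  fixes v :: "'a::euclidean_space"
  assumes "0 \<le> p"
  shows "norm v powr p \<le> real DIM('a) powr p * (\<Sum>i\<in>Basis. \<bar>v \<bullet> i\<bar> powr p)"
proof -
  define M where "M = Max ((\<lambda>i. \<bar>v \<bullet> i\<bar>) ` Basis)"
  have "M \<in> (\<lambda>i. \<bar>v \<bullet> i\<bar>) ` Basis" unfolding M_def by (intro Max_in) auto
  then obtain j where j: "j \<in> Basis" "M = \<bar>v \<bullet> j\<bar>" by blast
  have M: "\<bar>v \<bullet> i\<bar> \<le> M" if "i \<in> Basis" for i unfolding M_def using that by (intro Max_ge) auto
  have "norm v \<le> (\<Sum>i\<in>Basis. \<bar>v \<bullet> i\<bar>)" by (rule norm_le_l1)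
  also have "\<dots> \<le> real DIM('a) * M" using sum_bounded_above[of Basis "\<lambda>i. \<bar>v \<bullet> i\<bar>" M] M by simp
  finally have "norm v powr p \<le> (real DIM('a) * M) powr p" using assms by (intro powr_mono2) auto
  also have "\<dots> = real DIM('a) powr p * \<bar>v \<bullet> j\<bar> powr p" using j by (simp add: powr_mult)
  also have "\<dots> \<le> real DIM('a) powr p * (\<Sum>i\<in>Basis. \<bar>v \<bullet> i\<bar> powr p)"
    by (intro mult_left_mono member_le_sum[OF j(1)]) auto
  finally show ?thesis .
qed

lemma conv_eq_0:
  assumes "\<And>y. k (y - x) \<noteq> 0 \<Longrightarrow> w y = 0" shows "conv k w x = 0"
proof -
  have "k (y - x) * w y = 0" for y using assms[of y] by auto
  then show ?thesis unfolding conv_def by (simp only: Bochner_Integration.integral_zero)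
qed

text \<open>
  A kernel supported in the cone looks only into \<open>\<Omega>\<close>, so near the boundary mollification commutes
  with the weak gradient although \<open>u\<close> has been extended by zero.
\<close>

lemma conv_cone_gradient:
  fixes \<Omega> :: "'a::euclidean_space set"
  assumes c: "cone_at \<Omega> z r e \<kappa>" and b: "borel_weak_grad \<Omega> u g"
    and supp: "\<And>x. x \<notin> cball z (r / 2) \<Longrightarrow> u x = 0" "\<And>x. x \<notin> cball z (r / 2) \<Longrightarrow> g x = 0"
    and k: "test_function (ball e \<kappa>) k" and s: "0 < s" "s < r" "s * (norm e + \<kappa>) < r / 2"
    and i: "i \<in> Basis" and x: "x \<in> \<Omega>"
  shows "pderiv_at (conv (rescale s k) u) i x = conv (rescale s k) (\<lambda>x. g x \<bullet> i) x"
proof -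
  have tk: "test_function ((*\<^sub>R) s ` ball e \<kappa>) (rescale s k)" by (rule test_function_rescale[OF k s(1)])
  have tU: "test_function UNIV (rescale s k)" using test_function_mono[OF tk] by simp
  show ?thesis
  proof (cases "x \<in> ball z r")
    case True
    show ?thesis
    proof (rule borel_weak_grad_conv_pderiv[OF b i tU], rule test_function_translate[OF tk])
      fix y assume "y \<in> (*\<^sub>R) s ` ball e \<kappa>"
      then obtain w where "y = s *\<^sub>R w" "w \<in> ball e \<kappa>" by blast
      then show "x + y \<in> \<Omega>" using cone_atD(3)[OF c x True s(1,2)] by blast
    qed
  next
    case False
    \<comment> \<open>Outside \<open>ball z r\<close> both sides are 0: \<open>u\<close> and
      \<open>g\<close> live within r/2 of z, and the kernel reaches less than r/2 away from
      x.\<close>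
    have far: "y \<notin> cball z (r / 2)" if y: "y - x \<in> (*\<^sub>R) s ` ball e \<kappa>" for y
    proof
      assume yz: "y \<in> cball z (r / 2)"
      obtain w where w: "y - x = s *\<^sub>R w" "w \<in> ball e \<kappa>" using y by blast
      have "norm w \<le> norm e + \<kappa>" using w(2) norm_triangle_ineq2[of w e] by (simp add: dist_norm norm_minus_commute)
      then have "s * norm w \<le> s * (norm e + \<kappa>)" using s by (intro mult_left_mono) auto
      moreover have "dist y x = s * norm w" using w s by (simp add: dist_norm)
      ultimately have "dist y x < r / 2" using s by linarith
      moreover have "dist z x \<le> dist z y + dist y x" by (rule dist_triangle)
      ultimately have "dist z x < r" using yz unfolding mem_cball by linarith
      then show False using False by simp
    qed
    have "conv (rescale s k) (\<lambda>x. g x \<bullet> i) x = 0"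
      by (rule conv_eq_0) (use test_function_outside[OF tk] far supp(2) in force)
    moreover have "conv (\<lambda>z. - pderiv_at (rescale s k) i z) u x = 0"
      by (rule conv_eq_0) (use test_function_outside[OF test_function_pderiv[OF tk i]] far supp(1) in force)
    ultimately show ?thesis by (simp add: pderiv_conv[OF tU borel_weak_gradD(1)[OF b] i])
  qed
qed

text \<open>The approximants are smooth on the whole space, as the definition of a trace asks, while
  closeness is measured on \<Omega> alone. The gradient \<open>g\<close> is an explicit argument, so
  the notion can be localised by cutoffs.\<close>

definition approximable :: "real \<Rightarrow> 'a::euclidean_space set \<Rightarrow> ('a \<Rightarrow> real) \<Rightarrow> ('a \<Rightarrow> 'a) \<Rightarrow> bool" where
  "approximable p \<Omega> u g \<longleftrightarrow> (\<forall>\<epsilon>>0. \<exists>\<phi>. smooth \<phi> \<and>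
     p_integral (lebesgue_on \<Omega>) p (\<lambda>x. \<phi> x - u x) + p_integral (lebesgue_on \<Omega>) p (\<lambda>x. grad \<phi> x - g x) < ennreal \<epsilon>)"

lemma approximable_local:
  fixes \<Omega> :: "'a::euclidean_space set"
  assumes \<Omega>: "open \<Omega>" and p: "1 \<le> p" and c: "cone_at \<Omega> z r e \<kappa>" and b: "borel_weak_grad \<Omega> u g"
    and fin: "p_integral lborel p u < \<infinity>" "p_integral lborel p g < \<infinity>"
    and supp: "\<And>x. x \<notin> cball z (r / 2) \<Longrightarrow> u x = 0" "\<And>x. x \<notin> cball z (r / 2) \<Longrightarrow> g x = 0"
  shows "approximable p \<Omega> u g"
  unfolding approximable_def
proof (intro allI impI)
  fix \<epsilon> :: real assume "\<epsilon> > 0"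
  note r = cone_atD(1)[OF c] and \<kappa> = cone_atD(2)[OF c]
  note u = borel_weak_gradD[OF b]
  define n where "n = real DIM('a)"
  have n: "n \<ge> 1" using DIM_ge_Suc0[where 'a = 'a] by (simp add: n_def)
  \<comment> \<open>One error \<epsilon>' for the function and n^p n \<epsilon>' for the gradient,
    whose n components are mollified separately; together \<epsilon>/2.\<close>
  define \<epsilon>' where "\<epsilon>' = \<epsilon> / (2 * (n powr p * n + 1))"
  have npos: "n powr p * n + 1 > 0" using n by (simp add: add_nonneg_pos)
  have \<epsilon>': "\<epsilon>' > 0" using \<open>\<epsilon> > 0\<close> npos by (simp add: \<epsilon>'_def)
  obtain k :: "'a \<Rightarrow> real" where k: "test_function (ball e \<kappa>) k" "\<And>x. 0 \<le> k x" "(\<integral>x. k x \<partial>lborel) = 1"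
    using bump_exists[OF \<kappa>, of e] by auto
  have far: "x \<notin> cball z (r / 2)" if "norm z + r \<le> norm x" for x
    using that r norm_triangle_ineq2[of x z] by (auto simp: dist_norm norm_minus_commute)
  have evu: "\<forall>\<^sub>F s in at_right 0. p_integral lborel p (\<lambda>x. conv (rescale s k) u x - u x) < ennreal \<epsilon>'"
  proof -
    obtain s0 where "s0 > 0" "\<And>s. 0 < s \<Longrightarrow> s < s0 \<Longrightarrow> p_integral lborel p (\<lambda>x. conv (rescale s k) u x - u x) < ennreal \<epsilon>'"
      using conv_rescale_Lp[OF p k u(2) fin(1) _ \<epsilon>', of "norm z + r"] far supp(1) by blast
    then show ?thesis unfolding eventually_at_right_field by auto
  qed
  have evg: "\<forall>\<^sub>F s in at_right 0. p_integral lborel p (\<lambda>x. conv (rescale s k) (\<lambda>x. g x \<bullet> i) x - g x \<bullet> i) < ennreal \<epsilon>'"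
    if i: "i \<in> Basis" for i
  proof -
    have gm: "(\<lambda>x. g x \<bullet> i) \<in> borel_measurable borel" using u(3) by simp
    have "p_integral lborel p (\<lambda>x. g x \<bullet> i) \<le> p_integral lborel p g"
      unfolding p_integral_def using p Basis_le_norm[OF i]
      by (intro nn_integral_mono ennreal_leI powr_mono2) auto
    then have gf: "p_integral lborel p (\<lambda>x. g x \<bullet> i) < \<infinity>" using fin(2) by (rule le_less_trans)
    have gz: "g x \<bullet> i = 0" if "norm z + r \<le> norm x" for x using supp(2)[OF far[OF that]] by simp
    obtain s0 where "s0 > 0" "\<And>s. 0 < s \<Longrightarrow> s < s0 \<Longrightarrow> p_integral lborel p (\<lambda>x. conv (rescale s k) (\<lambda>x. g x \<bullet> i) x - g x \<bullet> i) < ennreal \<epsilon>'"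
      using conv_rescale_Lp[OF p k gm gf gz \<epsilon>'] by blast
    then show ?thesis unfolding eventually_at_right_field by auto
  qed
  have evs: "\<forall>\<^sub>F s in at_right 0. 0 < s \<and> s < r \<and> s * (norm e + \<kappa>) < r / 2"
  proof -
    have pos: "norm e + \<kappa> > 0" using \<kappa> by (simp add: add_nonneg_pos)
    have "s * (norm e + \<kappa>) < r / 2" if "s < r / 2 / (norm e + \<kappa>)" for s
      using that pos by (simp add: pos_less_divide_eq algebra_simps)
    then show ?thesis
      unfolding eventually_at_right_field using r pos
      by (intro exI[of _ "min r (r / 2 / (norm e + \<kappa>))"]) auto
  qed
  have "\<forall>\<^sub>F s in at_right (0::real). \<forall>i\<in>Basis. p_integral lborel p (\<lambda>x. conv (rescale s k) (\<lambda>x. g x \<bullet> i) x - g x \<bullet> i) < ennreal \<epsilon>'"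
    using evg by (intro eventually_ball_finite) auto
  then have "\<forall>\<^sub>F s in at_right (0::real). (0 < s \<and> s < r \<and> s * (norm e + \<kappa>) < r / 2) \<and>
     p_integral lborel p (\<lambda>x. conv (rescale s k) u x - u x) < ennreal \<epsilon>' \<and>
     (\<forall>i\<in>Basis. p_integral lborel p (\<lambda>x. conv (rescale s k) (\<lambda>x. g x \<bullet> i) x - g x \<bullet> i) < ennreal \<epsilon>')"
    using evs evu by eventually_elim blast
  then obtain s where s: "0 < s" "s < r" "s * (norm e + \<kappa>) < r / 2"
    and su: "p_integral lborel p (\<lambda>x. conv (rescale s k) u x - u x) < ennreal \<epsilon>'"
    and sg: "\<And>i. i \<in> Basis \<Longrightarrow> p_integral lborel p (\<lambda>x. conv (rescale s k) (\<lambda>x. g x \<bullet> i) x - g x \<bullet> i) < ennreal \<epsilon>'"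
    by (auto dest: eventually_happens'[OF trivial_limit_at_right_real])
  define \<phi> where "\<phi> = conv (rescale s k) u"
  have tU: "test_function UNIV (rescale s k)" using test_function_rescale_UNIV[OF k(1) s(1)] .
  have s\<phi>: "smooth \<phi>" unfolding \<phi>_def by (rule smooth_conv[OF tU u(1)])
  have gi_meas: "(\<lambda>x. conv (rescale s k) (\<lambda>x. g x \<bullet> i) x - g x \<bullet> i) \<in> borel_measurable lborel" if "i \<in> Basis" for i
    using conv_measurable[OF tU u(4)[OF that]] u(3) by simp
  have 1: "p_integral (lebesgue_on \<Omega>) p (\<lambda>x. \<phi> x - u x) \<le> ennreal \<epsilon>'"
    using p_integral_lebesgue_on_le[OF \<Omega>, of p "\<lambda>x. \<phi> x - u x"] su unfolding \<phi>_def
    by (meson le_less_trans less_imp_le)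
  have "p_integral (lebesgue_on \<Omega>) p (\<lambda>x. grad \<phi> x - g x) \<le>
    (\<integral>\<^sup>+x. ennreal (n powr p) * (\<Sum>i\<in>Basis. ennreal (\<bar>conv (rescale s k) (\<lambda>x. g x \<bullet> i) x - g x \<bullet> i\<bar> powr p)) \<partial>lborel)"
    unfolding p_integral_def nn_integral_lebesgue_on[OF \<Omega>]
  proof (rule nn_integral_mono)
    fix x
    show "ennreal (norm (grad \<phi> x - g x) powr p) * indicator \<Omega> x \<le>
      ennreal (n powr p) * (\<Sum>i\<in>Basis. ennreal (\<bar>conv (rescale s k) (\<lambda>x. g x \<bullet> i) x - g x \<bullet> i\<bar> powr p))"
    proof (cases "x \<in> \<Omega>")
      case True
      have "(grad \<phi> x - g x) \<bullet> i = conv (rescale s k) (\<lambda>x. g x \<bullet> i) x - g x \<bullet> i" if i: "i \<in> Basis" for i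
        using conv_cone_gradient[OF c b supp k(1) s i True]
        by (simp add: inner_diff_left grad_inner_Basis[OF i] \<phi>_def)
      then have "norm (grad \<phi> x - g x) powr p \<le> n powr p * (\<Sum>i\<in>Basis. \<bar>conv (rescale s k) (\<lambda>x. g x \<bullet> i) x - g x \<bullet> i\<bar> powr p)"
        using norm_powr_le_sum_Basis[of p "grad \<phi> x - g x"] p by (simp add: n_def)
      then show ?thesis using True
        by (simp add: sum_nonneg ennreal_leI flip: ennreal_mult)
    qed simp
  qed
  also have "\<dots> = ennreal (n powr p) * (\<Sum>i\<in>Basis. p_integral lborel p (\<lambda>x. conv (rescale s k) (\<lambda>x. g x \<bullet> i) x - g x \<bullet> i))"
    unfolding p_integral_def real_norm_def using gi_meas
    by (subst nn_integral_cmult, measurable, subst nn_integral_sum, measurable)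
  also have "\<dots> \<le> ennreal (n powr p) * (\<Sum>i\<in>(Basis::'a set). ennreal \<epsilon>')"
    by (intro mult_left_mono sum_mono less_imp_le[OF sg]) auto
  also have "\<dots> = ennreal (n powr p * n * \<epsilon>')"
    using \<epsilon>' by (simp add: n_def ennreal_mult ennreal_of_nat_eq_real_of_nat mult.assoc)
  finally have 2: "p_integral (lebesgue_on \<Omega>) p (\<lambda>x. grad \<phi> x - g x) \<le> ennreal (n powr p * n * \<epsilon>')" .
  have "p_integral (lebesgue_on \<Omega>) p (\<lambda>x. \<phi> x - u x) + p_integral (lebesgue_on \<Omega>) p (\<lambda>x. grad \<phi> x - g x) \<le>
     ennreal \<epsilon>' + ennreal (n powr p * n * \<epsilon>')"
    by (intro add_mono 1 2)
  also have "\<dots> = ennreal ((n powr p * n + 1) * \<epsilon>')"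
    using \<epsilon>' n by (simp add: algebra_simps flip: ennreal_plus)
  also have "(n powr p * n + 1) * \<epsilon>' = \<epsilon> / 2" using npos by (simp add: \<epsilon>'_def del: distrib_left_numeral)
  also have "ennreal (\<epsilon> / 2) < ennreal \<epsilon>" using \<open>\<epsilon> > 0\<close> by (intro ennreal_lessI) auto
  finally show "\<exists>\<phi>. smooth \<phi> \<and> p_integral (lebesgue_on \<Omega>) p (\<lambda>x. \<phi> x - u x) + p_integral (lebesgue_on \<Omega>) p (\<lambda>x. grad \<phi> x - g x) < ennreal \<epsilon>"
    using s\<phi> by blast
qed

lemma approximable_add:
  fixes \<Omega> :: "'a::euclidean_space set"
  assumes p: "1 \<le> p" and 1: "approximable p \<Omega> u g" and 2: "approximable p \<Omega> v h"
    and [measurable]: "u \<in> borel_measurable borel" "g \<in> borel_measurable borel" "v \<in> borel_measurable borel" "h \<in> borel_measurable borel"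
  shows "approximable p \<Omega> (\<lambda>x. u x + v x) (\<lambda>x. g x + h x)"
  unfolding approximable_def
proof (intro allI impI)
  fix \<epsilon> :: real assume "\<epsilon> > 0"
  define \<epsilon>' where "\<epsilon>' = \<epsilon> / (4 * 2 powr p)"
  have \<epsilon>': "\<epsilon>' > 0" using \<open>\<epsilon> > 0\<close> by (simp add: \<epsilon>'_def)
  obtain \<phi> where \<phi>: "smooth \<phi>" "p_integral (lebesgue_on \<Omega>) p (\<lambda>x. \<phi> x - u x) + p_integral (lebesgue_on \<Omega>) p (\<lambda>x. grad \<phi> x - g x) < ennreal \<epsilon>'"
    using 1 \<epsilon>' unfolding approximable_def by blast
  obtain \<psi> where \<psi>: "smooth \<psi>" "p_integral (lebesgue_on \<Omega>) p (\<lambda>x. \<psi> x - v x) + p_integral (lebesgue_on \<Omega>) p (\<lambda>x. grad \<psi> x - h x) < ennreal \<epsilon>'"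
    using 2 \<epsilon>' unfolding approximable_def by blast
  note [measurable] = smooth_measurable[OF \<phi>(1)] smooth_measurable[OF \<psi>(1)]
    smooth_grad_measurable[OF \<phi>(1)] smooth_grad_measurable[OF \<psi>(1)]
  have A: "p_integral (lebesgue_on \<Omega>) p (\<lambda>x. (\<phi> x + \<psi> x) - (u x + v x)) \<le>
    ennreal (2 powr p) * (p_integral (lebesgue_on \<Omega>) p (\<lambda>x. \<phi> x - u x) + p_integral (lebesgue_on \<Omega>) p (\<lambda>x. \<psi> x - v x))"
    using p_integral_add_le[of p "\<lambda>x. \<phi> x - u x" "lebesgue_on \<Omega>" "\<lambda>x. \<psi> x - v x"] p
    by (simp add: borel_measurable_lebesgue_on algebra_simps)
  have B: "p_integral (lebesgue_on \<Omega>) p (\<lambda>x. grad (\<lambda>x. \<phi> x + \<psi> x) x - (g x + h x)) \<le>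
    ennreal (2 powr p) * (p_integral (lebesgue_on \<Omega>) p (\<lambda>x. grad \<phi> x - g x) + p_integral (lebesgue_on \<Omega>) p (\<lambda>x. grad \<psi> x - h x))"
    using p_integral_add_le[of p "\<lambda>x. grad \<phi> x - g x" "lebesgue_on \<Omega>" "\<lambda>x. grad \<psi> x - h x"] p
    by (simp add: borel_measurable_lebesgue_on algebra_simps grad_add[OF \<phi>(1) \<psi>(1)])
  have "p_integral (lebesgue_on \<Omega>) p (\<lambda>x. (\<phi> x + \<psi> x) - (u x + v x)) + p_integral (lebesgue_on \<Omega>) p (\<lambda>x. grad (\<lambda>x. \<phi> x + \<psi> x) x - (g x + h x))
    \<le> ennreal (2 powr p) * ((p_integral (lebesgue_on \<Omega>) p (\<lambda>x. \<phi> x - u x) + p_integral (lebesgue_on \<Omega>) p (\<lambda>x. grad \<phi> x - g x)) +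
       (p_integral (lebesgue_on \<Omega>) p (\<lambda>x. \<psi> x - v x) + p_integral (lebesgue_on \<Omega>) p (\<lambda>x. grad \<psi> x - h x)))"
    using add_mono[OF A B] by (simp add: distrib_left add_ac)
  also have "\<dots> \<le> ennreal (2 powr p) * (ennreal \<epsilon>' + ennreal \<epsilon>')"
    by (intro mult_left_mono add_mono less_imp_le[OF \<phi>(2)] less_imp_le[OF \<psi>(2)]) auto
  also have "\<dots> = ennreal (\<epsilon> / 2)"
    using \<epsilon>' by (simp add: \<epsilon>'_def flip: ennreal_plus ennreal_mult)
  also have "\<dots> < ennreal \<epsilon>" using \<open>\<epsilon> > 0\<close> by (intro ennreal_lessI) auto
  finally show "\<exists>\<phi>. smooth \<phi> \<and> p_integral (lebesgue_on \<Omega>) p (\<lambda>x. \<phi> x - (u x + v x)) +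
      p_integral (lebesgue_on \<Omega>) p (\<lambda>x. grad \<phi> x - (g x + h x)) < ennreal \<epsilon>"
    using smooth_add[OF \<phi>(1) \<psi>(1)] by blast
qed

lemma p_integral_mult_le:
  fixes f :: "'a \<Rightarrow> 'b::euclidean_space" and g :: "'a \<Rightarrow> 'c::euclidean_space"
  assumes "0 \<le> p" "0 \<le> B" "\<And>x. norm (f x) \<le> B * norm (g x)" "g \<in> borel_measurable M"
  shows "p_integral M p f \<le> ennreal (B powr p) * p_integral M p g"
proof -
  have "p_integral M p f \<le> (\<integral>\<^sup>+x. ennreal (B powr p) * ennreal (norm (g x) powr p) \<partial>M)"
    unfolding p_integral_def
  proof (rule nn_integral_mono)
    fix x
    have "norm (f x) powr p \<le> (B * norm (g x)) powr p" using assms by (intro powr_mono2) auto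
    also have "\<dots> = B powr p * norm (g x) powr p" using assms by (simp add: powr_mult)
    finally show "ennreal (norm (f x) powr p) \<le> ennreal (B powr p) * ennreal (norm (g x) powr p)"
      by (simp add: ennreal_leI flip: ennreal_mult)
  qed
  also have "\<dots> = ennreal (B powr p) * p_integral M p g"
    unfolding p_integral_def using assms(4) by (intro nn_integral_cmult) simp
  finally show ?thesis .
qed

lemma test_function_grad_bounded:
  assumes "test_function \<Omega> \<phi>" obtains B where "\<And>x. norm (grad \<phi> x) \<le> B" "B \<ge> 0"
proof -
  obtain K where K: "compact K" "\<And>x. x \<notin> K \<Longrightarrow> grad \<phi> x = 0"
    using test_function_grad_support[OF assms] by metis
  have "bounded (grad \<phi> ` K)"
    using K(1) assms by (intro compact_imp_bounded compact_continuous_image smooth_grad_continuous test_functionD)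
  then obtain B where "\<forall>x\<in>K. norm (grad \<phi> x) \<le> B" "B > 0"
    by (auto simp: bounded_pos)
  then show thesis
    using K(2) that[of B] by (metis norm_zero less_eq_real_def)
qed

lemma p_integral_diff_finite:
  fixes f g :: "'a \<Rightarrow> 'b::euclidean_space"
  assumes "p_integral M p f < \<infinity>" "p_integral M p g < \<infinity>" "0 \<le> p"
    and "f \<in> borel_measurable M" "g \<in> borel_measurable M"
  shows "p_integral M p (\<lambda>x. f x - g x) < \<infinity>"
proof -
  have "p_integral M p (\<lambda>x. - g x) = p_integral M p g" by (simp add: p_integral_def)
  moreover have "p_integral M p (\<lambda>x. f x + - g x) \<le> ennreal (2 powr p) * (p_integral M p f + p_integral M p (\<lambda>x. - g x))"
    using assms by (intro p_integral_add_le) auto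
  ultimately have "p_integral M p (\<lambda>x. f x - g x) \<le> ennreal (2 powr p) * (p_integral M p f + p_integral M p g)" by simp
  also have "\<dots> < \<infinity>" using assms by (simp add: ennreal_mult_less_top)
  finally show ?thesis .
qed

text \<open>An induction over the balls in place of a partition of unity. The piece k u, with k = 1
  on the quarter ball and support in the half ball, is approximated locally; the remainder u - k u
  vanishes together with its gradient on the quarter ball and is left to the other balls.\<close>

lemma approximable_cover:
  fixes \<Omega> :: "'a::euclidean_space set"
  assumes \<Omega>: "open \<Omega>" and p: "1 \<le> p" and "finite Z" and c: "\<And>z. z \<in> Z \<Longrightarrow> cone_at \<Omega> z (r z) (e z) (\<kappa> z)"
    and b: "borel_weak_grad \<Omega> u g" and fin: "p_integral lborel p u < \<infinity>" "p_integral lborel p g < \<infinity>"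
    and supp: "\<And>x. x \<in> \<Omega> \<Longrightarrow> x \<notin> (\<Union>z\<in>Z. ball z (r z / 4)) \<Longrightarrow> u x = 0 \<and> g x = 0"
  shows "approximable p \<Omega> u g"
  using \<open>finite Z\<close> c b fin supp
proof (induction Z arbitrary: u g rule: finite_induct)
  case empty
  have "u = (\<lambda>x. 0)" "g = (\<lambda>x. 0)"
    using empty(5) borel_weak_gradD(5,6)[OF empty(2)] by (auto simp: fun_eq_iff)
  then show ?case
    unfolding approximable_def using p
    by (auto intro!: exI[of _ "\<lambda>_. 0"] smooth_const simp: grad_const p_integral_def)
next
  case (insert z Z)
  note u = borel_weak_gradD[OF insert.prems(2)]
  have cz: "cone_at \<Omega> z (r z) (e z) (\<kappa> z)" using insert.prems(1) by blast
  note r = cone_atD(1)[OF cz]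
  obtain k where k: "test_function (ball z (r z / 2)) k" "\<And>x. x \<in> ball z (r z / 4) \<Longrightarrow> k x = 1"
    using cutoff_exists[of "r z / 4" "r z / 2" z] r by auto
  have kU: "test_function UNIV k" using test_function_mono[OF k(1)] by simp
  define u1 where "u1 x = k x * u x" for x
  define g1 where "g1 x = k x *\<^sub>R g x + u x *\<^sub>R grad k x" for x
  have b1: "borel_weak_grad \<Omega> u1 g1" unfolding u1_def g1_def by (rule borel_weak_grad_mult[OF insert.prems(2) kU])
  have b2: "borel_weak_grad \<Omega> (\<lambda>x. u x - u1 x) (\<lambda>x. g x - g1 x)" by (rule borel_weak_grad_diff[OF insert.prems(2) b1])
  obtain B where B: "\<And>x. \<bar>k x\<bar> \<le> B" "B \<ge> 0" using test_function_bounded[OF kU] by blast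
  obtain C where C: "\<And>x. norm (grad k x) \<le> C" "C \<ge> 0" using test_function_grad_bounded[OF kU] by blast
  have [measurable]: "u \<in> borel_measurable borel" "g \<in> borel_measurable borel" "k \<in> borel_measurable borel"
    "grad k \<in> borel_measurable borel" "u1 \<in> borel_measurable borel" "g1 \<in> borel_measurable borel"
    using u test_function_measurable[OF kU] smooth_grad_measurable[OF test_functionD(1)[OF kU]] borel_weak_gradD[OF b1] by auto
  have fin1: "p_integral lborel p u1 < \<infinity>"
  proof -
    have "p_integral lborel p u1 \<le> ennreal (B powr p) * p_integral lborel p u"
      using B p by (intro p_integral_mult_le) (auto simp: u1_def abs_mult intro!: mult_right_mono)
    then show ?thesis using insert.prems(3) by (auto simp: ennreal_mult_less_top intro: le_less_trans)
  qed
  have fing1: "p_integral lborel p g1 < \<infinity>"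
  proof -
    have "p_integral lborel p (\<lambda>x. k x *\<^sub>R g x) \<le> ennreal (B powr p) * p_integral lborel p g"
      using B p by (intro p_integral_mult_le) (auto intro!: mult_right_mono)
    then have 1: "p_integral lborel p (\<lambda>x. k x *\<^sub>R g x) < \<infinity>"
      using insert.prems(4) by (auto simp: ennreal_mult_less_top intro: le_less_trans)
    have "p_integral lborel p (\<lambda>x. u x *\<^sub>R grad k x) \<le> ennreal (C powr p) * p_integral lborel p u"
    proof (rule p_integral_mult_le)
      show "norm (u x *\<^sub>R grad k x) \<le> C * norm (u x)" for x
        using mult_left_mono[OF C(1)[of x], of "\<bar>u x\<bar>"] by (simp add: mult.commute)
    qed (use p C in auto)
    then have 2: "p_integral lborel p (\<lambda>x. u x *\<^sub>R grad k x) < \<infinity>"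
      using insert.prems(3) by (auto simp: ennreal_mult_less_top intro: le_less_trans)
    have "p_integral lborel p g1 \<le> ennreal (2 powr p) * (p_integral lborel p (\<lambda>x. k x *\<^sub>R g x) + p_integral lborel p (\<lambda>x. u x *\<^sub>R grad k x))"
      unfolding g1_def by (rule p_integral_add_le) (use p in auto)
    also have "\<dots> < \<infinity>" using 1 2 by (simp add: ennreal_mult_less_top)
    finally show ?thesis .
  qed
  have "approximable p \<Omega> u1 g1"
  proof (rule approximable_local[OF \<Omega> p cz b1 fin1 fing1])
    fix x assume "x \<notin> cball z (r z / 2)"
    then have "x \<notin> ball z (r z / 2)" by auto
    then show "u1 x = 0" using test_function_outside[OF k(1)] by (simp add: u1_def)
    have "pderiv_at k i x = 0" if "i \<in> Basis" for i
      using test_function_outside[OF test_function_pderiv[OF k(1) that]] \<open>x \<notin> ball z (r z / 2)\<close> by blast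
    then have "grad k x = 0" by (simp add: grad_def)
    then show "g1 x = 0" using test_function_outside[OF k(1)] \<open>x \<notin> ball z (r z / 2)\<close> by (simp add: g1_def)
  qed
  moreover have "approximable p \<Omega> (\<lambda>x. u x - u1 x) (\<lambda>x. g x - g1 x)"
  proof (rule insert.IH[OF _ b2])
    show "p_integral lborel p (\<lambda>x. u x - u1 x) < \<infinity>" "p_integral lborel p (\<lambda>x. g x - g1 x) < \<infinity>"
      by (intro p_integral_diff_finite insert.prems fin1 fing1; use p in simp)+
    fix x assume x: "x \<in> \<Omega>" "x \<notin> (\<Union>z\<in>Z. ball z (r z / 4))"
    show "u x - u1 x = 0 \<and> g x - g1 x = 0"
    proof (cases "x \<in> ball z (r z / 4)")
      case True
      have "grad k x = 0"
        unfolding grad_def using pderiv_zero_outside[OF test_functionD(1)[OF k(1)] open_ball True k(2)] by simp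
      then show ?thesis using k(2)[OF True] by (simp add: u1_def g1_def)
    next
      case False
      then have "u x = 0 \<and> g x = 0" using insert.prems(5)[OF x(1)] x(2) by blast
      then show ?thesis by (simp add: u1_def g1_def)
    qed
  qed (use insert.prems(1) in auto)
  ultimately have "approximable p \<Omega> (\<lambda>x. u1 x + (u x - u1 x)) (\<lambda>x. g1 x + (g x - g1 x))"
    by (rule approximable_add[OF p]) auto
  then show ?case by simp
qed

lemma smooth_dense_W1p:
  fixes \<Omega> :: "'a::euclidean_space set"
  assumes \<Omega>: "open \<Omega>" "bounded \<Omega>" "cone_domain \<Omega>" and p: "1 \<le> p" and u: "u \<in> W1p p \<Omega>" and "\<epsilon> > 0"
  obtains \<phi> where "smooth \<phi>" "p_integral (lebesgue_on \<Omega>) p (\<lambda>x. \<phi> x - u x) +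
     p_integral (lebesgue_on \<Omega>) p (\<lambda>x. grad \<phi> x - weak_grad \<Omega> u x) < ennreal \<epsilon>"
proof -
  obtain g where g: "has_weak_gradient \<Omega> u g" "g \<in> Lp (lebesgue_on \<Omega>) p" and uL: "u \<in> Lp (lebesgue_on \<Omega>) p"
    using u unfolding W1p_def by blast
  obtain u' g' where b: "borel_weak_grad \<Omega> u' g'" and uu: "AE x in lborel. x \<in> \<Omega> \<longrightarrow> u x = u' x"
    and gg: "AE x in lborel. x \<in> \<Omega> \<longrightarrow> g x = g' x"
    and fin: "p_integral lborel p u' < \<infinity>" "p_integral lborel p g' < \<infinity>"
    using borel_weak_grad_exists[OF \<Omega>(1,2) p uL g(2,1)] by blast
  obtain r e \<kappa> where c: "\<And>z. z \<in> closure \<Omega> \<Longrightarrow> cone_at \<Omega> z (r z) (e z) (\<kappa> z)"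
    using \<Omega>(3) unfolding cone_domain_def by metis
  have "compact (closure \<Omega>)" using \<Omega>(2) by simp
  then obtain Z where Z: "Z \<subseteq> closure \<Omega>" "finite Z" "closure \<Omega> \<subseteq> (\<Union>z\<in>Z. ball z (r z / 4))"
    by (rule compactE_image[of "closure \<Omega>" "closure \<Omega>" "\<lambda>z. ball z (r z / 4)"])
      (use cone_atD(1)[OF c] in auto)
  have "approximable p \<Omega> u' g'"
  proof (rule approximable_cover[OF \<Omega>(1) p Z(2) _ b fin])
    show "cone_at \<Omega> z (r z) (e z) (\<kappa> z)" if "z \<in> Z" for z using that Z(1) c by blast
    show "u' x = 0 \<and> g' x = 0" if "x \<in> \<Omega>" "x \<notin> (\<Union>z\<in>Z. ball z (r z / 4))" for x
      using that Z(3) closure_subset by blast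
  qed
  then obtain \<phi> where \<phi>: "smooth \<phi>" "p_integral (lebesgue_on \<Omega>) p (\<lambda>x. \<phi> x - u' x) + p_integral (lebesgue_on \<Omega>) p (\<lambda>x. grad \<phi> x - g' x) < ennreal \<epsilon>"
    using \<open>\<epsilon> > 0\<close> unfolding approximable_def by blast
  have "p_integral (lebesgue_on \<Omega>) p (\<lambda>x. \<phi> x - u' x) = p_integral (lebesgue_on \<Omega>) p (\<lambda>x. \<phi> x - u x)"
  proof (rule p_integral_cong_AE)
    show "AE x in lebesgue_on \<Omega>. \<phi> x - u' x = \<phi> x - u x"
      unfolding AE_lebesgue_on_iff[OF \<Omega>(1)] using uu by eventually_elim auto
  qed
  moreover have "p_integral (lebesgue_on \<Omega>) p (\<lambda>x. grad \<phi> x - g' x) = p_integral (lebesgue_on \<Omega>) p (\<lambda>x. grad \<phi> x - weak_grad \<Omega> u x)"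
  proof (rule p_integral_cong_AE)
    have "AE x in lborel. x \<in> \<Omega> \<longrightarrow> weak_grad \<Omega> u x = g x"
      using weak_grad_AE[OF \<Omega>(1) g(1)] unfolding AE_lebesgue_on_iff[OF \<Omega>(1)] .
    then show "AE x in lebesgue_on \<Omega>. grad \<phi> x - g' x = grad \<phi> x - weak_grad \<Omega> u x"
      unfolding AE_lebesgue_on_iff[OF \<Omega>(1)] using gg by eventually_elim auto
  qed
  ultimately show thesis using that \<phi> by simp
qed

section \<open>Morrey estimates up to the boundary\<close>

text \<open>The integrals are moved to a box containing the support of \<open>k\<close>, where the
  Leibniz rule for parameter integrals with continuous integrand applies.\<close>

lemma average_has_derivative:
  fixes k \<phi> :: "'a::euclidean_space \<Rightarrow> real"
  assumes k: "test_function U k" and \<phi>: "smooth \<phi>"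
  shows "((\<lambda>t. \<integral>y. k y * \<phi> (x + t *\<^sub>R y) \<partial>lborel) has_real_derivative
     (\<integral>y. k y * (grad \<phi> (x + t *\<^sub>R y) \<bullet> y) \<partial>lborel)) (at t)"
    "integrable lborel (\<lambda>y. k y * \<phi> (x + t *\<^sub>R y))"
    "integrable lborel (\<lambda>y. k y * norm (grad \<phi> (x + t *\<^sub>R y)))"
    "integrable lborel (\<lambda>y. k y * (grad \<phi> (x + t *\<^sub>R y) \<bullet> y))"
proof -
  note sk = test_functionD(1)[OF k]
  obtain K where K: "K \<subseteq> U" "compact K" "\<forall>y. y \<notin> K \<longrightarrow> k y = 0"
    using k test_functionD by meson
  obtain a where a: "K \<subseteq> cbox (-a) a"
    using bounded_subset_cbox_symmetric[OF compact_imp_bounded[OF K(2)]] by blast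
  have key: "integrable lborel (\<lambda>y. k y * h y) \<and> integral (cbox (-a) a) (\<lambda>y. k y * h y) = (\<integral>y. k y * h y \<partial>lborel)"
    if h: "continuous_on UNIV h" for h :: "'a \<Rightarrow> real"
  proof -
    have c: "continuous_on (cbox (-a) a) (\<lambda>y. k y * h y)"
      by (intro continuous_intros smooth_continuous[OF sk] continuous_on_subset[OF h]) auto
    have "integrable lborel (\<lambda>y. indicator (cbox (-a) a) y *\<^sub>R (k y * h y))"
      by (rule borel_integrable_compact[OF compact_cbox c])
    moreover have e: "indicator (cbox (-a) a) y *\<^sub>R (k y * h y) = k y * h y" for y
      using K(3) a by (cases "y \<in> cbox (-a) a") auto
    ultimately have i: "integrable lborel (\<lambda>y. k y * h y)" by (simp only:)
    have "(\<lambda>y. if y \<in> cbox (-a) a then k y * h y else 0) = (\<lambda>y. k y * h y)"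
      using K(3) a by (auto simp: fun_eq_iff)
    then have "integral (cbox (-a) a) (\<lambda>y. k y * h y) = integral UNIV (\<lambda>y. k y * h y)"
      using integral_restrict_UNIV[of "cbox (-a) a" "\<lambda>y. k y * h y"] by simp
    then show ?thesis using i integral_lborel[OF i] by simp
  qed
  have c\<phi>: "continuous_on UNIV (\<lambda>y. \<phi> (x + t *\<^sub>R y))" for t
    by (rule continuous_on_compose2[OF smooth_continuous[OF \<phi>]]) (auto intro!: continuous_intros)
  have cg: "continuous_on UNIV (\<lambda>y. grad \<phi> (x + t *\<^sub>R y))" for t
    by (rule continuous_on_compose2[OF smooth_grad_continuous[OF \<phi>]]) (auto intro!: continuous_intros)
  have c1: "continuous_on UNIV (\<lambda>y. norm (grad \<phi> (x + t *\<^sub>R y)))"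
    and c2: "continuous_on UNIV (\<lambda>y. grad \<phi> (x + t *\<^sub>R y) \<bullet> y)" for t
    by (intro continuous_intros cg)+
  show "integrable lborel (\<lambda>y. k y * \<phi> (x + t *\<^sub>R y))"
    "integrable lborel (\<lambda>y. k y * norm (grad \<phi> (x + t *\<^sub>R y)))"
    "integrable lborel (\<lambda>y. k y * (grad \<phi> (x + t *\<^sub>R y) \<bullet> y))"
    using key[OF c\<phi>] key[OF c1] key[OF c2] by blast+
  have "((\<lambda>t. integral (cbox (-a) a) (\<lambda>y. k y * \<phi> (x + t *\<^sub>R y))) has_vector_derivative
     integral (cbox (-a) a) (\<lambda>y. k y * (grad \<phi> (x + t *\<^sub>R y) \<bullet> y))) (at t within UNIV)"
  proof (rule leibniz_rule_vector_derivative)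
    fix t y
    have "((\<lambda>t. \<phi> (x + t *\<^sub>R y)) has_derivative (\<lambda>h. grad \<phi> (x + t *\<^sub>R y) \<bullet> (h *\<^sub>R y))) (at t)"
      by (rule has_derivative_compose[OF _ smooth_has_derivative_grad[OF \<phi>], where f = "\<lambda>t. x + t *\<^sub>R y"])
        (auto intro!: derivative_eq_intros)
    then have "((\<lambda>t. \<phi> (x + t *\<^sub>R y)) has_real_derivative grad \<phi> (x + t *\<^sub>R y) \<bullet> y) (at t)"
      by (simp add: has_field_derivative_def mult.commute[of _ "grad \<phi> (x + t *\<^sub>R y) \<bullet> y"])
    then show "((\<lambda>t. k y * \<phi> (x + t *\<^sub>R y)) has_vector_derivative k y * (grad \<phi> (x + t *\<^sub>R y) \<bullet> y)) (at t within UNIV)"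
      by (simp add: DERIV_cmult has_real_derivative_iff_has_vector_derivative[symmetric])
  next
    fix t
    show "(\<lambda>y. k y * \<phi> (x + t *\<^sub>R y)) integrable_on cbox (-a) a"
      by (intro integrable_continuous continuous_intros smooth_continuous[OF sk] continuous_on_subset[OF c\<phi>]) auto
  next
    have "continuous_on (UNIV \<times> cbox (-a) a) (\<lambda>q. k (snd q) * (grad \<phi> (x + fst q *\<^sub>R snd q) \<bullet> snd q))"
      by (intro continuous_intros continuous_on_compose2[OF smooth_continuous[OF sk, of UNIV]]
          continuous_on_compose2[OF smooth_grad_continuous[OF \<phi>, of UNIV]]) auto
    then show "continuous_on (UNIV \<times> cbox (-a) a) (\<lambda>(t, y). k y * (grad \<phi> (x + t *\<^sub>R y) \<bullet> y))"
      by (simp add: case_prod_unfold)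
  qed auto
  moreover have "(\<lambda>t. integral (cbox (-a) a) (\<lambda>y. k y * \<phi> (x + t *\<^sub>R y))) = (\<lambda>t. \<integral>y. k y * \<phi> (x + t *\<^sub>R y) \<partial>lborel)"
    using key c\<phi> by (auto simp: fun_eq_iff)
  moreover have "integral (cbox (-a) a) (\<lambda>y. k y * (grad \<phi> (x + t *\<^sub>R y) \<bullet> y)) = (\<integral>y. k y * (grad \<phi> (x + t *\<^sub>R y) \<bullet> y) \<partial>lborel)"
    using key[OF c2] by blast
  ultimately show "((\<lambda>t. \<integral>y. k y * \<phi> (x + t *\<^sub>R y) \<partial>lborel) has_real_derivative
     (\<integral>y. k y * (grad \<phi> (x + t *\<^sub>R y) \<bullet> y) \<partial>lborel)) (at t)"
    by (simp add: has_real_derivative_iff_has_vector_derivative)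
qed

text \<open>
  The average of \<open>\<phi>\<close> over \<open>x + t U\<close> has \<open>t\<close>-derivative at most \<open>C t\<^bsup>-n/p\<^esup>\<close> by Jensen's inequality,
  and this is integrable at \<open>0\<close> because \<open>p > n\<close>.
\<close>

lemma morrey_one_sided:
  fixes \<Omega> :: "'a::euclidean_space set" and k \<phi> :: "'a \<Rightarrow> real"
  assumes \<Omega>: "open \<Omega>" and p: "real DIM('a) < p"
    and k: "test_function U k" "\<And>y. 0 \<le> k y" "\<And>y. k y \<le> M" "(\<integral>y. k y \<partial>lborel) = 1"
    and U: "\<And>y. y \<in> U \<Longrightarrow> norm y \<le> \<rho>" "\<And>y t. y \<in> U \<Longrightarrow> 0 < t \<Longrightarrow> t < s \<Longrightarrow> x + t *\<^sub>R y \<in> \<Omega>"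
    and \<phi>: "smooth \<phi>" and G: "p_integral (lebesgue_on \<Omega>) p (grad \<phi>) \<le> ennreal G" "0 \<le> G" and s: "0 < s"
  shows "(\<integral>y. k y * \<phi> (x + s *\<^sub>R y) \<partial>lborel) - \<phi> x \<le>
    \<bar>\<rho>\<bar> * (M * G) powr (1 / p) * (s powr (1 - real DIM('a) / p) / (1 - real DIM('a) / p))"
proof -
  define n where "n = real DIM('a)"
  have n: "n \<ge> 1" using DIM_ge_Suc0[where 'a = 'a] by (simp add: n_def)
  define \<alpha> where "\<alpha> = 1 - n / p"
  have pn: "p > n" using p by (simp add: n_def)
  with n have pp: "p > 1" "p > n" by linarith+
  have \<alpha>: "\<alpha> > 0" using pp n by (simp add: \<alpha>_def)
  have M: "M \<ge> 0" using k(2,3) order.trans by blast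
  define C where "C = \<bar>\<rho>\<bar> * (M * G) powr (1 / p)"
  define \<Phi> where "\<Phi> t = (\<integral>y. k y * \<phi> (x + t *\<^sub>R y) \<partial>lborel)" for t
  define D where "D t = (\<integral>y. k y * (grad \<phi> (x + t *\<^sub>R y) \<bullet> y) \<partial>lborel)" for t
  note avg = average_has_derivative[OF k(1) \<phi>, of x]
  have kint: "integrable lborel k" by (rule test_function_integrable[OF k(1)])
  have [measurable]: "k \<in> borel_measurable borel" "grad \<phi> \<in> borel_measurable borel" "\<Omega> \<in> sets borel"
    using test_function_measurable[OF k(1)] smooth_grad_measurable[OF \<phi>] borel_open[OF \<Omega>] by auto
  have Dbound: "D t \<le> C * t powr (\<alpha> - 1)" if t: "0 < t" "t < s" for t
  proof -
    define a where "a = (\<integral>y. k y * norm (grad \<phi> (x + t *\<^sub>R y)) \<partial>lborel)"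
    have a0: "a \<ge> 0" unfolding a_def using k(2) by (intro Bochner_Integration.integral_nonneg) auto
    have "D t \<le> (\<integral>y. \<bar>\<rho>\<bar> * (k y * norm (grad \<phi> (x + t *\<^sub>R y))) \<partial>lborel)"
      unfolding D_def
    proof (rule integral_mono[OF avg(4)])
      show "integrable lborel (\<lambda>y. \<bar>\<rho>\<bar> * (k y * norm (grad \<phi> (x + t *\<^sub>R y))))" using avg(3) by simp
      fix y
      show "k y * (grad \<phi> (x + t *\<^sub>R y) \<bullet> y) \<le> \<bar>\<rho>\<bar> * (k y * norm (grad \<phi> (x + t *\<^sub>R y)))"
      proof (cases "y \<in> U")
        case True
        have "grad \<phi> (x + t *\<^sub>R y) \<bullet> y \<le> norm (grad \<phi> (x + t *\<^sub>R y)) * norm y" by (rule norm_cauchy_schwarz)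
        also have "\<dots> \<le> norm (grad \<phi> (x + t *\<^sub>R y)) * \<bar>\<rho>\<bar>"
          using U(1)[OF True] by (intro mult_left_mono) auto
        finally have "k y * (grad \<phi> (x + t *\<^sub>R y) \<bullet> y) \<le> k y * (norm (grad \<phi> (x + t *\<^sub>R y)) * \<bar>\<rho>\<bar>)"
          by (rule mult_left_mono[OF _ k(2)])
        then show ?thesis by (simp add: mult_ac)
      next
        case False
        then show ?thesis using test_function_outside[OF k(1)] by simp
      qed
    qed
    then have D1: "D t \<le> \<bar>\<rho>\<bar> * a" by (simp add: a_def)
    have "ennreal (a powr p) \<le> (\<integral>\<^sup>+y. ennreal (k y * \<bar>norm (grad \<phi> (x + t *\<^sub>R y))\<bar> powr p) \<partial>lborel)"
      using jensen_powr[of p lborel k "\<lambda>y. norm (grad \<phi> (x + t *\<^sub>R y))"] pp kint k avg(3) a0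
      by (simp add: a_def)
    \<comment> \<open>\<open>k\<close> lives on \<open>U\<close>, and x + t y is in \<Omega> for y
      in \<open>U\<close>; so the indicator of \<Omega> may be inserted while k is replaced by its
      bound M.\<close>
    also have "\<dots> \<le> (\<integral>\<^sup>+y. ennreal M * (ennreal (norm (grad \<phi> (x + t *\<^sub>R y)) powr p) * indicator \<Omega> (x + t *\<^sub>R y)) \<partial>lborel)"
    proof (rule nn_integral_mono)
      fix y
      show "ennreal (k y * \<bar>norm (grad \<phi> (x + t *\<^sub>R y))\<bar> powr p) \<le>
        ennreal M * (ennreal (norm (grad \<phi> (x + t *\<^sub>R y)) powr p) * indicator \<Omega> (x + t *\<^sub>R y))"
      proof (cases "y \<in> U")
        case True
        then show ?thesis using U(2)[OF True t] k(3)[of y] M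
          by (simp add: ennreal_leI mult_right_mono flip: ennreal_mult)
      next
        case False
        then show ?thesis using test_function_outside[OF k(1)] by simp
      qed
    qed
    also have "\<dots> = ennreal M * (\<integral>\<^sup>+y. ennreal (norm (grad \<phi> (x + t *\<^sub>R y)) powr p) * indicator \<Omega> (x + t *\<^sub>R y) \<partial>lborel)"
      by (rule nn_integral_cmult) measurable
    finally have 1: "ennreal (a powr p) \<le> ennreal M * (\<integral>\<^sup>+y. ennreal (norm (grad \<phi> (x + t *\<^sub>R y)) powr p) * indicator \<Omega> (x + t *\<^sub>R y) \<partial>lborel)" .
    \<comment> \<open>The substitution z = x + t y produces the factor t^n; taking p-th roots leaves
      t^(-n/p) in the bound for \<open>a\<close>.\<close>
    have "ennreal (t powr n) * (\<integral>\<^sup>+y. ennreal (norm (grad \<phi> (x + t *\<^sub>R y)) powr p) * indicator \<Omega> (x + t *\<^sub>R y) \<partial>lborel)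
      = p_integral (lebesgue_on \<Omega>) p (grad \<phi>)"
      unfolding p_integral_def nn_integral_lebesgue_on[OF \<Omega>] using t
      by (subst lborel_affine_nn_integral[of _ t x]) (auto simp: n_def powr_realpow)
    then have "ennreal (t powr n) * ennreal (a powr p) \<le> ennreal M * p_integral (lebesgue_on \<Omega>) p (grad \<phi>)"
      using mult_left_mono[OF 1, of "ennreal (t powr n)"] by (simp add: mult_ac)
    also have "\<dots> \<le> ennreal M * ennreal G" by (intro mult_left_mono G) auto
    finally have "t powr n * a powr p \<le> M * G"
      using M G by (simp flip: ennreal_mult)
    then have "(t powr n * a powr p) powr (1 / p) \<le> (M * G) powr (1 / p)"
      using pp by (intro powr_mono2) auto
    then have "t powr (n / p) * a \<le> (M * G) powr (1 / p)"
      using pp t a0 by (simp add: powr_mult powr_powr)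
    then have "a \<le> (M * G) powr (1 / p) * t powr (- (n / p))"
      using t by (simp add: powr_minus_divide pos_le_divide_eq mult.commute)
    then have "\<bar>\<rho>\<bar> * a \<le> \<bar>\<rho>\<bar> * ((M * G) powr (1 / p) * t powr (- (n / p)))"
      by (intro mult_left_mono) auto
    moreover have "\<alpha> - 1 = - (n / p)" by (simp add: \<alpha>_def)
    ultimately show ?thesis using D1 by (simp add: C_def mult.assoc)
  qed
  \<comment> \<open>Subtracting the antiderivative of the bound on \<open>D\<close> gives a
    nonincreasing function. The bound blows up at t = 0, so monotonicity is derived from the open
    interval together with continuity on the closed one.\<close>
  define \<Psi> where "\<Psi> t = \<Phi> t - C * (t powr \<alpha> / \<alpha>)" for t
  have \<Phi>': "(\<Phi> has_real_derivative D t) (at t)" for t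
    using avg(1) unfolding \<Phi>_def D_def .
  have "\<Psi> s \<le> \<Psi> 0"
  proof (rule DERIV_nonpos_imp_decreasing_open[OF less_imp_le[OF s]])
    fix t assume t: "0 < t" "t < s"
    have "(\<Psi> has_real_derivative D t - C * t powr (\<alpha> - 1)) (at t)"
      unfolding \<Psi>_def using \<Phi>'[of t] t \<alpha> by (auto intro!: derivative_eq_intros)
    then show "\<exists>y. (\<Psi> has_real_derivative y) (at t) \<and> y \<le> 0" using Dbound[OF t] by auto
  next
    have "continuous_on {0..s} \<Phi>" using \<Phi>' DERIV_isCont continuous_at_imp_continuous_on by blast
    then show "continuous_on {0..s} \<Psi>"
      unfolding \<Psi>_def using \<alpha> by (intro continuous_intros continuous_on_powr') auto
  qed
  moreover have "\<Phi> 0 = \<phi> x" by (simp add: \<Phi>_def k(4))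
  ultimately have "\<Phi> s - \<phi> x \<le> C * (s powr \<alpha> / \<alpha>)" using \<alpha> by (simp add: \<Psi>_def)
  then show ?thesis by (simp only: \<Phi>_def C_def \<alpha>_def n_def)
qed

lemma p_integral_grad_minus: "smooth \<phi> \<Longrightarrow> p_integral M p (grad (\<lambda>x. - \<phi> x)) = p_integral M p (grad \<phi>)"
  using grad_cmult[of \<phi> "-1"] by (simp add: p_integral_def)

lemma smooth_minus: "smooth f \<Longrightarrow> smooth (\<lambda>x. - f x)"
  using smooth_cmult[of f "-1"] by simp

lemma morrey:
  fixes \<Omega> :: "'a::euclidean_space set" and k \<phi> :: "'a \<Rightarrow> real"
  assumes \<Omega>: "open \<Omega>" and p: "real DIM('a) < p"
    and k: "test_function U k" "\<And>y. 0 \<le> k y" "\<And>y. k y \<le> M" "(\<integral>y. k y \<partial>lborel) = 1"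
    and U: "\<And>y. y \<in> U \<Longrightarrow> norm y \<le> \<rho>" "\<And>y t. y \<in> U \<Longrightarrow> 0 < t \<Longrightarrow> t < s \<Longrightarrow> x + t *\<^sub>R y \<in> \<Omega>"
    and \<phi>: "smooth \<phi>" and G: "p_integral (lebesgue_on \<Omega>) p (grad \<phi>) \<le> ennreal G" "0 \<le> G" and s: "0 < s"
  shows "\<bar>(\<integral>y. k y * \<phi> (x + s *\<^sub>R y) \<partial>lborel) - \<phi> x\<bar> \<le>
    \<bar>\<rho>\<bar> * (M * G) powr (1 / p) * (s powr (1 - real DIM('a) / p) / (1 - real DIM('a) / p))"
  using morrey_one_sided[OF \<Omega> p k U \<phi> G s]
    morrey_one_sided[where \<phi> = "\<lambda>x. - \<phi> x" and G = G and s = s and x = x, OF \<Omega> p k U smooth_minus[OF \<phi>]] G s by (auto simp: p_integral_grad_minus[OF \<phi>])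

lemma L1_le_p_integral:
  fixes f :: "'a::euclidean_space \<Rightarrow> real"
  assumes \<Omega>: "open \<Omega>" "bounded \<Omega>" and p: "1 \<le> p" and [measurable]: "f \<in> borel_measurable borel"
    and B: "p_integral (lebesgue_on \<Omega>) p f \<le> ennreal B" "0 \<le> B"
  shows "integrable lborel (\<lambda>x. indicator \<Omega> x * f x)"
    "(\<integral>x. \<bar>indicator \<Omega> x * f x\<bar> \<partial>lborel) \<le> B + measure lborel \<Omega>"
proof -
  have [measurable]: "\<Omega> \<in> sets borel" using borel_open[OF \<Omega>(1)] .
  have fin: "emeasure lborel \<Omega> < \<infinity>" using emeasure_bounded_finite[OF \<Omega>(2)] .
  have "(\<integral>\<^sup>+x. ennreal \<bar>indicator \<Omega> x * f x\<bar> \<partial>lborel) \<le> (\<integral>\<^sup>+x. ennreal (\<bar>f x\<bar> powr p) * indicator \<Omega> x + indicator \<Omega> x \<partial>lborel)"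
  proof (rule nn_integral_mono)
    fix x
    show "ennreal \<bar>indicator \<Omega> x * f x\<bar> \<le> ennreal (\<bar>f x\<bar> powr p) * indicator \<Omega> x + indicator \<Omega> x"
    proof (cases "x \<in> \<Omega>")
      case True
      have "\<bar>f x\<bar> \<le> \<bar>f x\<bar> powr p + 1"
        using p powr_mono[of 1 p "\<bar>f x\<bar>"] by (cases "\<bar>f x\<bar> \<ge> 1") (auto intro: add_increasing)
      then have "ennreal \<bar>f x\<bar> \<le> ennreal (\<bar>f x\<bar> powr p + 1)" by (rule ennreal_leI)
      also have "\<dots> = ennreal (\<bar>f x\<bar> powr p) + 1" by simp
      finally show ?thesis using True by simp
    qed simp
  qed
  also have "\<dots> = p_integral (lebesgue_on \<Omega>) p f + emeasure lborel \<Omega>"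
    unfolding p_integral_def nn_integral_lebesgue_on[OF \<Omega>(1)]
    by (subst nn_integral_add) auto
  also have "\<dots> \<le> ennreal B + ennreal (measure lborel \<Omega>)"
    using B fin by (intro add_mono) (auto simp: emeasure_eq_ennreal_measure less_top)
  also have "\<dots> = ennreal (B + measure lborel \<Omega>)" using B by simp
  finally have le: "(\<integral>\<^sup>+x. ennreal \<bar>indicator \<Omega> x * f x\<bar> \<partial>lborel) \<le> ennreal (B + measure lborel \<Omega>)" .
  show i: "integrable lborel (\<lambda>x. indicator \<Omega> x * f x)"
  proof (rule integrableI_bounded)
    show "(\<integral>\<^sup>+x. ennreal (norm (indicator \<Omega> x * f x)) \<partial>lborel) < \<infinity>"
      using le_less_trans[OF le ennreal_less_top] by simp
  qed measurable
  have "ennreal (\<integral>x. \<bar>indicator \<Omega> x * f x\<bar> \<partial>lborel) \<le> ennreal (B + measure lborel \<Omega>)"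
    using nn_integral_eq_integral[OF integrable_abs[OF i]] le by simp
  then show "(\<integral>x. \<bar>indicator \<Omega> x * f x\<bar> \<partial>lborel) \<le> B + measure lborel \<Omega>"
    using B by (subst (asm) ennreal_le_iff) auto
qed

section \<open>Uniform bounds and equicontinuity up to the boundary\<close>

definition W1p_bounded :: "real \<Rightarrow> 'a::euclidean_space set \<Rightarrow> real \<Rightarrow> ('a \<Rightarrow> real) set" where
  "W1p_bounded p \<Omega> B = {\<phi>. smooth \<phi> \<and> p_integral (lebesgue_on \<Omega>) p \<phi> \<le> ennreal B \<and>
     p_integral (lebesgue_on \<Omega>) p (grad \<phi>) \<le> ennreal B}"

text \<open>Only the L1 norm of \<open>w\<close> enters, so for a fixed kernel the mollifications of
  a bounded family are uniformly bounded and equi-Lipschitz.\<close>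

lemma conv_bounds:
  fixes k w :: "'a::euclidean_space \<Rightarrow> real"
  assumes k: "test_function UNIV k" and w: "integrable lborel w"
    and M: "\<And>x. \<bar>k x\<bar> \<le> M" and L: "\<And>x. norm (grad k x) \<le> L"
  shows "\<bar>conv k w x\<bar> \<le> M * (\<integral>y. \<bar>w y\<bar> \<partial>lborel)"
    "\<bar>conv k w x - conv k w z\<bar> \<le> L * norm (x - z) * (\<integral>y. \<bar>w y\<bar> \<partial>lborel)"
proof -
  have M0: "M \<ge> 0" using M[of 0] by linarith
  have L0: "L \<ge> 0" using L[of 0] norm_ge_zero order.trans by blast
  have "\<bar>conv k w x\<bar> \<le> (\<integral>y. \<bar>k (y - x) * w y\<bar> \<partial>lborel)" unfolding conv_def by (rule integral_abs_bound)
  also have "\<dots> \<le> (\<integral>y. M * \<bar>w y\<bar> \<partial>lborel)"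
  proof (rule integral_mono)
    show "\<bar>k (y - x) * w y\<bar> \<le> M * \<bar>w y\<bar>" for y using M by (simp add: abs_mult mult_right_mono)
  qed (use conv_integrable[OF k w] w in auto)
  finally show "\<bar>conv k w x\<bar> \<le> M * (\<integral>y. \<bar>w y\<bar> \<partial>lborel)" by simp
  have lip: "\<bar>k a - k b\<bar> \<le> L * norm (a - b)" for a b
  proof -
    have "norm (k a - k b) \<le> L * norm (a - b)"
    proof (rule differentiable_bound[where S = UNIV and f' = "\<lambda>x h. grad k x \<bullet> h"])
      show "(k has_derivative (\<bullet>) (grad k x)) (at x within UNIV)" for x
        by (rule smooth_has_derivative_grad[OF test_functionD(1)[OF k]])
      show "onorm ((\<bullet>) (grad k x)) \<le> L" for x
      proof (rule onorm_le)
        fix h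
        have "norm (grad k x \<bullet> h) \<le> norm (grad k x) * norm h" using Cauchy_Schwarz_ineq2 by simp
        also have "\<dots> \<le> L * norm h" by (intro mult_right_mono L) auto
        finally show "norm (grad k x \<bullet> h) \<le> L * norm h" .
      qed
    qed auto
    then show ?thesis by simp
  qed
  have "conv k w x - conv k w z = (\<integral>y. (k (y - x) - k (y - z)) * w y \<partial>lborel)"
    unfolding conv_def using conv_integrable[OF k w, of x] conv_integrable[OF k w, of z]
    by (simp add: left_diff_distrib)
  also have "\<bar>\<dots>\<bar> \<le> (\<integral>y. \<bar>(k (y - x) - k (y - z)) * w y\<bar> \<partial>lborel)" by (rule integral_abs_bound)
  also have "\<dots> \<le> (\<integral>y. L * norm (x - z) * \<bar>w y\<bar> \<partial>lborel)"
  proof (rule integral_mono)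
    have "integrable lborel (\<lambda>y. (k (y - x) - k (y - z)) * w y)"
      using conv_integrable[OF k w, of x] conv_integrable[OF k w, of z] by (simp add: left_diff_distrib)
    then show "integrable lborel (\<lambda>y. \<bar>(k (y - x) - k (y - z)) * w y\<bar>)" by (rule integrable_abs)
    show "\<bar>(k (y - x) - k (y - z)) * w y\<bar> \<le> L * norm (x - z) * \<bar>w y\<bar>" for y
      using lip[of "y - x" "y - z"] by (simp add: abs_mult mult_right_mono norm_minus_commute)
  qed (use w in auto)
  finally show "\<bar>conv k w x - conv k w z\<bar> \<le> L * norm (x - z) * (\<integral>y. \<bar>w y\<bar> \<partial>lborel)" by simp
qed

text \<open>A function differs from its cone average at scale s by at most A s^\<alpha>, uniformly
  over the family, and for fixed s the averages obey the bounds of \<open>conv_bounds\<close>.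
  Fixing s first and then the distance of the points yields boundedness and equicontinuity.\<close>

lemma morrey_local:
  fixes \<Omega> :: "'a::euclidean_space set"
  assumes \<Omega>: "open \<Omega>" "bounded \<Omega>" and p: "real DIM('a) < p" and c: "cone_at \<Omega> z r e \<kappa>" and B: "0 \<le> B"
  shows "\<exists>C. \<forall>\<phi>\<in>W1p_bounded p \<Omega> B. \<forall>x\<in>\<Omega> \<inter> ball z r. \<bar>\<phi> x\<bar> \<le> C"
    "\<And>\<eta>. 0 < \<eta> \<Longrightarrow> \<exists>\<delta>>0. \<forall>\<phi>\<in>W1p_bounded p \<Omega> B. \<forall>x\<in>\<Omega> \<inter> ball z r. \<forall>y\<in>\<Omega> \<inter> ball z r. norm (x - y) < \<delta> \<longrightarrow> \<bar>\<phi> x - \<phi> y\<bar> \<le> \<eta>"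
proof -
  note r = cone_atD(1)[OF c] and \<kappa> = cone_atD(2)[OF c]
  obtain k :: "'a \<Rightarrow> real" where k: "test_function (ball e \<kappa>) k" "\<And>x. 0 \<le> k x" "(\<integral>x. k x \<partial>lborel) = 1"
    using bump_exists[OF \<kappa>, of e] by auto
  obtain M where M: "\<And>x. \<bar>k x\<bar> \<le> M" "M \<ge> 0" using test_function_bounded[OF k(1)] by blast
  have kM: "k y \<le> M" for y using M(1)[of y] by linarith
  have DIM: "real DIM('a) \<ge> 1" using DIM_ge_Suc0[where 'a = 'a] by simp
  have p1: "1 \<le> p" using p DIM by linarith
  define \<alpha> where "\<alpha> = 1 - real DIM('a) / p"
  have \<alpha>: "\<alpha> > 0" using p p1 by (simp add: \<alpha>_def)
  define \<rho> where "\<rho> = norm e + \<kappa>"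
  have \<rho>: "norm y \<le> \<rho>" if "y \<in> ball e \<kappa>" for y
    using that norm_triangle_ineq2[of y e] by (simp add: \<rho>_def dist_norm norm_minus_commute)
  define A where "A = \<bar>\<rho>\<bar> * (M * B) powr (1 / p) / \<alpha>"
  have A: "A \<ge> 0" using \<alpha> by (simp add: A_def)
  define V where "V = B + measure lborel \<Omega>"
  have V: "V \<ge> 0" using B by (simp add: V_def)
  define w where "w \<phi> = (\<lambda>x. indicator \<Omega> x * \<phi> x)" for \<phi> :: "'a \<Rightarrow> real"
  have W: "integrable lborel (w \<phi>)" "(\<integral>x. \<bar>w \<phi> x\<bar> \<partial>lborel) \<le> V" if "\<phi> \<in> W1p_bounded p \<Omega> B" for \<phi>
    unfolding w_def V_def
    using L1_le_p_integral[OF \<Omega> p1 smooth_measurable, of \<phi> B] that B by (auto simp: W1p_bounded_def)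
  have main: "\<bar>conv (rescale s k) (w \<phi>) x - \<phi> x\<bar> \<le> A * s powr \<alpha>"
    if \<phi>: "\<phi> \<in> W1p_bounded p \<Omega> B" and x: "x \<in> \<Omega> \<inter> ball z r" and s: "0 < s" "s < r" for \<phi> x s
  proof -
    have s\<phi>: "smooth \<phi>" and G: "p_integral (lebesgue_on \<Omega>) p (grad \<phi>) \<le> ennreal B"
      using \<phi> by (auto simp: W1p_bounded_def)
    have in\<Omega>: "x + t *\<^sub>R y \<in> \<Omega>" if "y \<in> ball e \<kappa>" "0 < t" "t \<le> s" for y t
      using cone_atD(3)[OF c, of x t y] that x s by auto
    have "\<bar>(\<integral>y. k y * \<phi> (x + s *\<^sub>R y) \<partial>lborel) - \<phi> x\<bar> \<le>
       \<bar>\<rho>\<bar> * (M * B) powr (1 / p) * (s powr (1 - real DIM('a) / p) / (1 - real DIM('a) / p))"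
      by (rule morrey[OF \<Omega>(1) p k(1,2) kM k(3) \<rho> _ s\<phi> G B s(1)]) (use in\<Omega> in auto)
    also have "\<dots> = A * s powr \<alpha>" by (simp add: A_def \<alpha>_def)
    finally have 1: "\<bar>(\<integral>y. k y * \<phi> (x + s *\<^sub>R y) \<partial>lborel) - \<phi> x\<bar> \<le> A * s powr \<alpha>" .
    have "conv (rescale s k) (w \<phi>) x = (\<integral>y. k y * w \<phi> (x + s *\<^sub>R y) \<partial>lborel)"
      using conv_rescale[of k "w \<phi>" s x] test_function_measurable[OF k(1)] W(1)[OF \<phi>] s by simp
    also have "\<dots> = (\<integral>y. k y * \<phi> (x + s *\<^sub>R y) \<partial>lborel)"
    proof (rule Bochner_Integration.integral_cong[OF refl])
      fix y
      show "k y * w \<phi> (x + s *\<^sub>R y) = k y * \<phi> (x + s *\<^sub>R y)"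
        using test_function_outside[OF k(1), of y] in\<Omega>[of y s] s by (cases "y \<in> ball e \<kappa>") (auto simp: w_def)
    qed
    finally show ?thesis using 1 by simp
  qed
  have sc: "\<exists>Ms Ls. 0 \<le> Ms \<and> 0 \<le> Ls \<and> (\<forall>\<phi>\<in>W1p_bounded p \<Omega> B. \<forall>x y. \<bar>conv (rescale s k) (w \<phi>) x\<bar> \<le> Ms \<and>
     \<bar>conv (rescale s k) (w \<phi>) x - conv (rescale s k) (w \<phi>) y\<bar> \<le> Ls * norm (x - y))" if s: "0 < s" for s
  proof -
    have tU: "test_function UNIV (rescale s k)" by (rule test_function_rescale_UNIV[OF k(1) s])
    obtain M' where M': "\<And>x. \<bar>rescale s k x\<bar> \<le> M'" "M' \<ge> 0" using test_function_bounded[OF tU] by blast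
    obtain L where L: "\<And>x. norm (grad (rescale s k) x) \<le> L" "L \<ge> 0" using test_function_grad_bounded[OF tU] by blast
    have "\<bar>conv (rescale s k) (w \<phi>) x\<bar> \<le> M' * V \<and>
     \<bar>conv (rescale s k) (w \<phi>) x - conv (rescale s k) (w \<phi>) y\<bar> \<le> L * V * norm (x - y)"
      if \<phi>: "\<phi> \<in> W1p_bounded p \<Omega> B" for \<phi> x y
    proof
      note cb = conv_bounds[OF tU W(1)[OF \<phi>] M'(1) L(1)]
      show "\<bar>conv (rescale s k) (w \<phi>) x\<bar> \<le> M' * V"
        using cb(1)[of x] mult_left_mono[OF W(2)[OF \<phi>] M'(2)] by linarith
      have "L * norm (x - y) * (\<integral>y. \<bar>w \<phi> y\<bar> \<partial>lborel) \<le> L * norm (x - y) * V"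
        using W(2)[OF \<phi>] L(2) by (intro mult_left_mono) auto
      then show "\<bar>conv (rescale s k) (w \<phi>) x - conv (rescale s k) (w \<phi>) y\<bar> \<le> L * V * norm (x - y)"
        using cb(2)[of x y] by (simp add: mult_ac)
    qed
    then show ?thesis using M'(2) L(2) V by (intro exI[of _ "M' * V"] exI[of _ "L * V"]) auto
  qed
  show "\<exists>C. \<forall>\<phi>\<in>W1p_bounded p \<Omega> B. \<forall>x\<in>\<Omega> \<inter> ball z r. \<bar>\<phi> x\<bar> \<le> C"
  proof -
    obtain Ms where Ms: "\<And>\<phi> x. \<phi> \<in> W1p_bounded p \<Omega> B \<Longrightarrow> \<bar>conv (rescale (r/2) k) (w \<phi>) x\<bar> \<le> Ms"
      using sc[of "r/2"] r by (metis half_gt_zero)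
    have "\<bar>\<phi> x\<bar> \<le> Ms + A * (r/2) powr \<alpha>" if "\<phi> \<in> W1p_bounded p \<Omega> B" "x \<in> \<Omega> \<inter> ball z r" for \<phi> x
      using main[OF that, of "r/2"] Ms[OF that(1), of x] r by linarith
    then show ?thesis by blast
  qed
  show "\<exists>\<delta>>0. \<forall>\<phi>\<in>W1p_bounded p \<Omega> B. \<forall>x\<in>\<Omega> \<inter> ball z r. \<forall>y\<in>\<Omega> \<inter> ball z r. norm (x - y) < \<delta> \<longrightarrow> \<bar>\<phi> x - \<phi> y\<bar> \<le> \<eta>"
    if \<eta>: "0 < \<eta>" for \<eta>
  proof -
    \<comment> \<open>The scale is small enough for each of the two averaging errors to be at most
      \<eta>/3; the last third goes to the Lipschitz bound, whose constant depends on s.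
      \<open>A + 1\<close> covers the case A = 0.\<close>
    define s where "s = min (r/2) ((\<eta> / (3 * (A + 1))) powr (1 / \<alpha>))"
    have s: "0 < s" "s < r" using r \<eta> A by (auto simp: s_def)
    have "s powr \<alpha> \<le> ((\<eta> / (3 * (A + 1))) powr (1 / \<alpha>)) powr \<alpha>"
      using s \<alpha> by (intro powr_mono2) (auto simp: s_def)
    also have "\<dots> = \<eta> / (3 * (A + 1))" using \<alpha> \<eta> A by (simp add: powr_powr)
    finally have "A * s powr \<alpha> \<le> A * (\<eta> / (3 * (A + 1)))" using A by (rule mult_left_mono)
    also have "\<dots> \<le> \<eta> / 3" using A \<eta> by (simp add: divide_simps)
    finally have sA: "A * s powr \<alpha> \<le> \<eta> / 3" .
    obtain Ls where Ls: "Ls \<ge> 0" "\<And>\<phi> x y. \<phi> \<in> W1p_bounded p \<Omega> B \<Longrightarrow>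
       \<bar>conv (rescale s k) (w \<phi>) x - conv (rescale s k) (w \<phi>) y\<bar> \<le> Ls * norm (x - y)"
      using sc[OF s(1)] by blast
    define \<delta> where "\<delta> = \<eta> / (3 * (Ls + 1))"
    have \<delta>: "\<delta> > 0" using \<eta> Ls by (simp add: \<delta>_def)
    have "\<bar>\<phi> x - \<phi> y\<bar> \<le> \<eta>" if \<phi>: "\<phi> \<in> W1p_bounded p \<Omega> B" and x: "x \<in> \<Omega> \<inter> ball z r" and y: "y \<in> \<Omega> \<inter> ball z r" and xy: "norm (x - y) < \<delta>" for \<phi> x y
    proof -
      have "Ls * norm (x - y) \<le> Ls * \<delta>" using xy Ls by (intro mult_left_mono) auto
      also have "\<dots> \<le> \<eta> / 3" using Ls \<eta> by (simp add: \<delta>_def divide_simps)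
      finally show ?thesis
        using main[OF \<phi> x s] main[OF \<phi> y s] Ls(2)[OF \<phi>, of x y] sA by linarith
    qed
    then show ?thesis using \<delta> by blast
  qed
qed

lemma bound_on_closure:
  fixes f :: "'a::euclidean_space \<Rightarrow> real"
  assumes "continuous_on UNIV f" "\<And>x. x \<in> S \<Longrightarrow> \<bar>f x\<bar> \<le> C" "x \<in> closure S"
  shows "\<bar>f x\<bar> \<le> C"
  by (rule continuous_le_on_closure[where f = "\<lambda>x. \<bar>f x\<bar>" and S = S])
    (use assms in \<open>auto intro!: continuous_intros continuous_on_subset[OF assms(1)]\<close>)

lemma W1p_bounded_sup:
  fixes \<Omega> :: "'a::euclidean_space set"
  assumes \<Omega>: "open \<Omega>" "bounded \<Omega>" "cone_domain \<Omega>" and p: "real DIM('a) < p" and B: "0 \<le> B"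
  shows "\<exists>C. \<forall>\<phi>\<in>W1p_bounded p \<Omega> B. \<forall>x\<in>closure \<Omega>. \<bar>\<phi> x\<bar> \<le> C"
proof -
  have "\<forall>z\<in>closure \<Omega>. \<exists>r>0. \<exists>C. \<forall>\<phi>\<in>W1p_bounded p \<Omega> B. \<forall>x\<in>\<Omega> \<inter> ball z r. \<bar>\<phi> x\<bar> \<le> C"
  proof
    fix z assume "z \<in> closure \<Omega>"
    then obtain r e \<kappa> where c: "cone_at \<Omega> z r e \<kappa>"
      using \<Omega>(3) unfolding cone_domain_def by blast
    show "\<exists>r>0. \<exists>C. \<forall>\<phi>\<in>W1p_bounded p \<Omega> B. \<forall>x\<in>\<Omega> \<inter> ball z r. \<bar>\<phi> x\<bar> \<le> C"
      using morrey_local(1)[OF \<Omega>(1,2) p c B] cone_atD(1)[OF c] by blast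
  qed
  then obtain r C where rC: "\<And>z. z \<in> closure \<Omega> \<Longrightarrow> r z > 0"
    "\<And>z \<phi> x. z \<in> closure \<Omega> \<Longrightarrow> \<phi> \<in> W1p_bounded p \<Omega> B \<Longrightarrow> x \<in> \<Omega> \<inter> ball z (r z) \<Longrightarrow> \<bar>\<phi> x\<bar> \<le> C z"
    by metis
  have "compact (closure \<Omega>)" using \<Omega>(2) by simp
  then obtain Z where Z: "Z \<subseteq> closure \<Omega>" "finite Z" "closure \<Omega> \<subseteq> (\<Union>z\<in>Z. ball z (r z))"
    by (rule compactE_image[of "closure \<Omega>" "closure \<Omega>" "\<lambda>z. ball z (r z)"]) (use rC(1) in auto)
  have "\<bar>\<phi> x\<bar> \<le> (\<Sum>z\<in>Z. \<bar>C z\<bar>)" if \<phi>: "\<phi> \<in> W1p_bounded p \<Omega> B" and x: "x \<in> closure \<Omega>" for \<phi> x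
  proof (rule bound_on_closure[OF _ _ x])
    show "continuous_on UNIV \<phi>" using \<phi> smooth_continuous by (auto simp: W1p_bounded_def)
    fix y assume y: "y \<in> \<Omega>"
    then obtain z where z: "z \<in> Z" "y \<in> ball z (r z)" using Z(3) closure_subset by blast
    have "\<bar>\<phi> y\<bar> \<le> \<bar>C z\<bar>" using rC(2)[of z \<phi> y] z Z(1) \<phi> y by force
    also have "\<dots> \<le> (\<Sum>z\<in>Z. \<bar>C z\<bar>)" using Z(2) z(1) by (intro member_le_sum) auto
    finally show "\<bar>\<phi> y\<bar> \<le> (\<Sum>z\<in>Z. \<bar>C z\<bar>)" .
  qed
  then show ?thesis by blast
qed

text \<open>The Morrey estimate holds for points of \<Omega> near z and is extended to the closure
  by continuity in one variable at a time. The radius at most \<delta>/2 makes any two points of the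
  ball \<delta>-close.\<close>

lemma W1p_bounded_equicontinuous:
  fixes \<Omega> :: "'a::euclidean_space set"
  assumes \<Omega>: "open \<Omega>" "bounded \<Omega>" "cone_domain \<Omega>" and p: "real DIM('a) < p" and B: "0 \<le> B"
    and z: "z \<in> closure \<Omega>" and \<eta>: "0 < \<eta>"
  shows "\<exists>\<delta>>0. \<forall>\<phi>\<in>W1p_bounded p \<Omega> B. \<forall>x\<in>closure \<Omega>. norm (z - x) < \<delta> \<longrightarrow> \<bar>\<phi> z - \<phi> x\<bar> \<le> \<eta>"
proof -
  obtain r e \<kappa> where c: "cone_at \<Omega> z r e \<kappa>"
    using \<Omega>(3) z unfolding cone_domain_def by blast
  obtain \<delta> where \<delta>: "\<delta> > 0" "\<And>\<phi> x y. \<phi> \<in> W1p_bounded p \<Omega> B \<Longrightarrow> x \<in> \<Omega> \<inter> ball z r \<Longrightarrow> y \<in> \<Omega> \<inter> ball z r \<Longrightarrow> norm (x - y) < \<delta> \<Longrightarrow> \<bar>\<phi> x - \<phi> y\<bar> \<le> \<eta>"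
    using morrey_local(2)[OF \<Omega>(1,2) p c B \<eta>] by metis
  define d where "d = min r (\<delta> / 2)"
  have d: "d > 0" using \<delta>(1) cone_atD(1)[OF c] by (simp add: d_def)
  define S where "S = ball z d \<inter> \<Omega>"
  have cl: "x \<in> closure S" if "x \<in> closure \<Omega>" "x \<in> ball z d" for x
    unfolding S_def using open_Int_closure_subset[of "ball z d" \<Omega>] that by auto
  have "\<bar>\<phi> z - \<phi> x\<bar> \<le> \<eta>" if \<phi>: "\<phi> \<in> W1p_bounded p \<Omega> B" and x: "x \<in> closure \<Omega>" "norm (z - x) < d" for \<phi> x
  proof -
    have cont: "continuous_on UNIV \<phi>" using \<phi> smooth_continuous by (auto simp: W1p_bounded_def)
    have SS: "\<bar>\<phi> a - \<phi> b\<bar> \<le> \<eta>" if "a \<in> S" "b \<in> S" for a b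
    proof (rule \<delta>(2)[OF \<phi>])
      show "a \<in> \<Omega> \<inter> ball z r" "b \<in> \<Omega> \<inter> ball z r" using that by (auto simp: S_def d_def)
      have "dist a b \<le> dist a z + dist z b" by (rule dist_triangle)
      then show "norm (a - b) < \<delta>" using that by (simp add: S_def d_def dist_norm norm_minus_commute)
    qed
    have "\<bar>\<phi> a - \<phi> x\<bar> \<le> \<eta>" if "a \<in> S" for a
    proof (rule bound_on_closure[of "\<lambda>y. \<phi> a - \<phi> y" S])
      show "continuous_on UNIV (\<lambda>y. \<phi> a - \<phi> y)" by (intro continuous_on_diff continuous_on_const cont)
    qed (use SS[OF that] cl[of x] x in \<open>auto simp: dist_norm\<close>)
    note ax = this
    show ?thesis
    proof (rule bound_on_closure[of "\<lambda>y. \<phi> y - \<phi> x" S])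
      show "continuous_on UNIV (\<lambda>y. \<phi> y - \<phi> x)" by (intro continuous_on_diff continuous_on_const cont)
    qed (use ax cl[of z] z d in auto)
  qed
  then show ?thesis using d by blast
qed

text \<open>For every x in the ball, translating the kernel by -x and averaging at scale 1 gives the
  same number \<open>\<integral>k \<phi>\<close>; convexity keeps the segments in the ball. All
  values are compared with this one number, and the error depends on the energy alone, so limits
  with vanishing energy are locally constant.\<close>

lemma morrey_ball:
  fixes \<Omega> :: "'a::euclidean_space set"
  assumes \<Omega>: "open \<Omega>" and p: "real DIM('a) < p" and b: "ball z r \<subseteq> \<Omega>" "0 < r" and \<eta>: "0 < \<eta>"
  obtains \<delta> where "\<delta> > 0" "\<And>\<phi> x y. smooth \<phi> \<Longrightarrow> p_integral (lebesgue_on \<Omega>) p (grad \<phi>) \<le> ennreal \<delta> \<Longrightarrow>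
     x \<in> ball z r \<Longrightarrow> y \<in> ball z r \<Longrightarrow> \<bar>\<phi> x - \<phi> y\<bar> \<le> \<eta>"
proof -
  obtain k :: "'a \<Rightarrow> real" where k: "test_function (ball z r) k" "\<And>x. 0 \<le> k x" "(\<integral>x. k x \<partial>lborel) = 1"
    using bump_exists[OF b(2), of z] by auto
  obtain M where M: "\<And>x. \<bar>k x\<bar> \<le> M" "M \<ge> 0" using test_function_bounded[OF k(1)] by blast
  have kM: "k y \<le> M" for y using M(1)[of y] by linarith
  have DIM: "real DIM('a) \<ge> 1" using DIM_ge_Suc0[where 'a = 'a] by simp
  have p1: "1 \<le> p" "p > 0" using p DIM by linarith+
  define \<alpha> where "\<alpha> = 1 - real DIM('a) / p"
  have \<alpha>: "\<alpha> > 0" using p p1 by (simp add: \<alpha>_def)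
  define A where "A = 2 * r * (M + 1) powr (1 / p) / \<alpha>"
  have A: "A > 0" using b M \<alpha> by (simp add: A_def)
  \<comment> \<open>Then \<delta>^(1/p) = \<eta> / (2A), and the Morrey error is at most \<eta>/2
    for each of the two points. Using M + 1 in \<open>A\<close> ensures A > 0.\<close>
  define \<delta> where "\<delta> = (\<eta> / (2 * A)) powr p"
  have \<delta>: "\<delta> > 0" using \<eta> A by (simp add: \<delta>_def)
  have "\<bar>(\<integral>y. k y * \<phi> y \<partial>lborel) - \<phi> x\<bar> \<le> \<eta> / 2"
    if \<phi>: "smooth \<phi>" and G: "p_integral (lebesgue_on \<Omega>) p (grad \<phi>) \<le> ennreal \<delta>" and x: "x \<in> ball z r" for \<phi> x
  proof -
    have k': "test_function (ball (z - x) r) (\<lambda>y. k (y - (- x)))"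
      by (rule test_function_translate[OF k(1)]) (auto simp: dist_norm algebra_simps)
    have k1: "(\<integral>y. k (y - (- x)) \<partial>lborel) = 1"
      using lborel_affine_integral[of k 1 x] test_function_measurable[OF k(1)] k(3) by (simp add: add.commute)
    have "\<bar>(\<integral>y. k (y - (- x)) * \<phi> (x + 1 *\<^sub>R y) \<partial>lborel) - \<phi> x\<bar> \<le>
      \<bar>2 * r\<bar> * (M * \<delta>) powr (1 / p) * (1 powr (1 - real DIM('a) / p) / (1 - real DIM('a) / p))"
    proof (rule morrey[OF \<Omega> p k' k(2) kM k1 _ _ \<phi> G])
      fix y assume y: "y \<in> ball (z - x) r"
      have "norm y \<le> norm (y - (z - x)) + norm (z - x)" using norm_triangle_sub by (simp add: add.commute)
      then show "norm y \<le> 2 * r" using y x by (simp add: dist_norm norm_minus_commute)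
      fix t :: real assume t: "0 < t" "t < 1"
      have "x + y \<in> ball z r" using y by (simp add: dist_norm algebra_simps)
      then have "(1 - t) *\<^sub>R x + t *\<^sub>R (x + y) \<in> ball z r"
        using x t by (intro convexD[OF convex_ball]) auto
      moreover have "(1 - t) *\<^sub>R x + t *\<^sub>R (x + y) = x + t *\<^sub>R y" by (simp add: algebra_simps)
      ultimately show "x + t *\<^sub>R y \<in> \<Omega>" using b by auto
    qed (use \<delta> in auto)
    also have "\<dots> = 2 * r * (M powr (1 / p) / \<alpha>) * (\<eta> / (2 * A))"
      using b M p1 \<eta> A by (simp add: \<delta>_def powr_mult powr_powr \<alpha>_def)
    also have "\<dots> \<le> A * (\<eta> / (2 * A))"
    proof (rule mult_right_mono)
      have "M powr (1 / p) \<le> (M + 1) powr (1 / p)" using M p1 by (intro powr_mono2) auto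
      then show "2 * r * (M powr (1 / p) / \<alpha>) \<le> A"
        using b \<alpha> by (simp add: A_def divide_right_mono)
    qed (use \<eta> A in auto)
    also have "\<dots> = \<eta> / 2" using A by simp
    finally have "\<bar>(\<integral>y. k (y - (- x)) * \<phi> (x + 1 *\<^sub>R y) \<partial>lborel) - \<phi> x\<bar> \<le> \<eta> / 2" .
    moreover have "(\<integral>y. k (y - (- x)) * \<phi> (x + 1 *\<^sub>R y) \<partial>lborel) = (\<integral>y. k y * \<phi> y \<partial>lborel)"
      using lborel_affine_integral[of "\<lambda>y. k y * \<phi> y" 1 x] test_function_measurable[OF k(1)] smooth_measurable[OF \<phi>]
      by (simp add: add.commute)
    ultimately show ?thesis by simp
  qed
  note bd = this
  show thesis
  proof (rule that[OF \<delta>])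
    fix \<phi> x y
    assume "smooth \<phi>" "p_integral (lebesgue_on \<Omega>) p (grad \<phi>) \<le> ennreal \<delta>" "x \<in> ball z r" "y \<in> ball z r"
    then show "\<bar>\<phi> x - \<phi> y\<bar> \<le> \<eta>" using bd[of \<phi> x] bd[of \<phi> y] by linarith
  qed
qed

section \<open>Traces and reduction to smooth functions\<close>

locale robin_domain =
  fixes \<Omega> :: "'a::euclidean_space set" and p :: real
  assumes \<Omega>: "open \<Omega>" "bounded \<Omega>" "cone_domain \<Omega>" and nonempty: "\<Omega> \<noteq> {}" and p: "real DIM('a) < p"
begin

lemma p_gt_1: "1 < p"
proof -
  have "real DIM('a) \<ge> 1" using DIM_ge_Suc0[where 'a = 'a] by simp
  then show ?thesis using p by linarith
qed

lemma compact_closure: "compact (closure \<Omega>)"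
  using \<Omega>(2) by simp

lemma frontier_subset: "frontier \<Omega> \<subseteq> closure \<Omega>"
  by (simp add: frontier_def)

lemma \<Omega>_borel [measurable]: "\<Omega> \<in> sets borel"
  using \<Omega>(1) by (rule borel_open)

sublocale bd: finite_measure "boundary_measure \<Omega>"
  by (rule finite_boundary_measure[OF \<Omega>])

text \<open>Homogeneity: multiplying by c scales both p-integrals by c^p, so the sup bound for the
  family with bound 1 becomes smallness of the sup norm.\<close>

lemma small_sup:
  assumes "0 < \<eta>"
  obtains \<delta> where "0 < \<delta>" "\<And>\<phi> x. \<phi> \<in> W1p_bounded p \<Omega> \<delta> \<Longrightarrow> x \<in> closure \<Omega> \<Longrightarrow> \<bar>\<phi> x\<bar> \<le> \<eta>"
proof -
  obtain C where C: "\<And>\<phi> x. \<phi> \<in> W1p_bounded p \<Omega> 1 \<Longrightarrow> x \<in> closure \<Omega> \<Longrightarrow> \<bar>\<phi> x\<bar> \<le> C"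
    using W1p_bounded_sup[OF \<Omega> p, of 1] by auto
  define c where "c = (\<bar>C\<bar> + 1) / \<eta>"
  have c: "c > 0" using assms by (simp add: c_def add_nonneg_pos)
  have "\<bar>\<phi> x\<bar> \<le> \<eta>" if \<phi>: "\<phi> \<in> W1p_bounded p \<Omega> (c powr (- p))" and x: "x \<in> closure \<Omega>" for \<phi> x
  proof -
    have s: "smooth \<phi>" using \<phi> by (simp add: W1p_bounded_def)
    have one: "ennreal (c powr p) * ennreal (c powr (- p)) = ennreal 1"
      using c by (simp add: powr_minus flip: ennreal_mult)
    have "p_integral (lebesgue_on \<Omega>) p (\<lambda>x. c * \<phi> x) \<le> ennreal (c powr p) * p_integral (lebesgue_on \<Omega>) p \<phi>"
      using c p_gt_1 by (intro p_integral_mult_le borel_measurable_lebesgue_on smooth_measurable s) (auto simp: abs_mult)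
    also have "\<dots> \<le> ennreal (c powr p) * ennreal (c powr (- p))"
      using \<phi> by (intro mult_left_mono) (auto simp: W1p_bounded_def)
    finally have 1: "p_integral (lebesgue_on \<Omega>) p (\<lambda>x. c * \<phi> x) \<le> ennreal 1" unfolding one .
    have "p_integral (lebesgue_on \<Omega>) p (grad (\<lambda>x. c * \<phi> x)) \<le> ennreal (c powr p) * p_integral (lebesgue_on \<Omega>) p (grad \<phi>)"
      using c p_gt_1 by (intro p_integral_mult_le borel_measurable_lebesgue_on smooth_grad_measurable s) (auto simp: grad_cmult[OF s])
    also have "\<dots> \<le> ennreal (c powr p) * ennreal (c powr (- p))"
      using \<phi> by (intro mult_left_mono) (auto simp: W1p_bounded_def)
    finally have 2: "p_integral (lebesgue_on \<Omega>) p (grad (\<lambda>x. c * \<phi> x)) \<le> ennreal 1" unfolding one .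
    have "(\<lambda>x. c * \<phi> x) \<in> W1p_bounded p \<Omega> 1"
      unfolding W1p_bounded_def using 1 2 smooth_cmult[OF s] by blast
    then have "\<bar>c * \<phi> x\<bar> \<le> C" using C x by blast
    then have "c * \<bar>\<phi> x\<bar> \<le> C" using c by (simp add: abs_mult)
    moreover have "c * \<eta> = \<bar>C\<bar> + 1" using assms by (simp add: c_def)
    ultimately have "c * \<bar>\<phi> x\<bar> \<le> c * \<eta>" by linarith
    then show ?thesis using c by simp
  qed
  then show thesis using that[of "c powr (- p)"] c by auto
qed

text \<open>Convergence in the Sobolev norm of smooth functions to \<open>u\<close>, with a concrete
  weak gradient \<open>g\<close> in place of the choice \<open>weak_grad\<close>.\<close>

definition W1p_conv :: "(nat \<Rightarrow> 'a \<Rightarrow> real) \<Rightarrow> ('a \<Rightarrow> real) \<Rightarrow> ('a \<Rightarrow> 'a) \<Rightarrow> bool" where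
  "W1p_conv \<phi> u g \<longleftrightarrow> (\<forall>k. smooth (\<phi> k)) \<and> u \<in> Lp (lebesgue_on \<Omega>) p \<and> g \<in> Lp (lebesgue_on \<Omega>) p \<and>
     has_weak_gradient \<Omega> u g \<and>
     (\<lambda>k. p_integral (lebesgue_on \<Omega>) p (\<lambda>x. \<phi> k x - u x)) \<longlonglongrightarrow> 0 \<and>
     (\<lambda>k. p_integral (lebesgue_on \<Omega>) p (\<lambda>x. grad (\<phi> k) x - g x)) \<longlonglongrightarrow> 0"

lemma p_integral_diff_small:
  fixes f g h :: "'a \<Rightarrow> 'b::euclidean_space"
  assumes [measurable]: "f \<in> borel_measurable M" "g \<in> borel_measurable M" "h \<in> borel_measurable M"
    and "p_integral M p (\<lambda>x. f x - h x) < ennreal (\<delta> / (2 * 2 powr p))" "p_integral M p (\<lambda>x. g x - h x) < ennreal (\<delta> / (2 * 2 powr p))"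
    and "0 < \<delta>"
  shows "p_integral M p (\<lambda>x. f x - g x) \<le> ennreal \<delta>"
proof -
  have eq: "p_integral M p (\<lambda>x. - (g x - h x)) = p_integral M p (\<lambda>x. g x - h x)"
    unfolding p_integral_def norm_minus_cancel ..
  have "p_integral M p (\<lambda>x. f x - g x) = p_integral M p (\<lambda>x. (f x - h x) + - (g x - h x))" by simp
  also have "\<dots> \<le> ennreal (2 powr p) * (p_integral M p (\<lambda>x. f x - h x) + p_integral M p (\<lambda>x. - (g x - h x)))"
    using p_gt_1 by (intro p_integral_add_le) auto
  also have "\<dots> \<le> ennreal (2 powr p) * (ennreal (\<delta> / (2 * 2 powr p)) + ennreal (\<delta> / (2 * 2 powr p)))"
    unfolding eq using assms(4,5) by (intro mult_left_mono add_mono less_imp_le) auto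
  also have "\<dots> = ennreal \<delta>"
    using assms(6) by (simp flip: ennreal_plus ennreal_mult)
  finally show ?thesis .
qed

text \<open>Two sequences with the same limit are compared at once: taking them equal yields the
  uniform Cauchy property, taking them different shows that the boundary values do not depend on the
  sequence.\<close>

lemma W1p_conv_cauchy:
  assumes \<phi>: "W1p_conv \<phi> u g" and \<psi>: "W1p_conv \<psi> u g" and \<delta>: "0 < \<delta>"
  shows "\<exists>K. \<forall>k\<ge>K. \<forall>l\<ge>K. (\<lambda>x. \<phi> k x - \<psi> l x) \<in> W1p_bounded p \<Omega> \<delta>"
proof -
  define d where "d = \<delta> / (2 * 2 powr p)"
  have d: "ennreal d > 0" using \<delta> by (simp add: d_def)
  have ev: "\<forall>\<^sub>F k in sequentially. p_integral (lebesgue_on \<Omega>) p (\<lambda>x. \<phi> k x - u x) < ennreal d"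
    "\<forall>\<^sub>F k in sequentially. p_integral (lebesgue_on \<Omega>) p (\<lambda>x. grad (\<phi> k) x - g x) < ennreal d"
    "\<forall>\<^sub>F k in sequentially. p_integral (lebesgue_on \<Omega>) p (\<lambda>x. \<psi> k x - u x) < ennreal d"
    "\<forall>\<^sub>F k in sequentially. p_integral (lebesgue_on \<Omega>) p (\<lambda>x. grad (\<psi> k) x - g x) < ennreal d"
    using \<phi> \<psi> d unfolding W1p_conv_def by (auto intro: order_tendstoD(2)[of _ 0])
  have "\<forall>\<^sub>F k in sequentially. p_integral (lebesgue_on \<Omega>) p (\<lambda>x. \<phi> k x - u x) < ennreal d \<and>
     p_integral (lebesgue_on \<Omega>) p (\<lambda>x. grad (\<phi> k) x - g x) < ennreal d \<and>
     p_integral (lebesgue_on \<Omega>) p (\<lambda>x. \<psi> k x - u x) < ennreal d \<and>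
     p_integral (lebesgue_on \<Omega>) p (\<lambda>x. grad (\<psi> k) x - g x) < ennreal d"
    by (intro eventually_conj ev)
  then obtain K where K: "\<And>k. k \<ge> K \<Longrightarrow> p_integral (lebesgue_on \<Omega>) p (\<lambda>x. \<phi> k x - u x) < ennreal d \<and>
     p_integral (lebesgue_on \<Omega>) p (\<lambda>x. grad (\<phi> k) x - g x) < ennreal d \<and>
     p_integral (lebesgue_on \<Omega>) p (\<lambda>x. \<psi> k x - u x) < ennreal d \<and>
     p_integral (lebesgue_on \<Omega>) p (\<lambda>x. grad (\<psi> k) x - g x) < ennreal d"
    unfolding eventually_sequentially by blast
  have s: "smooth (\<phi> k)" "smooth (\<psi> k)" for k using \<phi> \<psi> unfolding W1p_conv_def by auto
  have m: "u \<in> borel_measurable (lebesgue_on \<Omega>)" "g \<in> borel_measurable (lebesgue_on \<Omega>)"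
    using \<phi> unfolding W1p_conv_def Lp_def by auto
  have "(\<lambda>x. \<phi> k x - \<psi> l x) \<in> W1p_bounded p \<Omega> \<delta>" if "k \<ge> K" "l \<ge> K" for k l
  proof -
    have "p_integral (lebesgue_on \<Omega>) p (\<lambda>x. \<phi> k x - \<psi> l x) \<le> ennreal \<delta>"
      by (rule p_integral_diff_small[where h = u])
        (use K[OF that(1)] K[OF that(2)] m s \<delta> in \<open>auto simp: d_def intro: borel_measurable_lebesgue_on smooth_measurable\<close>)
    moreover have "p_integral (lebesgue_on \<Omega>) p (\<lambda>x. grad (\<phi> k) x - grad (\<psi> l) x) \<le> ennreal \<delta>"
      by (rule p_integral_diff_small[where h = g])
        (use K[OF that(1)] K[OF that(2)] m s \<delta> in \<open>auto simp: d_def intro: borel_measurable_lebesgue_on smooth_grad_measurable\<close>)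
    moreover have "grad (\<lambda>x. \<phi> k x - \<psi> l x) = (\<lambda>x. grad (\<phi> k) x - grad (\<psi> l) x)"
      using grad_diff[OF s] by (rule ext)
    ultimately show ?thesis
      unfolding W1p_bounded_def using smooth_diff[OF s] by auto
  qed
  then show ?thesis by blast
qed

lemma W1p_conv_sup:
  assumes \<phi>: "W1p_conv \<phi> u g" and \<psi>: "W1p_conv \<psi> u g" and \<eta>: "0 < \<eta>"
  shows "\<exists>K. \<forall>k\<ge>K. \<forall>l\<ge>K. \<forall>x\<in>closure \<Omega>. \<bar>\<phi> k x - \<psi> l x\<bar> \<le> \<eta>"
proof -
  obtain \<delta> where \<delta>: "0 < \<delta>" "\<And>\<phi> x. \<phi> \<in> W1p_bounded p \<Omega> \<delta> \<Longrightarrow> x \<in> closure \<Omega> \<Longrightarrow> \<bar>\<phi> x\<bar> \<le> \<eta>"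
    using small_sup[OF \<eta>] by blast
  then show ?thesis using W1p_conv_cauchy[OF \<phi> \<psi> \<delta>(1)] by blast
qed

lemma W1p_conv_uniform_limit:
  assumes \<phi>: "W1p_conv \<phi> u g"
  obtains w where "uniform_limit (closure \<Omega>) \<phi> w sequentially" "continuous_on (closure \<Omega>) w"
proof -
  have "uniformly_Cauchy_on (closure \<Omega>) \<phi>"
    unfolding uniformly_Cauchy_on_def
  proof (intro allI impI)
    fix e :: real assume "e > 0"
    then obtain K where "\<forall>k\<ge>K. \<forall>l\<ge>K. \<forall>x\<in>closure \<Omega>. \<bar>\<phi> k x - \<phi> l x\<bar> \<le> e / 2"
      using W1p_conv_sup[OF \<phi> \<phi>, of "e / 2"] by auto
    then show "\<exists>M. \<forall>x\<in>closure \<Omega>. \<forall>m\<ge>M. \<forall>n\<ge>M. dist (\<phi> m x) (\<phi> n x) < e"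
      using \<open>e > 0\<close> by (intro exI[of _ K]) (fastforce simp: dist_real_def)
  qed
  then have "uniformly_convergent_on (closure \<Omega>) \<phi>" by (rule Cauchy_uniformly_convergent)
  then obtain w where w: "uniform_limit (closure \<Omega>) \<phi> w sequentially"
    unfolding uniformly_convergent_on_def by blast
  have "continuous_on (closure \<Omega>) w"
  proof (rule uniform_limit_theorem[OF _ w])
    show "\<forall>\<^sub>F k in sequentially. continuous_on (closure \<Omega>) (\<phi> k)"
      using \<phi> unfolding W1p_conv_def by (auto intro!: always_eventually smooth_continuous)
  qed simp
  then show thesis using that w by blast
qed

lemma boundary_p_integral_le:
  fixes f :: "'a \<Rightarrow> real"
  assumes "\<And>x. x \<in> frontier \<Omega> \<Longrightarrow> \<bar>f x\<bar> \<le> \<eta>" "0 \<le> \<eta>"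
  shows "p_integral (boundary_measure \<Omega>) p f \<le> ennreal (\<eta> powr p * measure (boundary_measure \<Omega>) (frontier \<Omega>))"
proof -
  have "p_integral (boundary_measure \<Omega>) p f \<le> (\<integral>\<^sup>+x. ennreal (\<eta> powr p) \<partial>boundary_measure \<Omega>)"
    unfolding p_integral_def
    by (intro nn_integral_mono ennreal_leI powr_mono2) (use assms p_gt_1 in \<open>auto simp: space_boundary_measure\<close>)
  also have "\<dots> = ennreal (\<eta> powr p * measure (boundary_measure \<Omega>) (frontier \<Omega>))"
    by (simp add: space_boundary_measure bd.emeasure_eq_measure ennreal_mult)
  finally show ?thesis .
qed

lemma boundary_p_integral_tendsto:
  fixes f :: "nat \<Rightarrow> 'a \<Rightarrow> real"
  assumes "\<And>\<eta>. 0 < \<eta> \<Longrightarrow> \<exists>K. \<forall>k\<ge>K. \<forall>x\<in>frontier \<Omega>. \<bar>f k x\<bar> \<le> \<eta>"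
  shows "(\<lambda>k. p_integral (boundary_measure \<Omega>) p (f k)) \<longlonglongrightarrow> 0"
  unfolding order_tendsto_iff
proof (intro conjI allI impI)
  define m where "m = measure (boundary_measure \<Omega>) (frontier \<Omega>)"
  fix e :: ennreal assume "0 < e"
  show "\<forall>\<^sub>F k in sequentially. p_integral (boundary_measure \<Omega>) p (f k) < e"
  proof -
    obtain d where d: "0 < d" "d < e" using dense[OF \<open>0 < e\<close>] by blast
    then obtain e' where "d = ennreal e'" "0 \<le> e'" by (cases d) auto
    with d have e': "0 < e'" "ennreal e' < e" by auto
    define \<eta> where "\<eta> = (e' / (m + 1)) powr (1 / p)"
    have m: "m \<ge> 0" by (simp add: m_def)
    have \<eta>: "\<eta> > 0" using e' m by (simp add: \<eta>_def)
    obtain K where K: "\<And>k x. k \<ge> K \<Longrightarrow> x \<in> frontier \<Omega> \<Longrightarrow> \<bar>f k x\<bar> \<le> \<eta>" using assms[OF \<eta>] by blast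
    have "\<eta> powr p * m \<le> e'"
      using e' m p_gt_1 by (simp add: \<eta>_def powr_powr divide_simps)
    then have le: "ennreal (\<eta> powr p * m) < e" using e'(2) by (meson ennreal_leI le_less_trans)
    have "p_integral (boundary_measure \<Omega>) p (f k) < e" if "k \<ge> K" for k
      using boundary_p_integral_le[of "f k" \<eta>, OF K[OF that]] \<eta> le unfolding m_def
      by (meson le_less_trans less_imp_le)
    then show ?thesis unfolding eventually_sequentially by blast
  qed
qed auto

text \<open>The uniform limit \<open>w\<close> is a trace, hence the choice
  \<open>bdry_trace\<close> is a trace too. Any sequence approximating \<open>u\<close> for that
  trace is uniformly close to \<phi> on the closure, so it also tends to \<open>w\<close> uniformly;
  the two limits agree almost everywhere on the boundary.\<close>

lemma trace_unique:
  assumes \<phi>: "W1p_conv \<phi> u g" and w: "uniform_limit (closure \<Omega>) \<phi> w sequentially" "continuous_on (closure \<Omega>) w"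
  shows "AE x in boundary_measure \<Omega>. bdry_trace p \<Omega> u x = w x"
proof -
  have s: "smooth (\<phi> k)" for k using \<phi> unfolding W1p_conv_def by auto
  have g: "has_weak_gradient \<Omega> u g" using \<phi> unfolding W1p_conv_def by auto
  have wg: "p_integral (lebesgue_on \<Omega>) p (weak_grad \<Omega> (\<lambda>x. \<psi> x - u x)) = p_integral (lebesgue_on \<Omega>) p (\<lambda>x. grad \<psi> x - g x)"
    if "smooth \<psi>" for \<psi>
    by (rule p_integral_cong_AE, rule weak_grad_AE[OF \<Omega>(1)],
      rule has_weak_gradient_diff[OF has_weak_gradient_smooth[OF \<Omega>(1) that] g])
  have wmeas: "w \<in> borel_measurable (boundary_measure \<Omega>)"
    by (rule continuous_on_boundary_measurable[OF continuous_on_subset[OF w(2) frontier_subset]])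
  have smeas: "\<psi> \<in> borel_measurable (boundary_measure \<Omega>)" if "smooth \<psi>" for \<psi>
    by (rule continuous_on_boundary_measurable[OF smooth_continuous[OF that]])
  obtain W where W: "\<And>x. x \<in> closure \<Omega> \<Longrightarrow> \<bar>w x\<bar> \<le> W"
    using compact_imp_bounded[OF compact_continuous_image[OF w(2) compact_closure]] unfolding bounded_iff by auto
  have "w \<in> Lp (boundary_measure \<Omega>) p"
  proof -
    have "p_integral (boundary_measure \<Omega>) p w \<le> ennreal (\<bar>W\<bar> powr p * measure (boundary_measure \<Omega>) (frontier \<Omega>))"
      by (rule boundary_p_integral_le) (use W frontier_subset in force)+
    then show ?thesis using wmeas le_less_trans[OF _ ennreal_less_top] by (simp add: Lp_def)
  qed
  moreover have phiw: "\<exists>K. \<forall>k\<ge>K. \<forall>x\<in>frontier \<Omega>. \<bar>\<phi> k x - w x\<bar> \<le> \<eta>" if "0 < \<eta>" for \<eta>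
  proof -
    have "\<forall>\<^sub>F k in sequentially. \<forall>x\<in>closure \<Omega>. dist (\<phi> k x) (w x) < \<eta>"
      using w(1) that unfolding uniform_limit_iff by blast
    then obtain K where "\<And>k x. k \<ge> K \<Longrightarrow> x \<in> closure \<Omega> \<Longrightarrow> dist (\<phi> k x) (w x) < \<eta>"
      unfolding eventually_sequentially by blast
    then show ?thesis using frontier_subset by (intro exI[of _ K]) (auto simp: dist_real_def intro!: less_imp_le)
  qed
  moreover have "(\<lambda>k. W1p_norm_powr p \<Omega> (\<lambda>x. \<phi> k x - u x)) \<longlonglongrightarrow> 0"
    using tendsto_add[of "\<lambda>k. p_integral (lebesgue_on \<Omega>) p (\<lambda>x. \<phi> k x - u x)" 0 sequentially
       "\<lambda>k. p_integral (lebesgue_on \<Omega>) p (\<lambda>x. grad (\<phi> k) x - g x)" 0] \<phi>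
    unfolding W1p_norm_powr_def wg[OF s] W1p_conv_def by simp
  ultimately have "is_trace p \<Omega> u w"
    unfolding is_trace_def using s boundary_p_integral_tendsto[of "\<lambda>k x. \<phi> k x - w x"] by blast
  then have T: "is_trace p \<Omega> u (bdry_trace p \<Omega> u)"
    unfolding bdry_trace_def by (rule someI[of "is_trace p \<Omega> u"])
  define T where "T = bdry_trace p \<Omega> u"
  \<comment> \<open>The sequence that witnesses the chosen trace; it is unrelated to \<phi> except
    through their common Sobolev limit \<open>u\<close>.\<close>
  obtain \<psi> where \<psi>: "\<And>k. smooth (\<psi> k)" "(\<lambda>k. W1p_norm_powr p \<Omega> (\<lambda>x. \<psi> k x - u x)) \<longlonglongrightarrow> 0"
    "(\<lambda>k. p_integral (boundary_measure \<Omega>) p (\<lambda>x. \<psi> k x - T x)) \<longlonglongrightarrow> 0"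
    using T unfolding is_trace_def T_def by blast
  have Tmeas: "T \<in> borel_measurable (boundary_measure \<Omega>)" using T unfolding is_trace_def T_def Lp_def by auto
  have c\<psi>: "W1p_conv \<psi> u g"
  proof -
    have "(\<lambda>k. p_integral (lebesgue_on \<Omega>) p (\<lambda>x. \<psi> k x - u x)) \<longlonglongrightarrow> 0"
      by (rule tendsto_sandwich[OF _ _ tendsto_const \<psi>(2)]) (auto simp: W1p_norm_powr_def)
    moreover have "(\<lambda>k. p_integral (lebesgue_on \<Omega>) p (\<lambda>x. grad (\<psi> k) x - g x)) \<longlonglongrightarrow> 0"
      by (rule tendsto_sandwich[OF _ _ tendsto_const \<psi>(2)]) (auto simp: W1p_norm_powr_def wg[OF \<psi>(1)])
    ultimately show ?thesis using \<phi> \<psi>(1) unfolding W1p_conv_def by blast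
  qed
  have "(\<lambda>k. p_integral (boundary_measure \<Omega>) p (\<lambda>x. \<psi> k x - w x)) \<longlonglongrightarrow> 0"
  proof (rule boundary_p_integral_tendsto)
    fix \<eta> :: real assume \<eta>: "0 < \<eta>"
    obtain K1 where K1: "\<forall>k\<ge>K1. \<forall>x\<in>frontier \<Omega>. \<bar>\<phi> k x - w x\<bar> \<le> \<eta> / 2" using phiw[of "\<eta> / 2"] \<eta> by auto
    obtain K2 where K2: "\<forall>k\<ge>K2. \<forall>l\<ge>K2. \<forall>x\<in>closure \<Omega>. \<bar>\<phi> k x - \<psi> l x\<bar> \<le> \<eta> / 2"
      using W1p_conv_sup[OF \<phi> c\<psi>, of "\<eta> / 2"] \<eta> by auto
    have "\<bar>\<psi> k x - w x\<bar> \<le> \<eta>" if "k \<ge> max K1 K2" "x \<in> frontier \<Omega>" for k x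
    proof -
      have "\<bar>\<phi> k x - w x\<bar> \<le> \<eta> / 2" using K1 that by auto
      moreover have "\<bar>\<phi> k x - \<psi> k x\<bar> \<le> \<eta> / 2" using K2 that frontier_subset by auto
      ultimately show ?thesis by linarith
    qed
    then show "\<exists>K. \<forall>k\<ge>K. \<forall>x\<in>frontier \<Omega>. \<bar>\<psi> k x - w x\<bar> \<le> \<eta>" by blast
  qed
  note lim = tendsto_add[OF \<psi>(3) this]
  have le: "p_integral (boundary_measure \<Omega>) p (\<lambda>x. T x - w x) \<le> ennreal e" if "0 < e" for e
  proof -
    have pos: "0 < ennreal (e / (2 * 2 powr p))" using that by simp
    have "\<forall>\<^sub>F k in sequentially. p_integral (boundary_measure \<Omega>) p (\<lambda>x. \<psi> k x - T x) +
      p_integral (boundary_measure \<Omega>) p (\<lambda>x. \<psi> k x - w x) < ennreal (e / (2 * 2 powr p))"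
      using order_tendstoD(2)[OF lim, of "ennreal (e / (2 * 2 powr p))"] pos by simp
    then obtain k where k: "p_integral (boundary_measure \<Omega>) p (\<lambda>x. \<psi> k x - T x) +
      p_integral (boundary_measure \<Omega>) p (\<lambda>x. \<psi> k x - w x) < ennreal (e / (2 * 2 powr p))"
      using eventually_happens'[OF sequentially_bot] by auto
    have flip: "p_integral (boundary_measure \<Omega>) p (\<lambda>x. v x - \<psi> k x) = p_integral (boundary_measure \<Omega>) p (\<lambda>x. \<psi> k x - v x)" for v
      unfolding p_integral_def by (simp add: norm_minus_commute[of "v _"] abs_minus_commute[of "v _"])
    have "p_integral (boundary_measure \<Omega>) p (\<lambda>x. T x - \<psi> k x) < ennreal (e / (2 * 2 powr p))"
      "p_integral (boundary_measure \<Omega>) p (\<lambda>x. w x - \<psi> k x) < ennreal (e / (2 * 2 powr p))"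
      unfolding flip by (rule le_less_trans[OF _ k], simp)+
    then show ?thesis
      using p_integral_diff_small[OF Tmeas wmeas smeas[OF \<psi>(1)] _ _ that] by blast
  qed
  have "p_integral (boundary_measure \<Omega>) p (\<lambda>x. T x - w x) \<le> 0"
  proof (rule ennreal_le_epsilon)
    fix e :: real assume "0 < e"
    from le[OF this] show "p_integral (boundary_measure \<Omega>) p (\<lambda>x. T x - w x) \<le> 0 + ennreal e" by simp
  qed
  then have zero: "(\<integral>\<^sup>+x. ennreal (norm (T x - w x) powr p) \<partial>boundary_measure \<Omega>) = 0"
    by (simp add: p_integral_def)
  have "(\<lambda>x. ennreal (norm (T x - w x) powr p)) \<in> borel_measurable (boundary_measure \<Omega>)"
    using Tmeas wmeas by measurable
  from nn_integral_0_iff_AE[OF this] zero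
  have "AE x in boundary_measure \<Omega>. ennreal (norm (T x - w x) powr p) = 0" by blast
  then show ?thesis
    unfolding T_def by eventually_elim (simp add: ennreal_eq_0_iff)
qed

lemma W1p_conv_exists:
  assumes u: "u \<in> W1p p \<Omega>"
  obtains \<phi> g where "W1p_conv \<phi> u g"
    "p_integral (lebesgue_on \<Omega>) p (weak_grad \<Omega> u) = p_integral (lebesgue_on \<Omega>) p g"
proof -
  obtain g where g: "has_weak_gradient \<Omega> u g" "g \<in> Lp (lebesgue_on \<Omega>) p" and uL: "u \<in> Lp (lebesgue_on \<Omega>) p"
    using u unfolding W1p_def by blast
  have ae: "AE x in lebesgue_on \<Omega>. weak_grad \<Omega> u x = g x" by (rule weak_grad_AE[OF \<Omega>(1) g(1)])
  have "\<exists>\<phi>. smooth \<phi> \<and> p_integral (lebesgue_on \<Omega>) p (\<lambda>x. \<phi> x - u x) +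
     p_integral (lebesgue_on \<Omega>) p (\<lambda>x. grad \<phi> x - weak_grad \<Omega> u x) < ennreal (1 / real (Suc k))" for k
    using smooth_dense_W1p[OF \<Omega> less_imp_le[OF p_gt_1] u, of "1 / real (Suc k)"] by (metis of_nat_0_less_iff zero_less_Suc zero_less_divide_1_iff)
  then obtain \<phi> where \<phi>: "\<And>k. smooth (\<phi> k)" "\<And>k. p_integral (lebesgue_on \<Omega>) p (\<lambda>x. \<phi> k x - u x) +
     p_integral (lebesgue_on \<Omega>) p (\<lambda>x. grad (\<phi> k) x - weak_grad \<Omega> u x) < ennreal (1 / real (Suc k))"
    by metis
  have lim: "(\<lambda>k. ennreal (1 / real (Suc k))) \<longlonglongrightarrow> 0"
  proof -
    have "(\<lambda>k. 1 / real (Suc k)) \<longlonglongrightarrow> 0" using LIMSEQ_inverse_real_of_nat by (simp add: inverse_eq_divide)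
    then show ?thesis using tendsto_ennrealI by fastforce
  qed
  have eq: "p_integral (lebesgue_on \<Omega>) p (\<lambda>x. grad (\<phi> k) x - g x) = p_integral (lebesgue_on \<Omega>) p (\<lambda>x. grad (\<phi> k) x - weak_grad \<Omega> u x)" for k
    by (rule p_integral_cong_AE) (use ae in \<open>eventually_elim, simp\<close>)
  have le: "p_integral (lebesgue_on \<Omega>) p (\<lambda>x. \<phi> k x - u x) \<le> ennreal (1 / real (Suc k))"
    "p_integral (lebesgue_on \<Omega>) p (\<lambda>x. grad (\<phi> k) x - weak_grad \<Omega> u x) \<le> ennreal (1 / real (Suc k))" for k
    by (rule order.trans[OF _ less_imp_le[OF \<phi>(2)[of k]]], simp)+
  have "(\<lambda>k. p_integral (lebesgue_on \<Omega>) p (\<lambda>x. \<phi> k x - u x)) \<longlonglongrightarrow> 0"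
    by (rule tendsto_sandwich[OF _ _ tendsto_const lim]) (use le in \<open>auto intro!: always_eventually simp del: of_nat_Suc\<close>)
  moreover have "(\<lambda>k. p_integral (lebesgue_on \<Omega>) p (\<lambda>x. grad (\<phi> k) x - g x)) \<longlonglongrightarrow> 0"
    unfolding eq by (rule tendsto_sandwich[OF _ _ tendsto_const lim]) (use le in \<open>auto intro!: always_eventually simp del: of_nat_Suc\<close>)
  ultimately have "W1p_conv \<phi> u g" unfolding W1p_conv_def using \<phi>(1) uL g by blast
  moreover have "p_integral (lebesgue_on \<Omega>) p (weak_grad \<Omega> u) = p_integral (lebesgue_on \<Omega>) p g"
    by (rule p_integral_cong_AE[OF ae])
  ultimately show thesis using that by blast
qed

section \<open>Reduction of the eigenvalue to real integrals of smooth functions\<close>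

definition dom_int :: "('a \<Rightarrow> real) \<Rightarrow> real" where
  "dom_int h = (\<integral>x. indicator \<Omega> x * h x \<partial>lborel)"

abbreviation "mass \<phi> \<equiv> dom_int (\<lambda>x. \<bar>\<phi> x\<bar> powr p)"
abbreviation "energy \<phi> \<equiv> dom_int (\<lambda>x. norm (grad \<phi> x) powr p)"

definition bdry_energy :: "('a \<Rightarrow> real) \<Rightarrow> ('a \<Rightarrow> real) \<Rightarrow> real" where
  "bdry_energy \<sigma> \<phi> = (\<integral>x. \<sigma> x * \<bar>\<phi> x\<bar> powr p \<partial>boundary_measure \<Omega>)"

lemma dom_integrable:
  fixes h :: "'a \<Rightarrow> real"
  assumes "continuous_on (closure \<Omega>) h" shows "integrable lborel (\<lambda>x. indicator \<Omega> x * h x)"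
proof -
  have "integrable lborel (\<lambda>x. indicator (closure \<Omega>) x *\<^sub>R h x)"
    by (rule borel_integrable_compact[OF compact_closure assms])
  then have "integrable lborel (\<lambda>x. indicator \<Omega> x * (indicator (closure \<Omega>) x *\<^sub>R h x))"
    by (rule integrable_mult_bounded[where B = 1]) (auto simp: indicator_def)
  moreover have "indicator \<Omega> x * (indicator (closure \<Omega>) x *\<^sub>R h x) = indicator \<Omega> x * h x" for x
    using closure_subset by (auto simp: indicator_def)
  ultimately show ?thesis by (simp only:)
qed

lemma p_integral_dom:
  fixes f :: "'a \<Rightarrow> 'b::euclidean_space"
  assumes "continuous_on (closure \<Omega>) f"
  shows "p_integral (lebesgue_on \<Omega>) p f = ennreal (dom_int (\<lambda>x. norm (f x) powr p))"
proof -
  have c: "continuous_on (closure \<Omega>) (\<lambda>x. norm (f x) powr p)"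
    by (intro continuous_on_powr' continuous_intros assms) (use p_gt_1 in auto)
  have "p_integral (lebesgue_on \<Omega>) p f = (\<integral>\<^sup>+x. ennreal (indicator \<Omega> x * norm (f x) powr p) \<partial>lborel)"
    unfolding p_integral_def nn_integral_lebesgue_on[OF \<Omega>(1)]
    by (intro nn_integral_cong) (auto simp: indicator_def)
  also have "\<dots> = ennreal (dom_int (\<lambda>x. norm (f x) powr p))"
    unfolding dom_int_def by (rule nn_integral_eq_integral[OF dom_integrable[OF c]]) (auto simp: indicator_def)
  finally show ?thesis .
qed

lemma p_integral_mass: "smooth \<phi> \<Longrightarrow> p_integral (lebesgue_on \<Omega>) p \<phi> = ennreal (mass \<phi>)"
  using p_integral_dom[OF smooth_continuous, of \<phi>] by simp

lemma p_integral_energy: "smooth \<phi> \<Longrightarrow> p_integral (lebesgue_on \<Omega>) p (grad \<phi>) = ennreal (energy \<phi>)"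
  using p_integral_dom[OF smooth_grad_continuous, of \<phi>] by simp

lemma dom_int_nonneg: "(\<And>x. 0 \<le> h x) \<Longrightarrow> 0 \<le> dom_int h"
  unfolding dom_int_def by (rule Bochner_Integration.integral_nonneg) simp

lemma mass_nonneg: "0 \<le> mass \<phi>" and energy_nonneg: "0 \<le> energy \<phi>"
  by (auto intro: dom_int_nonneg)

lemma dom_int_mono:
  assumes "continuous_on (closure \<Omega>) f" "continuous_on (closure \<Omega>) g" "\<And>x. x \<in> \<Omega> \<Longrightarrow> f x \<le> g x"
  shows "dom_int f \<le> dom_int g"
  unfolding dom_int_def
  by (rule integral_mono[OF dom_integrable[OF assms(1)] dom_integrable[OF assms(2)]]) (use assms(3) in \<open>auto simp: indicator_def\<close>)

lemma dom_int_add: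
  assumes "continuous_on (closure \<Omega>) f" "continuous_on (closure \<Omega>) g"
  shows "dom_int (\<lambda>x. f x + g x) = dom_int f + dom_int g"
  unfolding dom_int_def using dom_integrable[OF assms(1)] dom_integrable[OF assms(2)]
  by (simp add: distrib_left)

lemma dom_int_cmult: "dom_int (\<lambda>x. c * f x) = c * dom_int f"
proof -
  have "(\<lambda>x. indicator \<Omega> x * (c * f x)) = (\<lambda>x. c * (indicator \<Omega> x * f x))" by (auto simp: mult_ac)
  then show ?thesis unfolding dom_int_def by simp
qed

lemma boundary_weight_integrable:
  assumes \<sigma>: "integrable (boundary_measure \<Omega>) \<sigma>" and w: "continuous_on (frontier \<Omega>) w"
  shows "integrable (boundary_measure \<Omega>) (\<lambda>x. \<sigma> x * \<bar>w x\<bar> powr p)"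
proof -
  have c: "continuous_on (frontier \<Omega>) (\<lambda>x. \<bar>w x\<bar> powr p)"
    by (intro continuous_on_powr' continuous_intros w) (use p_gt_1 in auto)
  obtain B where B: "\<And>x. x \<in> frontier \<Omega> \<Longrightarrow> \<bar>\<bar>w x\<bar> powr p\<bar> \<le> B"
    using compact_imp_bounded[OF compact_continuous_image[OF c compact_frontier_bounded[OF \<Omega>(2)]]] unfolding bounded_iff by auto
  show ?thesis
  proof (rule Bochner_Integration.integrable_bound)
    show "integrable (boundary_measure \<Omega>) (\<lambda>x. B * \<sigma> x)" using \<sigma> by simp
    show "(\<lambda>x. \<sigma> x * \<bar>w x\<bar> powr p) \<in> borel_measurable (boundary_measure \<Omega>)"
      using \<sigma> continuous_on_boundary_measurable[OF c] by simp
    show "AE x in boundary_measure \<Omega>. norm (\<sigma> x * \<bar>w x\<bar> powr p) \<le> norm (B * \<sigma> x)"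
    proof (rule AE_I2)
      fix x assume "x \<in> space (boundary_measure \<Omega>)"
      then have "\<bar>w x\<bar> powr p \<le> \<bar>B\<bar>" using B[of x] by (simp add: space_boundary_measure)
      from mult_right_mono[OF this abs_ge_zero[of "\<sigma> x"]]
      show "norm (\<sigma> x * \<bar>w x\<bar> powr p) \<le> norm (B * \<sigma> x)"
        by (simp add: abs_mult mult.commute)
    qed
  qed
qed

lemma Sigma_mD:
  assumes "\<sigma> \<in> Sigma_m m \<Omega>"
  shows "integrable (boundary_measure \<Omega>) \<sigma>" "AE x in boundary_measure \<Omega>. 0 \<le> \<sigma> x"
    "(\<integral>x. \<sigma> x \<partial>boundary_measure \<Omega>) = m"
  using assms unfolding Sigma_m_def by auto

lemma boundary_nn_integral:
  assumes \<sigma>: "\<sigma> \<in> Sigma_m m \<Omega>" and w: "continuous_on (frontier \<Omega>) w"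
    and ae: "AE x in boundary_measure \<Omega>. T x = w x"
  shows "(\<integral>\<^sup>+x. ennreal (\<sigma> x * \<bar>T x\<bar> powr p) \<partial>boundary_measure \<Omega>) = ennreal (bdry_energy \<sigma> w)" "0 \<le> bdry_energy \<sigma> w"
proof -
  have nn: "AE x in boundary_measure \<Omega>. 0 \<le> \<sigma> x * \<bar>w x\<bar> powr p"
    using Sigma_mD(2)[OF \<sigma>] by eventually_elim simp
  have "(\<integral>\<^sup>+x. ennreal (\<sigma> x * \<bar>T x\<bar> powr p) \<partial>boundary_measure \<Omega>) = (\<integral>\<^sup>+x. ennreal (\<sigma> x * \<bar>w x\<bar> powr p) \<partial>boundary_measure \<Omega>)"
    by (rule nn_integral_cong_AE) (use ae in \<open>eventually_elim, simp\<close>)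
  also have "\<dots> = ennreal (bdry_energy \<sigma> w)"
    unfolding bdry_energy_def by (rule nn_integral_eq_integral[OF boundary_weight_integrable[OF Sigma_mD(1)[OF \<sigma>] w] nn])
  finally show "(\<integral>\<^sup>+x. ennreal (\<sigma> x * \<bar>T x\<bar> powr p) \<partial>boundary_measure \<Omega>) = ennreal (bdry_energy \<sigma> w)" .
  show "0 \<le> bdry_energy \<sigma> w" unfolding bdry_energy_def by (rule integral_nonneg_AE[OF nn])
qed

lemma W1p_conv_smooth:
  assumes "smooth \<phi>" shows "W1p_conv (\<lambda>k. \<phi>) \<phi> (grad \<phi>)"
proof -
  have "p_integral (lebesgue_on \<Omega>) p \<phi> < \<infinity>" "p_integral (lebesgue_on \<Omega>) p (grad \<phi>) < \<infinity>"
    using p_integral_mass[OF assms] p_integral_energy[OF assms] by simp_all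
  then show ?thesis
    unfolding W1p_conv_def Lp_def
    using assms has_weak_gradient_smooth[OF \<Omega>(1) assms] p_gt_1
    by (auto simp: p_integral_def intro: borel_measurable_lebesgue_on smooth_measurable smooth_grad_measurable)
qed

text \<open>First half of the reduction to smooth functions. The constant sequence identifies the
  chosen trace of \<phi> with \<phi> itself, and the quotient becomes one of real numbers.\<close>

lemma ell1_le_smooth:
  assumes \<sigma>: "\<sigma> \<in> Sigma_m m \<Omega>" and \<phi>: "smooth \<phi>" and N: "0 < mass \<phi>"
  shows "ell1 p \<Omega> \<sigma> \<le> ennreal ((energy \<phi> + bdry_energy \<sigma> \<phi>) / mass \<phi>)"
proof -
  have conv: "W1p_conv (\<lambda>k. \<phi>) \<phi> (grad \<phi>)" by (rule W1p_conv_smooth[OF \<phi>])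
  have W: "\<phi> \<in> W1p p \<Omega>" using conv unfolding W1p_conv_def W1p_def by blast
  have cf: "continuous_on (frontier \<Omega>) \<phi>" by (rule smooth_continuous[OF \<phi>])
  have tr: "AE x in boundary_measure \<Omega>. bdry_trace p \<Omega> \<phi> x = \<phi> x"
    by (rule trace_unique[OF conv]) (auto simp: smooth_continuous[OF \<phi>] uniform_limit_iff)
  have nz: "\<not> (AE x in lebesgue_on \<Omega>. \<phi> x = 0)"
  proof
    assume "AE x in lebesgue_on \<Omega>. \<phi> x = 0"
    then have "p_integral (lebesgue_on \<Omega>) p \<phi> = p_integral (lebesgue_on \<Omega>) p (\<lambda>x. 0::real)"
      by (rule p_integral_cong_AE)
    then have "ennreal (mass \<phi>) = 0" using p_integral_mass[OF \<phi>] p_gt_1 by (simp add: p_integral_def)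
    then show False using N by (simp add: ennreal_eq_0_iff)
  qed
  have "ell1 p \<Omega> \<sigma> \<le> robin_quotient p \<Omega> \<sigma> \<phi>"
    unfolding ell1_def by (rule INF_lower) (use W nz in auto)
  also have "robin_quotient p \<Omega> \<sigma> \<phi> = (ennreal (energy \<phi>) + ennreal (bdry_energy \<sigma> \<phi>)) / ennreal (mass \<phi>)"
    unfolding robin_quotient_def
    using boundary_nn_integral(1)[OF \<sigma> cf tr] p_integral_mass[OF \<phi>] p_integral_energy[OF \<phi>]
      p_integral_cong_AE[OF weak_grad_AE[OF \<Omega>(1) has_weak_gradient_smooth[OF \<Omega>(1) \<phi>]], of p]
    by (simp add: p_integral_def)
  also have "\<dots> = ennreal ((energy \<phi> + bdry_energy \<sigma> \<phi>) / mass \<phi>)"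
    using N energy_nonneg[of \<phi>] boundary_nn_integral(2)[OF \<sigma> cf tr] by (simp add: divide_ennreal flip: ennreal_plus)
  finally show ?thesis .
qed

text \<open>Does the work of Minkowski's inequality while staying with p-th powers:
  \<open>powr_add_le\<close> puts a weight close to 1 on f and a large one on g - f, which is
  compensated by \<delta>. The bound B makes \<delta> uniform in f.\<close>

lemma p_integral_perturb:
  assumes B: "0 \<le> B" and \<epsilon>: "0 < \<epsilon>"
  obtains \<delta> where "0 < \<delta>" "\<And>(f :: 'a \<Rightarrow> 'b::euclidean_space) g. f \<in> borel_measurable (lebesgue_on \<Omega>) \<Longrightarrow> g \<in> borel_measurable (lebesgue_on \<Omega>) \<Longrightarrow>
    p_integral (lebesgue_on \<Omega>) p f \<le> ennreal B \<Longrightarrow> p_integral (lebesgue_on \<Omega>) p (\<lambda>x. g x - f x) \<le> ennreal \<delta> \<Longrightarrow>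
    p_integral (lebesgue_on \<Omega>) p g \<le> p_integral (lebesgue_on \<Omega>) p f + ennreal \<epsilon>"
proof -
  \<comment> \<open>The weight on f exceeds 1 by an amount tending to 0 with \<theta>; \<theta> is
    fixed so that this excess costs less than \<epsilon>/2.\<close>
  have "((\<lambda>\<theta>. ((1 - \<theta>) powr (1 - p) - 1) * B) \<longlongrightarrow> ((1 - 0) powr (1 - p) - 1) * B) (at_right 0)"
    by (intro tendsto_intros) auto
  then have "\<forall>\<^sub>F \<theta> in at_right 0. ((1 - \<theta>) powr (1 - p) - 1) * B < \<epsilon> / 2"
    using \<epsilon> by (intro order_tendstoD(2)) auto
  moreover have "\<forall>\<^sub>F \<theta> in at_right (0::real). 0 < \<theta> \<and> \<theta> < 1"
    unfolding eventually_at_right_field by (intro exI[of _ 1]) auto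
  ultimately have "\<forall>\<^sub>F \<theta> in at_right (0::real). ((1 - \<theta>) powr (1 - p) - 1) * B < \<epsilon> / 2 \<and> 0 < \<theta> \<and> \<theta> < 1"
    by (rule eventually_conj)
  then obtain \<theta> where \<theta>: "((1 - \<theta>) powr (1 - p) - 1) * B < \<epsilon> / 2" "0 < \<theta>" "\<theta> < 1"
    using eventually_happens'[OF trivial_limit_at_right_real] by blast
  define a where "a = (1 - \<theta>) powr (1 - p)"
  define b where "b = \<theta> powr (1 - p)"
  have a: "a \<ge> 1" unfolding a_def using \<theta> p_gt_1 powr_mono'[of "1 - p" 0 "1 - \<theta>"] by simp
  have b: "b > 0" using \<theta> by (simp add: b_def)
  define \<delta> where "\<delta> = \<epsilon> / (2 * b)"
  have \<delta>: "\<delta> > 0" using \<epsilon> b by (simp add: \<delta>_def)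
  have "p_integral (lebesgue_on \<Omega>) p g \<le> p_integral (lebesgue_on \<Omega>) p f + ennreal \<epsilon>"
    if [measurable]: "f \<in> borel_measurable (lebesgue_on \<Omega>)" "g \<in> borel_measurable (lebesgue_on \<Omega>)"
      and f: "p_integral (lebesgue_on \<Omega>) p f \<le> ennreal B" and d: "p_integral (lebesgue_on \<Omega>) p (\<lambda>x. g x - f x) \<le> ennreal \<delta>"
    for f g :: "'a \<Rightarrow> 'b"
  proof -
    have "p_integral (lebesgue_on \<Omega>) p g \<le> (\<integral>\<^sup>+x. ennreal a * ennreal (norm (f x) powr p) + ennreal b * ennreal (norm (g x - f x) powr p) \<partial>lebesgue_on \<Omega>)"
      unfolding p_integral_def
    proof (rule nn_integral_mono)
      fix x
      have "norm (g x) powr p \<le> (norm (f x) + norm (g x - f x)) powr p"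
        using p_gt_1 norm_triangle_sub[of "g x" "f x"] by (intro powr_mono2) auto
      also have "\<dots> \<le> a * norm (f x) powr p + b * norm (g x - f x) powr p"
        unfolding a_def b_def using \<theta> p_gt_1 by (intro powr_add_le) auto
      finally show "ennreal (norm (g x) powr p) \<le> ennreal a * ennreal (norm (f x) powr p) + ennreal b * ennreal (norm (g x - f x) powr p)"
        using a b by (simp add: ennreal_leI flip: ennreal_mult ennreal_plus)
    qed
    also have "\<dots> = ennreal a * p_integral (lebesgue_on \<Omega>) p f + ennreal b * p_integral (lebesgue_on \<Omega>) p (\<lambda>x. g x - f x)"
      unfolding p_integral_def by (subst nn_integral_add) (auto simp: nn_integral_cmult)
    also have "\<dots> \<le> (p_integral (lebesgue_on \<Omega>) p f + ennreal (\<epsilon> / 2)) + ennreal (\<epsilon> / 2)"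
    proof (rule add_mono)
      obtain F where F: "p_integral (lebesgue_on \<Omega>) p f = ennreal F" "0 \<le> F"
        using f by (metis ennreal_cases ennreal_less_top le_less_trans less_irrefl)
      have "F \<le> B" using f F B by (simp add: ennreal_le_iff)
      then have "(a - 1) * F \<le> (a - 1) * B" using a by (intro mult_left_mono) auto
      then have "a * F \<le> F + \<epsilon> / 2" using \<theta>(1) by (simp add: a_def[symmetric] algebra_simps)
      then show "ennreal a * p_integral (lebesgue_on \<Omega>) p f \<le> p_integral (lebesgue_on \<Omega>) p f + ennreal (\<epsilon> / 2)"
        unfolding F(1) using a F \<epsilon> by (simp add: ennreal_leI flip: ennreal_mult ennreal_plus)
      have "ennreal b * p_integral (lebesgue_on \<Omega>) p (\<lambda>x. g x - f x) \<le> ennreal b * ennreal \<delta>"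
        by (intro mult_left_mono d) simp
      also have "\<dots> = ennreal (\<epsilon> / 2)" using b \<delta> by (simp add: \<delta>_def flip: ennreal_mult)
      finally show "ennreal b * p_integral (lebesgue_on \<Omega>) p (\<lambda>x. g x - f x) \<le> ennreal (\<epsilon> / 2)" .
    qed
    also have "\<dots> = p_integral (lebesgue_on \<Omega>) p f + ennreal \<epsilon>"
      using \<epsilon> by (simp add: add.assoc flip: ennreal_plus)
    finally show ?thesis .
  qed
  then show thesis using that \<delta> by blast
qed

lemma p_integral_tendsto:
  fixes f :: "'a \<Rightarrow> 'b::euclidean_space" and g :: "nat \<Rightarrow> 'a \<Rightarrow> 'b"
  assumes f: "f \<in> borel_measurable (lebesgue_on \<Omega>)" and g: "\<And>k. g k \<in> borel_measurable (lebesgue_on \<Omega>)"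
    and fin: "p_integral (lebesgue_on \<Omega>) p f = ennreal F" "0 \<le> F"
    and gk: "\<And>k. p_integral (lebesgue_on \<Omega>) p (g k) = ennreal (G k)" "\<And>k. 0 \<le> G k"
    and lim: "(\<lambda>k. p_integral (lebesgue_on \<Omega>) p (\<lambda>x. g k x - f x)) \<longlonglongrightarrow> 0"
  shows "G \<longlonglongrightarrow> F"
proof (rule LIMSEQ_I)
  fix r :: real assume r: "0 < r"
  \<comment> \<open>The bound F + r serves both directions: the first application gives G k \<le> F
    + r/2, after which the roles of f and g k can be exchanged.\<close>
  obtain \<delta> where \<delta>: "0 < \<delta>" "\<And>(f :: 'a \<Rightarrow> 'b) g. f \<in> borel_measurable (lebesgue_on \<Omega>) \<Longrightarrow> g \<in> borel_measurable (lebesgue_on \<Omega>) \<Longrightarrow>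
    p_integral (lebesgue_on \<Omega>) p f \<le> ennreal (F + r) \<Longrightarrow> p_integral (lebesgue_on \<Omega>) p (\<lambda>x. g x - f x) \<le> ennreal \<delta> \<Longrightarrow>
    p_integral (lebesgue_on \<Omega>) p g \<le> p_integral (lebesgue_on \<Omega>) p f + ennreal (r / 2)"
    using p_integral_perturb[of "F + r" "r / 2"] fin r by auto
  have "\<forall>\<^sub>F k in sequentially. p_integral (lebesgue_on \<Omega>) p (\<lambda>x. g k x - f x) < ennreal \<delta>"
    using \<delta>(1) by (intro order_tendstoD(2)[OF lim]) simp
  then obtain K where K: "\<And>k. k \<ge> K \<Longrightarrow> p_integral (lebesgue_on \<Omega>) p (\<lambda>x. g k x - f x) < ennreal \<delta>"
    unfolding eventually_sequentially by blast
  have "norm (G k - F) < r" if "k \<ge> K" for k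
  proof -
    have d1: "p_integral (lebesgue_on \<Omega>) p (\<lambda>x. g k x - f x) \<le> ennreal \<delta>" using K[OF that] by simp
    have d2: "p_integral (lebesgue_on \<Omega>) p (\<lambda>x. f x - g k x) \<le> ennreal \<delta>"
      using d1 by (simp add: p_integral_def norm_minus_commute)
    have "p_integral (lebesgue_on \<Omega>) p (g k) \<le> p_integral (lebesgue_on \<Omega>) p f + ennreal (r / 2)"
      by (rule \<delta>(2)[OF f g _ d1]) (use fin r in \<open>simp add: ennreal_leI\<close>)
    then have 1: "G k \<le> F + r / 2"
      unfolding fin gk using r fin by (simp flip: ennreal_plus add: ennreal_le_iff)
    have "p_integral (lebesgue_on \<Omega>) p f \<le> p_integral (lebesgue_on \<Omega>) p (g k) + ennreal (r / 2)"
      by (rule \<delta>(2)[OF g f _ d2]) (use 1 gk r in \<open>simp add: ennreal_leI\<close>)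
    then have "F \<le> G k + r / 2"
      unfolding fin gk using r gk(2)[of k] by (simp flip: ennreal_plus add: ennreal_le_iff)
    then show ?thesis using 1 r by (simp add: abs_less_iff)
  qed
  then show "\<exists>no. \<forall>n\<ge>no. norm (G n - F) < r" by blast
qed

lemma bdry_energy_tendsto:
  assumes \<sigma>: "\<sigma> \<in> Sigma_m m \<Omega>" and \<phi>: "\<And>k. continuous_on (frontier \<Omega>) (\<phi> k)"
    and w: "uniform_limit (frontier \<Omega>) \<phi> w sequentially"
  shows "(\<lambda>k. bdry_energy \<sigma> (\<phi> k)) \<longlonglongrightarrow> bdry_energy \<sigma> w"
proof -
  have wc: "continuous_on (frontier \<Omega>) w"
    by (rule uniform_limit_theorem[OF _ w]) (use \<phi> in auto)
  obtain W where W: "\<And>x. x \<in> frontier \<Omega> \<Longrightarrow> \<bar>w x\<bar> \<le> W"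
    using compact_imp_bounded[OF compact_continuous_image[OF wc compact_frontier_bounded[OF \<Omega>(2)]]] unfolding bounded_iff by auto
  have "\<forall>\<^sub>F k in sequentially. \<forall>x\<in>frontier \<Omega>. dist (\<phi> k x) (w x) < 1"
    using w unfolding uniform_limit_iff by (auto dest: spec[of _ 1])
  then obtain K where K: "\<And>k x. k \<ge> K \<Longrightarrow> x \<in> frontier \<Omega> \<Longrightarrow> dist (\<phi> k x) (w x) < 1"
    unfolding eventually_sequentially by blast
  \<comment> \<open>The dominating function with |W| + 1 is valid only from index K on, hence the
    shifted sequence.\<close>
  have "(\<lambda>k. bdry_energy \<sigma> (\<phi> (k + K))) \<longlonglongrightarrow> bdry_energy \<sigma> w"
    unfolding bdry_energy_def
  proof (rule integral_dominated_convergence[where w = "\<lambda>x. (\<bar>W\<bar> + 1) powr p * \<bar>\<sigma> x\<bar>"])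
    show "(\<lambda>x. \<sigma> x * \<bar>w x\<bar> powr p) \<in> borel_measurable (boundary_measure \<Omega>)"
      using boundary_weight_integrable[OF Sigma_mD(1)[OF \<sigma>] wc] by auto
    show "(\<lambda>x. \<sigma> x * \<bar>\<phi> (k + K) x\<bar> powr p) \<in> borel_measurable (boundary_measure \<Omega>)" for k
      using boundary_weight_integrable[OF Sigma_mD(1)[OF \<sigma>] \<phi>] by auto
    show "integrable (boundary_measure \<Omega>) (\<lambda>x. (\<bar>W\<bar> + 1) powr p * \<bar>\<sigma> x\<bar>)"
      using Sigma_mD(1)[OF \<sigma>] by auto
    show "AE x in boundary_measure \<Omega>. (\<lambda>k. \<sigma> x * \<bar>\<phi> (k + K) x\<bar> powr p) \<longlonglongrightarrow> \<sigma> x * \<bar>w x\<bar> powr p"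
    proof (rule AE_I2)
      fix x assume "x \<in> space (boundary_measure \<Omega>)"
      then have "(\<lambda>k. \<phi> k x) \<longlonglongrightarrow> w x"
        using tendsto_uniform_limitI[OF w] by (simp add: space_boundary_measure)
      then have "(\<lambda>k. \<phi> (k + K) x) \<longlonglongrightarrow> w x" by (rule LIMSEQ_ignore_initial_segment)
      then show "(\<lambda>k. \<sigma> x * \<bar>\<phi> (k + K) x\<bar> powr p) \<longlonglongrightarrow> \<sigma> x * \<bar>w x\<bar> powr p"
        using p_gt_1 by (intro tendsto_intros tendsto_powr') auto
    qed
    show "AE x in boundary_measure \<Omega>. norm (\<sigma> x * \<bar>\<phi> (k + K) x\<bar> powr p) \<le> (\<bar>W\<bar> + 1) powr p * \<bar>\<sigma> x\<bar>" for k
    proof (rule AE_I2)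
      fix x assume "x \<in> space (boundary_measure \<Omega>)"
      then have "\<bar>\<phi> (k + K) x\<bar> \<le> \<bar>W\<bar> + 1"
        using K[of "k + K" x] W[of x] by (auto simp: space_boundary_measure dist_real_def)
      then have "\<bar>\<phi> (k + K) x\<bar> powr p \<le> (\<bar>W\<bar> + 1) powr p" using p_gt_1 by (intro powr_mono2) auto
      from mult_right_mono[OF this abs_ge_zero[of "\<sigma> x"]]
      show "norm (\<sigma> x * \<bar>\<phi> (k + K) x\<bar> powr p) \<le> (\<bar>W\<bar> + 1) powr p * \<bar>\<sigma> x\<bar>"
        by (simp add: abs_mult mult.commute)
    qed
  qed
  then show ?thesis by (rule LIMSEQ_offset)
qed

text \<open>Second half of the reduction. Written without division, the inequality passes to the
  limit along an approximating sequence: masses and energies by convergence in p-th mean, the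
  boundary term because the trace is the uniform limit of the boundary values.\<close>

lemma le_ell1_smooth:
  assumes \<sigma>: "\<sigma> \<in> Sigma_m m \<Omega>" and c: "0 \<le> c" and le: "\<And>\<phi>. smooth \<phi> \<Longrightarrow> c * mass \<phi> \<le> energy \<phi> + bdry_energy \<sigma> \<phi>"
  shows "ennreal c \<le> ell1 p \<Omega> \<sigma>"
  unfolding ell1_def
proof (rule INF_greatest)
  fix u assume "u \<in> {u \<in> W1p p \<Omega>. \<not> (AE x in lebesgue_on \<Omega>. u x = 0)}"
  then have u: "u \<in> W1p p \<Omega>" and nz: "\<not> (AE x in lebesgue_on \<Omega>. u x = 0)" by auto
  obtain \<phi> g where conv: "W1p_conv \<phi> u g"
    and wg: "p_integral (lebesgue_on \<Omega>) p (weak_grad \<Omega> u) = p_integral (lebesgue_on \<Omega>) p g"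
    using W1p_conv_exists[OF u] by blast
  have s: "smooth (\<phi> k)" for k using conv unfolding W1p_conv_def by auto
  obtain w where w: "uniform_limit (closure \<Omega>) \<phi> w sequentially" "continuous_on (closure \<Omega>) w"
    using W1p_conv_uniform_limit[OF conv] by blast
  have tr: "AE x in boundary_measure \<Omega>. bdry_trace p \<Omega> u x = w x" by (rule trace_unique[OF conv w])
  have cf: "continuous_on (frontier \<Omega>) w" by (rule continuous_on_subset[OF w(2) frontier_subset])
  have meas: "u \<in> borel_measurable (lebesgue_on \<Omega>)" "g \<in> borel_measurable (lebesgue_on \<Omega>)"
    and fin: "p_integral (lebesgue_on \<Omega>) p u < \<infinity>" "p_integral (lebesgue_on \<Omega>) p g < \<infinity>"
    using conv unfolding W1p_conv_def Lp_def by auto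
  obtain Nu where Nu: "p_integral (lebesgue_on \<Omega>) p u = ennreal Nu" "0 \<le> Nu"
    using fin(1) by (cases "p_integral (lebesgue_on \<Omega>) p u") auto
  obtain Ju where Ju: "p_integral (lebesgue_on \<Omega>) p g = ennreal Ju" "0 \<le> Ju"
    using fin(2) by (cases "p_integral (lebesgue_on \<Omega>) p g") auto
  have N: "(\<lambda>k. mass (\<phi> k)) \<longlonglongrightarrow> Nu"
    by (rule p_integral_tendsto[OF meas(1) _ Nu p_integral_mass[OF s] mass_nonneg])
      (use conv s in \<open>auto simp: W1p_conv_def intro: borel_measurable_lebesgue_on smooth_measurable\<close>)
  have J: "(\<lambda>k. energy (\<phi> k)) \<longlonglongrightarrow> Ju"
    by (rule p_integral_tendsto[OF meas(2) _ Ju p_integral_energy[OF s] energy_nonneg])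
      (use conv s in \<open>auto simp: W1p_conv_def intro: borel_measurable_lebesgue_on smooth_grad_measurable\<close>)
  have S: "(\<lambda>k. bdry_energy \<sigma> (\<phi> k)) \<longlonglongrightarrow> bdry_energy \<sigma> w"
    by (rule bdry_energy_tendsto[OF \<sigma> smooth_continuous[OF s] uniform_limit_on_subset[OF w(1) frontier_subset]])
  have ineq: "c * Nu \<le> Ju + bdry_energy \<sigma> w"
    by (rule LIMSEQ_le[OF tendsto_mult_left[OF N] tendsto_add[OF J S]]) (use le[OF s] in auto)
  have "Nu \<noteq> 0"
  proof
    assume "Nu = 0"
    then have "(\<integral>\<^sup>+x. ennreal (norm (u x) powr p) \<partial>lebesgue_on \<Omega>) = 0" using Nu by (simp add: p_integral_def)
    moreover have "(\<lambda>x. ennreal (norm (u x) powr p)) \<in> borel_measurable (lebesgue_on \<Omega>)" using meas by measurable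
    ultimately have "AE x in lebesgue_on \<Omega>. ennreal (norm (u x) powr p) = 0" using nn_integral_0_iff_AE by blast
    then have "AE x in lebesgue_on \<Omega>. u x = 0" by eventually_elim (simp add: ennreal_eq_0_iff)
    then show False using nz by simp
  qed
  then have Npos: "Nu > 0" using Nu by simp
  have "robin_quotient p \<Omega> \<sigma> u = (ennreal Ju + ennreal (bdry_energy \<sigma> w)) / ennreal Nu"
    unfolding robin_quotient_def
    using boundary_nn_integral(1)[OF \<sigma> cf tr] Nu Ju wg by (simp add: p_integral_def)
  also have "\<dots> = ennreal ((Ju + bdry_energy \<sigma> w) / Nu)"
    using Npos Ju boundary_nn_integral(2)[OF \<sigma> cf tr] by (simp add: divide_ennreal flip: ennreal_plus)
  finally show "ennreal c \<le> robin_quotient p \<Omega> \<sigma> u"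
    using ineq Npos by (simp add: ennreal_leI pos_le_divide_eq)
qed

end

section \<open>Positivity of the infimum\<close>

lemma powr_subadditive:
  fixes u v r :: real
  assumes "0 \<le> v" "v \<le> u" "0 < r" "r \<le> 1"
  shows "u powr r \<le> v powr r + (u - v) powr r"
proof (cases "v = 0 \<or> u = v")
  case False
  then have pos: "0 < v" "0 < u - v" "0 < u" using assms by auto
  have split: "x powr r = x * x powr (r - 1)" if "x > 0" for x
    using powr_add[of x 1 "r - 1"] that by simp
  have "u powr r = v * u powr (r - 1) + (u - v) * u powr (r - 1)"
    using split[OF pos(3)] by (simp add: algebra_simps)
  also have "\<dots> \<le> v * v powr (r - 1) + (u - v) * (u - v) powr (r - 1)"
    using pos assms by (intro add_mono mult_left_mono powr_mono2') auto
  finally show ?thesis using split[OF pos(1)] split[OF pos(2)] by simp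
qed (use assms in auto)

text \<open>Hoelder continuity of the r-th power with exponent \<open>min r 1\<close>: subadditivity
  for r \<le> 1, the tangent inequality for r > 1. The constant 2 r + 2 fits both cases, and b \<ge>
  1 lets b^r absorb the factors 1 and b^(r - 1).\<close>

lemma powr_diff_bound:
  fixes u v r :: real
  assumes "0 \<le> v" "0 \<le> u" "0 < r" "\<bar>u - v\<bar> \<le> 2 * s" "u \<le> b" "v \<le> b" "1 \<le> b" "s \<le> 1" "0 \<le> s"
  shows "\<bar>u powr r - v powr r\<bar> \<le> (2 * r + 2) * s powr min r 1 * b powr r"
proof -
  have main: "u powr r - v powr r \<le> (2 * r + 2) * s powr min r 1 * b powr r"
    if "0 \<le> v" "v \<le> u" "u - v \<le> 2 * s" "u \<le> b" for u v :: real
  proof (cases "r \<le> 1")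
    case True
    have "u powr r - v powr r \<le> (u - v) powr r"
      using powr_subadditive[OF that(1,2) assms(3) True] by simp
    also have "\<dots> \<le> (2 * s) powr r" using that assms by (intro powr_mono2) auto
    also have "\<dots> = 2 powr r * s powr r" using assms by (simp add: powr_mult)
    also have "\<dots> \<le> (2 * r + 2) * s powr r"
    proof (rule mult_right_mono)
      have "2 powr r \<le> 2 powr (1::real)" using True by (intro powr_mono) auto
      then show "2 powr r \<le> 2 * r + 2" using assms by simp
    qed simp
    also have "\<dots> \<le> (2 * r + 2) * s powr r * b powr r"
      using assms ge_one_powr_ge_zero[of b r] by (simp add: mult_le_cancel_left1 mult_less_0_iff)
    finally show ?thesis using True by (simp add: min_def)
  next
    case False
    then have r1: "1 \<le> r" by simp
    have "u powr r + r * u powr (r - 1) * (v - u) \<le> v powr r"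
      by (rule powr_tangent) (use r1 that in auto)
    then have "u powr r - v powr r \<le> r * u powr (r - 1) * (u - v)" by (simp add: algebra_simps)
    also have "\<dots> \<le> r * b powr r * (2 * s)"
    proof (intro mult_mono mult_left_mono)
      have "u powr (r - 1) \<le> b powr (r - 1)" using that r1 by (intro powr_mono2) auto
      also have "\<dots> \<le> b powr r" using assms by (intro powr_mono) auto
      finally show "u powr (r - 1) \<le> b powr r" .
    qed (use that r1 in auto)
    also have "\<dots> = 2 * r * s * b powr r" by simp
    also have "\<dots> \<le> (2 * r + 2) * s * b powr r"
      using assms r1 by (intro mult_right_mono) auto
    finally show ?thesis using False assms by (simp add: min_def)
  qed
  show ?thesis
  proof (cases "v \<le> u")
    case True
    then show ?thesis using main[of v u] assms by (simp add: powr_mono2)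
  next
    case False
    then have "u powr r \<le> v powr r" using assms by (intro powr_mono2) auto
    then show ?thesis using main[of u v] assms False by simp
  qed
qed

lemma norm_powr_eq: "norm a powr p = ((norm a)\<^sup>2) powr (p / 2)"
proof -
  have "((norm a)\<^sup>2) powr (p / 2) = (norm a powr 2) powr (p / 2)" by simp
  also have "\<dots> = norm a powr p" by (simp only: powr_powr) simp
  finally show ?thesis by simp
qed

text \<open>Write |c|^p as the convex power p/2 of |c|^2 and take tangents at the perturbed points c
  = a + h and c = a - h. The terms 2 (a \<bullet> h) come with opposite signs, so only the
  difference of |a + h|^(p-2) and |a - h|^(p-2) remains in front of them, and
  \<open>powr_diff_bound\<close> makes the product of order s^(1 + \<beta>).\<close>

lemma norm_powr_second_difference_le:
  fixes a h :: "'a::euclidean_space"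
  assumes p: "2 < p" and h: "norm h \<le> s" "s \<le> 1"
  shows "norm (a + h) powr p + norm (a - h) powr p \<le> 2 * norm a powr p +
     8 * p\<^sup>2 * 2 powr p * s powr (1 + min (p - 2) 1) * (norm a powr p + 1)"
proof -
  define r where "r = p - 2"
  define \<beta> where "\<beta> = min r 1"
  define u where "u = norm (a + h)"
  define v where "v = norm (a - h)"
  define b where "b = norm a + 1"
  have s0: "0 \<le> s" using h norm_ge_zero order.trans by blast
  have r: "r > 0" and \<beta>: "0 < \<beta>" "\<beta> \<le> 1" using p by (auto simp: r_def \<beta>_def)
  have b: "b \<ge> 1" by (simp add: b_def)
  have ub: "u \<le> b" "v \<le> b" "\<bar>u - v\<bar> \<le> 2 * s" "0 \<le> u" "0 \<le> v"
  proof -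
    show "u \<le> b" using norm_triangle_ineq[of a h] h by (simp add: u_def b_def)
    show "v \<le> b" using norm_triangle_ineq4[of a h] h by (simp add: v_def b_def)
    have "\<bar>u - v\<bar> \<le> norm ((a + h) - (a - h))" unfolding u_def v_def by (rule norm_triangle_ineq3)
    also have "(a + h) - (a - h) = 2 *\<^sub>R h" by (simp add: scaleR_2)
    finally show "\<bar>u - v\<bar> \<le> 2 * s" using h by simp
  qed (auto simp: u_def v_def)
  have tan: "norm c powr p - norm a powr p \<le> (p / 2) * norm c powr r * ((norm c)\<^sup>2 - (norm a)\<^sup>2)" for c :: 'a
  proof -
    have "((norm c)\<^sup>2) powr (p / 2) + (p / 2) * ((norm c)\<^sup>2) powr (p / 2 - 1) * ((norm a)\<^sup>2 - (norm c)\<^sup>2) \<le> ((norm a)\<^sup>2) powr (p / 2)"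
      by (rule powr_tangent) (use p in auto)
    moreover have "((norm c)\<^sup>2) powr (p / 2 - 1) = norm c powr r"
      using norm_powr_eq[of c r] by (simp add: r_def diff_divide_distrib)
    ultimately show ?thesis by (simp add: norm_powr_eq[of _ p] algebra_simps)
  qed
  have sq: "u\<^sup>2 - (norm a)\<^sup>2 = (norm h)\<^sup>2 + 2 * (a \<bullet> h)" "v\<^sup>2 - (norm a)\<^sup>2 = (norm h)\<^sup>2 - 2 * (a \<bullet> h)"
    unfolding u_def v_def power2_norm_eq_inner
    by (simp_all add: inner_add_left inner_add_right inner_diff_left inner_diff_right inner_commute)
  have s1: "s powr (1 + \<beta>) = s * s powr \<beta>" using s0 by (cases "s = 0") (auto simp: powr_add)
  have br: "b * b powr r \<le> b powr p"
  proof -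
    have "b * b powr r = b powr (1 + r)" using b by (simp add: powr_add)
    also have "\<dots> \<le> b powr p" using b by (intro powr_mono) (auto simp: r_def)
    finally show ?thesis .
  qed
  have brp: "b powr r \<le> b powr p" using b by (intro powr_mono) (auto simp: r_def)
  have 1: "(u powr r + v powr r) * (norm h)\<^sup>2 \<le> 2 * (s powr (1 + \<beta>) * b powr p)"
  proof -
    have "u powr r \<le> b powr r" "v powr r \<le> b powr r" using ub r by (auto intro: powr_mono2)
    then have A: "u powr r + v powr r \<le> 2 * b powr p" using brp by linarith
    have "(norm h)\<^sup>2 \<le> s * s" using h s0 by (simp add: power2_eq_square mult_mono)
    also have "s * s \<le> s * s powr \<beta>"
      using s0 h(2) \<beta> powr_mono'[of \<beta> 1 s] by (intro mult_left_mono) auto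
    finally have B: "(norm h)\<^sup>2 \<le> s powr (1 + \<beta>)" using s1 by simp
    have "(u powr r + v powr r) * (norm h)\<^sup>2 \<le> (2 * b powr p) * s powr (1 + \<beta>)"
      by (intro mult_mono A B) auto
    then show ?thesis by (simp add: mult_ac)
  qed
  have 2: "2 * (a \<bullet> h) * (u powr r - v powr r) \<le> (4 * r + 4) * (s powr (1 + \<beta>) * b powr p)"
  proof -
    have "2 * (a \<bullet> h) * (u powr r - v powr r) \<le> \<bar>2 * (a \<bullet> h)\<bar> * \<bar>u powr r - v powr r\<bar>"
      by (metis abs_ge_self abs_mult)
    also have "\<dots> \<le> (2 * (b * s)) * ((2 * r + 2) * s powr \<beta> * b powr r)"
    proof (rule mult_mono)
      have "\<bar>a \<bullet> h\<bar> \<le> norm a * norm h" by (rule Cauchy_Schwarz_ineq2)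
      also have "\<dots> \<le> b * s" using h s0 by (intro mult_mono) (auto simp: b_def)
      finally show "\<bar>2 * (a \<bullet> h)\<bar> \<le> 2 * (b * s)" by simp
      show "\<bar>u powr r - v powr r\<bar> \<le> (2 * r + 2) * s powr \<beta> * b powr r"
        unfolding \<beta>_def by (rule powr_diff_bound) (use ub r b s0 h in auto)
    qed (use b s0 in auto)
    also have "\<dots> = (4 * r + 4) * (s powr (1 + \<beta>) * (b * b powr r))"
      by (simp add: s1 algebra_simps)
    also have "\<dots> \<le> (4 * r + 4) * (s powr (1 + \<beta>) * b powr p)"
      using br r by (intro mult_left_mono) auto
    finally show ?thesis .
  qed
  have "norm (a + h) powr p + norm (a - h) powr p - 2 * norm a powr p \<le>
     (p / 2) * u powr r * (u\<^sup>2 - (norm a)\<^sup>2) + (p / 2) * v powr r * (v\<^sup>2 - (norm a)\<^sup>2)"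
    using tan[of "a + h"] tan[of "a - h"] by (simp add: u_def v_def)
  also have "\<dots> = (p / 2) * ((u powr r + v powr r) * (norm h)\<^sup>2 + 2 * (a \<bullet> h) * (u powr r - v powr r))"
    unfolding sq by (simp add: algebra_simps)
  also have "\<dots> \<le> (p / 2) * (2 * (s powr (1 + \<beta>) * b powr p) + (4 * r + 4) * (s powr (1 + \<beta>) * b powr p))"
    using 1 2 p by (intro mult_left_mono add_mono) auto
  also have "\<dots> = p * (2 * r + 3) * (s powr (1 + \<beta>) * b powr p)" by (simp add: algebra_simps)
  also have "\<dots> \<le> (8 * p\<^sup>2) * (s powr (1 + \<beta>) * (2 powr p * (norm a powr p + 1)))"
  proof (rule mult_mono)
    have "p * (2 * r + 3) \<le> p * (8 * p)" using p by (intro mult_left_mono) (auto simp: r_def)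
    then show "p * (2 * r + 3) \<le> 8 * p\<^sup>2" by (simp add: power2_eq_square)
    have "b powr p \<le> (2 * max (norm a) 1) powr p" using p b by (intro powr_mono2) (auto simp: b_def)
    also have "\<dots> = 2 powr p * max (norm a) 1 powr p" by (simp add: powr_mult)
    also have "\<dots> \<le> 2 powr p * (norm a powr p + 1)"
      by (intro mult_left_mono) (auto simp: max_def)
    finally show "s powr (1 + \<beta>) * b powr p \<le> s powr (1 + \<beta>) * (2 powr p * (norm a powr p + 1))"
      by (intro mult_left_mono) auto
  qed auto
  finally show ?thesis by (simp add: \<beta>_def r_def mult_ac)
qed

text \<open>The same substitution of squares, now with the tangent taken at the unperturbed a^2,
  which bounds from below. The quadratic term survives because (a + t)^2 + (a - t)^2 - 2 a^2 = 2
  t^2.\<close>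

lemma abs_powr_second_difference_ge:
  fixes a t :: real
  assumes p: "2 \<le> p"
  shows "2 * \<bar>a\<bar> powr p + p * \<bar>a\<bar> powr (p - 2) * t\<^sup>2 \<le> \<bar>a + t\<bar> powr p + \<bar>a - t\<bar> powr p"
proof -
  have tan: "\<bar>a\<bar> powr p + (p / 2) * \<bar>a\<bar> powr (p - 2) * (c\<^sup>2 - a\<^sup>2) \<le> \<bar>c\<bar> powr p" for c
  proof -
    have "(a\<^sup>2) powr (p / 2) + (p / 2) * (a\<^sup>2) powr (p / 2 - 1) * (c\<^sup>2 - a\<^sup>2) \<le> (c\<^sup>2) powr (p / 2)"
      by (rule powr_tangent) (use p in auto)
    moreover have "(a\<^sup>2) powr (p / 2 - 1) = \<bar>a\<bar> powr (p - 2)"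
      using norm_powr_eq[of a "p - 2"] by (simp add: diff_divide_distrib)
    ultimately show ?thesis using norm_powr_eq[of a p] norm_powr_eq[of c p] by simp
  qed
  have "\<bar>a\<bar> powr p + (p / 2) * \<bar>a\<bar> powr (p - 2) * ((a + t)\<^sup>2 - a\<^sup>2) + (\<bar>a\<bar> powr p + (p / 2) * \<bar>a\<bar> powr (p - 2) * ((a - t)\<^sup>2 - a\<^sup>2))
    = 2 * \<bar>a\<bar> powr p + p * \<bar>a\<bar> powr (p - 2) * t\<^sup>2"
    by (simp add: power2_eq_square field_simps)
  then show ?thesis using tan[of "a + t"] tan[of "a - t"] by linarith
qed

text \<open>Divide by t^a and let t tend to 0. Both final contradictions have this shape: a gain of
  lower order in t than its cost.\<close>

lemma powr_order_contradiction:
  fixes c K t0 a \<beta> :: real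
  assumes "0 < t0" "0 < \<beta>" "\<And>t. 0 < t \<Longrightarrow> t < t0 \<Longrightarrow> c * t powr a \<le> K * t powr (a + \<beta>)"
  shows "c \<le> 0"
proof -
  have "((\<lambda>t. K * t powr \<beta>) \<longlongrightarrow> K * 0 powr \<beta>) (at_right 0)"
    using assms(2) by (intro tendsto_intros tendsto_powr') (auto simp: eventually_at_right_field intro!: exI[of _ 1])
  then have lim: "((\<lambda>t. K * t powr \<beta>) \<longlongrightarrow> 0) (at_right 0)" by simp
  have "c \<le> K * t powr \<beta>" if "0 < t" "t < t0" for t
    using assms(3)[OF that] that by (simp add: powr_add mult.assoc[symmetric])
  then have "\<forall>\<^sub>F t in at_right 0. c \<le> K * t powr \<beta>"
    unfolding eventually_at_right_field using assms(1) by blast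
  from tendsto_lowerbound[OF lim this] show ?thesis by simp
qed

context robin_domain
begin

section \<open>Compactness and the uniform lower bound\<close>

lemma smooth_powr_continuous: "smooth \<phi> \<Longrightarrow> continuous_on S (\<lambda>x. \<bar>\<phi> x\<bar> powr p)"
  by (intro continuous_on_powr' continuous_intros smooth_continuous) (use p_gt_1 in auto)

lemma smooth_grad_powr_continuous: "smooth \<phi> \<Longrightarrow> continuous_on S (\<lambda>x. norm (grad \<phi> x) powr p)"
  by (intro continuous_on_powr' continuous_intros smooth_grad_continuous) (use p_gt_1 in auto)

lemma normalise:
  assumes \<phi>: "smooth \<phi>" and N: "0 < mass \<phi>"
  obtains \<psi> where "smooth \<psi>" "mass \<psi> = 1" "energy \<psi> = energy \<phi> / mass \<phi>" "\<And>\<sigma>. bdry_energy \<sigma> \<psi> = bdry_energy \<sigma> \<phi> / mass \<phi>"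
    "\<And>x. \<bar>\<psi> x\<bar> powr p = \<bar>\<phi> x\<bar> powr p / mass \<phi>"
proof -
  define a where "a = mass \<phi> powr (- 1 / p)"
  define \<psi> where "\<psi> x = a * \<phi> x" for x
  have a: "a > 0" "a powr p = inverse (mass \<phi>)"
  proof -
    show "a > 0" using N by (simp add: a_def)
    have "a powr p = mass \<phi> powr (- 1 / p * p)" by (simp only: a_def powr_powr)
    then show "a powr p = inverse (mass \<phi>)" using N p_gt_1 by (simp add: powr_minus)
  qed
  have pw: "\<bar>\<psi> x\<bar> powr p = inverse (mass \<phi>) * \<bar>\<phi> x\<bar> powr p" for x
    using a by (simp add: \<psi>_def abs_mult powr_mult)
  have gpw: "norm (grad \<psi> x) powr p = inverse (mass \<phi>) * norm (grad \<phi> x) powr p" for x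
    using a unfolding \<psi>_def grad_cmult[OF \<phi>] by (simp add: powr_mult)
  show thesis
  proof
    show "smooth \<psi>" unfolding \<psi>_def by (rule smooth_cmult[OF \<phi>])
    show "mass \<psi> = 1" unfolding pw dom_int_cmult using N by simp
    show "energy \<psi> = energy \<phi> / mass \<phi>" unfolding gpw dom_int_cmult using N by (simp add: field_simps)
    show "\<bar>\<psi> x\<bar> powr p = \<bar>\<phi> x\<bar> powr p / mass \<phi>" for x using pw by (simp add: field_simps)
    show "bdry_energy \<sigma> \<psi> = bdry_energy \<sigma> \<phi> / mass \<phi>" for \<sigma>
    proof -
      have "(\<lambda>x. \<sigma> x * \<bar>\<psi> x\<bar> powr p) = (\<lambda>x. inverse (mass \<phi>) * (\<sigma> x * \<bar>\<phi> x\<bar> powr p))"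
        using pw by (auto simp: mult_ac)
      then show ?thesis unfolding bdry_energy_def by (simp add: field_simps)
    qed
  qed
qed

lemma W1p_boundedI: "smooth \<phi> \<Longrightarrow> mass \<phi> \<le> B \<Longrightarrow> energy \<phi> \<le> B \<Longrightarrow> \<phi> \<in> W1p_bounded p \<Omega> B"
  unfolding W1p_bounded_def by (simp add: p_integral_mass p_integral_energy ennreal_leI)

lemma W1p_bounded_compact:
  assumes B: "0 \<le> B" and \<phi>: "\<And>k. \<phi> k \<in> W1p_bounded p \<Omega> B"
  obtains r U where "strict_mono (r :: nat \<Rightarrow> nat)" "continuous_on (closure \<Omega>) U"
    "uniform_limit (closure \<Omega>) (\<lambda>k. \<phi> (r k)) U sequentially"
proof -
  obtain C where C: "\<And>\<phi> x. \<phi> \<in> W1p_bounded p \<Omega> B \<Longrightarrow> x \<in> closure \<Omega> \<Longrightarrow> \<bar>\<phi> x\<bar> \<le> C"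
    using W1p_bounded_sup[OF \<Omega> p B] by blast
  have bdd: "\<And>n x. x \<in> closure \<Omega> \<Longrightarrow> norm (\<phi> n x) \<le> C" using C \<phi> by simp
  have eq: "\<exists>d. 0 < d \<and> (\<forall>n y. y \<in> closure \<Omega> \<and> norm (x - y) < d \<longrightarrow> norm (\<phi> n x - \<phi> n y) < e)"
    if x: "x \<in> closure \<Omega>" and e: "0 < e" for x e
  proof -
    obtain d where "d > 0" "\<And>\<phi> y. \<phi> \<in> W1p_bounded p \<Omega> B \<Longrightarrow> y \<in> closure \<Omega> \<Longrightarrow> norm (x - y) < d \<Longrightarrow> \<bar>\<phi> x - \<phi> y\<bar> \<le> e / 2"
      using W1p_bounded_equicontinuous[OF \<Omega> p B x, of "e / 2"] e by auto
    note d = this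
    have "norm (\<phi> n x - \<phi> n y) < e" if "y \<in> closure \<Omega>" "norm (x - y) < d" for n y
      using d(2)[OF \<phi>[of n] that] e by simp
    then show ?thesis using d(1) by blast
  qed
  obtain U r where U: "continuous_on (closure \<Omega>) U" "strict_mono (r :: nat \<Rightarrow> nat)"
    "\<And>e. 0 < e \<Longrightarrow> \<exists>N. \<forall>n x. n \<ge> N \<and> x \<in> closure \<Omega> \<longrightarrow> norm (\<phi> (r n) x - U x) < e"
    using Arzela_Ascoli[OF compact_closure bdd eq] by metis
  have "uniform_limit (closure \<Omega>) (\<lambda>k. \<phi> (r k)) U sequentially"
    unfolding uniform_limit_iff eventually_sequentially dist_norm using U(3) by blast
  then show thesis using that U by blast
qed

lemma mass_tendsto:
  assumes \<phi>: "\<And>k. continuous_on (closure \<Omega>) (\<phi> k)" and U: "continuous_on (closure \<Omega>) U"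
    and w: "uniform_limit (closure \<Omega>) \<phi> U sequentially"
  shows "(\<lambda>k. mass (\<phi> k)) \<longlonglongrightarrow> mass U"
proof -
  obtain W where W: "\<And>x. x \<in> closure \<Omega> \<Longrightarrow> \<bar>U x\<bar> \<le> W"
    using compact_imp_bounded[OF compact_continuous_image[OF U compact_closure]] unfolding bounded_iff by auto
  have "\<forall>\<^sub>F k in sequentially. \<forall>x\<in>closure \<Omega>. dist (\<phi> k x) (U x) < 1"
    using w unfolding uniform_limit_iff by (auto dest: spec[of _ 1])
  then obtain K where K: "\<And>k x. k \<ge> K \<Longrightarrow> x \<in> closure \<Omega> \<Longrightarrow> dist (\<phi> k x) (U x) < 1"
    unfolding eventually_sequentially by blast
  have cp: "continuous_on (closure \<Omega>) (\<lambda>x. \<bar>f x\<bar> powr p)" if "continuous_on (closure \<Omega>) f" for f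
    by (intro continuous_on_powr' continuous_intros that) (use p_gt_1 in auto)
  have "(\<lambda>k. mass (\<phi> (k + K))) \<longlonglongrightarrow> mass U"
    unfolding dom_int_def
  proof (rule integral_dominated_convergence[where w = "\<lambda>x. indicator \<Omega> x * (\<bar>W\<bar> + 1) powr p"])
    show "(\<lambda>x. indicator \<Omega> x * \<bar>U x\<bar> powr p) \<in> borel_measurable lborel"
      using dom_integrable[OF cp[OF U]] by (rule borel_measurable_integrable)
    show "(\<lambda>x. indicator \<Omega> x * \<bar>\<phi> (k + K) x\<bar> powr p) \<in> borel_measurable lborel" for k
      using dom_integrable[OF cp[OF \<phi>]] by (rule borel_measurable_integrable)
    show "integrable lborel (\<lambda>x. indicator \<Omega> x * (\<bar>W\<bar> + 1) powr p)"
      by (rule dom_integrable) simp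
    show "AE x in lborel. (\<lambda>k. indicator \<Omega> x * \<bar>\<phi> (k + K) x\<bar> powr p) \<longlonglongrightarrow> indicator \<Omega> x * \<bar>U x\<bar> powr p"
    proof (rule AE_I2)
      fix x
      show "(\<lambda>k. indicator \<Omega> x * \<bar>\<phi> (k + K) x\<bar> powr p) \<longlonglongrightarrow> indicator \<Omega> x * \<bar>U x\<bar> powr p"
      proof (cases "x \<in> \<Omega>")
        case True
        then have "(\<lambda>k. \<phi> k x) \<longlonglongrightarrow> U x" using tendsto_uniform_limitI[OF w] closure_subset by blast
        then have "(\<lambda>k. \<phi> (k + K) x) \<longlonglongrightarrow> U x" by (rule LIMSEQ_ignore_initial_segment)
        then show ?thesis using p_gt_1 by (intro tendsto_intros tendsto_powr') auto
      qed simp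
    qed
    show "AE x in lborel. norm (indicator \<Omega> x * \<bar>\<phi> (k + K) x\<bar> powr p) \<le> indicator \<Omega> x * (\<bar>W\<bar> + 1) powr p" for k
    proof (rule AE_I2)
      fix x
      show "norm (indicator \<Omega> x * \<bar>\<phi> (k + K) x\<bar> powr p) \<le> indicator \<Omega> x * (\<bar>W\<bar> + 1) powr p"
      proof (cases "x \<in> \<Omega>")
        case True
        then have "x \<in> closure \<Omega>" using closure_subset by blast
        then have "\<bar>\<phi> (k + K) x\<bar> \<le> \<bar>W\<bar> + 1"
          using K[of "k + K" x] W[of x] by (auto simp: dist_real_def)
        then have "\<bar>\<phi> (k + K) x\<bar> powr p \<le> (\<bar>W\<bar> + 1) powr p" using p_gt_1 by (intro powr_mono2) auto
        then show ?thesis using True by simp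
      qed simp
    qed
  qed
  then show ?thesis by (rule LIMSEQ_offset)
qed

lemma frontier_nonempty: "frontier \<Omega> \<noteq> {}"
  using nonempty \<Omega>(1,2) frontier_eq_empty[of \<Omega>] not_bounded_UNIV by blast

lemma uniform_limit_pointwise:
  assumes "uniform_limit S \<phi> U sequentially" "x \<in> S"
  shows "(\<lambda>k. \<phi> k x) \<longlonglongrightarrow> U x"
  using tendsto_uniform_limitI[OF assms] .

text \<open>The boundary term is taken at a minimum point of |\<phi>| because m |\<phi> x|^p then
  lies below the boundary energy for every weight of total mass m; the constant c is thus
  independent of the weight.\<close>

lemma uniform_lower_bound:
  assumes conn: "connected \<Omega>" and m: "0 < m"
  obtains c where "0 < c" "\<And>\<phi>. smooth \<phi> \<Longrightarrow> \<exists>x\<in>frontier \<Omega>. (\<forall>y\<in>frontier \<Omega>. \<bar>\<phi> x\<bar> \<le> \<bar>\<phi> y\<bar>) \<and> c * mass \<phi> \<le> energy \<phi> + m * \<bar>\<phi> x\<bar> powr p"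
proof (rule ccontr)
  assume no: "\<not> thesis"
  \<comment> \<open>Each c = 1 / (k + 1) fails for some \<phi>; the failure forces positive mass, so
    \<phi> can be normalised.\<close>
  have "\<exists>\<phi> x. smooth \<phi> \<and> x \<in> frontier \<Omega> \<and> mass \<phi> = 1 \<and> energy \<phi> + m * \<bar>\<phi> x\<bar> powr p \<le> 1 / real (Suc k)" for k
  proof -
    have "\<not> (\<forall>\<phi>. smooth \<phi> \<longrightarrow> (\<exists>x\<in>frontier \<Omega>. (\<forall>y\<in>frontier \<Omega>. \<bar>\<phi> x\<bar> \<le> \<bar>\<phi> y\<bar>) \<and> (1 / real (Suc k)) * mass \<phi> \<le> energy \<phi> + m * \<bar>\<phi> x\<bar> powr p))"
    proof
      assume A: "\<forall>\<phi>. smooth \<phi> \<longrightarrow> (\<exists>x\<in>frontier \<Omega>. (\<forall>y\<in>frontier \<Omega>. \<bar>\<phi> x\<bar> \<le> \<bar>\<phi> y\<bar>) \<and> (1 / real (Suc k)) * mass \<phi> \<le> energy \<phi> + m * \<bar>\<phi> x\<bar> powr p)"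
      have thesis by (rule that[of "1 / real (Suc k)"]) (use A in \<open>simp, blast\<close>)
      then show False using no by blast
    qed
    then obtain \<phi> where \<phi>: "smooth \<phi>" "\<And>x. x \<in> frontier \<Omega> \<Longrightarrow> \<forall>y\<in>frontier \<Omega>. \<bar>\<phi> x\<bar> \<le> \<bar>\<phi> y\<bar> \<Longrightarrow>
       energy \<phi> + m * \<bar>\<phi> x\<bar> powr p < (1 / real (Suc k)) * mass \<phi>"
      by (meson not_le)
    have "continuous_on (frontier \<Omega>) (\<lambda>x. \<bar>\<phi> x\<bar>)" by (intro continuous_intros smooth_continuous \<phi>)
    then obtain x where x: "x \<in> frontier \<Omega>" "\<forall>y\<in>frontier \<Omega>. \<bar>\<phi> x\<bar> \<le> \<bar>\<phi> y\<bar>"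
      using continuous_attains_inf[OF compact_frontier_bounded[OF \<Omega>(2)] frontier_nonempty] by blast
    note lt = \<phi>(2)[OF x]
    have "0 \<le> energy \<phi> + m * \<bar>\<phi> x\<bar> powr p" using energy_nonneg[of \<phi>] m by simp
    then have "0 < (1 / real (Suc k)) * mass \<phi>" using lt by linarith
    then have N: "0 < mass \<phi>" by (simp add: zero_less_mult_iff zero_less_divide_iff)
    obtain \<psi> where \<psi>: "smooth \<psi>" "mass \<psi> = 1" "energy \<psi> = energy \<phi> / mass \<phi>" "\<And>x. \<bar>\<psi> x\<bar> powr p = \<bar>\<phi> x\<bar> powr p / mass \<phi>"
      using normalise[OF \<phi>(1) N] by metis
    have "energy \<psi> + m * \<bar>\<psi> x\<bar> powr p = (energy \<phi> + m * \<bar>\<phi> x\<bar> powr p) / mass \<phi>"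
      unfolding \<psi>(3,4) by (simp add: add_divide_distrib)
    also have "\<dots> \<le> 1 / real (Suc k)" using lt N by (simp add: pos_divide_le_eq)
    finally show ?thesis using \<psi> x by blast
  qed
  then obtain \<phi> x where \<phi>: "\<And>k. smooth (\<phi> k)" "\<And>k. mass (\<phi> k) = 1" and x: "\<And>k. x k \<in> frontier \<Omega>"
    and le: "\<And>k. energy (\<phi> k) + m * \<bar>\<phi> k (x k)\<bar> powr p \<le> 1 / real (Suc k)"
    by metis
  have J: "energy (\<phi> k) \<le> 1 / real (Suc k)" "m * \<bar>\<phi> k (x k)\<bar> powr p \<le> 1 / real (Suc k)" for k
  proof -
    have "0 \<le> m * \<bar>\<phi> k (x k)\<bar> powr p" using m by simp
    then show "energy (\<phi> k) \<le> 1 / real (Suc k)" using le[of k] by linarith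
    show "m * \<bar>\<phi> k (x k)\<bar> powr p \<le> 1 / real (Suc k)" using le[of k] energy_nonneg[of "\<phi> k"] by linarith
  qed
  have "\<phi> k \<in> W1p_bounded p \<Omega> 1" for k
    by (rule W1p_boundedI[OF \<phi>(1)]) (use \<phi>(2) order.trans[OF J(1)[of k]] in auto)
  then obtain r U where r: "strict_mono (r :: nat \<Rightarrow> nat)" and U: "continuous_on (closure \<Omega>) U"
    and lim: "uniform_limit (closure \<Omega>) (\<lambda>k. \<phi> (r k)) U sequentially"
    using W1p_bounded_compact[of 1 \<phi>] by auto
  have zero: "(\<lambda>k. 1 / real (Suc (r k))) \<longlonglongrightarrow> 0"
    using LIMSEQ_subseq_LIMSEQ[OF LIMSEQ_inverse_real_of_nat r] by (simp add: o_def inverse_eq_divide)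
  have NU: "mass U = 1"
    using mass_tendsto[OF smooth_continuous[OF \<phi>(1)] U lim] \<phi>(2) by (simp add: LIMSEQ_const_iff)
  \<comment> \<open>The oscillation of \<phi> (r k) on an interior ball is controlled by its energy
    alone, and the energies tend to 0.\<close>
  have loc: "U a = U b" if b: "ball z d \<subseteq> \<Omega>" "0 < d" and ab: "a \<in> ball z d" "b \<in> ball z d" for z d a b
  proof (rule ccontr)
    assume "U a \<noteq> U b"
    then have \<eta>: "\<bar>U a - U b\<bar> / 2 > 0" by simp
    obtain \<delta> where \<delta>: "\<delta> > 0" "\<And>\<phi> x y. smooth \<phi> \<Longrightarrow> p_integral (lebesgue_on \<Omega>) p (grad \<phi>) \<le> ennreal \<delta> \<Longrightarrow>
       x \<in> ball z d \<Longrightarrow> y \<in> ball z d \<Longrightarrow> \<bar>\<phi> x - \<phi> y\<bar> \<le> \<bar>U a - U b\<bar> / 2"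
      using morrey_ball[OF \<Omega>(1) p b \<eta>] by metis
    have "\<forall>\<^sub>F k in sequentially. 1 / real (Suc (r k)) < \<delta>"
      by (rule order_tendstoD(2)[OF zero \<delta>(1)])
    then have ev: "\<forall>\<^sub>F k in sequentially. \<bar>\<phi> (r k) a - \<phi> (r k) b\<bar> \<le> \<bar>U a - U b\<bar> / 2"
    proof eventually_elim
      case (elim k)
      have "energy (\<phi> (r k)) \<le> \<delta>" using J(1)[of "r k"] elim by linarith
      then show ?case
        by (intro \<delta>(2)[OF \<phi>(1) _ ab]) (simp add: p_integral_energy[OF \<phi>(1)] ennreal_leI)
    qed
    have cl: "a \<in> closure \<Omega>" "b \<in> closure \<Omega>" using ab b(1) closure_subset by blast+
    have "(\<lambda>k. \<bar>\<phi> (r k) a - \<phi> (r k) b\<bar>) \<longlonglongrightarrow> \<bar>U a - U b\<bar>"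
      by (intro tendsto_intros uniform_limit_pointwise[OF lim] cl)
    from tendsto_upperbound[OF this ev] have "\<bar>U a - U b\<bar> \<le> \<bar>U a - U b\<bar> / 2" by simp
    then show False using \<open>U a \<noteq> U b\<close> by simp
  qed
  have const: "U a = U b" if "a \<in> \<Omega>" "b \<in> \<Omega>" for a b
  proof (rule connected_local_const[OF conn that])
    show "\<forall>a\<in>\<Omega>. \<forall>\<^sub>F b in at a within \<Omega>. U a = U b"
    proof
      fix a assume "a \<in> \<Omega>"
      then obtain d where d: "d > 0" "ball a d \<subseteq> \<Omega>" using \<Omega>(1) openE by blast
      have "U a = U b" if "dist b a < d" for b
        using loc[OF d(2,1), of a b] d(1) that by (simp add: dist_commute)
      then show "\<forall>\<^sub>F b in at a within \<Omega>. U a = U b"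
        unfolding eventually_at using d(1) by blast
    qed
  qed
  obtain a where a: "a \<in> \<Omega>" using nonempty by blast
  have clc: "U b = U a" if "b \<in> closure \<Omega>" for b
    by (rule continuous_constant_on_closure[OF U const[OF _ a] that])
  have "U a = 0"
  proof (rule ccontr)
    \<comment> \<open>Uniform convergence on the closure keeps |\<phi> (r k)| above |U a| / 2 even
      at the moving points x (r k), so the boundary terms could not tend to 0.\<close>
    assume nz: "U a \<noteq> 0"
    have "\<forall>\<^sub>F k in sequentially. \<forall>y\<in>closure \<Omega>. dist (\<phi> (r k) y) (U y) < \<bar>U a\<bar> / 2"
      by (rule uniform_limitD[OF lim]) (use nz in simp)
    moreover have "\<forall>\<^sub>F k in sequentially. 1 / real (Suc (r k)) < m * (\<bar>U a\<bar> / 2) powr p"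
      by (rule order_tendstoD(2)[OF zero]) (use m nz in simp)
    ultimately have "\<forall>\<^sub>F k in sequentially. False"
    proof eventually_elim
      case (elim k)
      have xc: "x (r k) \<in> closure \<Omega>" using x frontier_subset by blast
      have "dist (\<phi> (r k) (x (r k))) (U (x (r k))) < \<bar>U a\<bar> / 2" using elim(1) xc by blast
      then have "\<bar>U a\<bar> / 2 \<le> \<bar>\<phi> (r k) (x (r k))\<bar>" using clc[OF xc] unfolding dist_real_def by linarith
      then have "(\<bar>U a\<bar> / 2) powr p \<le> \<bar>\<phi> (r k) (x (r k))\<bar> powr p" using p_gt_1 by (intro powr_mono2) auto
      then have "m * (\<bar>U a\<bar> / 2) powr p \<le> m * \<bar>\<phi> (r k) (x (r k))\<bar> powr p" using m by (intro mult_left_mono) auto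
      then show False using J(2)[of "r k"] elim(2) by linarith
    qed
    then show False by simp
  qed
  then have "indicator \<Omega> y * \<bar>U y\<bar> powr p = 0" for y
    using const[OF _ a] p_gt_1 by (auto simp: indicator_def)
  then have "mass U = 0" unfolding dom_int_def by (simp only: Bochner_Integration.integral_zero)
  then show False using NU by simp
qed

lemma bdry_energy_lower:
  assumes \<sigma>: "\<sigma> \<in> Sigma_m m \<Omega>" and \<phi>: "continuous_on (frontier \<Omega>) \<phi>" and a: "\<And>y. y \<in> frontier \<Omega> \<Longrightarrow> a \<le> \<bar>\<phi> y\<bar> powr p"
  shows "m * a \<le> bdry_energy \<sigma> \<phi>"
proof -
  have "(\<integral>x. \<sigma> x * a \<partial>boundary_measure \<Omega>) \<le> bdry_energy \<sigma> \<phi>"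
    unfolding bdry_energy_def
  proof (rule integral_mono_AE)
    show "AE x in boundary_measure \<Omega>. \<sigma> x * a \<le> \<sigma> x * \<bar>\<phi> x\<bar> powr p"
      using Sigma_mD(2)[OF \<sigma>] AE_space
      by eventually_elim (use a in \<open>auto simp: space_boundary_measure intro: mult_left_mono\<close>)
  qed (use Sigma_mD(1)[OF \<sigma>] boundary_weight_integrable[OF _ \<phi>] in auto)
  then show ?thesis using Sigma_mD(3)[OF \<sigma>] by simp
qed

lemma lambda_inf_pos:
  assumes conn: "connected \<Omega>" and m: "0 < m"
  shows "0 < lambda_inf p m \<Omega>"
proof -
  obtain c where c: "0 < c" "\<And>\<phi>. smooth \<phi> \<Longrightarrow> \<exists>x\<in>frontier \<Omega>. (\<forall>y\<in>frontier \<Omega>. \<bar>\<phi> x\<bar> \<le> \<bar>\<phi> y\<bar>) \<and> c * mass \<phi> \<le> energy \<phi> + m * \<bar>\<phi> x\<bar> powr p"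
    using uniform_lower_bound[OF assms] by metis
  have "ennreal c \<le> ell1 p \<Omega> \<sigma>" if \<sigma>: "\<sigma> \<in> Sigma_m m \<Omega>" for \<sigma>
  proof (rule le_ell1_smooth[OF \<sigma>])
    fix \<phi> :: "'a \<Rightarrow> real" assume \<phi>: "smooth \<phi>"
    obtain x where x: "x \<in> frontier \<Omega>" "\<forall>y\<in>frontier \<Omega>. \<bar>\<phi> x\<bar> \<le> \<bar>\<phi> y\<bar>" "c * mass \<phi> \<le> energy \<phi> + m * \<bar>\<phi> x\<bar> powr p"
      using c(2)[OF \<phi>] by blast
    have "m * \<bar>\<phi> x\<bar> powr p \<le> bdry_energy \<sigma> \<phi>"
      by (rule bdry_energy_lower[OF \<sigma> smooth_continuous[OF \<phi>]]) (use x(2) p_gt_1 in \<open>auto intro: powr_mono2\<close>)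
    then show "c * mass \<phi> \<le> energy \<phi> + bdry_energy \<sigma> \<phi>" using x(3) by linarith
  qed (use c in simp)
  then have "ennreal c \<le> lambda_inf p m \<Omega>" unfolding lambda_inf_def by (rule INF_greatest)
  then show ?thesis using c(1) by (meson ennreal_less_zero_iff less_le_trans)
qed

end

section \<open>The infimum is not attained\<close>

context robin_domain
begin

section \<open>Second differences of mass and energy\<close>

lemma dom_int_one_pos: "0 < dom_int (\<lambda>x. 1)"
proof -
  have "emeasure lborel \<Omega> \<noteq> 0"
  proof
    assume "emeasure lborel \<Omega> = 0"
    then have "negligible \<Omega>"
      by (simp add: negligible_iff_emeasure0 emeasure_completion open_sets_lebesgue[OF \<Omega>(1)])
    then show False using open_not_negligible[OF \<Omega>(1) nonempty] by blast
  qed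
  moreover have "emeasure lborel \<Omega> < \<infinity>" by (rule emeasure_bounded_finite[OF \<Omega>(2)])
  ultimately have "measure lborel \<Omega> > 0"
    by (metis emeasure_eq_ennreal_measure ennreal_0 less_irrefl top.not_eq_extremum infinity_ennreal_def zero_less_measure_iff)
  then show ?thesis by (simp add: dom_int_def)
qed

lemma mass_add_sub_ge:
  assumes p2: "2 \<le> p" and \<phi>: "smooth \<phi>" and \<psi>: "smooth \<psi>"
  shows "2 * mass \<phi> \<le> mass (\<lambda>x. \<phi> x + \<psi> x) + mass (\<lambda>x. \<phi> x - \<psi> x)"
proof -
  note c = smooth_powr_continuous[of _ "closure \<Omega>"]
  have "2 * mass \<phi> = dom_int (\<lambda>x. 2 * \<bar>\<phi> x\<bar> powr p)" by (simp add: dom_int_cmult)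
  also have "\<dots> \<le> dom_int (\<lambda>x. \<bar>\<phi> x + \<psi> x\<bar> powr p + \<bar>\<phi> x - \<psi> x\<bar> powr p)"
  proof (rule dom_int_mono)
    show "continuous_on (closure \<Omega>) (\<lambda>x. 2 * \<bar>\<phi> x\<bar> powr p)" by (intro continuous_intros c \<phi>)
    show "continuous_on (closure \<Omega>) (\<lambda>x. \<bar>\<phi> x + \<psi> x\<bar> powr p + \<bar>\<phi> x - \<psi> x\<bar> powr p)"
      using c[OF smooth_add[OF \<phi> \<psi>]] c[OF smooth_diff[OF \<phi> \<psi>]] by (rule continuous_on_add)
    fix x
    have "0 \<le> p * \<bar>\<phi> x\<bar> powr (p - 2) * (\<psi> x)\<^sup>2" using p2 by simp
    then show "2 * \<bar>\<phi> x\<bar> powr p \<le> \<bar>\<phi> x + \<psi> x\<bar> powr p + \<bar>\<phi> x - \<psi> x\<bar> powr p"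
      using abs_powr_second_difference_ge[OF p2, of "\<phi> x" "\<psi> x"] by linarith
  qed
  also have "\<dots> = mass (\<lambda>x. \<phi> x + \<psi> x) + mass (\<lambda>x. \<phi> x - \<psi> x)"
    by (rule dom_int_add[OF c[OF smooth_add[OF \<phi> \<psi>]] c[OF smooth_diff[OF \<phi> \<psi>]]])
  finally show ?thesis .
qed

text \<open>The symmetric sum removes the term linear in the gradient of \<psi>, about which nothing
  is known along a minimising sequence. The error s^(1 + \<beta>) with \<beta> > 0 is of higher
  order than the first-order change that \<psi> causes at a contact point.\<close>

lemma energy_add_sub_le:
  assumes p2: "2 < p" and \<phi>: "smooth \<phi>" and \<psi>: "smooth \<psi>" "\<And>x. norm (grad \<psi> x) \<le> s" "s \<le> 1"
  shows "energy (\<lambda>x. \<phi> x + \<psi> x) + energy (\<lambda>x. \<phi> x - \<psi> x) \<le>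
    2 * energy \<phi> + 8 * p\<^sup>2 * 2 powr p * s powr (1 + min (p - 2) 1) * (energy \<phi> + dom_int (\<lambda>x. 1))"
proof -
  define C where "C = 8 * p\<^sup>2 * 2 powr p * s powr (1 + min (p - 2) 1)"
  note c = smooth_grad_powr_continuous[of _ "closure \<Omega>"]
  have "energy (\<lambda>x. \<phi> x + \<psi> x) + energy (\<lambda>x. \<phi> x - \<psi> x) =
    dom_int (\<lambda>x. norm (grad (\<lambda>x. \<phi> x + \<psi> x) x) powr p + norm (grad (\<lambda>x. \<phi> x - \<psi> x) x) powr p)"
    by (rule dom_int_add[OF c[OF smooth_add[OF \<phi> \<psi>(1)]] c[OF smooth_diff[OF \<phi> \<psi>(1)]], symmetric])
  also have "\<dots> \<le> dom_int (\<lambda>x. 2 * norm (grad \<phi> x) powr p + C * (norm (grad \<phi> x) powr p + 1))"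
  proof (rule dom_int_mono)
    show "continuous_on (closure \<Omega>) (\<lambda>x. norm (grad (\<lambda>x. \<phi> x + \<psi> x) x) powr p + norm (grad (\<lambda>x. \<phi> x - \<psi> x) x) powr p)"
      using c[OF smooth_add[OF \<phi> \<psi>(1)]] c[OF smooth_diff[OF \<phi> \<psi>(1)]] by (rule continuous_on_add)
    show "continuous_on (closure \<Omega>) (\<lambda>x. 2 * norm (grad \<phi> x) powr p + C * (norm (grad \<phi> x) powr p + 1))"
      by (intro continuous_intros c \<phi>)
    fix x
    show "norm (grad (\<lambda>x. \<phi> x + \<psi> x) x) powr p + norm (grad (\<lambda>x. \<phi> x - \<psi> x) x) powr p \<le>
      2 * norm (grad \<phi> x) powr p + C * (norm (grad \<phi> x) powr p + 1)"
      unfolding grad_add[OF \<phi> \<psi>(1)] grad_diff[OF \<phi> \<psi>(1)] C_def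
      by (rule norm_powr_second_difference_le[OF p2 \<psi>(2,3)])
  qed
  also have "\<dots> = 2 * energy \<phi> + C * (energy \<phi> + dom_int (\<lambda>x. 1))"
  proof -
    have c1: "continuous_on (closure \<Omega>) (\<lambda>x. norm (grad \<phi> x) powr p + 1)" by (intro continuous_intros c \<phi>)
    have "dom_int (\<lambda>x. norm (grad \<phi> x) powr p + 1) = energy \<phi> + dom_int (\<lambda>x. 1)"
      by (rule dom_int_add[OF c[OF \<phi>]]) simp
    moreover have "dom_int (\<lambda>x. 2 * norm (grad \<phi> x) powr p + C * (norm (grad \<phi> x) powr p + 1)) =
       dom_int (\<lambda>x. 2 * norm (grad \<phi> x) powr p) + dom_int (\<lambda>x. C * (norm (grad \<phi> x) powr p + 1))"
      by (rule dom_int_add) (intro continuous_intros c \<phi> c1)+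
    ultimately show ?thesis by (simp only: dom_int_cmult)
  qed
  finally show ?thesis by (simp add: C_def)
qed

section \<open>Weights concentrating at a point\<close>

lemma indicator_ball_integrable:
  fixes \<sigma> :: "'a \<Rightarrow> real"
  assumes "integrable (boundary_measure \<Omega>) \<sigma>"
  shows "integrable (boundary_measure \<Omega>) (\<lambda>y. indicator (ball x \<delta>) y * \<sigma> y)"
proof (rule integrable_mult_bounded[OF assms, where B = 1])
  have "indicator (ball x \<delta>) \<in> borel_measurable (restrict_space borel (frontier \<Omega>))"
    by (intro measurable_restrict_space1 borel_measurable_indicator) (simp add: borel_open)
  then show "(indicator (ball x \<delta>) :: 'a \<Rightarrow> real) \<in> borel_measurable (boundary_measure \<Omega>)"
    by (simp add: measurable_cong_sets[OF sets_boundary_measure refl])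
qed (auto simp: indicator_def)

text \<open>Point masses are not admissible weights, so they are approximated by renormalised
  restrictions of \<sigma> to small balls. Around a point of the support of \<sigma> such a
  restriction has positive mass by definition.\<close>

lemma Sigma_m_concentrated:
  assumes \<sigma>: "\<sigma> \<in> Sigma_m m \<Omega>" and "0 < m" and "0 < \<delta>"
    and M: "0 < (\<integral>y. indicator (ball x \<delta>) y * \<sigma> y \<partial>boundary_measure \<Omega>)"
  shows "(\<lambda>y. m / (\<integral>y. indicator (ball x \<delta>) y * \<sigma> y \<partial>boundary_measure \<Omega>) * (indicator (ball x \<delta>) y * \<sigma> y)) \<in> Sigma_m m \<Omega>"
proof -
  define M where "M = (\<integral>y. indicator (ball x \<delta>) y * \<sigma> y \<partial>boundary_measure \<Omega>)"
  note indicator_ball_integrable[OF Sigma_mD(1)[OF \<sigma>], of x \<delta>]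
  moreover have "AE y in boundary_measure \<Omega>. 0 \<le> m / M * (indicator (ball x \<delta>) y * \<sigma> y)"
    using Sigma_mD(2)[OF \<sigma>] by eventually_elim (use assms in \<open>auto simp: M_def\<close>)
  moreover have "(\<integral>y. m / M * (indicator (ball x \<delta>) y * \<sigma> y) \<partial>boundary_measure \<Omega>) = m"
    using M by (simp add: M_def)
  ultimately show ?thesis unfolding Sigma_m_def M_def by simp
qed

text \<open>The topological support of the measure with density \<sigma> on the boundary.\<close>

definition weight_support :: "('a \<Rightarrow> real) \<Rightarrow> 'a set" where
  "weight_support \<sigma> = {x \<in> frontier \<Omega>. \<forall>\<delta>>0. 0 < (\<integral>y. indicator (ball x \<delta>) y * \<sigma> y \<partial>boundary_measure \<Omega>)}"

text \<open>Off the support every point lies in a ball on which \<sigma> has integral 0, hence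
  vanishes almost everywhere; by Lindelof countably many such balls cover all these points.\<close>

lemma weight_support_AE:
  assumes \<sigma>: "\<sigma> \<in> Sigma_m m \<Omega>"
  shows "AE x in boundary_measure \<Omega>. \<sigma> x \<noteq> 0 \<longrightarrow> x \<in> weight_support \<sigma>"
proof -
  note int = indicator_ball_integrable[OF Sigma_mD(1)[OF \<sigma>]]
  define \<F> where "\<F> = {ball x \<delta> |x \<delta>. (\<integral>y. indicator (ball x \<delta>) y * \<sigma> y \<partial>boundary_measure \<Omega>) = 0}"
  obtain \<G> where \<G>: "\<G> \<subseteq> \<F>" "countable \<G>" "\<Union>\<G> = \<Union>\<F>"
    by (rule Lindelof[of \<F>]) (auto simp: \<F>_def)
  have nn: "AE y in boundary_measure \<Omega>. 0 \<le> indicator (ball x \<delta>) y * \<sigma> y" for x \<delta>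
    using Sigma_mD(2)[OF \<sigma>] by eventually_elim simp
  have "AE x in boundary_measure \<Omega>. x \<in> B \<longrightarrow> \<sigma> x = 0" if B: "B \<in> \<G>" for B
  proof -
    obtain x \<delta> where x: "B = ball x \<delta>" "(\<integral>y. indicator (ball x \<delta>) y * \<sigma> y \<partial>boundary_measure \<Omega>) = 0"
      using B \<G>(1) unfolding \<F>_def by blast
    have "AE y in boundary_measure \<Omega>. indicator (ball x \<delta>) y * \<sigma> y = 0"
      using integral_nonneg_eq_0_iff_AE[OF int nn] x(2) by blast
    then show ?thesis unfolding x(1) by eventually_elim (auto simp: indicator_def split: if_splits)
  qed
  then have "AE x in boundary_measure \<Omega>. \<forall>B\<in>\<G>. x \<in> B \<longrightarrow> \<sigma> x = 0"
    using \<G>(2) by (subst AE_ball_countable) auto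
  then show ?thesis using AE_space
  proof eventually_elim
    case (elim x)
    show ?case
    proof (rule impI, rule ccontr)
      assume nz: "\<sigma> x \<noteq> 0" and "x \<notin> weight_support \<sigma>"
      then obtain \<delta> where \<delta>: "\<delta> > 0" "\<not> 0 < (\<integral>y. indicator (ball x \<delta>) y * \<sigma> y \<partial>boundary_measure \<Omega>)"
        using elim(2) unfolding weight_support_def space_boundary_measure by blast
      moreover have "0 \<le> (\<integral>y. indicator (ball x \<delta>) y * \<sigma> y \<partial>boundary_measure \<Omega>)"
        by (rule integral_nonneg_AE[OF nn])
      ultimately have "ball x \<delta> \<in> \<F>" unfolding \<F>_def by force
      moreover have "x \<in> ball x \<delta>" using \<delta>(1) by simp
      ultimately have "x \<in> \<Union>\<G>" unfolding \<G>(3) by (rule UnionI)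
      then show False using elim(1) nz by blast
    qed
  qed
qed

text \<open>Concentrating a weight near a point of its support bounds the infimum by the point-mass functional.\<close>

lemma point_mass_bound:
  assumes \<sigma>: "\<sigma> \<in> Sigma_m m \<Omega>" and m: "0 < m" and x: "x \<in> weight_support \<sigma>" and \<phi>: "smooth \<phi>"
    and l: "\<And>\<tau>. \<tau> \<in> Sigma_m m \<Omega> \<Longrightarrow> l * mass \<phi> \<le> energy \<phi> + bdry_energy \<tau> \<phi>"
  shows "l * mass \<phi> \<le> energy \<phi> + m * \<bar>\<phi> x\<bar> powr p"
proof (rule field_le_epsilon)
  fix e :: real assume e: "0 < e"
  have "continuous_on UNIV (\<lambda>y. \<bar>\<phi> y\<bar> powr p)" by (rule smooth_powr_continuous[OF \<phi>])
  then have "isCont (\<lambda>y. \<bar>\<phi> y\<bar> powr p) x" by (simp add: continuous_on_eq_continuous_at)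
  then obtain \<delta> where \<delta>: "\<delta> > 0" "\<And>y. dist y x < \<delta> \<Longrightarrow> dist (\<bar>\<phi> y\<bar> powr p) (\<bar>\<phi> x\<bar> powr p) < e / m"
    using e m unfolding continuous_at_eps_delta dist_norm by (metis divide_pos_pos)
  define M where "M = (\<integral>y. indicator (ball x \<delta>) y * \<sigma> y \<partial>boundary_measure \<Omega>)"
  have M: "M > 0" using x \<delta>(1) unfolding weight_support_def M_def by blast
  define \<tau> where "\<tau> y = m / M * (indicator (ball x \<delta>) y * \<sigma> y)" for y
  have \<tau>: "\<tau> \<in> Sigma_m m \<Omega>"
    using Sigma_m_concentrated[OF \<sigma> m \<delta>(1)] M unfolding M_def \<tau>_def by blast
  have "bdry_energy \<tau> \<phi> \<le> (\<integral>y. \<tau> y * (\<bar>\<phi> x\<bar> powr p + e / m) \<partial>boundary_measure \<Omega>)"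
    unfolding bdry_energy_def
  proof (rule integral_mono_AE)
    show "integrable (boundary_measure \<Omega>) (\<lambda>y. \<tau> y * \<bar>\<phi> y\<bar> powr p)"
      by (rule boundary_weight_integrable[OF Sigma_mD(1)[OF \<tau>] smooth_continuous[OF \<phi>]])
    show "integrable (boundary_measure \<Omega>) (\<lambda>y. \<tau> y * (\<bar>\<phi> x\<bar> powr p + e / m))"
      using Sigma_mD(1)[OF \<tau>] by (rule integrable_mult_left)
    show "AE y in boundary_measure \<Omega>. \<tau> y * \<bar>\<phi> y\<bar> powr p \<le> \<tau> y * (\<bar>\<phi> x\<bar> powr p + e / m)"
      using Sigma_mD(2)[OF \<tau>]
    proof eventually_elim
      case (elim y)
      show ?case
      proof (cases "y \<in> ball x \<delta>")
        case True
        then have "\<bar>\<phi> y\<bar> powr p \<le> \<bar>\<phi> x\<bar> powr p + e / m"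
          using \<delta>(2)[of y] by (simp add: dist_commute dist_real_def abs_less_iff)
        then show ?thesis using elim by (rule mult_left_mono)
      qed (simp add: \<tau>_def)
    qed
  qed
  also have "\<dots> = m * (\<bar>\<phi> x\<bar> powr p + e / m)"
    using Sigma_mD(3)[OF \<tau>] by simp
  also have "\<dots> = m * \<bar>\<phi> x\<bar> powr p + e"
    using m by (simp add: distrib_left)
  finally show "l * mass \<phi> \<le> energy \<phi> + m * \<bar>\<phi> x\<bar> powr p + e"
    using l[OF \<tau>] by linarith
qed

text \<open>The energies are squeezed between l minus the boundary energies and the same plus 1 / (k
  + 1), and the boundary energies converge by uniform convergence. This gives the exact limit of the
  energies, where lower semicontinuity alone would give an inequality for the energy of the
  limit.\<close>

lemma minimising_sequence:
  assumes \<sigma>: "\<sigma> \<in> Sigma_m m \<Omega>" and l: "ell1 p \<Omega> \<sigma> = ennreal l" "0 \<le> l"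
  obtains \<phi> U where "\<And>k. smooth (\<phi> k)" "\<And>k. mass (\<phi> k) = 1" "\<And>k. energy (\<phi> k) \<le> l + 1"
    "continuous_on (closure \<Omega>) U" "uniform_limit (closure \<Omega>) \<phi> U sequentially"
    "(\<lambda>k. energy (\<phi> k)) \<longlonglongrightarrow> l - bdry_energy \<sigma> U"
proof -
  \<comment> \<open>Multiplied out by the mass, the bound also holds for functions of zero
    mass.\<close>
  have lower: "l * mass \<phi> \<le> energy \<phi> + bdry_energy \<sigma> \<phi>" if \<phi>: "smooth \<phi>" for \<phi>
  proof (cases "0 < mass \<phi>")
    case True
    have "0 \<le> bdry_energy \<sigma> \<phi>" using boundary_nn_integral(2)[OF \<sigma> smooth_continuous[OF \<phi>], of \<phi>] by simp
    then have "0 \<le> (energy \<phi> + bdry_energy \<sigma> \<phi>) / mass \<phi>" using energy_nonneg[of \<phi>] True by simp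
    then have "l \<le> (energy \<phi> + bdry_energy \<sigma> \<phi>) / mass \<phi>"
      using ell1_le_smooth[OF \<sigma> \<phi> True] l by (simp add: ennreal_le_iff)
    then show ?thesis using True by (simp add: pos_le_divide_eq)
  next
    case False
    then have "mass \<phi> = 0" using mass_nonneg[of \<phi>] by linarith
    moreover have "0 \<le> bdry_energy \<sigma> \<phi>" using boundary_nn_integral(2)[OF \<sigma> smooth_continuous[OF \<phi>], of \<phi>] by simp
    ultimately show ?thesis using energy_nonneg[of \<phi>] by simp
  qed
  have "\<exists>\<psi>. smooth \<psi> \<and> mass \<psi> = 1 \<and> energy \<psi> + bdry_energy \<sigma> \<psi> \<le> l + 1 / real (Suc k)" for k
  proof -
    define c where "c = l + 1 / real (Suc k)"
    have c: "c > l" "c \<ge> 0" using l by (auto simp: c_def)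
    have "\<not> ennreal c \<le> ell1 p \<Omega> \<sigma>" unfolding l(1) using c l by (simp add: ennreal_le_iff)
    then obtain \<phi> where \<phi>: "smooth \<phi>" "\<not> c * mass \<phi> \<le> energy \<phi> + bdry_energy \<sigma> \<phi>"
      using le_ell1_smooth[OF \<sigma> c(2)] by blast
    have "0 \<le> bdry_energy \<sigma> \<phi>" using boundary_nn_integral(2)[OF \<sigma> smooth_continuous[OF \<phi>(1)], of \<phi>] by simp
    then have "0 < c * mass \<phi>" using \<phi>(2) energy_nonneg[of \<phi>] by linarith
    then have N: "0 < mass \<phi>" using c(2) by (simp add: zero_less_mult_iff)
    obtain \<psi> where \<psi>: "smooth \<psi>" "mass \<psi> = 1" "energy \<psi> = energy \<phi> / mass \<phi>" "bdry_energy \<sigma> \<psi> = bdry_energy \<sigma> \<phi> / mass \<phi>"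
      using normalise[OF \<phi>(1) N] by metis
    have "energy \<psi> + bdry_energy \<sigma> \<psi> = (energy \<phi> + bdry_energy \<sigma> \<phi>) / mass \<phi>" unfolding \<psi>(3,4) by (simp add: add_divide_distrib)
    also have "\<dots> \<le> c" using \<phi>(2) N by (simp add: pos_divide_le_eq)
    finally show ?thesis using \<psi>(1,2) unfolding c_def by blast
  qed
  then obtain \<psi> where \<psi>: "\<And>k. smooth (\<psi> k)" "\<And>k. mass (\<psi> k) = 1" "\<And>k. energy (\<psi> k) + bdry_energy \<sigma> (\<psi> k) \<le> l + 1 / real (Suc k)"
    by metis
  have SS0: "0 \<le> bdry_energy \<sigma> (\<psi> k)" for k
    using boundary_nn_integral(2)[OF \<sigma> smooth_continuous[OF \<psi>(1)], of "\<psi> k"] by simp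
  have J: "energy (\<psi> k) \<le> l + 1" for k
  proof -
    have "1 / real (Suc k) \<le> 1" by simp
    then show ?thesis using \<psi>(3)[of k] SS0[of k] by linarith
  qed
  have "\<psi> k \<in> W1p_bounded p \<Omega> (l + 1)" for k
    by (rule W1p_boundedI[OF \<psi>(1) _ J]) (use \<psi>(2) l in simp)
  then obtain r U where r: "strict_mono (r :: nat \<Rightarrow> nat)" and U: "continuous_on (closure \<Omega>) U"
    and lim: "uniform_limit (closure \<Omega>) (\<lambda>k. \<psi> (r k)) U sequentially"
    using W1p_bounded_compact[of "l + 1" \<psi>] l(2) by auto
  have S: "(\<lambda>k. bdry_energy \<sigma> (\<psi> (r k))) \<longlonglongrightarrow> bdry_energy \<sigma> U"
    by (rule bdry_energy_tendsto[OF \<sigma> smooth_continuous[OF \<psi>(1)] uniform_limit_on_subset[OF lim frontier_subset]])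
  have zero: "(\<lambda>k. 1 / real (Suc (r k))) \<longlonglongrightarrow> 0"
    using LIMSEQ_subseq_LIMSEQ[OF LIMSEQ_inverse_real_of_nat r] by (simp add: o_def inverse_eq_divide)
  have "(\<lambda>k. energy (\<psi> (r k))) \<longlonglongrightarrow> l - bdry_energy \<sigma> U"
  proof (rule tendsto_sandwich)
    show "(\<lambda>k. l - bdry_energy \<sigma> (\<psi> (r k))) \<longlonglongrightarrow> l - bdry_energy \<sigma> U" by (intro tendsto_intros S)
    have "(\<lambda>k. l + 1 / real (Suc (r k)) - bdry_energy \<sigma> (\<psi> (r k))) \<longlonglongrightarrow> l + 0 - bdry_energy \<sigma> U" by (intro tendsto_intros S zero)
    then show "(\<lambda>k. l + 1 / real (Suc (r k)) - bdry_energy \<sigma> (\<psi> (r k))) \<longlonglongrightarrow> l - bdry_energy \<sigma> U" by simp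
    show "\<forall>\<^sub>F k in sequentially. l - bdry_energy \<sigma> (\<psi> (r k)) \<le> energy (\<psi> (r k))"
    proof (rule always_eventually, rule allI)
      fix k
      show "l - bdry_energy \<sigma> (\<psi> (r k)) \<le> energy (\<psi> (r k))" using lower[OF \<psi>(1), of "r k"] \<psi>(2)[of "r k"] by simp
    qed
    show "\<forall>\<^sub>F k in sequentially. energy (\<psi> (r k)) \<le> l + 1 / real (Suc (r k)) - bdry_energy \<sigma> (\<psi> (r k))"
    proof (rule always_eventually, rule allI)
      fix k
      show "energy (\<psi> (r k)) \<le> l + 1 / real (Suc (r k)) - bdry_energy \<sigma> (\<psi> (r k))" using \<psi>(3)[of "r k"] by linarith
    qed
  qed
  then show thesis using that[of "\<lambda>k. \<psi> (r k)" U] \<psi> J U lim by blast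
qed

text \<open>
  With \<open>\<psi>\<close> linear, \<open>\<psi> y = 0\<close> and \<open>\<psi> x = sgn (U x)\<close>, test the bound at \<open>y\<close> with \<open>\<phi>\<^sub>k + t \<psi>\<close> and the bound at \<open>x\<close> with
  \<open>\<phi>\<^sub>k - t \<psi>\<close>: the point masses lose a term of order \<open>t\<close>, the energies gain only \<open>O(t\<^bsup>1+\<beta>\<^esup>)\<close>.
\<close>

lemma two_contact_points_vanish:
  assumes p2: "2 < p" and m: "0 < m" and l: "0 < l"
    and \<phi>: "\<And>k. smooth (\<phi> k)" "\<And>k. mass (\<phi> k) = 1" "\<And>k. energy (\<phi> k) \<le> l + 1"
    and U: "continuous_on (closure \<Omega>) U" "uniform_limit (closure \<Omega>) \<phi> U sequentially"
    and J: "(\<lambda>k. energy (\<phi> k)) \<longlonglongrightarrow> l - m * \<bar>U x\<bar> powr p"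
    and x: "x \<in> closure \<Omega>" "\<And>\<psi>. smooth \<psi> \<Longrightarrow> l * mass \<psi> \<le> energy \<psi> + m * \<bar>\<psi> x\<bar> powr p"
    and y: "y \<in> closure \<Omega>" "\<And>\<psi>. smooth \<psi> \<Longrightarrow> l * mass \<psi> \<le> energy \<psi> + m * \<bar>\<psi> y\<bar> powr p"
    and xy: "x \<noteq> y" "\<bar>U x\<bar> = \<bar>U y\<bar>"
  shows "U x = 0"
proof (rule ccontr)
  assume nz: "U x \<noteq> 0"
  define M where "M = \<bar>U x\<bar>"
  have M: "M > 0" "\<bar>U y\<bar> = M" using nz xy by (auto simp: M_def)
  \<comment> \<open>Normalised so that (x - y) \<bullet> a = sgn (U x); the affine function t (z
    \<bullet> a - y \<bullet> a) then moves the value at x and fixes the value at y.\<close>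
  define a where "a = (sgn (U x) / (norm (x - y))\<^sup>2) *\<^sub>R (x - y)"
  define \<psi> where "\<psi> t z = t * (z \<bullet> a - y \<bullet> a)" for t z
  have \<psi>s: "smooth (\<psi> t)" for t unfolding \<psi>_def by (intro smooth_cmult smooth_diff smooth_inner smooth_const)
  have \<psi>y: "\<psi> t y = 0" for t by (simp add: \<psi>_def)
  have \<psi>x: "\<psi> t x = t * sgn (U x)" for t
  proof -
    have "x \<bullet> a - y \<bullet> a = (x - y) \<bullet> a" by (simp add: inner_diff_left)
    also have "\<dots> = sgn (U x)" using xy(1) by (simp add: a_def dot_square_norm)
    finally show ?thesis by (simp add: \<psi>_def)
  qed
  have \<psi>g: "grad (\<psi> t) z = t *\<^sub>R a" for t z
    unfolding \<psi>_def grad_cmult[OF smooth_diff[OF smooth_inner smooth_const]] grad_diff[OF smooth_inner smooth_const]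
    by (simp add: grad_inner grad_const)
  define \<beta> where "\<beta> = min (p - 2) 1"
  have \<beta>: "\<beta> > 0" using p2 by (simp add: \<beta>_def)
  define K where "K = 8 * p\<^sup>2 * 2 powr p * (norm a + 1) powr (1 + \<beta>) * (l + 1 + dom_int (\<lambda>x. 1))"
  \<comment> \<open>t < M keeps U x - t sgn (U x) on the same side of 0 as U x; the second bound
    gives s \<le> 1 as \<open>energy_add_sub_le\<close> requires.\<close>
  define t0 where "t0 = min M (1 / (norm a + 1))"
  have t0: "t0 > 0" using M by (simp add: t0_def add_nonneg_pos)
  have "m * M powr (p - 1) * t powr 1 \<le> K * t powr (1 + \<beta>)" if t: "0 < t" "t < t0" for t
  proof -
    define s where "s = t * (norm a + 1)"
    have na: "norm a + 1 > 0" by (simp add: add_nonneg_pos)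
    have s: "s \<le> 1" "0 \<le> s" using t na by (auto simp: s_def t0_def pos_less_divide_eq)
    have gs: "norm (grad (\<psi> t) z) \<le> s" for z unfolding \<psi>g s_def using t by (simp add: algebra_simps)
    have tM: "t < M" using t by (simp add: t0_def)
    have Kt: "8 * p\<^sup>2 * 2 powr p * s powr (1 + \<beta>) * (l + 1 + dom_int (\<lambda>x. 1)) = K * t powr (1 + \<beta>)"
      using t na by (simp add: s_def K_def powr_mult)
    have step: "2 * l \<le> 2 * energy (\<phi> k) + K * t powr (1 + \<beta>) + m * \<bar>\<phi> k y\<bar> powr p + m * \<bar>\<phi> k x - t * sgn (U x)\<bar> powr p" for k
    proof -
      have 1: "l * mass (\<lambda>z. \<phi> k z + \<psi> t z) \<le> energy (\<lambda>z. \<phi> k z + \<psi> t z) + m * \<bar>\<phi> k y\<bar> powr p"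
        using y(2)[OF smooth_add[OF \<phi>(1) \<psi>s], of k t] by (simp add: \<psi>y)
      have 2: "l * mass (\<lambda>z. \<phi> k z - \<psi> t z) \<le> energy (\<lambda>z. \<phi> k z - \<psi> t z) + m * \<bar>\<phi> k x - t * sgn (U x)\<bar> powr p"
        using x(2)[OF smooth_diff[OF \<phi>(1) \<psi>s], of k t] by (simp add: \<psi>x)
      have 3: "l * (2 * mass (\<phi> k)) \<le> l * (mass (\<lambda>z. \<phi> k z + \<psi> t z) + mass (\<lambda>z. \<phi> k z - \<psi> t z))"
        using l by (intro mult_left_mono mass_add_sub_ge \<phi> \<psi>s) (use p2 in auto)
      have "energy (\<lambda>z. \<phi> k z + \<psi> t z) + energy (\<lambda>z. \<phi> k z - \<psi> t z) \<le>
        2 * energy (\<phi> k) + 8 * p\<^sup>2 * 2 powr p * s powr (1 + \<beta>) * (energy (\<phi> k) + dom_int (\<lambda>x. 1))"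
        unfolding \<beta>_def by (rule energy_add_sub_le[OF p2 \<phi>(1) \<psi>s gs s(1)])
      also have "\<dots> \<le> 2 * energy (\<phi> k) + 8 * p\<^sup>2 * 2 powr p * s powr (1 + \<beta>) * (l + 1 + dom_int (\<lambda>x. 1))"
        using \<phi>(3)[of k] by (intro add_left_mono mult_left_mono) auto
      finally have 4: "energy (\<lambda>z. \<phi> k z + \<psi> t z) + energy (\<lambda>z. \<phi> k z - \<psi> t z) \<le> 2 * energy (\<phi> k) + K * t powr (1 + \<beta>)"
        unfolding Kt .
      show ?thesis using 1 2 3 4 \<phi>(2)[of k] by (simp add: distrib_left)
    qed
    have "(\<lambda>k. 2 * energy (\<phi> k) + K * t powr (1 + \<beta>) + m * \<bar>\<phi> k y\<bar> powr p + m * \<bar>\<phi> k x - t * sgn (U x)\<bar> powr p)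
       \<longlonglongrightarrow> 2 * (l - m * \<bar>U x\<bar> powr p) + K * t powr (1 + \<beta>) + m * \<bar>U y\<bar> powr p + m * \<bar>U x - t * sgn (U x)\<bar> powr p"
      using p_gt_1 by (intro tendsto_intros tendsto_powr' J uniform_limit_pointwise[OF U(2)] x(1) y(1)) auto
    \<comment> \<open>Since |U x| = |U y| = M, what remains after cancellation is m (M^p - (M -
      t)^p) \<le> K t^(1 + \<beta>), and the left side is at least m M^(p-1) t.\<close>
    then have "2 * l \<le> 2 * (l - m * \<bar>U x\<bar> powr p) + K * t powr (1 + \<beta>) + m * \<bar>U y\<bar> powr p + m * \<bar>U x - t * sgn (U x)\<bar> powr p"
      by (rule LIMSEQ_le_const) (simp only: step, simp)
    moreover have "\<bar>U x - t * sgn (U x)\<bar> = M - t"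
      using tM nz by (auto simp: M_def sgn_if abs_if)
    ultimately have ineq: "m * M powr p - m * (M - t) powr p \<le> K * t powr (1 + \<beta>)"
      using M(2) by (simp add: M_def[symmetric])
    have "(M - t) powr p \<le> M powr (p - 1) * (M - t)"
    proof -
      have "(M - t) powr p = (M - t) powr (p - 1) * (M - t)"
        using powr_add[of "M - t" "p - 1" 1] tM by simp
      also have "\<dots> \<le> M powr (p - 1) * (M - t)"
        using tM t p_gt_1 by (intro mult_right_mono powr_mono2) auto
      finally show ?thesis .
    qed
    moreover have "M powr p = M powr (p - 1) * M" using powr_add[of M "p - 1" 1] M by simp
    ultimately have "M powr (p - 1) * t \<le> M powr p - (M - t) powr p" by (simp add: right_diff_distrib)
    then have "m * (M powr (p - 1) * t) \<le> m * (M powr p - (M - t) powr p)" using m by (intro mult_left_mono) auto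
    then show ?thesis using ineq t by (simp add: right_diff_distrib mult.assoc)
  qed
  then have "m * M powr (p - 1) \<le> 0" by (rule powr_order_contradiction[OF t0 \<beta>])
  moreover have "0 < m * M powr (p - 1)" using m M by simp
  ultimately show False by linarith
qed

text \<open>
  If \<open>U x = 0\<close>, shifting by the constants \<open>\<plusminus>t\<close> costs \<open>t\<^sup>p\<close> at \<open>x\<close>, but increases the
  \<open>p\<close>-th moment by order \<open>t\<^sup>2\<close>.
\<close>

lemma contact_value_nonzero:
  assumes p2: "2 < p" and m: "0 < m" and l: "0 < l"
    and \<phi>: "\<And>k. smooth (\<phi> k)" "\<And>k. mass (\<phi> k) = 1"
    and U: "continuous_on (closure \<Omega>) U" "uniform_limit (closure \<Omega>) \<phi> U sequentially"
    and J: "(\<lambda>k. energy (\<phi> k)) \<longlonglongrightarrow> l"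
    and x: "x \<in> closure \<Omega>" "\<And>\<psi>. smooth \<psi> \<Longrightarrow> l * mass \<psi> \<le> energy \<psi> + m * \<bar>\<psi> x\<bar> powr p"
  shows "U x \<noteq> 0"
proof
  assume Ux: "U x = 0"
  have NU: "mass U = 1"
    using mass_tendsto[OF smooth_continuous[OF \<phi>(1)] U] \<phi>(2) by (simp add: LIMSEQ_const_iff)
  have cq: "continuous_on (closure \<Omega>) (\<lambda>z. \<bar>U z\<bar> powr q)" if "q > 0" for q
    by (intro continuous_on_powr' continuous_intros U) (use that in auto)
  \<comment> \<open>p D is the coefficient of t^2 in the lower bound for the mass of U + t plus that
    of U - t. It is positive because U, having mass 1, is not almost everywhere 0.\<close>
  define D where "D = dom_int (\<lambda>z. \<bar>U z\<bar> powr (p - 2))"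
  have Dpos: "D > 0"
  proof -
    have int: "integrable lborel (\<lambda>z. indicator \<Omega> z * \<bar>U z\<bar> powr (p - 2))"
      by (rule dom_integrable[OF cq]) (use p2 in simp)
    have "D \<noteq> 0"
    proof
      assume "D = 0"
      then have "AE z in lborel. indicator \<Omega> z * \<bar>U z\<bar> powr (p - 2) = 0"
        using integral_nonneg_eq_0_iff_AE[OF int] unfolding D_def dom_int_def by (simp add: indicator_def)
      then have "AE z in lborel. indicator \<Omega> z * \<bar>U z\<bar> powr p = 0"
        by eventually_elim auto
      then have "mass U = 0"
        unfolding dom_int_def by (rule integral_eq_zero_AE)
      then show False using NU by simp
    qed
    moreover have "D \<ge> 0" unfolding D_def by (rule dom_int_nonneg) simp
    ultimately show ?thesis by simp
  qed
  \<comment> \<open>The exponent p is written \<open>2 + (p - 2)\<close> to match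
    \<open>powr_order_contradiction\<close> with \<beta> = p - 2.\<close>
  have "l * p * D * t powr 2 \<le> 2 * m * t powr (2 + (p - 2))" if t: "0 < t" "t < 1" for t
  proof -
    have grad_t: "grad (\<lambda>z. \<phi> k z + c) z = grad (\<phi> k) z" for k c z
      using grad_add[OF \<phi>(1) smooth_const, of k c z] by (simp add: grad_const)
    have bound: "l * mass (\<lambda>z. \<phi> k z + c) \<le> energy (\<phi> k) + m * \<bar>\<phi> k x + c\<bar> powr p" for k c
      using x(2)[OF smooth_add[OF \<phi>(1) smooth_const], of k c] unfolding grad_t .
    \<comment> \<open>A constant shift leaves the gradients unchanged, so the energies still tend to
      l; U x = 0 leaves only |c|^p at x.\<close>
    have lim: "l * mass (\<lambda>z. U z + c) \<le> l + m * \<bar>c\<bar> powr p" for c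
    proof (rule LIMSEQ_le)
      have "(\<lambda>k. mass (\<lambda>z. \<phi> k z + c)) \<longlonglongrightarrow> mass (\<lambda>z. U z + c)"
      proof (rule mass_tendsto)
        show "uniform_limit (closure \<Omega>) (\<lambda>k z. \<phi> k z + c) (\<lambda>z. U z + c) sequentially"
          by (intro uniform_limit_add U(2) uniform_limit_const)
      qed (intro continuous_intros smooth_continuous \<phi> U)+
      then show "(\<lambda>k. l * mass (\<lambda>z. \<phi> k z + c)) \<longlonglongrightarrow> l * mass (\<lambda>z. U z + c)" by (rule tendsto_mult_left)
      have "(\<lambda>k. energy (\<phi> k) + m * \<bar>\<phi> k x + c\<bar> powr p) \<longlonglongrightarrow> l + m * \<bar>U x + c\<bar> powr p"
        using p_gt_1 by (intro tendsto_intros tendsto_powr' J uniform_limit_pointwise[OF U(2)] x(1)) auto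
      then show "(\<lambda>k. energy (\<phi> k) + m * \<bar>\<phi> k x + c\<bar> powr p) \<longlonglongrightarrow> l + m * \<bar>c\<bar> powr p" by (simp add: Ux)
    qed (use bound in blast)
    have c1: "continuous_on (closure \<Omega>) (\<lambda>z. \<bar>U z + c\<bar> powr p)" for c
      by (intro continuous_on_powr' continuous_intros U) (use p_gt_1 in auto)
    have "2 * mass U + p * t\<^sup>2 * D = dom_int (\<lambda>z. 2 * \<bar>U z\<bar> powr p + (p * t\<^sup>2) * \<bar>U z\<bar> powr (p - 2))"
      unfolding D_def
      by (subst dom_int_add) (use p2 in \<open>simp_all add: dom_int_cmult continuous_on_mult_left cq\<close>)
    also have "\<dots> \<le> dom_int (\<lambda>z. \<bar>U z + t\<bar> powr p + \<bar>U z + - t\<bar> powr p)"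
    proof (rule dom_int_mono)
      show "continuous_on (closure \<Omega>) (\<lambda>z. 2 * \<bar>U z\<bar> powr p + (p * t\<^sup>2) * \<bar>U z\<bar> powr (p - 2))"
        by (intro continuous_on_add continuous_on_mult_left cq) (use p2 in auto)
      show "continuous_on (closure \<Omega>) (\<lambda>z. \<bar>U z + t\<bar> powr p + \<bar>U z + - t\<bar> powr p)"
        by (intro continuous_on_add c1)
      show "2 * \<bar>U z\<bar> powr p + (p * t\<^sup>2) * \<bar>U z\<bar> powr (p - 2) \<le> \<bar>U z + t\<bar> powr p + \<bar>U z + - t\<bar> powr p" for z
        using abs_powr_second_difference_ge[of p "U z" t] p2 by (simp add: mult_ac)
    qed
    also have "\<dots> = mass (\<lambda>z. U z + t) + mass (\<lambda>z. U z + - t)" by (rule dom_int_add[OF c1 c1])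
    finally have "l * (2 * mass U + p * t\<^sup>2 * D) \<le> l * (mass (\<lambda>z. U z + t) + mass (\<lambda>z. U z + - t))"
      using l by (intro mult_left_mono) auto
    then have "l * (2 + p * t\<^sup>2 * D) \<le> 2 * l + 2 * m * t powr p"
      using lim[of t] lim[of "- t"] t NU by (simp add: distrib_left)
    then show ?thesis using t by (simp add: algebra_simps)
  qed
  then have "l * p * D \<le> 0" by (rule powr_order_contradiction[of 1 "p - 2", rotated 2]) (use p2 in auto)
  moreover have "0 < l * p * D" using l p2 Dpos by simp
  ultimately show False by linarith
qed

text \<open>Dimension greater than 1 enters twice: p > n \<ge> 2 gives p > 2, on which the
  second-difference estimates rest, and single points are null, so \<sigma> cannot be concentrated
  at one contact point.\<close>

lemma lambda_inf_not_attained: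
  assumes conn: "connected \<Omega>" and m: "0 < m" and dim: "1 < DIM('a)" and \<sigma>: "\<sigma> \<in> Sigma_m m \<Omega>"
  shows "ell1 p \<Omega> \<sigma> \<noteq> lambda_inf p m \<Omega>"
proof
  assume eq: "ell1 p \<Omega> \<sigma> = lambda_inf p m \<Omega>"
  have p2: "2 < p"
  proof -
    have "2 \<le> real DIM('a)" using dim by linarith
    then show ?thesis using p by linarith
  qed
  have "ell1 p \<Omega> \<sigma> < \<infinity>"
  proof -
    have "0 < mass (\<lambda>x. 1)" using dom_int_one_pos by simp
    from ell1_le_smooth[OF \<sigma> smooth_const this] show ?thesis by (rule le_less_trans) simp
  qed
  then obtain l where l: "ell1 p \<Omega> \<sigma> = ennreal l" "0 \<le> l" by (cases "ell1 p \<Omega> \<sigma>") auto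
  have lpos: "0 < l" using lambda_inf_pos[OF conn m] l eq by simp
  have low: "l * mass \<psi> \<le> energy \<psi> + bdry_energy \<tau> \<psi>" if \<psi>: "smooth \<psi>" and \<tau>: "\<tau> \<in> Sigma_m m \<Omega>" for \<psi> \<tau>
  proof -
    have S0: "0 \<le> bdry_energy \<tau> \<psi>" using boundary_nn_integral(2)[OF \<tau> smooth_continuous[OF \<psi>], of \<psi>] by simp
    show ?thesis
    proof (cases "0 < mass \<psi>")
      case True
      have "ennreal l \<le> ell1 p \<Omega> \<tau>" using eq l(1) \<tau> unfolding lambda_inf_def by (metis INF_lower)
      also have "\<dots> \<le> ennreal ((energy \<psi> + bdry_energy \<tau> \<psi>) / mass \<psi>)" by (rule ell1_le_smooth[OF \<tau> \<psi> True])
      finally have "l \<le> (energy \<psi> + bdry_energy \<tau> \<psi>) / mass \<psi>"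
        using S0 energy_nonneg[of \<psi>] True by (simp add: ennreal_le_iff)
      then show ?thesis using True by (simp add: pos_le_divide_eq)
    next
      case False
      then have "mass \<psi> = 0" using mass_nonneg[of \<psi>] by linarith
      then show ?thesis using S0 energy_nonneg[of \<psi>] by simp
    qed
  qed
  obtain \<phi> U where \<phi>: "\<And>k. smooth (\<phi> k)" "\<And>k. mass (\<phi> k) = 1" "\<And>k. energy (\<phi> k) \<le> l + 1"
    and U: "continuous_on (closure \<Omega>) U" "uniform_limit (closure \<Omega>) \<phi> U sequentially"
    and J: "(\<lambda>k. energy (\<phi> k)) \<longlonglongrightarrow> l - bdry_energy \<sigma> U"
    using minimising_sequence[OF \<sigma> l] by metis
  define A where "A = bdry_energy \<sigma> U"
  have Uf: "continuous_on (frontier \<Omega>) U" by (rule continuous_on_subset[OF U(1) frontier_subset])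
  have point: "l * mass \<psi> \<le> energy \<psi> + m * \<bar>\<psi> x\<bar> powr p" if "x \<in> weight_support \<sigma>" "smooth \<psi>" for x \<psi>
    by (rule point_mass_bound[OF \<sigma> m that low[OF that(2)]])
  have supp_sub: "x \<in> closure \<Omega>" if "x \<in> weight_support \<sigma>" for x
    using that frontier_subset unfolding weight_support_def by blast
  \<comment> \<open>The point-mass bound for the minimising sequence, in the limit where the
    energies tend to l - A.\<close>
  have Ale: "A / m \<le> \<bar>U x\<bar> powr p" if x: "x \<in> weight_support \<sigma>" for x
  proof -
    have "l \<le> l - A + m * \<bar>U x\<bar> powr p"
    proof (rule LIMSEQ_le_const)
      show "(\<lambda>k. energy (\<phi> k) + m * \<bar>\<phi> k x\<bar> powr p) \<longlonglongrightarrow> l - A + m * \<bar>U x\<bar> powr p"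
        unfolding A_def using p_gt_1 by (intro tendsto_intros tendsto_powr' J uniform_limit_pointwise[OF U(2)] supp_sub[OF x]) auto
      show "\<exists>N. \<forall>n\<ge>N. l \<le> energy (\<phi> n) + m * \<bar>\<phi> n x\<bar> powr p"
        using point[OF x \<phi>(1)] \<phi>(2) by simp
    qed
    then show ?thesis using m by (simp add: pos_divide_le_eq mult.commute)
  qed
  \<comment> \<open>A / m is the \<sigma>-average of |U|^p and, by \<open>Ale\<close>, also a lower
    bound for it on the support. So f is nonnegative with integral A - (A / m) m = 0, and equality
    holds wherever \<sigma> does not vanish, up to a null set.\<close>
  define f where "f x = \<sigma> x * \<bar>U x\<bar> powr p - A / m * \<sigma> x" for x
  have fint: "integrable (boundary_measure \<Omega>) f"
    unfolding f_def using boundary_weight_integrable[OF Sigma_mD(1)[OF \<sigma>] Uf] Sigma_mD(1)[OF \<sigma>] by simp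
  have fnn: "AE x in boundary_measure \<Omega>. 0 \<le> f x"
    using Sigma_mD(2)[OF \<sigma>] weight_support_AE[OF \<sigma>]
  proof eventually_elim
    case (elim x)
    show ?case
    proof (cases "\<sigma> x = 0")
      case False
      then have "A / m \<le> \<bar>U x\<bar> powr p" using elim Ale by blast
      then have "\<sigma> x * (A / m) \<le> \<sigma> x * \<bar>U x\<bar> powr p" using elim by (intro mult_left_mono) auto
      then show ?thesis by (simp add: f_def mult.commute)
    qed (simp add: f_def)
  qed
  have "(\<integral>x. f x \<partial>boundary_measure \<Omega>) = A - A / m * m"
    unfolding f_def using boundary_weight_integrable[OF Sigma_mD(1)[OF \<sigma>] Uf] Sigma_mD(1,3)[OF \<sigma>]
    by (simp add: A_def bdry_energy_def)
  then have "(\<integral>x. f x \<partial>boundary_measure \<Omega>) = 0" using m by simp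
  then have "AE x in boundary_measure \<Omega>. f x = 0"
    using integral_nonneg_eq_0_iff_AE[OF fint fnn] by blast
  then have G: "AE x in boundary_measure \<Omega>. \<sigma> x \<noteq> 0 \<longrightarrow> x \<in> weight_support \<sigma> \<and> \<bar>U x\<bar> powr p = A / m"
    using weight_support_AE[OF \<sigma>]
  proof eventually_elim
    case (elim x)
    have "f x = \<sigma> x * (\<bar>U x\<bar> powr p - A / m)" by (simp add: f_def algebra_simps)
    then show ?case using elim by auto
  qed
  define S where "S = {x \<in> weight_support \<sigma>. \<bar>U x\<bar> powr p = A / m}"
  \<comment> \<open>With at most one point in S, \<sigma> would vanish almost everywhere, against
    its integral m > 0.\<close>
  have "\<exists>x\<in>S. \<exists>y\<in>S. x \<noteq> y"
  proof (rule ccontr)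
    assume one: "\<not> (\<exists>x\<in>S. \<exists>y\<in>S. x \<noteq> y)"
    have "AE x in boundary_measure \<Omega>. \<sigma> x = 0"
    proof (cases "S = {}")
      case True
      show ?thesis using G by eventually_elim (use True in \<open>auto simp: S_def\<close>)
    next
      case False
      then obtain x0 where x0: "x0 \<in> S" by blast
      then have fr: "x0 \<in> frontier \<Omega>" by (simp add: S_def weight_support_def)
      have "{x0} \<in> sets (boundary_measure \<Omega>)"
        unfolding sets_boundary_measure using fr by (subst sets_restrict_space_iff) auto
      then have "{x0} \<in> null_sets (boundary_measure \<Omega>)"
        using boundary_emeasure_singleton[OF dim fr] by blast
      then have "AE x in boundary_measure \<Omega>. x \<notin> {x0}" by (rule AE_not_in)
      then show ?thesis using G
        by eventually_elim (use one x0 in \<open>auto simp: S_def\<close>)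
    qed
    then have "(\<integral>x. \<sigma> x \<partial>boundary_measure \<Omega>) = 0" by (rule integral_eq_zero_AE)
    then show False using Sigma_mD(3)[OF \<sigma>] m by simp
  qed
  then obtain x y where xy: "x \<in> S" "y \<in> S" "x \<noteq> y" by blast
  have xs: "x \<in> weight_support \<sigma>" "\<bar>U x\<bar> powr p = A / m" and ys: "y \<in> weight_support \<sigma>" "\<bar>U y\<bar> powr p = A / m"
    using xy by (auto simp: S_def)
  have "\<bar>U x\<bar> = \<bar>U y\<bar>"
  proof -
    have "(\<bar>U x\<bar> powr p) powr (1 / p) = (\<bar>U y\<bar> powr p) powr (1 / p)" using xs(2) ys(2) by simp
    then show ?thesis using p_gt_1 by (simp add: powr_powr)
  qed
  moreover have J': "(\<lambda>k. energy (\<phi> k)) \<longlonglongrightarrow> l - m * \<bar>U x\<bar> powr p"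
    using J m xs(2) by (simp add: A_def)
  ultimately have U0: "U x = 0"
    by (intro two_contact_points_vanish[OF p2 m lpos \<phi> U J' supp_sub[OF xs(1)] point[OF xs(1)] supp_sub[OF ys(1)] point[OF ys(1)] xy(3)])
  then have "(\<lambda>k. energy (\<phi> k)) \<longlonglongrightarrow> l" using J' p_gt_1 by simp
  then have "U x \<noteq> 0"
    by (rule contact_value_nonzero[OF p2 m lpos \<phi>(1,2) U _ supp_sub[OF xs(1)] point[OF xs(1)]])
  then show False using U0 by simp
qed

end

theorem theorem4p1:
  fixes \<Omega> :: "'a::euclidean_space set" and p m \<epsilon> :: real
  assumes "open \<Omega>" and "connected \<Omega>" and "\<Omega> \<noteq> {}" and "bounded \<Omega>"
    and "0 < \<epsilon>" and "\<epsilon> \<le> 1" and "C1_holder_boundary \<epsilon> \<Omega>"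
    and "1 < p" and "0 < m"
  shows "(p > real DIM('a) \<longrightarrow> 0 < lambda_inf p m \<Omega>) \<and>
    (p > real DIM('a) \<and> DIM('a) > 1 \<longrightarrow>
       \<not> (\<exists>\<sigma>\<in>Sigma_m m \<Omega>. ell1 p \<Omega> \<sigma> = lambda_inf p m \<Omega>))"
proof -
  have "robin_domain \<Omega> p" if "real DIM('a) < p"
    using assms that C1_holder_boundary_cone_domain[of \<Omega> \<epsilon>] by unfold_locales auto
  then show ?thesis
    using robin_domain.lambda_inf_pos[of \<Omega> p m] robin_domain.lambda_inf_not_attained[of \<Omega> p m] assms by blast
qed

end
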